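(* Let $M$ be the closed simply connected 7-manifold (defined in the context; it admits metrics with holonomy $G_2$) obtained by resolving the singularities of the torus orbifold $\mathbb T^7/\Gamma$. Then $M$ admits a polarized $\mathcal F$-structure in which all but one of the Galois coverings are trivial.
   Context: **$\mathcal F$-structures.** An $\mathcal F$-structure on a closed manifold $M$ is given by the following data and conditions: (1) a finite open cover $\{U_{1},\dots,U_{N}\}$ of $M$; (2) finite Galois coverings $\pi_{i}:\widetilde{U}_{i}\to U_{i}$ with group of deck transformations $\Gamma_{i}$, $1\leq i\leq N$; (3) a smooth action with finite kernel of the $k_{i}$-dimensional torus $T^{k_i}$ ($k_i\ge 1$), $\phi_{i}:T^{k_{i}}\to \mathrm{Diff}(\widetilde{U}_{i})$, $1\leq i\leq N$; (4) a homomorphism $\Psi_{i}:\Gamma_{i}\to \mathrm{Aut}(T^{k_{i}})$ such that $\gamma(\phi_{i}(t)(x))=\phi_{i}(\Psi_{i}(\gamma)(t))(\gamma x)$ for all $\gamma\in \Gamma_{i}$, $t\in T^{k_{i}}$, $x\in \widetilde{U}_{i}$; (5) for any finite sub-collection $\{U_{i_{1}},\dots,U_{i_{l}}\}$ such that $U_{i_{1}\dots i_{l}}:=U_{i_{1}}\cap\dots\cap U_{i_{l}}\neq\emptyset$, let $\widetilde{U}_{i_{1}\dots i_{l}}$ be the set of all $(x_{i_{1}},\dots,x_{i_{l}})\in \widetilde{U}_{i_{1}}\times\dots\times\widetilde{U}_{i_{l}}$ such that $\pi_{i_{1}}(x_{i_{1}})=\dots=\pi_{i_{l}}(x_{i_{l}})$;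 it covers $\pi_{i_{j}}^{-1}(U_{i_{1}\dots i_{l}})\subset \widetilde{U}_{i_{j}}$ for all $1\leq j\leq l$. It is required that each $\phi_{i_{j}}$ leaves $\pi_{i_{j}}^{-1}(U_{i_{1}\dots i_{l}})$ invariant and lifts to an action on $\widetilde{U}_{i_{1}\dots i_{l}}$, and that all the lifted actions commute. A Galois covering $\pi_i$ is trivial if it is one-sheeted. A subset $S\subset M$ is invariant if for any $y\in S\cap U_i$, any $x\in\widetilde U_i$ with $\pi_i(x)=y$ and any $t\in T^{k_i}$, we have $\pi_i(\phi_i(t)(x))\in S$. The orbit of a point of $M$ is the minimal invariant set containing it. The $\mathcal F$-structure is polarized if for any $I\subset\{1,\dots,N\}$, with $U=\bigcap_{i\in I}U_i$ (assumed non-empty) and $V=\bigcup_{i\in I^c}U_i$, the dimension of the orbits is constant in $U-V$. **The manifold $M$.** Let $\mathbb T^7=\mathbb R^7/\mathbb Z^7$ and consider the involutions $$\alpha(x)=(-x_{1},-x_{2},-x_{3},-x_{4},x_{5},x_{6},x_{7}),$$ $$\beta(x)=(-x_{1},\tfrac12-x_{2},x_{3},x_{4},-x_{5},-x_{6},x_{7}),$$ $$\gamma(x)=(\tfrac12-x_{1},x_{2},\tfrac12-x_{3},x_{4},-x_{5},x_{6},-x_{7}).$$ They commute and generate a group $\Gamma\cong\mathbb Z_2^3$. The only non-trivial elements of $\Gamma$ with fixed points are $\alpha,\beta,\gamma$. Each fixed point set consists of 16 copies of $\mathbb T^3$, the resulting 48 tori are pairwise disjoint, and the singular set of $\mathbb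 T^7/\Gamma$ consists of 12 copies of $\mathbb T^3$, each with a neighbourhood isometric to $\mathbb T^3\times B^4_\varepsilon/\{\pm1\}$ for small $\varepsilon$. Let $X$ be the Eguchi–Hanson space: the 4-manifold diffeomorphic to $T^*S^2$ obtained as the blow-up $b:X\to\mathbb C^2/\{\pm1\}$ at the origin. The map $b$ is a diffeomorphism from the complement of the zero section onto $(\mathbb C^2\setminus0)/\{\pm1\}$, and $b^{-1}(B^4_\varepsilon/\{\pm1\})$ is diffeomorphic to $X$. The manifold $M$ is obtained from $\mathbb T^7/\Gamma$ by replacing each of the 12 neighbourhoods $\mathbb T^3\times B^4_\varepsilon/\{\pm1\}$ by $\mathbb T^3\times b^{-1}(B^4_\varepsilon/\{\pm1\})$ via $b$. Here the normal directions are identified (constantly along the tori) with $\mathbb C^2$ by the complex coordinates $(x_1+ix_2,x_3+ix_4)$ for $\alpha$, $(x_1+ix_2,x_5+ix_6)$ for $\beta$, and $(x_1+ix_3,x_7+ix_5)$ for $\gamma$, each centred at the fixed point in question. *)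

theory Defs
  imports "HOL-Analysis.Analysis" "HOL-Library.Function_Algebras"
begin

section \<open>Smooth functions\<close>

text \<open>Pointwise scalar multiplication completes the vector space structure on function types.
  It is only used for \<open>\<real>\<^sup>k\<close>, the functions \<open>nat \<Rightarrow> real\<close> that vanish from \<open>k\<close> on; this is how
  tori of varying dimension are coordinatised.\<close>

instantiation "fun" :: (type, real_vector) real_vector
begin

definition "scaleR r f = (\<lambda>x. r *\<^sub>R f x)"

instance
  by standard (simp_all add: scaleR_fun_def plus_fun_def scaleR_add_right scaleR_add_left)

end

definition Rn :: "nat \<Rightarrow> (nat \<Rightarrow> real) set" where
  "Rn k = {\<theta>. \<forall>j\<ge>k. \<theta> j = 0}"

text \<open>\<open>C_k r D S f\<close>: on \<open>S\<close>, a relatively open subset of the finite-dimensional space \<open>D\<close>, all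
  iterated directional derivatives of \<open>f\<close> of order at most \<open>r\<close> in directions from \<open>D\<close> exist and
  are continuous.\<close>

primrec C_k :: "nat \<Rightarrow> 'a set \<Rightarrow> 'a set
    \<Rightarrow> ('a::{real_vector,topological_space} \<Rightarrow> 'b::real_normed_vector) \<Rightarrow> bool" where
  "C_k 0 D S f \<longleftrightarrow> continuous_on S f"
| "C_k (Suc r) D S f \<longleftrightarrow> continuous_on S f \<and>
     (\<forall>v\<in>D. \<exists>f'. (\<forall>x\<in>S. ((\<lambda>s. f (x + s *\<^sub>R v)) has_vector_derivative f' x) (at 0)) \<and>
               C_k r D S f')"

definition C_infinity :: "'a set \<Rightarrow> 'a set
    \<Rightarrow> ('a::{real_vector,topological_space} \<Rightarrow> 'b::real_normed_vector) \<Rightarrow> bool" where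
  "C_infinity D S f \<longleftrightarrow> (\<forall>r. C_k r D S f)"

section \<open>Smooth manifolds\<close>

text \<open>An atlas consists of local parametrisations \<open>(V, p)\<close>: \<open>p\<close> maps the open subset \<open>V\<close> of the
  model space bijectively onto a subset of the manifold. The manifold topology is the one for
  which all these maps are homeomorphisms onto open subsets.\<close>

type_synonym ('e, 'a) atlas = "('e set \<times> ('e \<Rightarrow> 'a)) set"

definition points :: "('e, 'a) atlas \<Rightarrow> 'a set" where
  "points A = (\<Union>(V, p)\<in>A. p ` V)"

definition mtop :: "('e::euclidean_space, 'a) atlas \<Rightarrow> 'a topology" where
  "mtop A = topology (\<lambda>U. U \<subseteq> points A \<and> (\<forall>(V, p)\<in>A. open {x\<in>V. p x \<in> U}))"

lemma openin_mtop:
  "openin (mtop A) U \<longleftrightarrow> U \<subseteq> points A \<and> (\<forall>(V, p)\<in>A. open {x\<in>V. p x \<in> U})"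
proof -
  have "istopology (\<lambda>U. U \<subseteq> points A \<and> (\<forall>(V, p)\<in>A. open {x\<in>V. p x \<in> U}))"
    unfolding istopology_def
  proof (intro conjI allI impI)
    fix S T
    assume *: "S \<subseteq> points A \<and> (\<forall>(V, p)\<in>A. open {x\<in>V. p x \<in> S})"
              "T \<subseteq> points A \<and> (\<forall>(V, p)\<in>A. open {x\<in>V. p x \<in> T})"
    have "{x\<in>V. p x \<in> S \<inter> T} = {x\<in>V. p x \<in> S} \<inter> {x\<in>V. p x \<in> T}" for V and p :: "'b \<Rightarrow> 'a"
      by auto
    with * show "\<forall>(V, p)\<in>A. open {x\<in>V. p x \<in> S \<inter> T}"
      by (auto intro: open_Int)
  next
    fix \<K>
    assume *: "\<forall>K\<in>\<K>. K \<subseteq> points A \<and> (\<forall>(V, p)\<in>A. open {x\<in>V. p x \<in> K})"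
    have "{x\<in>V. p x \<in> \<Union>\<K>} = (\<Union>K\<in>\<K>. {x\<in>V. p x \<in> K})" for V and p :: "'b \<Rightarrow> 'a"
      by auto
    with * show "\<forall>(V, p)\<in>A. open {x\<in>V. p x \<in> \<Union>\<K>}"
      by (auto intro!: open_UN)
  qed (auto simp: subset_iff)
  then show ?thesis
    unfolding mtop_def by (simp add: topology_inverse')
qed

text \<open>The map \<open>f\<close>, read in the parametrisations \<open>(V, p)\<close> and \<open>(W, q)\<close>, has open domain and is
  smooth there. Openness of the domains (for all \<open>(W, q)\<close>) amounts to continuity of \<open>f\<close>.\<close>

fun smooth_in_charts ::
  "'e::euclidean_space set \<times> ('e \<Rightarrow> 'a) \<Rightarrow> 'f::euclidean_space set \<times> ('f \<Rightarrow> 'b) \<Rightarrow> ('a \<Rightarrow> 'b) \<Rightarrow> bool"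
where
  "smooth_in_charts (V, p) (W, q) f \<longleftrightarrow>
     (let S = {x\<in>V. f (p x) \<in> q ` W}
      in open S \<and> C_infinity UNIV S (\<lambda>x. inv_into W q (f (p x))))"

definition smooth_map ::
  "('e::euclidean_space, 'a) atlas \<Rightarrow> ('f::euclidean_space, 'b) atlas \<Rightarrow> ('a \<Rightarrow> 'b) \<Rightarrow> bool" where
  "smooth_map A B f \<longleftrightarrow>
     f ` points A \<subseteq> points B \<and> (\<forall>c\<in>A. \<forall>d\<in>B. smooth_in_charts c d f)"

definition diffeomorphism ::
  "('e::euclidean_space, 'a) atlas \<Rightarrow> ('f::euclidean_space, 'b) atlas \<Rightarrow> ('a \<Rightarrow> 'b) \<Rightarrow> bool" where
  "diffeomorphism A B f \<longleftrightarrow> bij_betw f (points A) (points B) \<and>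
     smooth_map A B f \<and> smooth_map B A (inv_into (points A) f)"

definition compatible ::
  "'e::euclidean_space set \<times> ('e \<Rightarrow> 'a) \<Rightarrow> 'e set \<times> ('e \<Rightarrow> 'a) \<Rightarrow> bool" where
  "compatible c d \<longleftrightarrow> smooth_in_charts c d (\<lambda>y. y) \<and> smooth_in_charts d c (\<lambda>y. y)"

definition maximal_atlas :: "('e::euclidean_space, 'a) atlas \<Rightarrow> ('e, 'a) atlas" where
  "maximal_atlas A = {(V, p). open V \<and> inj_on p V \<and> p ` V \<subseteq> points A \<and>
                              (\<forall>c\<in>A. compatible (V, p) c)}"

definition smooth_manifold :: "('e::euclidean_space, 'a) atlas \<Rightarrow> bool" where
  "smooth_manifold A \<longleftrightarrow> A \<subseteq> maximal_atlas A \<and>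
     Hausdorff_space (mtop A) \<and> second_countable (mtop A)"

definition closed_manifold :: "('e::euclidean_space, 'a) atlas \<Rightarrow> bool" where
  "closed_manifold A \<longleftrightarrow> smooth_manifold A \<and> compact_space (mtop A)"

definition open_submanifold :: "('e, 'a) atlas \<Rightarrow> 'a set \<Rightarrow> ('e, 'a) atlas" where
  "open_submanifold A S = {({x\<in>V. p x \<in> S}, p) | V p. (V, p) \<in> A}"

text \<open>\<open>Q\<close> is an embedded submanifold of dimension \<open>d\<close> (local slice condition).\<close>

definition submanifold_of_dim :: "('e::euclidean_space, 'a) atlas \<Rightarrow> nat \<Rightarrow> 'a set \<Rightarrow> bool" where
  "submanifold_of_dim A d Q \<longleftrightarrow> Q \<subseteq> points A \<and>
     (\<forall>y\<in>Q. \<exists>V p L. (V, p) \<in> maximal_atlas A \<and> y \<in> p ` V \<and>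
               subspace L \<and> dim L = d \<and> {x\<in>V. p x \<in> Q} = V \<inter> L)"

section \<open>Galois coverings\<close>

definition smooth_covering :: "('e::euclidean_space, 'b) atlas \<Rightarrow> ('e, 'a) atlas \<Rightarrow> 'a set
    \<Rightarrow> ('b \<Rightarrow> 'a) \<Rightarrow> bool" where
  "smooth_covering C M U \<pi> \<longleftrightarrow> \<pi> ` points C = U \<and>
     (\<forall>y\<in>U. \<exists>V. y \<in> V \<and> V \<subseteq> U \<and> openin (mtop M) V \<and>
        (\<exists>\<S>. disjoint \<S> \<and> \<Union>\<S> = {x\<in>points C. \<pi> x \<in> V} \<and>
           (\<forall>S\<in>\<S>. openin (mtop C) S \<and>
              diffeomorphism (open_submanifold C S) (open_submanifold M V) \<pi>)))"

definition deck :: "('e::euclidean_space, 'b) atlas \<Rightarrow> ('b \<Rightarrow> 'a) \<Rightarrow> ('b \<Rightarrow> 'b) set" where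
  "deck C \<pi> = {g \<in> extensional (points C). diffeomorphism C C g \<and> (\<forall>x\<in>points C. \<pi> (g x) = \<pi> x)}"

text \<open>Following the usual convention, the total space of a Galois covering is connected.\<close>

definition finite_Galois_covering :: "('e::euclidean_space, 'b) atlas \<Rightarrow> ('e, 'a) atlas \<Rightarrow> 'a set
    \<Rightarrow> ('b \<Rightarrow> 'a) \<Rightarrow> bool" where
  "finite_Galois_covering C M U \<pi> \<longleftrightarrow> smooth_manifold C \<and> connected_space (mtop C) \<and>
     smooth_covering C M U \<pi> \<and> (\<forall>y\<in>U. finite {x\<in>points C. \<pi> x = y}) \<and>
     (\<forall>x\<in>points C. \<forall>x'\<in>points C. \<pi> x = \<pi> x' \<longrightarrow> (\<exists>g\<in>deck C \<pi>. g x = x'))"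

section \<open>Torus actions\<close>

text \<open>The torus \<open>T\<^sup>k\<close> is the product of \<open>k\<close> unit circles, with pointwise multiplication.\<close>

definition torus :: "nat \<Rightarrow> (nat \<Rightarrow> complex) set" where
  "torus k = {t. (\<forall>j<k. cmod (t j) = 1) \<and> (\<forall>j\<ge>k. t j = 1)}"

definition torus_exp :: "(nat \<Rightarrow> real) \<Rightarrow> nat \<Rightarrow> complex" where
  "torus_exp \<theta> = (\<lambda>j. cis (2 * pi * \<theta> j))"

definition torus_aut :: "nat \<Rightarrow> ((nat \<Rightarrow> complex) \<Rightarrow> nat \<Rightarrow> complex) set" where
  "torus_aut k = {a. (\<exists>a'. homeomorphism (torus k) (torus k) a a') \<and>
                     (\<forall>s\<in>torus k. \<forall>t\<in>torus k. a (s * t) = a s * a t)}"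

definition torus_acts :: "nat \<Rightarrow> 'b set \<Rightarrow> ((nat \<Rightarrow> complex) \<Rightarrow> 'b \<Rightarrow> 'b) \<Rightarrow> bool" where
  "torus_acts k X \<phi> \<longleftrightarrow> (\<forall>t\<in>torus k. \<forall>x\<in>X. \<phi> t x \<in> X) \<and> (\<forall>x\<in>X. \<phi> 1 x = x) \<and>
     (\<forall>s\<in>torus k. \<forall>t\<in>torus k. \<forall>x\<in>X. \<phi> (s * t) x = \<phi> s (\<phi> t x))"

definition continuous_torus_action ::
  "nat \<Rightarrow> 'b topology \<Rightarrow> ((nat \<Rightarrow> complex) \<Rightarrow> 'b \<Rightarrow> 'b) \<Rightarrow> bool" where
  "continuous_torus_action k X \<phi> \<longleftrightarrow> torus_acts k (topspace X) \<phi> \<and>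
     continuous_map (prod_topology (top_of_set (torus k)) X) X (\<lambda>(t, x). \<phi> t x)"

text \<open>The map \<open>T\<^sup>k \<times> C \<rightarrow> C\<close> is smooth, where \<open>T\<^sup>k\<close> is parametrised by \<open>torus_exp\<close> on \<open>\<real>\<^sup>k\<close>.\<close>

definition smooth_torus_action ::
  "nat \<Rightarrow> ('e::euclidean_space, 'b) atlas \<Rightarrow> ((nat \<Rightarrow> complex) \<Rightarrow> 'b \<Rightarrow> 'b) \<Rightarrow> bool" where
  "smooth_torus_action k C \<phi> \<longleftrightarrow> torus_acts k (points C) \<phi> \<and>
     (\<forall>(V, p)\<in>C. \<forall>(W, q)\<in>C.
        let D = Rn k \<times> UNIV;
            S = {(\<theta>, x). \<theta> \<in> Rn k \<and> x \<in> V \<and> \<phi> (torus_exp \<theta>) (p x) \<in> q ` W}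
        in openin (top_of_set D) S \<and>
           C_infinity D S (\<lambda>(\<theta>, x). inv_into W q (\<phi> (torus_exp \<theta>) (p x))))"

section \<open>F-structures\<close>

text \<open>The open sets are indexed by \<open>{..<num F}\<close>. The total spaces of the coverings are sets of
  elements of \<open>'b\<close>. As the coverings are finite, \<open>'b = 'a \<times> nat\<close> has room for all of them.\<close>

record ('e, 'a, 'b) F_structure =
  num :: nat
  cset :: "nat \<Rightarrow> 'a set"
  cover :: "nat \<Rightarrow> ('e, 'b) atlas"
  proj :: "nat \<Rightarrow> 'b \<Rightarrow> 'a"
  tdim :: "nat \<Rightarrow> nat"
  act :: "nat \<Rightarrow> (nat \<Rightarrow> complex) \<Rightarrow> 'b \<Rightarrow> 'b"
  twist :: "nat \<Rightarrow> ('b \<Rightarrow> 'b) \<Rightarrow> (nat \<Rightarrow> complex) \<Rightarrow> nat \<Rightarrow> complex"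

definition fibre_product :: "('e, 'a, 'b) F_structure \<Rightarrow> nat set \<Rightarrow> (nat \<Rightarrow> 'b) set" where
  "fibre_product F J = {x \<in> (\<Pi>\<^sub>E j\<in>J. points (cover F j)).
                          \<forall>i\<in>J. \<forall>j\<in>J. proj F i (x i) = proj F j (x j)}"

definition fibre_product_topology ::
  "('e::euclidean_space, 'a, 'b) F_structure \<Rightarrow> nat set \<Rightarrow> (nat \<Rightarrow> 'b) topology" where
  "fibre_product_topology F J =
     subtopology (product_topology (\<lambda>j. mtop (cover F j)) J) (fibre_product F J)"

text \<open>The action on the fibre product that lifts \<open>act F j\<close> is unique because the torus is
  connected, and it is automatically smooth; so only continuity is asked for.\<close>

definition commuting_lifts :: "('e::euclidean_space, 'a, 'b) F_structure \<Rightarrow> nat set \<Rightarrow> bool" where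
  "commuting_lifts F J \<longleftrightarrow>
     (\<exists>lift. (\<forall>j\<in>J. continuous_torus_action (tdim F j) (fibre_product_topology F J) (lift j) \<and>
                (\<forall>t\<in>torus (tdim F j). \<forall>x\<in>fibre_product F J. lift j t x j = act F j t (x j))) \<and>
             (\<forall>i\<in>J. \<forall>j\<in>J. \<forall>s\<in>torus (tdim F i). \<forall>t\<in>torus (tdim F j). \<forall>x\<in>fibre_product F J.
                lift i s (lift j t x) = lift j t (lift i s x)))"

definition is_F_structure ::
  "('e::euclidean_space, 'a) atlas \<Rightarrow> ('e, 'a, 'b) F_structure \<Rightarrow> bool" where
  "is_F_structure M F \<longleftrightarrow> closed_manifold M \<and>
     (\<forall>i<num F. openin (mtop M) (cset F i)) \<and> (\<Union>i<num F. cset F i) = points M \<and>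
     (\<forall>i<num F. finite_Galois_covering (cover F i) M (cset F i) (proj F i)) \<and>
     (\<forall>i<num F. tdim F i \<ge> 1 \<and> smooth_torus_action (tdim F i) (cover F i) (act F i) \<and>
        finite {t\<in>torus (tdim F i). \<forall>x\<in>points (cover F i). act F i t x = x}) \<and>
     (\<forall>i<num F. let \<Gamma> = deck (cover F i) (proj F i); X = points (cover F i); T = torus (tdim F i) in
        (\<forall>g\<in>\<Gamma>. twist F i g \<in> torus_aut (tdim F i)) \<and>
        (\<forall>g\<in>\<Gamma>. \<forall>h\<in>\<Gamma>. \<forall>t\<in>T. twist F i (compose X g h) t = twist F i g (twist F i h t)) \<and>
        (\<forall>g\<in>\<Gamma>. \<forall>t\<in>T. \<forall>x\<in>X. g (act F i t x) = act F i (twist F i g t) (g x))) \<and>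
     (\<forall>J. J \<subseteq> {..<num F} \<and> J \<noteq> {} \<and> (\<Inter>j\<in>J. cset F j) \<noteq> {} \<longrightarrow>
        (\<forall>j\<in>J. \<forall>t\<in>torus (tdim F j). \<forall>x\<in>points (cover F j).
           proj F j x \<in> (\<Inter>i\<in>J. cset F i) \<longrightarrow> proj F j (act F j t x) \<in> (\<Inter>i\<in>J. cset F i)) \<and>
        commuting_lifts F J)"

definition trivial_covering :: "('e, 'a, 'b) F_structure \<Rightarrow> nat \<Rightarrow> bool" where
  "trivial_covering F i \<longleftrightarrow> inj_on (proj F i) (points (cover F i))"

definition invariant :: "('e, 'a) atlas \<Rightarrow> ('e, 'a, 'b) F_structure \<Rightarrow> 'a set \<Rightarrow> bool" where
  "invariant M F S \<longleftrightarrow> S \<subseteq> points M \<and>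
     (\<forall>i<num F. \<forall>x\<in>points (cover F i). \<forall>t\<in>torus (tdim F i).
        proj F i x \<in> S \<longrightarrow> proj F i (act F i t x) \<in> S)"

definition orbit :: "('e, 'a) atlas \<Rightarrow> ('e, 'a, 'b) F_structure \<Rightarrow> 'a \<Rightarrow> 'a set" where
  "orbit M F y = \<Inter>{S. invariant M F S \<and> y \<in> S}"

text \<open>The orbits are compact embedded submanifolds, being locally images of orbits of the
  commuting lifted torus actions.\<close>

definition polarized :: "('e::euclidean_space, 'a) atlas \<Rightarrow> ('e, 'a, 'b) F_structure \<Rightarrow> bool" where
  "polarized M F \<longleftrightarrow>
     (\<forall>I \<subseteq> {..<num F}.
        let U = {y\<in>points M. \<forall>i\<in>I. y \<in> cset F i};
            V = (\<Union>i\<in>{..<num F} - I. cset F i)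
        in U \<noteq> {} \<longrightarrow> (\<exists>d. \<forall>y\<in>U - V. submanifold_of_dim M d (orbit M F y)))"

section \<open>The orbifold\<close>

definition inv_alpha :: "real^7 \<Rightarrow> real^7" where
  "inv_alpha x = vector [- x$1, - x$2, - x$3, - x$4, x$5, x$6, x$7]"

definition inv_beta :: "real^7 \<Rightarrow> real^7" where
  "inv_beta x = vector [- x$1, 1/2 - x$2, x$3, x$4, - x$5, - x$6, x$7]"

definition inv_gamma :: "real^7 \<Rightarrow> real^7" where
  "inv_gamma x = vector [1/2 - x$1, x$2, 1/2 - x$3, x$4, - x$5, x$6, - x$7]"

definition int_lattice :: "(real^'n) set" where
  "int_lattice = {n. \<forall>i. n $ i \<in> \<int>}"

text \<open>The point of \<open>T\<^sup>7/\<Gamma>\<close> represented by \<open>x\<close>, as the set of all its representatives in \<open>\<real>\<^sup>7\<close>.\<close>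

definition orb :: "real^7 \<Rightarrow> (real^7) set" where
  "orb x = {(inv_alpha ^^ a) ((inv_beta ^^ b) ((inv_gamma ^^ c) x)) + n | a b c n. n \<in> int_lattice}"

definition singular :: "(real^7) set" where
  "singular = {x. inv_alpha x - x \<in> int_lattice \<or> inv_beta x - x \<in> int_lattice \<or>
                  inv_gamma x - x \<in> int_lattice}"

text \<open>Each of the 12 singular tori of \<open>T\<^sup>7/\<Gamma>\<close> is represented by exactly one of the
  following: the fixed torus, of the involution \<open>k\<close>, through the centre \<open>c\<close>. A different choice of
  centres within the \<open>\<Gamma>\<close>-orbits changes the complex coordinates \<open>(z\<^sub>1, z\<^sub>2)\<close> below only by signs and
  a simultaneous complex conjugation, both of which lift to the blow-up.\<close>

datatype invol = By_alpha | By_beta | By_gamma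

fun centres :: "invol \<Rightarrow> (real^7) set" where
  "centres By_alpha = {vector [0, 0, a, b, 0, 0, 0] | a b. a \<in> {0, 1/2} \<and> b \<in> {0, 1/2}}"
| "centres By_beta = {vector [0, 1/4, 0, 0, a, b, 0] | a b. a \<in> {0, 1/2} \<and> b \<in> {0, 1/2}}"
| "centres By_gamma = {vector [1/4, 0, 1/4, 0, a, 0, b] | a b. a \<in> {0, 1/2} \<and> b \<in> {0, 1/2}}"

text \<open>Coordinates near the fixed tori: \<open>t\<close> along the torus, \<open>(z\<^sub>1, z\<^sub>2)\<close> in the normal directions.\<close>

fun tube :: "invol \<Rightarrow> real^7 \<Rightarrow> real^3 \<Rightarrow> complex \<times> complex \<Rightarrow> real^7" where
  "tube By_alpha c t (z, w) = c + vector [Re z, Im z, Re w, Im w, t$1, t$2, t$3]"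
| "tube By_beta c t (z, w) = c + vector [Re z, Im z, t$1, t$2, Re w, Im w, t$3]"
| "tube By_gamma c t (z, w) = c + vector [Re z, t$1, Im z, t$2, Im w, t$3, Re w]"

section \<open>The Eguchi--Hanson space\<close>

text \<open>The blow-up of \<open>\<complex>\<^sup>2/{\<plusminus>1}\<close> at the origin is the set of pairs \<open>({z, -z}, l)\<close> with \<open>l\<close> a complex
  line through \<open>0\<close> in \<open>\<complex>\<^sup>2\<close> and \<open>z \<in> l\<close>.\<close>

definition cline :: "complex \<times> complex \<Rightarrow> (complex \<times> complex) set" where
  "cline v = {(c * fst v, c * snd v) | c. True}"

type_synonym eh_point = "(complex \<times> complex) set \<times> (complex \<times> complex) set"

definition eguchi_hanson :: "eh_point set" where
  "eguchi_hanson = {({z, - z}, cline v) | z v. v \<noteq> 0 \<and> z \<in> cline v}"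

definition blow_down :: "eh_point \<Rightarrow> (complex \<times> complex) set" where
  "blow_down = fst"

text \<open>\<open>B\<^sub>\<epsilon>/{\<plusminus>1}\<close> and its preimage under \<open>blow_down\<close>\<close>

definition cone_ball :: "real \<Rightarrow> (complex \<times> complex) set set" where
  "cone_ball \<epsilon> = {{z, - z} | z. norm z < \<epsilon>}"

definition eh_ball :: "real \<Rightarrow> eh_point set" where
  "eh_ball \<epsilon> = {e\<in>eguchi_hanson. blow_down e \<in> cone_ball \<epsilon>}"

text \<open>The two standard parametrisations of the blow-up by \<open>\<complex>\<^sup>2\<close>: \<open>m\<close> is an affine coordinate of the
  line in \<open>\<complex>P\<^sup>1\<close> and \<open>u = s\<^sup>2\<close> is the linear coordinate in the fibre of \<open>O(-2) = T\<^sup>*\<complex>P\<^sup>1\<close>.\<close>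

fun eh_param :: "bool \<Rightarrow> complex \<times> complex \<Rightarrow> eh_point" where
  "eh_param False (m, u) = ({(s, s * m) | s. s\<^sup>2 = u}, cline (1, m))"
| "eh_param True (m, u) = ({(s * m, s) | s. s\<^sup>2 = u}, cline (m, 1))"

section \<open>The resolution\<close>

text \<open>In the quotient of \<open>(T\<^sup>7 - singular)/\<Gamma> \<squnion> \<Squnion> T\<^sup>3 \<times> eh_ball \<epsilon>\<close> by the gluing relation, every class
  contains either exactly one point of the first summand, or exactly one point of some \<open>T\<^sup>3 \<times> \<close>
  zero section, and is represented by it. Points of \<open>T\<^sup>3\<close> are cosets of the lattice in \<open>\<real>\<^sup>3\<close>.\<close>

datatype mpoint =
    Reg "(real^7) set"
  | Exc invol "real^7" "(real^3) set" "(complex \<times> complex) set"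

text \<open>The class of the point \<open>(t, e)\<close> in the copy of \<open>T\<^sup>3 \<times> eh_ball \<epsilon>\<close> at the centre \<open>c\<close>. The two
  elements \<open>z\<close>, \<open>-z\<close> of \<open>blow_down e\<close> give the same \<open>\<Gamma>\<close>-orbit, so that the union is this orbit.\<close>

definition glue :: "invol \<Rightarrow> real^7 \<Rightarrow> real^3 \<Rightarrow> eh_point \<Rightarrow> mpoint" where
  "glue k c t e =
     (if blow_down e = {0} then Exc k c {t + n | n. n \<in> int_lattice} (snd e)
      else Reg (\<Union>z\<in>blow_down e. orb (tube k c t z)))"

definition exc_coord :: "real^7 \<Rightarrow> (real^3) \<times> (complex \<times> complex)" where
  "exc_coord y = (vector [y$1, y$2, y$3], (Complex (y$4) (y$5), Complex (y$6) (y$7)))"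

definition exc_param :: "invol \<Rightarrow> real^7 \<Rightarrow> bool \<Rightarrow> real^7 \<Rightarrow> mpoint" where
  "exc_param k c j y = (let (t, mu) = exc_coord y in glue k c t (eh_param j mu))"

definition joyce_manifold :: "real \<Rightarrow> (real^7, mpoint) atlas" where
  "joyce_manifold \<epsilon> =
     {(V, \<lambda>x. Reg (orb x)) | V.
        open V \<and> V \<inter> singular = {} \<and> inj_on (\<lambda>x. Reg (orb x)) V} \<union>
     {(V, exc_param k c j) | V k c j.
        open V \<and> c \<in> centres k \<and> (\<forall>y\<in>V. eh_param j (snd (exc_coord y)) \<in> eh_ball \<epsilon>) \<and>
        inj_on (exc_param k c j) V}"

end

theory Submission
  imports Defs "HOL-Complex_Analysis.Complex_Analysis"
begin

text \<open>Up to sign and modulo \<open>1/2\<close>, the coordinate \<open>x\<^sub>1\<close> is invariant under \<open>\<Gamma>\<close>. The \<open>\<alpha>\<close>- and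
  \<open>\<beta>\<close>-singularities lie over \<open>x\<^sub>1 = 0\<close> and the \<open>\<gamma>\<close>-singularities over \<open>x\<^sub>1 = 1/4\<close>. On the open
  set \<open>\<bar>x\<^sub>1\<bar> < 1/4\<close>, whose stabiliser is generated by \<open>\<alpha>\<close> and \<open>\<beta>\<close>, the translations of \<open>x\<^sub>7\<close>
  descend to a circle action and extend over the resolution; on \<open>0 < x\<^sub>1 < 1/2\<close>, with stabiliser
  generated by \<open>\<alpha>\<beta>\<close> and \<open>\<gamma>\<close>, so do the translations of \<open>x\<^sub>2\<close>. These two sets cover the
  manifold, both with a trivial covering. They meet in \<open>0 < x\<^sub>1 < 1/4\<close>, a free quotient by
  \<open>\<alpha>\<beta>\<close>, which is taken as a third set: its double covering by a piece of the torus is the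
  nontrivial one. Orbits are tori of dimension 2 over \<open>0 < x\<^sub>1 < 1/4\<close> and circles elsewhere.

  Smoothness is handled by families of locally injective parametrisations any two of which are
  locally related by smooth maps of the parameter spaces; in all of them the circles act by
  translations of the parameters.\<close>

section \<open>Smooth maps between Euclidean spaces\<close>

text \<open>The coordinate x_1 is chosen because all three involutions reverse it and only \<gamma>
  adds a shift by 1/2, which separates the \<gamma>-tori from the others. The two circle directions
  are dictated by signs: x_7 is reversed only by elements containing \<gamma>, and x_2 only by those
  containing exactly one of \<alpha>, \<beta>. Since \<alpha>\<beta> fixes x_7 and adds 1/2 to x_2,
  it commutes with both translations; hence the homomorphisms into the automorphisms of the torus
  can all be taken trivial. The third set brings no new orbits, its circle being again that of x_7:
  it supplies the one nontrivial covering that the statement counts. The bound 1/8 on the radius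
  comes from the centres, whose coordinates are multiples of 1/4: tubes of radius 1/8 around
  inequivalent singular tori are disjoint, and they stay inside
  \<open>\<bar>x\<^sub>1\<bar> < 1/4\<close> or \<open>0 < x\<^sub>1 < 1/2\<close>. The obstacle is
  that the manifold is a set of concretely encoded classes, so that its Hausdorffness, compactness
  and connectedness have to be read off from the parametrisations.\<close>

primrec sm :: "nat \<Rightarrow> 'a::euclidean_space set \<Rightarrow> ('a \<Rightarrow> 'b::real_normed_vector) \<Rightarrow> bool" where
  "sm 0 S f \<longleftrightarrow> continuous_on S f"
| "sm (Suc r) S f \<longleftrightarrow> (\<exists>f'. (\<forall>x\<in>S. (f has_derivative f' x) (at x)) \<and> (\<forall>v. sm r S (\<lambda>x. f' x v)))"

text \<open>\<open>sm\<close> iterates the Frechet derivative, evaluated in fixed directions so that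
  the codomain never changes. In this form sums, products and compositions are covered by the usual
  rules; the directional \<open>C_k\<close> of the statement is recovered from it in
  \<open>C_k_local_smooth\<close>.\<close>

definition smooth_on :: "'a::euclidean_space set \<Rightarrow> ('a \<Rightarrow> 'b::real_normed_vector) \<Rightarrow> bool" where
  "smooth_on S f \<longleftrightarrow> (\<forall>r. sm r S f)"

lemma sm_subset: "sm r S f \<Longrightarrow> T \<subseteq> S \<Longrightarrow> sm r T f"
proof (induction r arbitrary: f)
  case 0 then show ?case by (auto intro: continuous_on_subset)
next
  case (Suc r) then show ?case by (auto; blast)
qed

lemma sm_SucD: "sm (Suc r) S f \<Longrightarrow> sm r S f"
proof (induction r arbitrary: f)
  case 0
  then obtain f' where "\<forall>x\<in>S. (f has_derivative f' x) (at x)" by auto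
  then have "continuous_on S f"
    by (meson has_derivative_continuous continuous_at_imp_continuous_on)
  then show ?case by simp
next
  case (Suc r)
  then obtain f' where "\<forall>x\<in>S. (f has_derivative f' x) (at x)" "\<And>v. sm (Suc r) S (\<lambda>x. f' x v)"
    by (auto simp del: sm.simps(1))
  with Suc.IH show ?case unfolding sm.simps by blast
qed

lemma sm_const: "sm r S (\<lambda>x. c)"
proof (induction r arbitrary: c)
  case (Suc r)
  show ?case unfolding sm.simps
    by (rule exI[of _ "\<lambda>x v. 0"]) (use Suc[of 0] in auto)
qed auto

lemma sm_bounded_linear:
  assumes "bounded_linear f" shows "sm r S f"
proof (cases r)
  case 0
  then show ?thesis by (simp add: assms linear_continuous_on)
next
  case (Suc m)
  then show ?thesis unfolding Suc sm.simps
    by (intro exI[of _ "\<lambda>x. f"]) (auto intro: sm_const assms bounded_linear_imp_has_derivative)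
qed

lemma sm_linear_comp:
  assumes "bounded_linear l" shows "sm r S f \<Longrightarrow> sm r S (\<lambda>x. l (f x))"
proof (induction r arbitrary: f)
  case 0
  then show ?case using bounded_linear.continuous_on[OF assms] by auto
next
  case (Suc r)
  then obtain f' where "\<forall>x\<in>S. (f has_derivative f' x) (at x)" "\<And>v. sm r S (\<lambda>x. f' x v)" by auto
  then show ?case unfolding sm.simps
    by (intro exI[of _ "\<lambda>x v. l (f' x v)"])
       (auto intro: Suc.IH bounded_linear.has_derivative[OF assms])
qed

lemma sm_add: "sm r S f \<Longrightarrow> sm r S g \<Longrightarrow> sm r S (\<lambda>x. f x + g x)"
proof (induction r arbitrary: f g)
  case 0
  then show ?case by (auto intro: continuous_intros)
next
  case (Suc r)
  obtain f' where f': "\<forall>x\<in>S. (f has_derivative f' x) (at x)" "\<And>v. sm r S (\<lambda>x. f' x v)"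
    using Suc.prems(1) by auto
  obtain g' where g': "\<forall>x\<in>S. (g has_derivative g' x) (at x)" "\<And>v. sm r S (\<lambda>x. g' x v)"
    using Suc.prems(2) by auto
  show ?case unfolding sm.simps
  proof (intro exI[of _ "\<lambda>x v. f' x v + g' x v"] conjI ballI allI)
    show "((\<lambda>x. f x + g x) has_derivative (\<lambda>v. f' x v + g' x v)) (at x)" if "x \<in> S" for x
      using that f' g' by (intro has_derivative_add) auto
  qed (intro Suc.IH f' g')
qed

lemma sm_sum: "finite I \<Longrightarrow> (\<And>i. i \<in> I \<Longrightarrow> sm r S (f i)) \<Longrightarrow> sm r S (\<lambda>x. \<Sum>i\<in>I. f i x)"
  by (induction I rule: finite_induct) (auto intro: sm_const sm_add)

lemma sm_bilinear:
  assumes "bounded_bilinear b"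
  shows "sm r S f \<Longrightarrow> sm r S g \<Longrightarrow> sm r S (\<lambda>x. b (f x) (g x))"
proof (induction r arbitrary: f g)
  case 0
  then show ?case using bounded_bilinear.continuous_on[OF assms] by auto
next
  case (Suc r)
  obtain f' where f': "\<forall>x\<in>S. (f has_derivative f' x) (at x)" "\<And>v. sm r S (\<lambda>x. f' x v)"
    using Suc.prems(1) by auto
  obtain g' where g': "\<forall>x\<in>S. (g has_derivative g' x) (at x)" "\<And>v. sm r S (\<lambda>x. g' x v)"
    using Suc.prems(2) by auto
  have fg: "sm r S f" "sm r S g" using Suc.prems sm_SucD by blast+
  show ?case unfolding sm.simps
  proof (intro exI[of _ "\<lambda>x v. b (f x) (g' x v) + b (f' x v) (g x)"] conjI ballI allI)
    show "((\<lambda>x. b (f x) (g x)) has_derivative (\<lambda>v. b (f x) (g' x v) + b (f' x v) (g x))) (at x)"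
      if "x \<in> S" for x
      using that f' g' by (intro bounded_bilinear.FDERIV[OF assms]) auto
  qed (intro sm_add Suc.IH f' g' fg)
qed

text \<open>In the chain rule both the base point and the direction of the outer derivative depend
  on x, whereas \<open>sm\<close> controls that derivative only in fixed directions. Expanding the
  direction in a basis of the Euclidean middle space gives a finite sum of products, to which the
  induction hypothesis applies.\<close>

lemma sm_compose:
  fixes g :: "'a::euclidean_space \<Rightarrow> 'b::euclidean_space"
  shows "sm r S g \<Longrightarrow> sm r T f \<Longrightarrow> g ` S \<subseteq> T \<Longrightarrow> sm r S (\<lambda>x. f (g x))"
proof (induction r arbitrary: f)
  case 0
  then show ?case by (auto intro: continuous_on_compose2)
next
  case (Suc r)
  obtain g' where g': "\<forall>x\<in>S. (g has_derivative g' x) (at x)" "\<And>v. sm r S (\<lambda>x. g' x v)"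
    using Suc.prems(1) by auto
  obtain f' where f': "\<forall>x\<in>T. (f has_derivative f' x) (at x)" "\<And>v. sm r T (\<lambda>x. f' x v)"
    using Suc.prems(2) by auto
  have g: "sm r S g" using Suc.prems sm_SucD by blast
  have "((\<lambda>x. f (g x)) has_derivative (\<lambda>v. \<Sum>b\<in>Basis. (g' x v \<bullet> b) *\<^sub>R f' (g x) b)) (at x)"
    if x: "x \<in> S" for x
  proof -
    have gx: "(f has_derivative f' (g x)) (at (g x))" using f'(1) Suc.prems(3) x by auto
    then have "linear (f' (g x))" by (rule has_derivative_linear)
    then have "f' (g x) w = (\<Sum>b\<in>Basis. (w \<bullet> b) *\<^sub>R f' (g x) b)" for w
      by (subst euclidean_representation[of w, symmetric])
         (simp only: linear_sum linear_scale)
    then have "(\<lambda>v. \<Sum>b\<in>Basis. (g' x v \<bullet> b) *\<^sub>R f' (g x) b) = (\<lambda>v. f' (g x) (g' x v))" by metis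
    then show ?thesis using has_derivative_compose[of g "g' x" x UNIV, OF _ gx] g'(1) x by auto
  qed
  moreover have "sm r S (\<lambda>x. \<Sum>b\<in>Basis. (g' x v \<bullet> b) *\<^sub>R f' (g x) b)" for v
    by (intro sm_sum sm_bilinear[OF bounded_bilinear_scaleR]
        sm_linear_comp[OF bounded_linear_inner_left] g'(2) Suc.IH[OF g f'(2)] Suc.prems(3)) auto
  ultimately show ?case unfolding sm.simps
    by (intro exI[of _ "\<lambda>x v. \<Sum>b\<in>Basis. (g' x v \<bullet> b) *\<^sub>R f' (g x) b"]) auto
qed

text \<open>The transition maps below are built from linear maps, products, \<open>inverse\<close>
  and \<open>csqrt\<close>; this supplies the last two. The complex derivative is holomorphic again,
  which drives the induction.\<close>

lemma sm_holomorphic: "open S \<Longrightarrow> f holomorphic_on S \<Longrightarrow> sm r S f"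
proof (induction r arbitrary: f)
  case 0
  then show ?case by (auto intro: holomorphic_on_imp_continuous_on)
next
  case (Suc r)
  have "\<forall>x\<in>S. (f has_derivative (\<lambda>v. deriv f x * v)) (at x)"
    using holomorphic_derivI[OF Suc.prems(2,1)] by (auto simp: has_field_derivative_def)
  moreover have "sm r S (\<lambda>x. deriv f x * v)" for v
    by (intro Suc.IH Suc.prems holomorphic_intros holomorphic_deriv)
  ultimately show ?case by auto
qed

lemma smooth_on_subset: "smooth_on S f \<Longrightarrow> T \<subseteq> S \<Longrightarrow> smooth_on T f"
  and smooth_on_const: "smooth_on S (\<lambda>x. c)"
  and smooth_on_bounded_linear: "bounded_linear l \<Longrightarrow> smooth_on S l"
  and smooth_on_linear_comp: "bounded_linear h \<Longrightarrow> smooth_on S f' \<Longrightarrow> smooth_on S (\<lambda>x. h (f' x))"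
  and smooth_on_add: "smooth_on S f \<Longrightarrow> smooth_on S g \<Longrightarrow> smooth_on S (\<lambda>x. f x + g x)"
  and smooth_on_holomorphic: "open T' \<Longrightarrow> k holomorphic_on T' \<Longrightarrow> smooth_on T' k"
  by (auto simp: smooth_on_def intro: sm_subset sm_const sm_bounded_linear sm_linear_comp
      sm_add sm_holomorphic)

lemma smooth_on_mult:
  fixes f g :: "'a::euclidean_space \<Rightarrow> 'b::real_normed_algebra"
  shows "smooth_on S f \<Longrightarrow> smooth_on S g \<Longrightarrow> smooth_on S (\<lambda>x. f x * g x)"
  by (auto simp: smooth_on_def intro: sm_bilinear bounded_bilinear_mult)

lemma smooth_on_compose:
  fixes g :: "'a::euclidean_space \<Rightarrow> 'b::euclidean_space"
  shows "smooth_on S g \<Longrightarrow> smooth_on T f \<Longrightarrow> g ` S \<subseteq> T \<Longrightarrow> smooth_on S (\<lambda>x. f (g x))"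
  unfolding smooth_on_def by (blast intro: sm_compose)

lemma smooth_on_Pair:
  fixes f :: "'a::euclidean_space \<Rightarrow> 'b::euclidean_space" and g :: "'a \<Rightarrow> 'c::euclidean_space"
  assumes "smooth_on S f" "smooth_on S g"
  shows "smooth_on S (\<lambda>x. (f x, g x))"
proof -
  have "bounded_linear (\<lambda>y::'b. (y, 0::'c))" "bounded_linear (\<lambda>z::'c. (0::'b, z))"
    by (auto intro!: bounded_linear_Pair bounded_linear_ident bounded_linear_zero)
  then have "smooth_on S (\<lambda>x. (f x, 0::'c) + (0::'b, g x))"
    using assms by (intro smooth_on_add) (auto intro: smooth_on_linear_comp)
  then show ?thesis by simp
qed

lemma smooth_on_imp_continuous_on: "smooth_on S f \<Longrightarrow> continuous_on S f"
  unfolding smooth_on_def using sm.simps(1) by blast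

section \<open>From Frechet derivatives to iterated directional derivatives\<close>

lemma continuous_on_local:
  assumes "\<And>x. x \<in> S \<Longrightarrow> \<exists>N g. open N \<and> x \<in> N \<and> continuous_on (S \<inter> N) g \<and> (\<forall>z\<in>S\<inter>N. f z = g z)"
  shows "continuous_on S f"
  unfolding continuous_on_topological
proof (intro ballI allI impI)
  fix x B assume x: "x \<in> S" and B: "open B" "f x \<in> B"
  obtain N g where N: "open N" "x \<in> N" "continuous_on (S \<inter> N) g" "\<forall>z\<in>S\<inter>N. f z = g z"
    using assms[OF x] by blast
  then obtain A where A: "open A" "x \<in> A" "\<forall>y\<in>S\<inter>N. y \<in> A \<longrightarrow> g y \<in> B"
    using x B unfolding continuous_on_topological by (metis IntI)
  then show "\<exists>A. open A \<and> x \<in> A \<and> (\<forall>y\<in>S. y \<in> A \<longrightarrow> f y \<in> B)"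
    using N by (intro exI[of _ "A \<inter> N"]) auto
qed

text \<open>The model space \<open>D\<close> of a torus action is not a normed space, which is why the linear map \<open>l\<close>
  to a Euclidean space intervenes here.\<close>

lemma C_k_local_smooth:
  fixes f :: "'a::{real_vector,topological_space} \<Rightarrow> 'b::real_normed_vector"
    and l :: "'a \<Rightarrow> 'c::euclidean_space"
  assumes l: "\<And>x v s. l (x + s *\<^sub>R v) = l x + s *\<^sub>R l v" "continuous_on S l"
    and D: "S \<subseteq> D" "\<And>x v s. x \<in> D \<Longrightarrow> v \<in> D \<Longrightarrow> x + s *\<^sub>R v \<in> D"
    and ray: "\<And>x v. continuous_on UNIV (\<lambda>s::real. x + s *\<^sub>R v :: 'a)"
    and loc: "\<And>x. x \<in> S \<Longrightarrow> \<exists>N T g. open N \<and> x \<in> N \<and> open T \<and> sm r T g \<and>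
                 (\<forall>z\<in>N\<inter>D. z \<in> S \<and> l z \<in> T \<and> f z = g (l z))"
  shows "C_k r D S f"
proof -
  have cont: "continuous_on S f"
    if A: "\<And>x. x \<in> S \<Longrightarrow> \<exists>N T g. open N \<and> x \<in> N \<and> open T \<and> continuous_on T g \<and>
                 (\<forall>z\<in>N\<inter>D. z \<in> S \<and> l z \<in> T \<and> f z = g (l z))" for f :: "'a \<Rightarrow> 'b"
  proof (rule continuous_on_local)
    fix x assume "x \<in> S"
    then obtain N T g where *: "open N" "x \<in> N" "open T" "continuous_on T g"
      "\<forall>z\<in>N\<inter>D. z \<in> S \<and> l z \<in> T \<and> f z = g (l z)"
      using A[of x] by metis
    have SN: "S \<inter> N \<subseteq> N \<inter> D" using D by auto
    have "continuous_on (S \<inter> N) (\<lambda>z. g (l z))"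
      by (rule continuous_on_compose2[OF *(4) continuous_on_subset[OF l(2)]]) (use * SN in auto)
    then show "\<exists>N g. open N \<and> x \<in> N \<and> continuous_on (S \<inter> N) g \<and> (\<forall>z\<in>S\<inter>N. f z = g z)"
      using * SN by blast
  qed
  show ?thesis using loc
proof (induction r arbitrary: f)
  case (0 f)
  then show ?case using cont[of f] by simp
next
  case (Suc r f)
  have "\<exists>f'. (\<forall>x\<in>S. ((\<lambda>s. f (x + s *\<^sub>R v)) has_vector_derivative f' x) (at 0)) \<and> C_k r D S f'"
    if v: "v \<in> D" for v
  proof -
    \<comment> \<open>The local representations \<open>g\<close> give different expressions for the
      derivative, but one function on all of \<open>S\<close> is required. The vector derivative
      along \<open>v\<close> is such a function, and agrees with each local expression.\<close>
    define f' where "f' x = vector_derivative (\<lambda>s. f (x + s *\<^sub>R v)) (at 0)" for x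
    have loc': "\<exists>N T g g'. open N \<and> x \<in> N \<and> open T \<and> sm r T g' \<and>
       (\<forall>z\<in>N\<inter>D. z \<in> S \<and> l z \<in> T \<and> f' z = g' (l z)
          \<and> ((\<lambda>s. f (z + s *\<^sub>R v)) has_vector_derivative f' z) (at 0))"
      if x: "x \<in> S" for x
    proof -
      obtain N T g where *: "open N" "x \<in> N" "open T" "sm (Suc r) T g"
        "\<forall>z\<in>N\<inter>D. z \<in> S \<and> l z \<in> T \<and> f z = g (l z)"
        using Suc.prems[OF x] by auto
      obtain g' where g': "\<forall>x\<in>T. (g has_derivative g' x) (at x)" "\<And>v. sm r T (\<lambda>x. g' x v)"
        using *(4) by auto
      have der: "((\<lambda>s. f (z + s *\<^sub>R v)) has_vector_derivative g' (l z) (l v)) (at 0)"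
        if z: "z \<in> N \<inter> D" for z
      proof -
        \<comment> \<open>For small s the ray stays in \<open>N\<close>, and it never leaves
          \<open>D\<close>; on it \<open>f\<close> coincides with \<open>g\<close> composed with
          \<open>l\<close>, along which the ray becomes a straight line in the Euclidean
          space.\<close>
        have op: "open ((\<lambda>s::real. z + s *\<^sub>R v) -` N)"
          using open_vimage[OF *(1) ray] .
        have gd: "(g has_derivative g' (l z)) (at (l z))" using g' * z by auto
        moreover have "((\<lambda>s::real. l z + s *\<^sub>R l v) has_derivative (\<lambda>s. s *\<^sub>R l v)) (at 0)"
          by (auto intro!: derivative_eq_intros)
        ultimately have "((\<lambda>s::real. g (l z + s *\<^sub>R l v)) has_derivative
            (\<lambda>s. g' (l z) (s *\<^sub>R l v))) (at 0)"
          using has_derivative_compose[of "\<lambda>s::real. l z + s *\<^sub>R l v" "\<lambda>s. s *\<^sub>R l v" 0 UNIV g "g' (l z)"]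
          by simp
        then have "((\<lambda>s::real. g (l z + s *\<^sub>R l v)) has_vector_derivative g' (l z) (l v)) (at 0)"
          using linear_scale[OF has_derivative_linear[OF gd]] by (simp add: has_vector_derivative_def)
        then show ?thesis
        proof (rule has_vector_derivative_transform_within_open[OF _ op])
          show "0 \<in> (\<lambda>s. z + s *\<^sub>R v) -` N" using z by simp
          fix s assume "s \<in> (\<lambda>s. z + s *\<^sub>R v) -` N"
          then have "z + s *\<^sub>R v \<in> N \<inter> D" using D(2) z v by auto
          then show "g (l z + s *\<^sub>R l v) = f (z + s *\<^sub>R v)" using * l(1) by metis
        qed
      qed
      then have f'z: "f' z = g' (l z) (l v)" if "z \<in> N \<inter> D" for z
        unfolding f'_def using that by (simp add: vector_derivative_at)
      have "z \<in> S \<and> l z \<in> T \<and> f' z = g' (l z) (l v)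
          \<and> ((\<lambda>s. f (z + s *\<^sub>R v)) has_vector_derivative f' z) (at 0)" if "z \<in> N \<inter> D" for z
        using der[OF that] f'z[OF that] *(5) that by simp
      with *(1-3) g'(2)[of "l v"] show ?thesis
        by (intro exI[of _ N] exI[of _ T] exI[of _ g] exI[of _ "\<lambda>y. g' y (l v)"] conjI ballI) blast+
    qed
    have "C_k r D S f'"
    proof (rule Suc.IH)
      fix x assume "x \<in> S"
      from loc'[OF this] show "\<exists>N T g. open N \<and> x \<in> N \<and> open T \<and> sm r T g \<and>
        (\<forall>z\<in>N\<inter>D. z \<in> S \<and> l z \<in> T \<and> f' z = g (l z))"
        by metis
    qed
    moreover have "((\<lambda>s. f (x + s *\<^sub>R v)) has_vector_derivative f' x) (at 0)" if "x \<in> S" for x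
      using loc'[OF that] D(1) that by (metis IntI subsetD)
    ultimately show ?thesis by blast
  qed
  moreover have "continuous_on S f"
  proof (rule cont)
    fix x assume "x \<in> S"
    then obtain N T g where *: "open N" "x \<in> N" "open T" "sm (Suc r) T g"
      "\<forall>z\<in>N\<inter>D. z \<in> S \<and> l z \<in> T \<and> f z = g (l z)"
      using Suc.prems[of x] by metis
    have "sm 0 T g" using *(4) by (induction r) (auto dest: sm_SucD simp del: sm.simps)
    then show "\<exists>N T g. open N \<and> x \<in> N \<and> open T \<and> continuous_on T g \<and>
                 (\<forall>z\<in>N\<inter>D. z \<in> S \<and> l z \<in> T \<and> f z = g (l z))"
      using * by auto
  qed
  ultimately show ?case by simp
qed
qed

section \<open>Atlases generated by locally injective parametrisations\<close>

text \<open>The parametrisations \<open>(W, p)\<close> of such a family need not be injective; the atlas consists of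
  their restrictions to the open sets on which they are.\<close>

definition gen_atlas :: "('e::euclidean_space set \<times> ('e \<Rightarrow> 'a)) set \<Rightarrow> ('e, 'a) atlas" where
  "gen_atlas P = {(V, p). \<exists>W. (W, p) \<in> P \<and> V \<subseteq> W \<and> open V \<and> inj_on p V}"

text \<open>Since \<open>q\<close> is only locally injective, several parameters y may represent the
  point \<open>f (p x)\<close>; prescribing \<tau> x = y selects the local branch of the coordinate
  expression of \<open>f\<close>.\<close>

definition smooth_lift :: "'e::euclidean_space set \<Rightarrow> ('e \<Rightarrow> 'a) \<Rightarrow> 'f::euclidean_space set \<Rightarrow> ('f \<Rightarrow> 'b)
    \<Rightarrow> ('a \<Rightarrow> 'b) \<Rightarrow> 'e \<Rightarrow> 'f \<Rightarrow> bool" where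
  "smooth_lift V p W q f x y \<longleftrightarrow> (\<exists>N \<tau>. open N \<and> x \<in> N \<and> N \<subseteq> V \<and> smooth_on N \<tau> \<and> \<tau> x = y \<and>
     \<tau> ` N \<subseteq> W \<and> (\<forall>z\<in>N. f (p z) = q (\<tau> z)))"

lemma gen_atlasD: "(V, p) \<in> gen_atlas P \<Longrightarrow> open V \<and> inj_on p V \<and> (\<exists>W. (W, p) \<in> P \<and> V \<subseteq> W)"
  by (auto simp: gen_atlas_def)

lemma smooth_liftI:
  assumes "open N" "x \<in> N" "N \<subseteq> V" "smooth_on N \<tau>" "\<tau> x = y" "open W" "y \<in> W"
    "\<And>z. z \<in> N \<Longrightarrow> \<tau> z \<in> W \<Longrightarrow> f (p z) = q (\<tau> z)"
  shows "smooth_lift V p W q f x y"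
proof -
  have "open (N \<inter> \<tau> -` W)"
    using continuous_open_preimage[OF smooth_on_imp_continuous_on] assms by blast
  then show ?thesis unfolding smooth_lift_def
    using assms by (intro exI[of _ "N \<inter> \<tau> -` W"] exI[of _ \<tau>])
      (auto intro: smooth_on_subset)
qed

lemma smooth_liftE:
  assumes "smooth_lift V p W q f x y"
  obtains N \<tau> where "open N" "x \<in> N" "N \<subseteq> V" "smooth_on N \<tau>" "\<tau> x = y" "\<tau> ` N \<subseteq> W"
    "\<And>z. z \<in> N \<Longrightarrow> f (p z) = q (\<tau> z)"
  using assms unfolding smooth_lift_def by blast

text \<open>Only germs at x and y matter, so the domains can be exchanged for any other open sets
  containing these points, not just for smaller ones.\<close>

lemma smooth_lift_mono:
  assumes "smooth_lift V p W q f x y" "open V'" "open W'" "x \<in> V'" "y \<in> W'"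
  shows "smooth_lift V' p W' q f x y"
proof -
  obtain N \<tau> where N: "open N" "x \<in> N" "N \<subseteq> V" "smooth_on N \<tau>" "\<tau> x = y" "\<tau> ` N \<subseteq> W"
    "\<And>z. z \<in> N \<Longrightarrow> f (p z) = q (\<tau> z)"
    using smooth_liftE[OF assms(1)] by metis
  show ?thesis
    by (rule smooth_liftI[of "N \<inter> V'" _ _ \<tau>]) (use assms N smooth_on_subset[OF N(4)] in auto)
qed

lemma smooth_lift_compose:
  assumes "smooth_lift V p W q f x y" "smooth_lift W' q U r g y z" "open W'" "open V"
  shows "smooth_lift V p U r (\<lambda>a. g (f a)) x z"
proof -
  obtain N \<tau> where N: "open N" "x \<in> N" "N \<subseteq> V" "smooth_on N \<tau>" "\<tau> x = y" "\<tau> ` N \<subseteq> W"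
    "\<And>z. z \<in> N \<Longrightarrow> f (p z) = q (\<tau> z)"
    using smooth_liftE[OF assms(1)] by metis
  obtain N' \<tau>' where N': "open N'" "y \<in> N'" "N' \<subseteq> W'" "smooth_on N' \<tau>'" "\<tau>' y = z" "\<tau>' ` N' \<subseteq> U"
    "\<And>z. z \<in> N' \<Longrightarrow> g (q z) = r (\<tau>' z)"
    using smooth_liftE[OF assms(2)] by metis
  have "open (N \<inter> \<tau> -` N')"
    using continuous_open_preimage[OF smooth_on_imp_continuous_on] N N' by blast
  moreover have "smooth_on (N \<inter> \<tau> -` N') (\<lambda>x. \<tau>' (\<tau> x))"
    by (rule smooth_on_compose[OF smooth_on_subset[OF N(4)] N'(4)]) auto
  ultimately show ?thesis unfolding smooth_lift_def
    by (intro exI[of _ "N \<inter> \<tau> -` N'"] exI[of _ "\<lambda>x. \<tau>' (\<tau> x)"]) (use N N' in auto)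
qed

lemma C_infinity_UNIV:
  fixes f :: "'e::euclidean_space \<Rightarrow> 'b::real_normed_vector"
  assumes "\<And>x. x \<in> S \<Longrightarrow> \<exists>N g. open N \<and> x \<in> N \<and> N \<subseteq> S \<and> smooth_on N g \<and> (\<forall>z\<in>N. f z = g z)"
  shows "C_infinity UNIV S f"
  unfolding C_infinity_def
proof
  fix r
  show "C_k r UNIV S f"
  proof (rule C_k_local_smooth[where l = "\<lambda>x. x"])
    fix x assume "x \<in> S"
    from assms[OF this] obtain N g where
      "open N" "x \<in> N" "N \<subseteq> S" "smooth_on N g" "\<forall>z\<in>N. f z = g z" by metis
    then show "\<exists>N T g. open N \<and> x \<in> N \<and> open T \<and> sm r T g \<and>
        (\<forall>z\<in>N \<inter> UNIV. z \<in> S \<and> z \<in> T \<and> f z = g z)"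
      by (intro exI[of _ N] exI[of _ g]) (auto simp: smooth_on_def)
  qed (auto intro!: continuous_intros)
qed

text \<open>The neighbourhoods on which the lifts live show that the domain of the coordinate
  expression is open; on each of them injectivity of \<open>q\<close> identifies this expression
  with the smooth map \<tau>.\<close>

lemma smooth_in_chartsI:
  assumes "open V" "open W" "inj_on q W"
    and "\<And>x y. x \<in> V \<Longrightarrow> y \<in> W \<Longrightarrow> f (p x) = q y \<Longrightarrow> smooth_lift V p W q f x y"
  shows "smooth_in_charts (V, p) (W, q) f"
proof -
  define S where "S = {x\<in>V. f (p x) \<in> q ` W}"
  have loc: "\<exists>N g. open N \<and> x \<in> N \<and> N \<subseteq> S \<and> smooth_on N g \<and> (\<forall>z\<in>N. inv_into W q (f (p z)) = g z)"
    if "x \<in> S" for x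
  proof -
    obtain y where "x \<in> V" "y \<in> W" "f (p x) = q y" using \<open>x \<in> S\<close> by (auto simp: S_def)
    from smooth_liftE[OF assms(4)[OF this]]
    obtain N \<tau> where N: "open N" "x \<in> N" "N \<subseteq> V" "smooth_on N \<tau>" "\<tau> ` N \<subseteq> W"
      "\<And>z. z \<in> N \<Longrightarrow> f (p z) = q (\<tau> z)" by metis
    have "inv_into W q (f (p z)) = \<tau> z" if "z \<in> N" for z
      using that N assms(3) by (metis image_subset_iff inv_into_f_f)
    moreover have "N \<subseteq> S" using N by (auto simp: S_def)
    ultimately show ?thesis using N by blast
  qed
  have "open S" using loc by (meson open_subopen)
  then show ?thesis using C_infinity_UNIV[OF loc] by (simp add: S_def Let_def)
qed

text \<open>Each assumption serves one property of the generated manifold: countability its second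
  countability, local injectivity the existence of charts around every point, the smooth lifts of
  the identity the compatibility of charts, and closedness of the coincidence relation the Hausdorff
  property.\<close>

locale param_family =
  fixes P :: "('e::euclidean_space set \<times> ('e \<Rightarrow> 'a)) set"
  assumes countable_P: "countable P"
    and open_dom: "(V, p) \<in> P \<Longrightarrow> open V"
    and loc_inj: "(V, p) \<in> P \<Longrightarrow> x \<in> V \<Longrightarrow> \<exists>N. open N \<and> x \<in> N \<and> N \<subseteq> V \<and> inj_on p N"
    and trans: "(V, p) \<in> P \<Longrightarrow> (W, q) \<in> P \<Longrightarrow> x \<in> V \<Longrightarrow> y \<in> W \<Longrightarrow> p x = q y \<Longrightarrow>
                  smooth_lift V p W q (\<lambda>a. a) x y"
    and closed_rel: "(V, p) \<in> P \<Longrightarrow> (W, q) \<in> P \<Longrightarrow>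
                  closedin (top_of_set (V \<times> W)) {(x, y). x \<in> V \<and> y \<in> W \<and> p x = q y}"
begin

lemma points_gen: "points (gen_atlas P) = (\<Union>(V, p)\<in>P. p ` V)"
proof (intro set_eqI iffI)
  fix a assume "a \<in> (\<Union>(V, p)\<in>P. p ` V)"
  then obtain V p x where x: "(V, p) \<in> P" "x \<in> V" "a = p x" by auto
  then obtain N where "open N" "x \<in> N" "N \<subseteq> V" "inj_on p N" using loc_inj by metis
  then have "(N, p) \<in> gen_atlas P" using x by (auto simp: gen_atlas_def)
  then show "a \<in> points (gen_atlas P)" using x \<open>x \<in> N\<close> by (force simp: points_def)
qed (auto simp: points_def gen_atlas_def)

lemma in_points: "(V, p) \<in> P \<Longrightarrow> x \<in> V \<Longrightarrow> p x \<in> points (gen_atlas P)"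
  unfolding points_gen by auto

lemma pointsE:
  assumes "a \<in> points (gen_atlas P)" obtains V p x where "(V, p) \<in> P" "x \<in> V" "a = p x"
  using assms unfolding points_gen by auto

text \<open>Openness can be tested on the parametrisations themselves rather than on their injective
  restrictions, because local injectivity puts a chart around every parameter.\<close>

lemma openin_gen:
  "openin (mtop (gen_atlas P)) U \<longleftrightarrow>
     U \<subseteq> points (gen_atlas P) \<and> (\<forall>(V, p)\<in>P. open {x\<in>V. p x \<in> U})"
proof -
  have "open {x\<in>V. p x \<in> U}" if "(V, p) \<in> P" "\<forall>(V, p)\<in>gen_atlas P. open {x\<in>V. p x \<in> U}" for V p
  proof (subst open_subopen, safe)
    fix x assume "x \<in> V" "p x \<in> U"
    then obtain N where N: "open N" "x \<in> N" "N \<subseteq> V" "inj_on p N" using loc_inj \<open>(V, p) \<in> P\<close> by metis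
    then have "(N, p) \<in> gen_atlas P" using that by (auto simp: gen_atlas_def)
    then show "\<exists>T. open T \<and> x \<in> T \<and> T \<subseteq> {x \<in> V. p x \<in> U}"
      using that N \<open>p x \<in> U\<close> by (intro exI[of _ "{x\<in>N. p x \<in> U}"]) auto
  qed
  moreover have "open {x\<in>V. p x \<in> U}"
    if V: "(V, p) \<in> gen_atlas P" and *: "\<forall>(V, p)\<in>P. open {x\<in>V. p x \<in> U}" for V p
  proof -
    obtain W where W: "(W, p) \<in> P" "V \<subseteq> W" "open V" using V by (auto simp: gen_atlas_def)
    then have "{x\<in>V. p x \<in> U} = V \<inter> {x\<in>W. p x \<in> U}" by auto
    with W * show ?thesis by auto
  qed
  ultimately show ?thesis unfolding openin_mtop by blast
qed

lemma topspace_gen [simp]: "topspace (mtop (gen_atlas P)) = points (gen_atlas P)"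
proof -
  have "open {x\<in>V. p x \<in> points (gen_atlas P)}" if "(V, p) \<in> P" for V p
  proof -
    have "{x\<in>V. p x \<in> points (gen_atlas P)} = V" using in_points that by auto
    then show ?thesis using open_dom that by simp
  qed
  then have "openin (mtop (gen_atlas P)) (points (gen_atlas P))" by (auto simp: openin_gen)
  then show ?thesis
    by (metis openin_gen openin_subset openin_topspace subset_antisym)
qed

text \<open>If \<open>q y\<close> lies in the image of \<open>N\<close>, the lift of the identity
  carries a whole neighbourhood of y into \<open>N\<close>; hence preimages under every other
  parametrisation are open.\<close>

lemma open_image:
  assumes "(V, p) \<in> P" "N \<subseteq> V" "open N" shows "openin (mtop (gen_atlas P)) (p ` N)"
  unfolding openin_gen
proof (intro conjI ballI, use assms in_points in blast, safe)
  fix W q assume Q: "(W, q) \<in> P"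
  show "open {y\<in>W. q y \<in> p ` N}"
  proof (subst open_subopen, safe)
    fix y x assume "y \<in> W" "x \<in> N" "q y = p x"
    then have "smooth_lift W q V p (\<lambda>a. a) y x" using trans[OF Q assms(1)] assms by auto
    then have "smooth_lift W q N p (\<lambda>a. a) y x"
      using smooth_lift_mono assms(3) \<open>x \<in> N\<close> \<open>y \<in> W\<close> open_dom[OF Q] by metis
    then obtain M \<tau> where "open M" "y \<in> M" "M \<subseteq> W" "\<tau> ` M \<subseteq> N" "\<And>z. z \<in> M \<Longrightarrow> q z = p (\<tau> z)"
      by (rule smooth_liftE) metis
    then show "\<exists>T. open T \<and> y \<in> T \<and> T \<subseteq> {y\<in>W. q y \<in> p ` N}"
      by (intro exI[of _ M]) auto
  qed
qed

lemma open_preimage: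
  "(V, p) \<in> P \<Longrightarrow> openin (mtop (gen_atlas P)) U \<Longrightarrow> open {x\<in>V. p x \<in> U}"
  unfolding openin_gen by auto

lemma continuous_param:
  assumes "(V, p) \<in> P" shows "continuous_map (top_of_set V) (mtop (gen_atlas P)) p"
  unfolding continuous_map_def
proof (intro conjI allI impI)
  show "p \<in> topspace (top_of_set V) \<rightarrow> topspace (mtop (gen_atlas P))" using assms in_points by auto
  fix U assume "openin (mtop (gen_atlas P)) U"
  then have "open {x\<in>V. p x \<in> U}" by (rule open_preimage[OF assms])
  then show "openin (top_of_set V) {x \<in> topspace (top_of_set V). p x \<in> U}"
    by (auto intro: openin_open_Int simp: openin_open)
qed

lemma gen_subset_maximal: "gen_atlas P \<subseteq> maximal_atlas (gen_atlas P)"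
proof -
  have charts: "smooth_in_charts (V, p) (W, q) (\<lambda>a. a)"
    if c: "(V, p) \<in> gen_atlas P" "(W, q) \<in> gen_atlas P" for V p W q
  proof (rule smooth_in_chartsI)
    obtain V' W' where V': "(V', p) \<in> P" "V \<subseteq> V'" "open V" and W': "(W', q) \<in> P" "W \<subseteq> W'" "open W"
      using c by (auto simp: gen_atlas_def)
    then show "open V" "open W" by auto
    show "inj_on q W" using c by (auto simp: gen_atlas_def)
    fix x y assume "x \<in> V" "y \<in> W" "p x = q y"
    then show "smooth_lift V p W q (\<lambda>a. a) x y"
      using trans[OF V'(1) W'(1)] V' W' smooth_lift_mono by (metis subsetD)
  qed
  show ?thesis
  proof safe
    fix V p assume V: "(V, p) \<in> gen_atlas P"
    then have "open V" "inj_on p V" "p ` V \<subseteq> points (gen_atlas P)"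
      using in_points by (blast dest: gen_atlasD)+
    then show "(V, p) \<in> maximal_atlas (gen_atlas P)"
      unfolding maximal_atlas_def using charts[OF V] charts[OF _ V]
      by (auto simp: compatible_def simp del: smooth_in_charts.simps)
  qed
qed

text \<open>Slices in \<open>submanifold_of_dim\<close> are cut out by linear subspaces, so an orbit
  point has to sit at parameter 0. The recentred chart need not be a restriction of a member of
  \<open>P\<close>, which is why the maximal atlas enters.\<close>

lemma translated_in_maximal:
  assumes "(V, p) \<in> gen_atlas P"
  shows "({z. z + x \<in> V}, \<lambda>z. p (z + x)) \<in> maximal_atlas (gen_atlas P)"
proof -
  obtain V' where V': "(V', p) \<in> P" "V \<subseteq> V'" "open V" "inj_on p V"
    using assms by (auto simp: gen_atlas_def)
  define N where "N = {z. z + x \<in> V}"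
  have "open ((\<lambda>z. z + x) -` V)"
    by (intro open_vimage V') (auto intro: continuous_intros)
  then have N: "open N" by (simp add: N_def vimage_def)
  have inj: "inj_on (\<lambda>z. p (z + x)) N" using V'(4) by (force simp: inj_on_def N_def)
  have sub: "(\<lambda>z. p (z + x)) ` N \<subseteq> points (gen_atlas P)" using in_points V' by (auto simp: N_def)
  have shift: "smooth_on S (\<lambda>z. z + b)" for S and b :: 'e
    by (intro smooth_on_add smooth_on_const smooth_on_bounded_linear bounded_linear_ident)
  have "compatible (N, \<lambda>z. p (z + x)) c" if c_in: "c \<in> gen_atlas P" for c
  proof -
    obtain W q where c: "c = (W, q)" by force
    obtain W' where W': "(W', q) \<in> P" "W \<subseteq> W'" "open W" "inj_on q W"
      using gen_atlasD c_in unfolding c by metis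
    have "smooth_in_charts (N, \<lambda>z. p (z + x)) (W, q) (\<lambda>a. a)"
    proof (rule smooth_in_chartsI[OF N W'(3,4)])
      fix z y assume z: "z \<in> N" "y \<in> W" "p (z + x) = q y"
      have 1: "smooth_lift N (\<lambda>z. p (z + x)) V p (\<lambda>a. a) z (z + x)"
        by (rule smooth_liftI[of N _ _ "\<lambda>z. z + x"]) (use V' N z shift in \<open>auto simp: N_def\<close>)
      have 2: "smooth_lift V p W q (\<lambda>a. a) (z + x) y"
        by (rule smooth_lift_mono[OF trans[OF V'(1) W'(1)]]) (use V' W' z in \<open>auto simp: N_def\<close>)
      show "smooth_lift N (\<lambda>z. p (z + x)) W q (\<lambda>a. a) z y"
        by (rule smooth_lift_compose[OF 1 2 V'(3) N])
    qed
    moreover have "smooth_in_charts (W, q) (N, \<lambda>z. p (z + x)) (\<lambda>a. a)"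
    proof (rule smooth_in_chartsI[OF W'(3) N inj])
      fix y z assume z: "y \<in> W" "z \<in> N" "q y = p (z + x)"
      have 1: "smooth_lift W q V p (\<lambda>a. a) y (z + x)"
        by (rule smooth_lift_mono[OF trans[OF W'(1) V'(1)]]) (use V' W' z in \<open>auto simp: N_def\<close>)
      have 2: "smooth_lift V p N (\<lambda>z. p (z + x)) (\<lambda>a. a) (z + x) z"
        by (rule smooth_liftI[of V _ _ "\<lambda>z. z + (- x)"]) (use V' N z shift[of _ "-x"] in \<open>auto simp: N_def\<close>)
      show "smooth_lift W q N (\<lambda>z. p (z + x)) (\<lambda>a. a) y z"
        by (rule smooth_lift_compose[OF 1 2 V'(3) W'(3)])
    qed
    ultimately show ?thesis by (simp add: compatible_def c del: smooth_in_charts.simps)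
  qed
  then show ?thesis unfolding maximal_atlas_def using N inj sub
    by (auto simp: N_def[symmetric] simp del: smooth_in_charts.simps)
qed

text \<open>Parameters of distinct points lie off the closed coincidence relation, so a product
  neighbourhood avoids it; the images of its two factors are disjoint, and open by
  \<open>open_image\<close>.\<close>

lemma Hausdorff_gen: "Hausdorff_space (mtop (gen_atlas P))"
  unfolding Hausdorff_space_def
proof (intro allI impI, elim conjE, unfold topspace_gen)
  fix a b assume a: "a \<in> points (gen_atlas P)" and b: "b \<in> points (gen_atlas P)" and "a \<noteq> b"
  obtain V p x where x: "(V, p) \<in> P" "x \<in> V" "a = p x" using pointsE[OF a] .
  obtain W q y where y: "(W, q) \<in> P" "y \<in> W" "b = q y" using pointsE[OF b] .
  let ?R = "{(x, y). x \<in> V \<and> y \<in> W \<and> p x = q y}"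
  have "openin (top_of_set (V \<times> W)) (V \<times> W - ?R)"
    using closed_rel[OF x(1) y(1)] by (auto simp: closedin_def)
  then have op: "open (V \<times> W - ?R)"
    using openin_open_eq[OF open_Times[OF open_dom[OF x(1)] open_dom[OF y(1)]]] by blast
  have mem: "(x, y) \<in> V \<times> W - ?R" using x y \<open>a \<noteq> b\<close> by auto
  obtain A B where AB: "open A" "open B" "(x, y) \<in> A \<times> B" "A \<times> B \<subseteq> V \<times> W - ?R"
    using open_prod_elim[OF op mem] .
  then have "A \<subseteq> V" "B \<subseteq> W" by auto
  then have "openin (mtop (gen_atlas P)) (p ` A)" "openin (mtop (gen_atlas P)) (q ` B)"
    using open_image x y AB by auto
  moreover have "disjnt (p ` A) (q ` B)" using AB \<open>A \<subseteq> V\<close> \<open>B \<subseteq> W\<close> by (force simp: disjnt_def)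
  ultimately show "\<exists>U V. openin (mtop (gen_atlas P)) U \<and> openin (mtop (gen_atlas P)) V \<and>
      a \<in> U \<and> b \<in> V \<and> disjnt U V"
    using AB x y by (intro exI[of _ "p ` A"] exI[of _ "q ` B"]) auto
qed

lemma second_countable_gen: "second_countable (mtop (gen_atlas P))"
proof -
  obtain \<B> :: "'e set set" where \<B>: "countable \<B>" "\<And>S. S \<in> \<B> \<Longrightarrow> open S"
    "\<And>S. open S \<Longrightarrow> \<exists>\<U>. \<U> \<subseteq> \<B> \<and> S = \<Union>\<U>"
    using univ_second_countable by blast
  define \<C> where "\<C> = (\<lambda>((V, p), B). p ` B) ` {((V, p), B). (V, p) \<in> P \<and> B \<in> \<B> \<and> B \<subseteq> V}"
  have "countable (P \<times> \<B>)" using countable_P \<B> by auto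
  then have "countable \<C>" unfolding \<C>_def
    by (intro countable_image) (rule countable_subset, auto)
  moreover have "openin (mtop (gen_atlas P)) C" if "C \<in> \<C>" for C
    using that open_image \<B> by (auto simp: \<C>_def)
  moreover have "\<exists>C\<in>\<C>. a \<in> C \<and> C \<subseteq> U" if U: "openin (mtop (gen_atlas P)) U" and "a \<in> U" for U a
  proof -
    have "a \<in> points (gen_atlas P)" using that openin_subset by fastforce
    then obtain V p x where x: "(V, p) \<in> P" "x \<in> V" "a = p x" by (rule pointsE)
    have "open {x\<in>V. p x \<in> U}" using open_preimage x U by blast
    then obtain \<U> where "\<U> \<subseteq> \<B>" "{x\<in>V. p x \<in> U} = \<Union>\<U>" using \<B>(3) by metis
    then obtain B where "B \<in> \<B>" "x \<in> B" "B \<subseteq> {x\<in>V. p x \<in> U}" using x \<open>a \<in> U\<close> by blast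
    then show ?thesis using x by (intro bexI[of _ "p ` B"]) (auto simp: \<C>_def intro!: image_eqI[of _ _ "((V, p), B)"])
  qed
  ultimately show ?thesis unfolding second_countable_def by meson
qed

lemma smooth_manifold_gen: "smooth_manifold (gen_atlas P)"
  unfolding smooth_manifold_def using gen_subset_maximal Hausdorff_gen second_countable_gen by blast

lemma compactin_image:
  assumes "(V, p) \<in> P" "compact K" "K \<subseteq> V" shows "compactin (mtop (gen_atlas P)) (p ` K)"
  using image_compactin[OF _ continuous_param[OF assms(1)], of K] assms
  by (simp add: compactin_subtopology)

text \<open>Connectedness is reduced to density of one connected piece of one domain, since the
  closure of a connected set is connected.\<close>

lemma connected_gen:
  assumes "(V0, p0) \<in> P" "connected A" "A \<subseteq> V0"
    and dense: "\<And>V p x. (V, p) \<in> P \<Longrightarrow> x \<in> V \<Longrightarrow> p x \<in> mtop (gen_atlas P) closure_of (p0 ` A)"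
  shows "connected_space (mtop (gen_atlas P))"
proof -
  have "connectedin (mtop (gen_atlas P)) (p0 ` A)"
    using connectedin_continuous_map_image[OF continuous_param[OF assms(1)], of A] assms
    by (simp add: connectedin_subtopology)
  then have "connectedin (mtop (gen_atlas P)) (mtop (gen_atlas P) closure_of (p0 ` A))"
    by (rule connectedin_closure_of)
  moreover have "mtop (gen_atlas P) closure_of (p0 ` A) = points (gen_atlas P)"
  proof
    show "mtop (gen_atlas P) closure_of (p0 ` A) \<subseteq> points (gen_atlas P)"
      using closure_of_subset_topspace by fastforce
  qed (use dense in \<open>auto elim!: pointsE\<close>)
  ultimately show ?thesis using connectedin_topspace[of "mtop (gen_atlas P)"] by simp
qed

text \<open>By idempotence of the closure, density can be proved in stages: it is enough to approach
  the point through points already known to lie in the closure.\<close>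

lemma closure_of_param:
  assumes "(V, p) \<in> P" "x \<in> V"
    and "\<And>N. open N \<Longrightarrow> x \<in> N \<Longrightarrow> N \<subseteq> V \<Longrightarrow> \<exists>z\<in>N. p z \<in> mtop (gen_atlas P) closure_of B"
  shows "p x \<in> mtop (gen_atlas P) closure_of B"
proof -
  have "p x \<in> mtop (gen_atlas P) closure_of (mtop (gen_atlas P) closure_of B)"
  proof (subst in_closure_of, intro conjI allI impI)
    show "p x \<in> topspace (mtop (gen_atlas P))" using assms(1,2) in_points by simp
    fix T assume T: "p x \<in> T \<and> openin (mtop (gen_atlas P)) T"
    then have "open {x\<in>V. p x \<in> T}" using open_preimage assms by blast
    with T assms(2) assms(3)[of "{x\<in>V. p x \<in> T}"]
    show "\<exists>y. y \<in> mtop (gen_atlas P) closure_of B \<and> y \<in> T" by auto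
  qed
  then show ?thesis by simp
qed

end

text \<open>One lift per parameter suffices: any other parametrisation of the image point is reached
  by composing with a lift of the identity in \<open>Q\<close>.\<close>

lemma smooth_map_lift:
  assumes "param_family P" "param_family Q"
    and lift: "\<And>V p x. (V, p) \<in> P \<Longrightarrow> x \<in> V \<Longrightarrow>
                \<exists>W q y. (W, q) \<in> Q \<and> y \<in> W \<and> smooth_lift V p W q f x y"
  shows "smooth_map (gen_atlas P) (gen_atlas Q) f"
proof -
  interpret P: param_family P by fact
  interpret Q: param_family Q by fact
  have lift': "smooth_lift V p W q f x y"
    if *: "(V, p) \<in> P" "x \<in> V" "(W, q) \<in> Q" "y \<in> W" "f (p x) = q y" for V p W q x y
  proof -
    obtain W' q' y' where W': "(W', q') \<in> Q" "y' \<in> W'" "smooth_lift V p W' q' f x y'"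
      using lift[OF *(1,2)] by metis
    then have "f (p x) = q' y'" by (auto elim!: smooth_liftE)
    then have "smooth_lift W' q' W q (\<lambda>a. a) y' y" using Q.trans W' that by metis
    from smooth_lift_compose[OF W'(3) this Q.open_dom[OF W'(1)] P.open_dom[OF *(1)]]
    show ?thesis .
  qed
  have "f ` points (gen_atlas P) \<subseteq> points (gen_atlas Q)"
  proof safe
    fix a assume "a \<in> points (gen_atlas P)"
    then obtain V p x where x: "(V, p) \<in> P" "x \<in> V" "a = p x" by (rule P.pointsE)
    then obtain W q y where W: "(W, q) \<in> Q" "y \<in> W" "smooth_lift V p W q f x y"
      using lift by metis
    then have "f (p x) = q y" by (auto elim!: smooth_liftE)
    then show "f a \<in> points (gen_atlas Q)" using W x Q.in_points by auto
  qed
  moreover have "smooth_in_charts (V, p) (W, q) f"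
    if c: "(V, p) \<in> gen_atlas P" "(W, q) \<in> gen_atlas Q" for V p W q
  proof (rule smooth_in_chartsI)
    obtain V' W' where V': "(V', p) \<in> P" "V \<subseteq> V'" "open V" and W': "(W', q) \<in> Q" "W \<subseteq> W'" "open W"
      using c by (auto simp: gen_atlas_def)
    then show "open V" "open W" by auto
    show "inj_on q W" using that by (auto simp: gen_atlas_def)
    fix x y assume "x \<in> V" "y \<in> W" "f (p x) = q y"
    then show "smooth_lift V p W q f x y"
      using lift'[OF V'(1) _ W'(1)] V' W' smooth_lift_mono by (metis subsetD)
  qed
  ultimately show ?thesis unfolding smooth_map_def by (auto simp del: smooth_in_charts.simps)
qed

text \<open>Here \<open>f\<close> is known only through charts, as happens for an arbitrary deck
  transformation. Continuity comes from the requirement that coordinate expressions have open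
  domains, together with their continuity there.\<close>

lemma smooth_map_continuous:
  assumes "param_family P" "param_family Q" "smooth_map (gen_atlas P) (gen_atlas Q) f"
  shows "continuous_map (mtop (gen_atlas P)) (mtop (gen_atlas Q)) f"
proof -
  interpret P: param_family P by fact
  interpret Q: param_family Q by fact
  show ?thesis unfolding continuous_map_def
  proof (intro conjI allI impI)
    show "f \<in> topspace (mtop (gen_atlas P)) \<rightarrow> topspace (mtop (gen_atlas Q))"
      using assms(3) by (auto simp: smooth_map_def)
    fix U assume U: "openin (mtop (gen_atlas Q)) U"
    have "open {x\<in>V. f (p x) \<in> U}" if V: "(V, p) \<in> gen_atlas P" for V p
    proof (subst open_subopen, safe)
      fix x assume x: "x \<in> V" "f (p x) \<in> U"
      have "p x \<in> points (gen_atlas P)" using V x by (force simp: points_def)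
      then have "f (p x) \<in> points (gen_atlas Q)" using assms(3) by (auto simp: smooth_map_def)
      then obtain W q y where W: "(W, q) \<in> gen_atlas Q" "y \<in> W" "f (p x) = q y"
        unfolding points_def by auto
      define S where "S = {x\<in>V. f (p x) \<in> q ` W}"
      have sc: "smooth_in_charts (V, p) (W, q) f" using assms(3) V W unfolding smooth_map_def by blast
      then have S: "open S" "C_infinity UNIV S (\<lambda>x. inv_into W q (f (p x)))"
        using W x unfolding smooth_in_charts.simps Let_def S_def[symmetric] by blast+
      then have cont: "continuous_on S (\<lambda>x. inv_into W q (f (p x)))"
        unfolding C_infinity_def using C_k.simps(1) by blast
      have "open {y\<in>W. q y \<in> U}" using U W by (auto simp: openin_mtop)
      from continuous_open_preimage[OF cont S(1) this]
      have "open (S \<inter> (\<lambda>x. inv_into W q (f (p x))) -` {y\<in>W. q y \<in> U})" .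
      moreover have "x \<in> S \<inter> (\<lambda>x. inv_into W q (f (p x))) -` {y\<in>W. q y \<in> U}"
        using x W by (auto simp: S_def inv_into_into f_inv_into_f intro!: inv_into_into)
      moreover have "S \<inter> (\<lambda>x. inv_into W q (f (p x))) -` {y\<in>W. q y \<in> U} \<subseteq> {x\<in>V. f (p x) \<in> U}"
        by (auto simp: S_def f_inv_into_f)
      ultimately show "\<exists>T. open T \<and> x \<in> T \<and> T \<subseteq> {x \<in> V. f (p x) \<in> U}" by blast
    qed
    moreover have "p x \<in> points (gen_atlas P)" if "(V, p) \<in> gen_atlas P" "x \<in> V" for V p x
      using that by (force simp: points_def)
    then have "{x \<in> V. p x \<in> points (gen_atlas P) \<and> f (p x) \<in> U} = {x\<in>V. f (p x) \<in> U}"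
      if "(V, p) \<in> gen_atlas P" for V p
      using that by auto
    ultimately show "openin (mtop (gen_atlas P)) {x \<in> topspace (mtop (gen_atlas P)). f x \<in> U}"
      unfolding openin_mtop by auto
  qed
qed

section \<open>Families over a given family\<close>

text \<open>A member of \<open>Q\<close> uses the parameters of a member of \<open>P\<close>, and
  \<pi> becomes the identity in them. This is how both the one-sheeted coverings and the double
  covering sit over the manifold.\<close>

definition coord_over :: "('e::euclidean_space set \<times> ('e \<Rightarrow> 'b)) set \<Rightarrow> ('e set \<times> ('e \<Rightarrow> 'a)) set
    \<Rightarrow> ('b \<Rightarrow> 'a) \<Rightarrow> bool" where
  "coord_over Q P \<pi> \<longleftrightarrow> (\<forall>(W, q)\<in>Q. open W \<and> (\<exists>V p. (V, p) \<in> P \<and> W \<subseteq> V \<and> (\<forall>y\<in>W. \<pi> (q y) = p y)))"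

lemma coord_overE:
  assumes "coord_over Q P \<pi>" "(W, q) \<in> Q"
  obtains V p where "(V, p) \<in> P" "W \<subseteq> V" "\<And>y. y \<in> W \<Longrightarrow> \<pi> (q y) = p y" "open W"
proof -
  have "open W \<and> (\<exists>V p. (V, p) \<in> P \<and> W \<subseteq> V \<and> (\<forall>y\<in>W. \<pi> (q y) = p y))"
    using bspec[OF assms(1)[unfolded coord_over_def] assms(2)] by simp
  then show ?thesis using that by metis
qed

lemma smooth_on_id: "smooth_on S (\<lambda>x. x)"
  by (intro smooth_on_bounded_linear bounded_linear_ident)

text \<open>With \<pi> injective, coincidence of points upstairs is equivalent to coincidence
  downstairs, so transition maps, local injectivity and the closed relation are all inherited with
  the same parameters.\<close>

lemma param_family_over:
  assumes "param_family P" "countable Q" "coord_over Q P \<pi>" and inj: "inj_on \<pi> (\<Union>(W, q)\<in>Q. q ` W)"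
  shows "param_family Q"
proof -
  interpret P: param_family P by fact
  have eqD: "q x = q' y" if "(W, q) \<in> Q" "(W', q') \<in> Q" "x \<in> W" "y \<in> W'" "\<pi> (q x) = \<pi> (q' y)"
    for W q W' q' x y
    by (rule inj_onD[OF inj that(5)]) (use that in force)+
  show ?thesis
  proof
    show "countable Q" by fact
  next
    fix W q assume "(W, q) \<in> Q" then show "open W" using assms(3) by (auto simp: coord_over_def)
  next
    fix W q x assume Q: "(W, q) \<in> Q" and x: "x \<in> W"
    obtain V p where V: "(V, p) \<in> P" "W \<subseteq> V" "\<And>y. y \<in> W \<Longrightarrow> \<pi> (q y) = p y" "open W"
      using coord_overE[OF assms(3) Q] by metis
    obtain N where N: "open N" "x \<in> N" "inj_on p N"
      using P.loc_inj[OF V(1) subsetD[OF V(2) x]] by blast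
    have "inj_on q (N \<inter> W)"
      using N(3) V(3) unfolding inj_on_def by (metis IntE)
    then show "\<exists>N. open N \<and> x \<in> N \<and> N \<subseteq> W \<and> inj_on q N"
      using N V x by (intro exI[of _ "N \<inter> W"]) auto
  next
    fix W q W' q' x y
    assume Q: "(W, q) \<in> Q" "(W', q') \<in> Q" and xy: "x \<in> W" "y \<in> W'" "q x = q' y"
    obtain V p where V: "(V, p) \<in> P" "W \<subseteq> V" "\<And>y. y \<in> W \<Longrightarrow> \<pi> (q y) = p y" "open W"
      using coord_overE[OF assms(3) Q(1)] by metis
    obtain V' p' where V': "(V', p') \<in> P" "W' \<subseteq> V'" "\<And>y. y \<in> W' \<Longrightarrow> \<pi> (q' y) = p' y" "open W'"
      using coord_overE[OF assms(3) Q(2)] by metis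
    have "p x = p' y" using V V' xy by metis
    then have "smooth_lift W p W' p' (\<lambda>a. a) x y"
      using smooth_lift_mono[OF P.trans[OF V(1) V'(1)]] V V' xy by blast
    then obtain N \<tau> where N: "open N" "x \<in> N" "N \<subseteq> W" "smooth_on N \<tau>" "\<tau> x = y" "\<tau> ` N \<subseteq> W'"
      "\<And>z. z \<in> N \<Longrightarrow> p z = p' (\<tau> z)"
      by (rule smooth_liftE) metis
    have "q z = q' (\<tau> z)" if "z \<in> N" for z
    proof (rule eqD[OF Q])
      show z: "z \<in> W" "\<tau> z \<in> W'" using that N by auto
      show "\<pi> (q z) = \<pi> (q' (\<tau> z))" using V(3)[OF z(1)] V'(3)[OF z(2)] N(7)[OF that] by simp
    qed
    then show "smooth_lift W q W' q' (\<lambda>a. a) x y"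
      unfolding smooth_lift_def using N by blast
  next
    fix W q W' q'
    assume Q: "(W, q) \<in> Q" "(W', q') \<in> Q"
    obtain V p where V: "(V, p) \<in> P" "W \<subseteq> V" "\<And>y. y \<in> W \<Longrightarrow> \<pi> (q y) = p y" "open W"
      using coord_overE[OF assms(3) Q(1)] by metis
    obtain V' p' where V': "(V', p') \<in> P" "W' \<subseteq> V'" "\<And>y. y \<in> W' \<Longrightarrow> \<pi> (q' y) = p' y" "open W'"
      using coord_overE[OF assms(3) Q(2)] by metis
    have "{(x, y). x \<in> W \<and> y \<in> W' \<and> q x = q' y}
        = (W \<times> W') \<inter> {(x, y). x \<in> V \<and> y \<in> V' \<and> p x = p' y}"
    proof (intro set_eqI iffI; clarify)
      fix x y assume "x \<in> W" "y \<in> W'" "q x = q' y"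
      then show "(x, y) \<in> (W \<times> W') \<inter> {(x, y). x \<in> V \<and> y \<in> V' \<and> p x = p' y}"
        using V V' by (auto; metis)
    next
      fix x y assume "x \<in> W" "y \<in> W'" "p x = p' y"
      then show "q x = q' y" using eqD[OF Q] V V' by metis
    qed
    moreover have "closedin (top_of_set (W \<times> W')) ((W \<times> W') \<inter> {(x, y). x \<in> V \<and> y \<in> V' \<and> p x = p' y})"
      using P.closed_rel[OF V(1) V'(1)] V V' unfolding closedin_closed by (auto 0 3)
    ultimately show "closedin (top_of_set (W \<times> W')) {(x, y). x \<in> W \<and> y \<in> W' \<and> q x = q' y}" by simp
  qed
qed

definition restr :: "('e::euclidean_space set \<times> ('e \<Rightarrow> 'a)) set \<Rightarrow> 'a set \<Rightarrow> ('e set \<times> ('e \<Rightarrow> 'a)) set" where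
  "restr P S = (\<lambda>(V, p). ({x\<in>V. p x \<in> S}, p)) ` P"

context param_family
begin

lemma param_family_restr:
  assumes "openin (mtop (gen_atlas P)) S" shows "param_family (restr P S)"
proof (rule param_family_over[where \<pi> = "\<lambda>a. a"])
  show "param_family P" by unfold_locales
  show "countable (restr P S)" unfolding restr_def by (intro countable_image countable_P)
  show "coord_over (restr P S) P (\<lambda>a. a)"
    using open_preimage[OF _ assms] by (auto simp: coord_over_def restr_def; blast)
qed auto

lemma open_submanifold_gen:
  assumes "openin (mtop (gen_atlas P)) S"
  shows "open_submanifold (gen_atlas P) S = gen_atlas (restr P S)"
proof (intro set_eqI iffI; clarify)
  fix V p assume "(V, p) \<in> open_submanifold (gen_atlas P) S"
  then obtain V' W where V: "V = {x\<in>V'. p x \<in> S}" "(W, p) \<in> P" "V' \<subseteq> W" "open V'" "inj_on p V'"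
    by (auto simp: open_submanifold_def gen_atlas_def)
  have "{x\<in>V'. p x \<in> S} = V' \<inter> {x\<in>W. p x \<in> S}" using V by auto
  then have "open V" using open_preimage[OF V(2) assms] V by auto
  moreover have "inj_on p V" using V by (auto intro: inj_on_subset)
  moreover have "({x\<in>W. p x \<in> S}, p) \<in> restr P S" using V by (force simp: restr_def)
  ultimately show "(V, p) \<in> gen_atlas (restr P S)"
    unfolding gen_atlas_def using V by blast
next
  fix V p assume "(V, p) \<in> gen_atlas (restr P S)"
  then obtain W where "(W, p) \<in> P" "V \<subseteq> {x\<in>W. p x \<in> S}" "open V" "inj_on p V"
    by (auto simp: gen_atlas_def restr_def)
  moreover from this have "V = {x\<in>V. p x \<in> S}" by auto
  ultimately show "(V, p) \<in> open_submanifold (gen_atlas P) S"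
    unfolding open_submanifold_def gen_atlas_def by blast
qed

lemma points_restr:
  assumes "openin (mtop (gen_atlas P)) S" shows "points (gen_atlas (restr P S)) = S"
proof -
  interpret R: param_family "restr P S" by (rule param_family_restr[OF assms])
  have sub: "S \<subseteq> points (gen_atlas P)" using openin_subset[OF assms] by simp
  show ?thesis
  proof (intro set_eqI iffI)
    fix a assume a: "a \<in> S"
    obtain V p x where "(V, p) \<in> P" "x \<in> V" "a = p x" using pointsE[OF subsetD[OF sub a]] .
    then show "a \<in> points (gen_atlas (restr P S))"
      using R.in_points[of "{x\<in>V. p x \<in> S}" p x] a by (force simp: restr_def)
  next
    fix a assume "a \<in> points (gen_atlas (restr P S))"
    then show "a \<in> S" by (rule R.pointsE) (auto simp: restr_def)
  qed
qed

end

section \<open>Local diffeomorphisms and one-sheeted coverings\<close>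

lemma over_smooth:
  assumes "param_family P" "param_family Q" "coord_over Q P \<pi>"
  shows "smooth_map (gen_atlas Q) (gen_atlas P) \<pi>"
proof (rule smooth_map_lift[OF assms(2,1)])
  fix W q y assume Q: "(W, q) \<in> Q" "y \<in> W"
  obtain V p where V: "(V, p) \<in> P" "W \<subseteq> V" "\<And>y. y \<in> W \<Longrightarrow> \<pi> (q y) = p y" "open W"
    using coord_overE[OF assms(3) Q(1)] by metis
  have "open V" using assms(1) V(1) by (rule param_family.open_dom)
  then have "smooth_lift W q V p \<pi> y y"
    by (intro smooth_liftI[of W _ _ "\<lambda>x. x"]) (use V Q smooth_on_id in auto)
  then show "\<exists>V p x. (V, p) \<in> P \<and> x \<in> V \<and> smooth_lift W q V p \<pi> y x" using V Q by blast
qed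

lemma over_open:
  assumes "param_family P" "param_family Q" "coord_over Q P \<pi>" and S: "openin (mtop (gen_atlas Q)) S"
  shows "openin (mtop (gen_atlas P)) (\<pi> ` S)"
proof (subst openin_subopen, safe)
  interpret P: param_family P by fact
  interpret Q: param_family Q by fact
  fix a assume a: "a \<in> S"
  then have "a \<in> points (gen_atlas Q)" using openin_subset[OF S] by auto
  then obtain W q y where Q: "(W, q) \<in> Q" "y \<in> W" "a = q y" by (rule Q.pointsE)
  obtain V p where V: "(V, p) \<in> P" "W \<subseteq> V" "\<And>y. y \<in> W \<Longrightarrow> \<pi> (q y) = p y" "open W"
    using coord_overE[OF assms(3) Q(1)] by metis
  let ?N = "{y\<in>W. q y \<in> S}"
  have "openin (mtop (gen_atlas P)) (p ` ?N)"
    using P.open_image[OF V(1), of ?N] Q.open_preimage[OF Q(1) S] V by auto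
  moreover have "p ` ?N \<subseteq> \<pi> ` S" using V(3) by (metis (no_types, lifting) image_eqI image_subsetI mem_Collect_eq)
  moreover have "\<pi> a \<in> p ` ?N" using V Q a by auto
  ultimately show "\<exists>T. openin (mtop (gen_atlas P)) T \<and> \<pi> a \<in> T \<and> T \<subseteq> \<pi> ` S" by blast
qed

text \<open>Read in parameters, the inverse of \<pi> on \<open>S\<close> is a transition map of
  \<open>P\<close> from an arbitrary parametrisation to one that underlies a member of
  \<open>Q\<close>; it is therefore smooth.\<close>

lemma over_diffeo:
  assumes PQ: "param_family P" "param_family Q" "coord_over Q P \<pi>" and S: "openin (mtop (gen_atlas Q)) S"
    and inj: "inj_on \<pi> S"
  shows "diffeomorphism (open_submanifold (gen_atlas Q) S) (open_submanifold (gen_atlas P) (\<pi> ` S)) \<pi>"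
proof -
  interpret P: param_family P by fact
  interpret Q: param_family Q by fact
  have T: "openin (mtop (gen_atlas P)) (\<pi> ` S)" using over_open[OF PQ S] .
  interpret RQ: param_family "restr Q S" by (rule Q.param_family_restr[OF S])
  interpret RP: param_family "restr P (\<pi> ` S)" by (rule P.param_family_restr[OF T])
  have pts: "points (gen_atlas (restr Q S)) = S" "points (gen_atlas (restr P (\<pi> ` S))) = \<pi> ` S"
    using Q.points_restr[OF S] P.points_restr[OF T] .
  have over: "coord_over (restr Q S) (restr P (\<pi> ` S)) \<pi>"
    unfolding coord_over_def
  proof (clarify)
    fix W' q assume "(W', q) \<in> restr Q S"
    then obtain W where W: "(W, q) \<in> Q" "W' = {y\<in>W. q y \<in> S}" by (auto simp: restr_def)
    obtain V p where V: "(V, p) \<in> P" "W \<subseteq> V" "\<And>y. y \<in> W \<Longrightarrow> \<pi> (q y) = p y" "open W"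
      using coord_overE[OF PQ(3) W(1)] by metis
    have "({x\<in>V. p x \<in> \<pi> ` S}, p) \<in> restr P (\<pi> ` S)" using V(1) by (force simp: restr_def)
    moreover have "W' \<subseteq> {x\<in>V. p x \<in> \<pi> ` S}" using W V(2) V(3)[symmetric] by auto
    ultimately show "open W' \<and> (\<exists>V p. (V, p) \<in> restr P (\<pi> ` S) \<and> W' \<subseteq> V \<and> (\<forall>y\<in>W'. \<pi> (q y) = p y))"
      using Q.open_preimage[OF W(1) S] W V(3) by blast
  qed
  have "smooth_map (gen_atlas (restr P (\<pi> ` S))) (gen_atlas (restr Q S)) (inv_into S \<pi>)"
  proof (rule smooth_map_lift)
    show "param_family (restr P (\<pi> ` S))" "param_family (restr Q S)" by unfold_locales
    fix V' p x assume V': "(V', p) \<in> restr P (\<pi> ` S)" "x \<in> V'"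
    then obtain V where V: "(V, p) \<in> P" "V' = {x\<in>V. p x \<in> \<pi> ` S}" by (auto simp: restr_def)
    then obtain a where a: "a \<in> S" "p x = \<pi> a" using V' by auto
    then have "a \<in> points (gen_atlas (restr Q S))" using pts by simp
    then obtain W q y where Q: "(W, q) \<in> restr Q S" "y \<in> W" "a = q y" by (rule RQ.pointsE)
    obtain V2 p2 where V2: "(V2, p2) \<in> restr P (\<pi> ` S)" "W \<subseteq> V2" "\<And>y. y \<in> W \<Longrightarrow> \<pi> (q y) = p2 y" "open W"
      using coord_overE[OF over Q(1)] by metis
    have "p x = p2 y" using a Q V2 by simp
    then have "smooth_lift V' p V2 p2 (\<lambda>a. a) x y" using RP.trans[OF V'(1) V2(1) V'(2)] V2 Q by auto
    then have "smooth_lift V' p W p2 (\<lambda>a. a) x y"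
      by (rule smooth_lift_mono) (use V' V2 Q RP.open_dom in auto)
    then obtain N \<tau> where N: "open N" "x \<in> N" "N \<subseteq> V'" "smooth_on N \<tau>" "\<tau> x = y" "\<tau> ` N \<subseteq> W"
      "\<And>z. z \<in> N \<Longrightarrow> p z = p2 (\<tau> z)"
      by (rule smooth_liftE) metis
    have "inv_into S \<pi> (p z) = q (\<tau> z)" if "z \<in> N" for z
    proof -
      have "\<tau> z \<in> W" using that N by auto
      then have "q (\<tau> z) \<in> S" using Q by (auto simp: restr_def)
      moreover have "p z = \<pi> (q (\<tau> z))" using N(7)[OF that] V2(3)[OF \<open>\<tau> z \<in> W\<close>] by simp
      ultimately show ?thesis using inj by simp
    qed
    then have "smooth_lift V' p W q (inv_into S \<pi>) x y" unfolding smooth_lift_def using N by blast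
    then show "\<exists>W q y. (W, q) \<in> restr Q S \<and> y \<in> W \<and> smooth_lift V' p W q (inv_into S \<pi>) x y"
      using Q by blast
  qed
  then show ?thesis
    unfolding diffeomorphism_def Q.open_submanifold_gen[OF S] P.open_submanifold_gen[OF T] pts
    using over_smooth[OF _ _ over] inj by (auto simp: bij_betw_def intro: RP.param_family_axioms RQ.param_family_axioms)
qed

text \<open>An involution is its own inverse, so a single set of lifts proves smoothness in both
  directions. The deck transformations constructed below, the identity and the swap of two sheets,
  are of this kind.\<close>

lemma diffeomorphism_involution:
  assumes "param_family Q" and invol: "\<And>a. a \<in> points (gen_atlas Q) \<Longrightarrow> g a \<in> points (gen_atlas Q) \<and> g (g a) = a"
    and lift: "\<And>W q y. (W, q) \<in> Q \<Longrightarrow> y \<in> W \<Longrightarrow> \<exists>W' q' y'. (W', q') \<in> Q \<and> y' \<in> W' \<and> smooth_lift W q W' q' g y y'"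
  shows "diffeomorphism (gen_atlas Q) (gen_atlas Q) g"
proof -
  interpret Q: param_family Q by fact
  let ?X = "points (gen_atlas Q)"
  have bij: "bij_betw g ?X ?X"
    by (rule bij_betw_byWitness[where f' = g]) (use invol in auto)
  then have inv: "inv_into ?X g a = g a" if "a \<in> ?X" for a
    using that invol by (metis bij_betw_inv_into_left)
  have "smooth_map (gen_atlas Q) (gen_atlas Q) (inv_into ?X g)"
  proof (rule smooth_map_lift[OF assms(1,1)])
    fix W q y assume Q: "(W, q) \<in> Q" "y \<in> W"
    then obtain W' q' y' where L: "(W', q') \<in> Q" "y' \<in> W'" "smooth_lift W q W' q' g y y'"
      using lift by metis
    then have "smooth_lift W q W' q' (inv_into ?X g) y y'"
      unfolding smooth_lift_def using inv Q.in_points[OF Q(1)] by (metis subsetD)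
    with L show "\<exists>W' q' y'. (W', q') \<in> Q \<and> y' \<in> W' \<and> smooth_lift W q W' q' (inv_into ?X g) y y'"
      by blast
  qed
  then show ?thesis unfolding diffeomorphism_def using bij smooth_map_lift[OF assms(1,1) lift] by blast
qed

lemma deck_identity:
  assumes "param_family Q" shows "(\<lambda>a\<in>points (gen_atlas Q). a) \<in> deck (gen_atlas Q) \<pi>"
proof -
  interpret Q: param_family Q by fact
  have "diffeomorphism (gen_atlas Q) (gen_atlas Q) (\<lambda>a\<in>points (gen_atlas Q). a)"
  proof (rule diffeomorphism_involution[OF assms])
    fix W q y assume Q: "(W, q) \<in> Q" "y \<in> W"
    then have "smooth_lift W q W q (\<lambda>a\<in>points (gen_atlas Q). a) y y"
      by (intro smooth_liftI[of W _ _ "\<lambda>x. x"])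
         (use Q.open_dom[OF Q(1)] Q.in_points[OF Q(1)] smooth_on_id in auto)
    with Q show "\<exists>W' q' y'. (W', q') \<in> Q \<and> y' \<in> W' \<and>
        smooth_lift W q W' q' (\<lambda>a\<in>points (gen_atlas Q). a) y y'" by blast
  qed auto
  then show ?thesis by (auto simp: deck_def)
qed

lemma one_sheeted_covering:
  assumes PQ: "param_family P" "param_family Q" "coord_over Q P \<pi>"
    and inj: "inj_on \<pi> (points (gen_atlas Q))" and conn: "connected_space (mtop (gen_atlas Q))"
  shows "finite_Galois_covering (gen_atlas Q) (gen_atlas P) (\<pi> ` points (gen_atlas Q)) \<pi>"
proof -
  interpret Q: param_family Q by fact
  let ?X = "points (gen_atlas Q)"
  have X: "openin (mtop (gen_atlas Q)) ?X" using openin_topspace[of "mtop (gen_atlas Q)"] by simp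
  have "smooth_covering (gen_atlas Q) (gen_atlas P) (\<pi> ` ?X) \<pi>"
    unfolding smooth_covering_def
  proof (intro conjI ballI refl)
    fix y assume y: "y \<in> \<pi> ` ?X"
    show "\<exists>V. y \<in> V \<and> V \<subseteq> \<pi> ` ?X \<and> openin (mtop (gen_atlas P)) V \<and>
      (\<exists>\<S>. disjoint \<S> \<and> \<Union> \<S> = {x \<in> ?X. \<pi> x \<in> V} \<and>
        (\<forall>S\<in>\<S>. openin (mtop (gen_atlas Q)) S \<and>
           diffeomorphism (open_submanifold (gen_atlas Q) S) (open_submanifold (gen_atlas P) V) \<pi>))"
      using y over_open[OF PQ X] over_diffeo[OF PQ X inj] X
      by (intro exI[of _ "\<pi> ` ?X"] conjI exI[of _ "{?X}"]) (auto simp: disjoint_def)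
  qed
  moreover have "finite {x\<in>?X. \<pi> x = y}" for y
  proof (cases "\<exists>a\<in>?X. \<pi> a = y")
    case True
    then obtain a where "a \<in> ?X" "\<pi> a = y" by blast
    then have "{x\<in>?X. \<pi> x = y} \<subseteq> {a}" using inj by (auto simp: inj_on_def)
    then show ?thesis using finite_subset by blast
  next
    case False
    then have "{x\<in>?X. \<pi> x = y} = {}" by auto
    then show ?thesis by (simp only: finite.emptyI)
  qed
  moreover have "\<exists>g\<in>deck (gen_atlas Q) \<pi>. g x = x'"
    if "x \<in> ?X" "x' \<in> ?X" "\<pi> x = \<pi> x'" for x x'
  proof -
    have "x = x'" using that inj by (auto simp: inj_on_def)
    then show ?thesis using deck_identity[OF PQ(2)] that
      by (intro bexI[of _ "\<lambda>a\<in>?X. a"]) auto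
  qed
  ultimately show ?thesis
    unfolding finite_Galois_covering_def using Q.smooth_manifold_gen conn by blast
qed

section \<open>Circle actions by translations\<close>

definition fam :: "('e set \<times> ('e \<Rightarrow> 'a) \<times> 'e) set \<Rightarrow> ('e set \<times> ('e \<Rightarrow> 'a)) set" where
  "fam T = (\<lambda>(V, p, v). (V, p)) ` T"

text \<open>The action is chosen from all ways of writing the point as \<open>p x\<close> and the
  group element as an angle s; independence of these choices is what the locale \<open>flow\<close>
  guarantees. Only the entry \<open>t 0\<close> enters, as all other entries of an element of the
  1-torus are 1.\<close>

definition flow_act :: "('e::euclidean_space set \<times> ('e \<Rightarrow> 'a) \<times> 'e) set \<Rightarrow> (nat \<Rightarrow> complex) \<Rightarrow> 'a \<Rightarrow> 'a" where
  "flow_act T t a = (SOME b. \<exists>V p v x s. (V, p, v) \<in> T \<and> x \<in> V \<and> a = p x \<and> t 0 = cis (2 * pi * s) \<and>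
     b = p (x + s *\<^sub>R v))"

lemma torus_1_cis:
  assumes "t \<in> torus 1" obtains s where "t 0 = cis (2 * pi * s)"
proof -
  have 1: "cmod (t 0) = 1" using assms by (auto simp: torus_def)
  then have "t 0 \<noteq> 0" by auto
  then have "cis (Arg (t 0)) = t 0" using cis_Arg[of "t 0"] 1 by (simp add: sgn_div_norm)
  then show ?thesis using that[of "Arg (t 0) / (2 * pi)"] by simp
qed

lemma cis_eq_imp_diff_int: "cis (2 * pi * s) = cis (2 * pi * r) \<Longrightarrow> \<exists>n. s = r + of_int n"
proof -
  assume "cis (2 * pi * s) = cis (2 * pi * r)"
  then have "sin (2 * pi * s) = sin (2 * pi * r) \<and> cos (2 * pi * s) = cos (2 * pi * r)"
    by (metis cis.sel)
  then obtain n where "2 * pi * s = 2 * pi * r + 2 * pi * of_int n"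
    unfolding sin_cos_eq_iff by (auto simp: algebra_simps)
  then have "2 * pi * s = 2 * pi * (r + of_int n)" by (simp add: algebra_simps)
  then show ?thesis by auto
qed

text \<open>The exponential map onto the circle is open. A local inverse near s0 is obtained from
  \<open>Arg\<close> of the quotient by the given point: the quotient is near 1, hence away from the
  branch cut.\<close>

lemma cis_image_nhd:
  assumes "open A" "s0 \<in> A"
  shows "\<exists>d>0. \<forall>w. cmod w = 1 \<longrightarrow> dist w (cis (2 * pi * s0)) < d \<longrightarrow> (\<exists>s\<in>A. w = cis (2 * pi * s))"
proof -
  define h where "h w = s0 + Arg (w / cis (2 * pi * s0)) / (2 * pi)" for w
  let ?c = "cis (2 * pi * s0)"
  have "isCont (\<lambda>w. w / ?c) ?c" by (rule continuous_divide) auto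
  moreover have "isCont Arg (?c / ?c)" by (rule continuous_at_Arg) auto
  ultimately have "isCont (\<lambda>w. Arg (w / ?c)) ?c" by (rule isCont_o2)
  then have "isCont h ?c" unfolding h_def
    by (intro continuous_add continuous_divide continuous_const) auto
  moreover have h0: "h (cis (2 * pi * s0)) = s0" by (simp add: h_def)
  ultimately have "eventually (\<lambda>w. h w \<in> A) (at (cis (2 * pi * s0)))"
    using assms topological_tendstoD[of h s0 _ A] unfolding isCont_def by auto
  then have "eventually (\<lambda>w. h w \<in> A) (nhds (cis (2 * pi * s0)))"
    using h0 assms by (simp add: eventually_nhds_conv_at)
  then obtain d where d: "d > 0" "\<And>w. dist w (cis (2 * pi * s0)) < d \<Longrightarrow> h w \<in> A"
    unfolding eventually_nhds_metric by blast
  have "w = cis (2 * pi * h w)" if "cmod w = 1" for w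
  proof -
    have "cmod (w / cis (2 * pi * s0)) = 1" using that by (simp add: norm_divide)
    then have "cis (Arg (w / cis (2 * pi * s0))) = w / cis (2 * pi * s0)"
      using cis_Arg[of "w / cis (2 * pi * s0)"] that by (force simp: sgn_div_norm norm_divide)
    moreover have "2 * pi * h w = 2 * pi * s0 + Arg (w / cis (2 * pi * s0))"
      by (simp add: h_def algebra_simps)
    ultimately show ?thesis by (simp add: cis_mult[symmetric])
  qed
  then show ?thesis using d by blast
qed

text \<open>Translations along the vector attached to each parametrisation patch to an action of the
  real line by \<open>consistent\<close>, and \<open>period\<close> makes time 1 act trivially, so
  that the circle acts.\<close>

locale flow =
  fixes T :: "('e::euclidean_space set \<times> ('e \<Rightarrow> 'a) \<times> 'e) set"
  assumes family: "param_family (fam T)"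
    and invariant_dom: "(V, p, v) \<in> T \<Longrightarrow> x \<in> V \<Longrightarrow> x + s *\<^sub>R v \<in> V"
    and consistent: "(V, p, v) \<in> T \<Longrightarrow> (W, q, w) \<in> T \<Longrightarrow> x \<in> V \<Longrightarrow> y \<in> W \<Longrightarrow> p x = q y \<Longrightarrow>
                       p (x + s *\<^sub>R v) = q (y + s *\<^sub>R w)"
    and period: "(V, p, v) \<in> T \<Longrightarrow> x \<in> V \<Longrightarrow> p (x + v) = p x"

sublocale flow \<subseteq> param_family "fam T" by (rule family)

context flow
begin

lemma fam_memI: "(V, p, v) \<in> T \<Longrightarrow> (V, p) \<in> fam T"
  by (force simp: fam_def)

lemma fam_memE:
  assumes "(V, p) \<in> fam T" obtains v where "(V, p, v) \<in> T"
  using assms by (auto simp: fam_def)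

lemma period_int:
  assumes "(V, p, v) \<in> T" "x \<in> V" shows "p (x + of_int n *\<^sub>R v) = p x"
proof -
  have nat: "p (y + of_nat m *\<^sub>R v) = p y" if "y \<in> V" for y m
  proof (induction m)
    case (Suc m)
    have "p (y + of_nat (Suc m) *\<^sub>R v) = p ((y + of_nat m *\<^sub>R v) + v)" by (simp add: algebra_simps)
    then show ?case using period[OF assms(1) invariant_dom[OF assms(1) that]] Suc by metis
  qed simp
  show ?thesis
  proof (cases "n \<ge> 0")
    case True
    then show ?thesis using nat[OF assms(2), of "nat n"] by simp
  next
    case False
    \<comment> \<open>A negative number of periods is handled by walking forward from the translated
      point back to x.\<close>
    let ?y = "x + of_int n *\<^sub>R v"
    have "p (?y + of_nat (nat (- n)) *\<^sub>R v) = p ?y"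
      by (rule nat[OF invariant_dom[OF assms]])
    then show ?thesis using False by simp
  qed
qed

text \<open>Two angles for \<open>t 0\<close> differ by an integer, absorbed by
  \<open>period_int\<close>; two parametrisations of the same point give the same result by
  \<open>consistent\<close>.\<close>

lemma flow_act_eq:
  assumes "(V, p, v) \<in> T" "x \<in> V" "t 0 = cis (2 * pi * s)"
  shows "flow_act T t (p x) = p (x + s *\<^sub>R v)"
  unfolding flow_act_def
proof (rule someI2)
  show "\<exists>V' p' v' x' s'. (V', p', v') \<in> T \<and> x' \<in> V' \<and> p x = p' x' \<and> t 0 = cis (2 * pi * s') \<and>
     p (x + s *\<^sub>R v) = p' (x' + s' *\<^sub>R v')"
    using assms by blast
  fix b assume "\<exists>V' p' v' x' s'. (V', p', v') \<in> T \<and> x' \<in> V' \<and> p x = p' x' \<and> t 0 = cis (2 * pi * s') \<and>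
     b = p' (x' + s' *\<^sub>R v')"
  then obtain V' p' v' x' s' where *: "(V', p', v') \<in> T" "x' \<in> V'" "p x = p' x'" "t 0 = cis (2 * pi * s')"
    "b = p' (x' + s' *\<^sub>R v')" by blast
  obtain n where n: "s' = s + of_int n" using cis_eq_imp_diff_int[of s' s] * assms by auto
  have "b = p (x + s' *\<^sub>R v)" using consistent[OF *(1) assms(1) *(2) assms(2)] * by metis
  also have "x + s' *\<^sub>R v = (x + s *\<^sub>R v) + of_int n *\<^sub>R v" by (simp add: n algebra_simps)
  also have "p \<dots> = p (x + s *\<^sub>R v)" by (rule period_int[OF assms(1) invariant_dom[OF assms(1,2)]])
  finally show "b = p (x + s *\<^sub>R v)" .
qed

lemma points_T:
  assumes "a \<in> points (gen_atlas (fam T))" obtains V p v x where "(V, p, v) \<in> T" "x \<in> V" "a = p x"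
  using assms by (metis pointsE fam_memE)

lemma torus_acts_flow: "torus_acts 1 (points (gen_atlas (fam T))) (flow_act T)"
  unfolding torus_acts_def
proof (intro conjI ballI)
  fix t a assume "t \<in> torus 1" "a \<in> points (gen_atlas (fam T))"
  then obtain V p v x s where "(V, p, v) \<in> T" "x \<in> V" "a = p x" "t 0 = cis (2 * pi * s)"
    by (metis points_T torus_1_cis)
  then show "flow_act T t a \<in> points (gen_atlas (fam T))"
    using flow_act_eq in_points fam_memI invariant_dom by metis
next
  fix a assume "a \<in> points (gen_atlas (fam T))"
  then obtain V p v x where *: "(V, p, v) \<in> T" "x \<in> V" "a = p x" by (rule points_T)
  then show "flow_act T 1 a = a" using flow_act_eq[OF *(1,2), of 1 0] by simp
next
  fix t t' a assume "t \<in> torus 1" "t' \<in> torus 1" "a \<in> points (gen_atlas (fam T))"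
  then obtain V p v x s s' where *: "(V, p, v) \<in> T" "x \<in> V" "a = p x" "t 0 = cis (2 * pi * s)"
    "t' 0 = cis (2 * pi * s')" by (metis points_T torus_1_cis)
  have "(t * t') 0 = cis (2 * pi * (s' + s))" using * by (simp add: cis_mult algebra_simps)
  then have "flow_act T (t * t') a = p (x + (s' + s) *\<^sub>R v)" using flow_act_eq[OF *(1,2)] * by simp
  moreover have "flow_act T t (flow_act T t' a) = p ((x + s' *\<^sub>R v) + s *\<^sub>R v)"
    using flow_act_eq[where t = t and s = s, OF *(1) invariant_dom[where s = s', OF *(1,2)] *(4)]
      flow_act_eq[where t = t' and s = s', OF *(1,2,5)] * by simp
  ultimately show "flow_act T (t * t') a = flow_act T t (flow_act T t' a)"
    by (simp add: algebra_simps)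
qed

lemma continuous_flow: "continuous_torus_action 1 (mtop (gen_atlas (fam T))) (flow_act T)"
  unfolding continuous_torus_action_def
proof (intro conjI)
  let ?X = "mtop (gen_atlas (fam T))"
  show "torus_acts 1 (topspace ?X) (flow_act T)" using torus_acts_flow by simp
  show "continuous_map (prod_topology (top_of_set (torus 1)) ?X) ?X (\<lambda>(t, a). flow_act T t a)"
    unfolding continuous_map_def
  proof (intro conjI allI impI)
    show "(\<lambda>(t, a). flow_act T t a) \<in> topspace (prod_topology (top_of_set (torus 1)) ?X) \<rightarrow> topspace ?X"
      using torus_acts_flow by (auto simp: torus_acts_def)
    fix O' assume O': "openin ?X O'"
    show "openin (prod_topology (top_of_set (torus 1)) ?X)
        {z \<in> topspace (prod_topology (top_of_set (torus 1)) ?X). (case z of (t, a) \<Rightarrow> flow_act T t a) \<in> O'}"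
      unfolding openin_prod_topology_alt
    proof (clarify, goal_cases)
      case (1 t0 a0)
      then have t0: "t0 \<in> torus 1" and a0: "a0 \<in> points (gen_atlas (fam T))" and inO: "flow_act T t0 a0 \<in> O'"
        by auto
      obtain V p v x0 where x0: "(V, p, v) \<in> T" "x0 \<in> V" "a0 = p x0" using a0 by (rule points_T)
      obtain s0 where s0: "t0 0 = cis (2 * pi * s0)" using t0 by (rule torus_1_cis)
      let ?G = "{z\<in>V. p z \<in> O'}"
      have "open ?G" by (rule open_preimage[OF fam_memI[OF x0(1)] O'])
      then have "open ((\<lambda>(s, x). x + s *\<^sub>R v) -` ?G)"
        by (rule open_vimage) (auto simp: case_prod_unfold intro!: continuous_intros)
      then have op: "open ((\<lambda>(s, x). x + s *\<^sub>R v) -` ?G \<inter> (UNIV \<times> V))"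
        using open_dom[OF fam_memI[OF x0(1)]] by (intro open_Int open_Times) auto
      have mem: "(s0, x0) \<in> (\<lambda>(s, x). x + s *\<^sub>R v) -` ?G \<inter> (UNIV \<times> V)"
        using x0 inO flow_act_eq[where t = t0 and s = s0, OF x0(1,2) s0] invariant_dom[OF x0(1,2)] by auto
      obtain A B where AB: "open A" "open B" "(s0, x0) \<in> A \<times> B"
        "A \<times> B \<subseteq> (\<lambda>(s, x). x + s *\<^sub>R v) -` ?G \<inter> (UNIV \<times> V)"
        using open_prod_elim[OF op mem] .
      \<comment> \<open>Only the group element varies, not its angle. Group elements close to the
        given one have an angle in the neighbourhood \<open>A\<close> of s0, because the exponential
        map is open.\<close>
      obtain d where d: "d > 0" "\<And>w. cmod w = 1 \<Longrightarrow> dist w (cis (2 * pi * s0)) < d \<Longrightarrow> \<exists>s\<in>A. w = cis (2 * pi * s)"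
        using cis_image_nhd[of A s0] AB by auto
      let ?U = "torus 1 \<inter> (\<lambda>t. t 0) -` ball (cis (2 * pi * s0)) d"
      have "open ((\<lambda>t::nat \<Rightarrow> complex. t 0) -` ball (cis (2 * pi * s0)) d)"
        by (rule open_vimage) auto
      then have U: "openin (top_of_set (torus 1)) ?U" by (auto intro: openin_open_Int)
      have "x0 \<in> B" using AB by auto
      have BV: "B \<subseteq> V" using AB by auto
      have pB: "openin ?X (p ` B)" using open_image[OF fam_memI[OF x0(1)] BV AB(2)] .
      have "flow_act T t (p x) \<in> O'" if tx: "t \<in> ?U" "x \<in> B" for t x
      proof -
        have "cmod (t 0) = 1" "dist (t 0) (cis (2 * pi * s0)) < d"
          using tx by (auto simp: torus_def dist_commute)
        then obtain s where s: "s \<in> A" "t 0 = cis (2 * pi * s)"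
          using d(2)[of "t 0"] by blast
        then have "p (x + s *\<^sub>R v) \<in> O'" using AB tx by auto
        then show ?thesis using flow_act_eq[where t = t and s = s, OF x0(1) _ s(2)] tx BV by auto
      qed
      moreover have "p ` B \<subseteq> points (gen_atlas (fam T))" using openin_subset[OF pB] by simp
      ultimately have "?U \<times> p ` B \<subseteq> {z \<in> topspace (prod_topology (top_of_set (torus 1)) ?X).
          (case z of (t, a) \<Rightarrow> flow_act T t a) \<in> O'}"
        by auto
      then show ?case using U pB t0 d(1) x0 \<open>x0 \<in> B\<close> s0
        by (intro exI[of _ ?U] exI[of _ "p ` B"]) auto
    qed
  qed
qed

lemma continuous_on_translation:
  "continuous_on S (\<lambda>(\<theta>, x). x + \<theta> 0 *\<^sub>R v :: 'e)" for S :: "((nat \<Rightarrow> real) \<times> 'e) set"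
proof -
  have "continuous_on S (\<lambda>z. fst z 0)" for S :: "((nat \<Rightarrow> real) \<times> 'e) set"
    by (rule continuous_on_compose2[of UNIV "\<lambda>\<theta>. \<theta> 0" S fst]) (auto intro!: continuous_on_fst continuous_on_id)
  then show ?thesis by (auto simp: case_prod_unfold intro!: continuous_intros)
qed

lemma continuous_on_ray: "continuous_on UNIV (\<lambda>s::real. x + s *\<^sub>R v :: (nat \<Rightarrow> real) \<times> 'e)"
proof -
  have "continuous_on UNIV (\<lambda>s::real. fst x + s *\<^sub>R fst v)"
    by (rule continuous_on_coordinatewise_then_product)
       (auto simp: scaleR_fun_def plus_fun_def intro!: continuous_on_add continuous_on_const continuous_on_mult continuous_on_id)
  then have "continuous_on UNIV (\<lambda>s::real. (fst x + s *\<^sub>R fst v, snd x + s *\<^sub>R snd v))"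
    by (intro continuous_on_Pair) (auto intro!: continuous_intros)
  then show ?thesis by (simp add: plus_prod_def scaleR_prod_def)
qed

text \<open>In charts the action is a transition map applied to x plus \<theta> 0 times the vector
  v. The inner map is linear in \<theta> and x jointly, so \<open>C_k_local_smooth\<close> applies
  with it in the role of \<open>l\<close>.\<close>

lemma smooth_flow: "smooth_torus_action 1 (gen_atlas (fam T)) (flow_act T)"
  unfolding smooth_torus_action_def
proof (intro conjI torus_acts_flow, clarify)
  fix V p W q assume c: "(V, p) \<in> gen_atlas (fam T)" "(W, q) \<in> gen_atlas (fam T)"
  obtain V' where V': "(V', p) \<in> fam T" "V \<subseteq> V'" "open V" using gen_atlasD[OF c(1)] by blast
  obtain W' where W': "(W', q) \<in> fam T" "W \<subseteq> W'" "open W" "inj_on q W" using gen_atlasD[OF c(2)] by blast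
  obtain v where v: "(V', p, v) \<in> T" using V'(1) by (rule fam_memE)
  define D where "D = Rn 1 \<times> (UNIV :: 'e set)"
  define S where "S = {(\<theta>, x). \<theta> \<in> Rn 1 \<and> x \<in> V \<and> flow_act T (torus_exp \<theta>) (p x) \<in> q ` W}"
  define f where "f = (\<lambda>(\<theta>, x). inv_into W q (flow_act T (torus_exp \<theta>) (p x)))"
  let ?l = "\<lambda>(\<theta> :: nat \<Rightarrow> real, x). x + \<theta> 0 *\<^sub>R v"
  have act: "flow_act T (torus_exp \<theta>) (p x) = p (x + \<theta> 0 *\<^sub>R v)" if "x \<in> V" for \<theta> x
    using flow_act_eq[OF v] that V' by (auto simp: torus_exp_def)
  have loc: "\<exists>N M \<tau>. open N \<and> z \<in> N \<and> open M \<and> smooth_on M \<tau> \<and>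
      (\<forall>y\<in>N \<inter> D. y \<in> S \<and> ?l y \<in> M \<and> f y = \<tau> (?l y))" if z_in: "z \<in> S" for z
  proof -
    obtain \<theta> x where z: "z = (\<theta>, x)" by force
    have x: "x \<in> V" using z_in by (auto simp: S_def z)
    obtain y where y: "y \<in> W" "p (x + \<theta> 0 *\<^sub>R v) = q y"
      using z_in act[of x \<theta>] by (auto simp: S_def z)
    have xV': "x + \<theta> 0 *\<^sub>R v \<in> V'" using invariant_dom[OF v] V' x by auto
    have "smooth_lift V' p W q (\<lambda>a. a) (x + \<theta> 0 *\<^sub>R v) y"
      by (rule smooth_lift_mono[OF trans[OF V'(1) W'(1) xV' _ y(2)]])
         (use W' V' y xV' open_dom in auto)
    then obtain M \<tau> where M: "open M" "x + \<theta> 0 *\<^sub>R v \<in> M" "M \<subseteq> V'" "smooth_on M \<tau>" "\<tau> ` M \<subseteq> W"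
      "\<And>z. z \<in> M \<Longrightarrow> p z = q (\<tau> z)"
      by (rule smooth_liftE) metis
    have "open (?l -` M \<inter> (UNIV \<times> V))"
      using open_vimage[OF M(1) continuous_on_translation[of UNIV v]] V' by (intro open_Int open_Times) auto
    moreover have "z \<in> ?l -` M \<inter> (UNIV \<times> V)" using M x by (auto simp: z)
    moreover have "(\<theta>', x') \<in> S \<and> ?l (\<theta>', x') \<in> M \<and> f (\<theta>', x') = \<tau> (?l (\<theta>', x'))"
      if "(\<theta>', x') \<in> (?l -` M \<inter> (UNIV \<times> V)) \<inter> D" for \<theta>' x'
    proof -
      have m: "x' + \<theta>' 0 *\<^sub>R v \<in> M" "x' \<in> V" "\<theta>' \<in> Rn 1" using that by (auto simp: D_def)
      then have "flow_act T (torus_exp \<theta>') (p x') = q (\<tau> (x' + \<theta>' 0 *\<^sub>R v))" using act M(6) by auto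
      moreover have "\<tau> (x' + \<theta>' 0 *\<^sub>R v) \<in> W" using M m by auto
      ultimately show ?thesis using m W'(4) by (auto simp: S_def f_def)
    qed
    ultimately show ?thesis using M
      by (intro exI[of _ "?l -` M \<inter> (UNIV \<times> V)"] exI[of _ M] exI[of _ \<tau>]) blast
  qed
  have "openin (top_of_set D) S"
  proof (subst openin_subopen, safe)
    fix \<theta> x assume "(\<theta>, x) \<in> S"
    from loc[OF this] obtain N where N: "open N" "(\<theta>, x) \<in> N" "N \<inter> D \<subseteq> S" by auto
    moreover have "(\<theta>, x) \<in> D" using \<open>(\<theta>, x) \<in> S\<close> by (auto simp: S_def D_def)
    ultimately show "\<exists>T. openin (top_of_set D) T \<and> (\<theta>, x) \<in> T \<and> T \<subseteq> S"
      by (intro exI[of _ "D \<inter> N"]) (auto intro: openin_open_Int)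
  qed
  moreover have "C_infinity D S f"
    unfolding C_infinity_def
  proof
    fix r
    show "C_k r D S f"
    proof (rule C_k_local_smooth[where l = ?l])
      show "?l (x + s *\<^sub>R v) = ?l x + s *\<^sub>R ?l v" for x v s
        by (auto simp: case_prod_unfold scaleR_fun_def algebra_simps)
      show "continuous_on S ?l" by (rule continuous_on_translation)
      show "S \<subseteq> D" by (auto simp: S_def D_def)
      show "x + s *\<^sub>R v \<in> D" if "x \<in> D" "v \<in> D" for x v s
        using that by (auto simp: D_def Rn_def scaleR_fun_def)
      show "continuous_on UNIV (\<lambda>s. x + s *\<^sub>R v)" for x v :: "(nat \<Rightarrow> real) \<times> 'e"
        by (rule continuous_on_ray)
      fix z assume "z \<in> S"
      from loc[OF this] show "\<exists>N M \<tau>. open N \<and> z \<in> N \<and> open M \<and> sm r M \<tau> \<and>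
          (\<forall>y\<in>N \<inter> D. y \<in> S \<and> ?l y \<in> M \<and> f y = \<tau> (?l y))"
        unfolding smooth_on_def by metis
    qed
  qed
  ultimately show "let D = Rn 1 \<times> UNIV;
            S = {(\<theta>, x). \<theta> \<in> Rn 1 \<and> x \<in> V \<and> flow_act T (torus_exp \<theta>) (p x) \<in> q ` W}
        in openin (top_of_set D) S \<and>
           C_infinity D S (\<lambda>(\<theta>, x). inv_into W q (flow_act T (torus_exp \<theta>) (p x)))"
    unfolding Let_def S_def D_def f_def by simp
qed

end

section \<open>Orbits as submanifolds\<close>

text \<open>If parameters \<open>z\<close> tending to \<open>x\<close> outside \<open>x + L\<close> were mapped into the orbit of \<open>p x\<close>, say
  \<open>p z = p (x + k)\<close> with \<open>k \<in> K\<close>, then along a subsequence \<open>k\<close> would converge to some \<open>k'\<close> with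
  \<open>p x = p (x + k')\<close>; as \<open>p (z + (k' - k)) = p x\<close>, local injectivity would give \<open>z \<in> x + L\<close>.\<close>

lemma (in param_family) orbit_submanifold:
  assumes P: "(V, p) \<in> P" and U: "open U" "U \<subseteq> V" and L: "subspace L"
    and stay: "\<And>x l. x \<in> U \<Longrightarrow> l \<in> L \<Longrightarrow> x + l \<in> U"
    and eqv: "\<And>x y l. x \<in> U \<Longrightarrow> y \<in> U \<Longrightarrow> p x = p y \<Longrightarrow> l \<in> L \<Longrightarrow> p (x + l) = p (y + l)"
    and K: "compact K" "K \<subseteq> L" "\<And>l. l \<in> L \<Longrightarrow> \<exists>k\<in>K. \<forall>x\<in>U. p (x + l) = p (x + k)"
    and x0: "x0 \<in> U"
  shows "submanifold_of_dim (gen_atlas P) (dim L) {p (x0 + l) |l. l \<in> L}" (is "submanifold_of_dim _ _ ?Q")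
proof -
  have *: "\<exists>V' p' L'. (V', p') \<in> maximal_atlas (gen_atlas P) \<and> y \<in> p' ` V' \<and> subspace L' \<and>
      dim L' = dim L \<and> {x\<in>V'. p' x \<in> ?Q} = V' \<inter> L'" if "y \<in> ?Q" for y
  proof -
    obtain l0 where l0: "l0 \<in> L" "y = p (x0 + l0)" using \<open>y \<in> ?Q\<close> by auto
    \<comment> \<open>The base point is moved to the orbit point under consideration; the orbit is
      then the image of \<open>x + L\<close>, and its slice is taken at x itself.\<close>
    define x where "x = x0 + l0"
    have x: "x \<in> U" using stay x0 l0 by (simp add: x_def)
    have Q: "?Q = {p (x + l) |l. l \<in> L}"
    proof -
      have "\<exists>l'\<in>L. x0 + l = x + l'" if "l \<in> L" for l
        using that l0 L by (intro bexI[of _ "l - l0"]) (auto simp: x_def subspace_diff)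
      moreover have "\<exists>l'\<in>L. x + l = x0 + l'" if "l \<in> L" for l
        using that l0 L by (intro bexI[of _ "l0 + l"]) (auto simp: x_def subspace_add add.assoc)
      ultimately show ?thesis by (smt (verit, best) Collect_cong)
    qed
    obtain N where N: "open N" "x \<in> N" "N \<subseteq> V" "inj_on p N" using loc_inj[OF P] x U by blast
    then have "open (N \<inter> U)" "x \<in> N \<inter> U" using U x by auto
    then obtain e where e: "e > 0" "ball x e \<subseteq> N \<inter> U" using open_contains_ball by metis
    obtain Q' where Q': "Q' = ?Q" by simp
    have "\<exists>r>0. r \<le> e \<and> (\<forall>z\<in>ball x r. p z \<in> Q' \<longrightarrow> z - x \<in> L)"
    proof (rule ccontr)
      assume neg: "\<not> ?thesis"
      have "\<exists>z. z \<in> ball x (e / of_nat (Suc n)) \<and> p z \<in> Q' \<and> z - x \<notin> L" for n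
      proof (rule ccontr)
        assume "\<not> ?thesis"
        moreover have "0 < e / of_nat (Suc n)" "e / of_nat (Suc n) \<le> e"
          using e(1) by (auto simp: divide_le_eq)
        ultimately show False using neg by meson
      qed
      then obtain z where z: "\<And>n. z n \<in> ball x (e / of_nat (Suc n))" "\<And>n. p (z n) \<in> Q'"
        "\<And>n. z n - x \<notin> L" by metis
      have zU: "z n \<in> U" for n
      proof -
        have "e / of_nat (Suc n) \<le> e" using e(1) by (simp add: field_simps)
        then show ?thesis using z(1)[of n] e(2) subset_ball by (metis IntE subsetD)
      qed
      have "z \<longlonglongrightarrow> x"
      proof (rule metric_LIMSEQ_I)
        fix d :: real assume "d > 0"
        obtain n0 :: nat where n0: "e / d < of_nat n0" using reals_Archimedean2 by blast
        have "dist (z n) x < d" if "n \<ge> n0" for n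
        proof -
          have "dist (z n) x < e / of_nat (Suc n)" using z(1)[of n] by (simp add: dist_commute)
          also have "e / of_nat (Suc n) < d"
          proof -
            have "e / d < of_nat (Suc n)" using n0 that by linarith
            then show ?thesis using \<open>d > 0\<close> by (simp add: field_simps)
          qed
          finally show ?thesis .
        qed
        then show "\<exists>n0. \<forall>n\<ge>n0. dist (z n) x < d" by blast
      qed
      have "\<exists>k\<in>K. p (z n) = p (x + k)" for n
      proof -
        obtain l where "l \<in> L" "p (z n) = p (x + l)" using z(2)[of n] unfolding Q' Q by auto
        then show ?thesis using K(3)[of l] x by metis
      qed
      then obtain k where k: "\<And>n. k n \<in> K" "\<And>n. p (z n) = p (x + k n)" by metis
      obtain k' s where s: "k' \<in> K" "strict_mono s" "(k \<circ> s) \<longlonglongrightarrow> k'"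
        using K(1) k(1) unfolding compact_def by metis
      have zs: "(\<lambda>n. z (s n)) \<longlonglongrightarrow> x"
        using LIMSEQ_subseq_LIMSEQ[OF \<open>z \<longlonglongrightarrow> x\<close> s(2)] by (simp add: o_def)
      have ks: "(\<lambda>n. k (s n)) \<longlonglongrightarrow> k'" using s(3) by (simp add: o_def)
      obtain C where C: "closed C" "{(x, y). x \<in> V \<and> y \<in> V \<and> p x = p y} = (V \<times> V) \<inter> C"
        using closed_rel[OF P P] unfolding closedin_closed by blast
      have "(z (s n), x + k (s n)) \<in> C" for n
        using C(2) zU k[of "s n"] stay[OF x] K(2) U by blast
      moreover have "(\<lambda>n. (z (s n), x + k (s n))) \<longlonglongrightarrow> (x, x + k')"
        by (intro tendsto_intros zs ks)
      ultimately have "(x, x + k') \<in> C" by (rule closed_sequentially[OF C(1)])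
      moreover have "(x, x + k') \<in> V \<times> V" using stay[OF x] s(1) K(2) U x by auto
      ultimately have px: "p x = p (x + k')" using C(2) by auto
      define w where "w n = z (s n) + (k' - k (s n))" for n
      have "w \<longlonglongrightarrow> x + (k' - k')" unfolding w_def by (intro tendsto_intros zs ks)
      then have "w \<longlonglongrightarrow> x" by simp
      then have "eventually (\<lambda>n. w n \<in> N) sequentially"
        using topological_tendstoD[OF _ N(1,2)] by blast
      then obtain n where wN: "w n \<in> N" by (meson eventually_sequentially order_refl)
      have kL: "k' - k (s n) \<in> L" using s(1) k(1) K(2) L by (meson subsetD subspace_diff)
      have "p (w n) = p ((x + k (s n)) + (k' - k (s n)))"
        unfolding w_def by (rule eqv) (use zU k stay[OF x subsetD[OF K(2) k(1)]] kL in auto)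
      also have "\<dots> = p x" using px by simp
      finally have "w n = x" using wN N(2,4) by (auto simp: inj_on_def)
      then have "z (s n) - x = - (k' - k (s n))" by (simp add: w_def algebra_simps)
      then show False using z(3)[of "s n"] kL L subspace_neg by metis
    qed
    then obtain r where r: "r > 0" "r \<le> e" "\<And>z. z \<in> ball x r \<Longrightarrow> p z \<in> Q' \<Longrightarrow> z - x \<in> L" by blast
    have "(ball x r, p) \<in> gen_atlas P"
      using r e N P unfolding gen_atlas_def
      by (auto intro!: exI[of _ V] inj_on_subset[OF N(4)]) (meson IntE ball_subset_ball_iff dual_order.trans mem_ball subsetD subset_ball)+
    then have "({z. z + x \<in> ball x r}, \<lambda>z. p (z + x)) \<in> maximal_atlas (gen_atlas P)"
      by (rule translated_in_maximal)
    moreover have "y \<in> (\<lambda>z. p (z + x)) ` {z. z + x \<in> ball x r}"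
      using r l0 by (intro image_eqI[of _ _ 0]) (auto simp: x_def)
    moreover have "{z \<in> {z. z + x \<in> ball x r}. p (z + x) \<in> ?Q} = {z. z + x \<in> ball x r} \<inter> L"
    proof safe
      fix z assume "z \<in> L"
      then have "p (z + x) \<in> {p (x + l) |l. l \<in> L}" by (auto simp: add.commute)
      then show "\<exists>l. p (z + x) = p (x0 + l) \<and> l \<in> L" unfolding Q[symmetric] by blast
    next
      fix z l assume "z + x \<in> ball x r" "p (z + x) = p (x0 + l)" "l \<in> L"
      then have "(z + x) - x \<in> L" by (intro r(3)) (auto simp: Q')
      then show "z \<in> L" by simp
    qed
    ultimately show ?thesis using L
      by (intro exI[of _ "{z. z + x \<in> ball x r}"] exI[of _ "\<lambda>z. p (z + x)"] exI[of _ L]) blast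
  qed
  show ?thesis
    unfolding submanifold_of_dim_def
  proof (intro conjI ballI *)
    show "?Q \<subseteq> points (gen_atlas P)" using in_points[OF P] stay[OF x0] U by blast
  qed
qed

section \<open>Lifts to fibre products\<close>

lemma continuous_torus_action_subtopology:
  assumes "continuous_torus_action k X \<phi>" "E \<subseteq> topspace X"
    and "\<And>t a. t \<in> torus k \<Longrightarrow> a \<in> E \<Longrightarrow> \<phi> t a \<in> E"
  shows "continuous_torus_action k (subtopology X E) \<phi>"
proof -
  have E: "topspace (subtopology X E) = E" using assms(2) by auto
  have "continuous_map (prod_topology (top_of_set (torus k)) (subtopology X E)) X (\<lambda>(t, x). \<phi> t x)"
    using assms(1) continuous_map_from_subtopology
    by (auto simp: continuous_torus_action_def prod_topology_subtopology)
  then have "continuous_map (prod_topology (top_of_set (torus k)) (subtopology X E)) (subtopology X E) (\<lambda>(t, x). \<phi> t x)"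
    unfolding continuous_map_in_subtopology using assms(3) E by auto
  then show ?thesis using assms unfolding continuous_torus_action_def torus_acts_def E by blast
qed

text \<open>A fibre product over \<open>J\<close> of one covering \<open>m\<close> and one-sheeted coverings with sections \<open>\<sigma> i\<close>
  is a copy of the subset \<open>E\<close> of the total space of \<open>m\<close>.\<close>

lemma commuting_liftsI:
  fixes F :: "('e::euclidean_space, 'a, 'b) F_structure"
  assumes m: "m \<in> J"
    and top: "\<And>i. i \<in> J \<Longrightarrow> topspace (mtop (cover F i)) = points (cover F i)"
    and \<sigma>: "\<And>i b. i \<in> J \<Longrightarrow> i \<noteq> m \<Longrightarrow> b \<in> points (cover F i) \<Longrightarrow> \<sigma> i (proj F i b) = b"
    and E: "E = {a\<in>points (cover F m). \<forall>i\<in>J. i \<noteq> m \<longrightarrow> (\<exists>b\<in>points (cover F i). proj F i b = proj F m a)}"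
    and act: "\<And>j. j \<in> J \<Longrightarrow> continuous_torus_action (tdim F j) (subtopology (mtop (cover F m)) E) (\<psi> j)"
    and cont: "\<And>i. i \<in> J \<Longrightarrow> i \<noteq> m \<Longrightarrow>
        continuous_map (subtopology (mtop (cover F m)) E) (mtop (cover F i)) (\<lambda>a. \<sigma> i (proj F m a))"
    and compat: "\<And>t a. t \<in> torus (tdim F m) \<Longrightarrow> a \<in> E \<Longrightarrow> \<psi> m t a = act F m t a"
      "\<And>j t a. j \<in> J \<Longrightarrow> j \<noteq> m \<Longrightarrow> t \<in> torus (tdim F j) \<Longrightarrow> a \<in> E \<Longrightarrow>
          act F j t (\<sigma> j (proj F m a)) = \<sigma> j (proj F m (\<psi> j t a))"
    and comm: "\<And>i j s t a. i \<in> J \<Longrightarrow> j \<in> J \<Longrightarrow> s \<in> torus (tdim F i) \<Longrightarrow> t \<in> torus (tdim F j) \<Longrightarrow> a \<in> E \<Longrightarrow>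
          \<psi> i s (\<psi> j t a) = \<psi> j t (\<psi> i s a)"
  shows "commuting_lifts F J"
proof -
  let ?C = "mtop (cover F m)"
  \<comment> \<open>The embedding of \<open>E\<close> into the fibre product: the component at m is
    kept, and every other component is the section value over the same point of the base.\<close>
  define \<iota> where "\<iota> a = (\<lambda>i\<in>J. if i = m then a else \<sigma> i (proj F m a))" for a
  have topE: "topspace (subtopology ?C E) = E" using top[OF m] by (auto simp: E)
  have sec: "\<sigma> i (proj F m a) \<in> points (cover F i) \<and> proj F i (\<sigma> i (proj F m a)) = proj F m a"
    if ai: "a \<in> E" "i \<in> J" "i \<noteq> m" for a i
  proof -
    obtain b where "b \<in> points (cover F i)" "proj F i b = proj F m a" using ai unfolding E by blast
    then show ?thesis using \<sigma>[OF ai(2,3)] by metis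
  qed
  have \<iota>_in: "\<iota> a \<in> fibre_product F J" if a: "a \<in> E" for a
  proof -
    have pr: "proj F i (\<iota> a i) = proj F m a" if "i \<in> J" for i
      using that sec[OF a that] by (auto simp: \<iota>_def)
    have "\<iota> a \<in> (\<Pi>\<^sub>E j\<in>J. points (cover F j))"
      using sec[OF a] a by (auto simp: \<iota>_def E)
    then show ?thesis using pr by (auto simp: fibre_product_def)
  qed
  have fp: "x m \<in> E \<and> x = \<iota> (x m)" if x: "x \<in> fibre_product F J" for x
  proof
    have pts: "x i \<in> points (cover F i)" if "i \<in> J" for i
      using x that unfolding fibre_product_def by (metis (no_types, lifting) PiE_mem mem_Collect_eq)
    have pr: "proj F i (x i) = proj F m (x m)" if "i \<in> J" for i
    proof -
      have "\<forall>i\<in>J. \<forall>j\<in>J. proj F i (x i) = proj F j (x j)" 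
        using x unfolding fibre_product_def mem_Collect_eq by (rule conjunct2)
      then show ?thesis using that m by blast
    qed
    show "x m \<in> E" unfolding E using pts pr m by blast
    have "x i = \<iota> (x m) i" for i
    proof (cases "i \<in> J")
      case True
      then show ?thesis using \<sigma>[OF True _ pts[OF True]] pr[OF True] by (auto simp: \<iota>_def)
    next
      case False
      then show ?thesis using x by (simp add: \<iota>_def fibre_product_def PiE_def extensional_def)
    qed
    then show "x = \<iota> (x m)" by blast
  qed
  have \<iota>m: "\<iota> a m = a" for a using m by (simp add: \<iota>_def)
  have topF: "topspace (fibre_product_topology F J) = fibre_product F J"
    using top by (auto simp: fibre_product_topology_def fibre_product_def)
  have ta: "torus_acts (tdim F j) E (\<psi> j)" if "j \<in> J" for j
    using act[OF that] unfolding continuous_torus_action_def topE by blast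
  \<comment> \<open>A point of the fibre product is determined by its component at m, so the lifted
    action is \<psi> transported along this embedding.\<close>
  define lift where "lift j t x = \<iota> (\<psi> j t (x m))" for j t x
  have "continuous_torus_action (tdim F j) (fibre_product_topology F J) (lift j)" if j: "j \<in> J" for j
    unfolding continuous_torus_action_def topF
  proof
    show "torus_acts (tdim F j) (fibre_product F J) (lift j)"
      using ta[OF j] fp \<iota>_in unfolding torus_acts_def lift_def \<iota>m by metis
    let ?T = "top_of_set (torus (tdim F j))"
    have "continuous_map (fibre_product_topology F J) ?C (\<lambda>x. x m)"
      unfolding fibre_product_topology_def
      by (intro continuous_map_from_subtopology continuous_map_product_projection m)
    then have "continuous_map (fibre_product_topology F J) (subtopology ?C E) (\<lambda>x. x m)"
      unfolding continuous_map_in_subtopology topF using fp by auto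
    then have "continuous_map (prod_topology ?T (fibre_product_topology F J)) (prod_topology ?T (subtopology ?C E))
        (\<lambda>z. (fst z, snd z m))"
      by (intro continuous_map_pairedI continuous_map_fst continuous_map_compose[OF continuous_map_snd, unfolded o_def])
    from continuous_map_compose[OF this] act[OF j]
    have \<psi>c: "continuous_map (prod_topology ?T (fibre_product_topology F J)) (subtopology ?C E) (\<lambda>z. \<psi> j (fst z) (snd z m))"
      unfolding continuous_torus_action_def by (force simp: o_def case_prod_unfold)
    have "continuous_map (prod_topology ?T (fibre_product_topology F J)) (mtop (cover F i))
        (\<lambda>z. lift j (fst z) (snd z) i)" if i: "i \<in> J" for i
    proof (cases "i = m")
      case True
      then show ?thesis using \<psi>c \<iota>m unfolding lift_def continuous_map_in_subtopology by simp
    next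
      case False
      then show ?thesis using continuous_map_compose[OF \<psi>c cont[OF i False]] i
        by (simp add: lift_def \<iota>_def o_def)
    qed
    moreover have "lift j t x \<in> fibre_product F J" if "t \<in> torus (tdim F j)" "x \<in> fibre_product F J" for t x
      using ta[OF j] fp \<iota>_in that unfolding torus_acts_def lift_def by metis
    ultimately show "continuous_map (prod_topology ?T (fibre_product_topology F J))
        (fibre_product_topology F J) (\<lambda>(t, x). lift j t x)"
      unfolding fibre_product_topology_def[of F J] continuous_map_in_subtopology continuous_map_componentwise
      unfolding fibre_product_topology_def[of F J, symmetric]
      by (auto simp: topF case_prod_unfold lift_def \<iota>_def)
  qed
  moreover have "lift j t x j = act F j t (x j)"
    if j: "j \<in> J" and t: "t \<in> torus (tdim F j)" and x: "x \<in> fibre_product F J" for j t x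
  proof (cases "j = m")
    case True
    then show ?thesis using compat(1) t conjunct1[OF fp[OF x]] \<iota>m by (simp add: lift_def)
  next
    case False
    have "x j = \<iota> (x m) j" by (rule fun_cong[OF conjunct2[OF fp[OF x]]])
    also have "\<dots> = \<sigma> j (proj F m (x m))" using j False by (simp add: \<iota>_def)
    finally have "x j = \<sigma> j (proj F m (x m))" .
    then show ?thesis using compat(2)[OF j False t] conjunct1[OF fp[OF x]] j False by (simp add: lift_def \<iota>_def)
  qed
  moreover have "lift i s (lift j t x) = lift j t (lift i s x)"
    if "i \<in> J" "j \<in> J" "s \<in> torus (tdim F i)" "t \<in> torus (tdim F j)" "x \<in> fibre_product F J" for i j s t x
    using comm[OF that(1-4)] conjunct1[OF fp[OF that(5)]] by (simp add: lift_def \<iota>m)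
  ultimately show ?thesis unfolding commuting_lifts_def by blast
qed

section \<open>The orbifold\<close>

lemma exhaust_7:
  fixes x :: 7
  shows "x = 1 \<or> x = 2 \<or> x = 3 \<or> x = 4 \<or> x = 5 \<or> x = 6 \<or> x = 7"
proof (induct x)
  case (of_int z)
  then have "0 \<le> z" and "z < 7" by simp_all
  then have "z = 0 \<or> z = 1 \<or> z = 2 \<or> z = 3 \<or> z = 4 \<or> z = 5 \<or> z = 6" by arith
  then show ?case by auto
qed

lemma forall_7: "(\<forall>i::7. Q i) \<longleftrightarrow> Q 1 \<and> Q 2 \<and> Q 3 \<and> Q 4 \<and> Q 5 \<and> Q 6 \<and> Q 7"
  by (metis exhaust_7)

lemma vector_7 [simp]: fixes x1 :: "'a::zero" shows
  "(vector [x1, x2, x3, x4, x5, x6, x7] :: 'a^7) $ 1 = x1"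
  "(vector [x1, x2, x3, x4, x5, x6, x7] :: 'a^7) $ 2 = x2"
  "(vector [x1, x2, x3, x4, x5, x6, x7] :: 'a^7) $ 3 = x3"
  "(vector [x1, x2, x3, x4, x5, x6, x7] :: 'a^7) $ 4 = x4"
  "(vector [x1, x2, x3, x4, x5, x6, x7] :: 'a^7) $ 5 = x5"
  "(vector [x1, x2, x3, x4, x5, x6, x7] :: 'a^7) $ 6 = x6"
  "(vector [x1, x2, x3, x4, x5, x6, x7] :: 'a^7) $ 7 = x7"
  unfolding vector_def by simp_all

definition sgb :: "bool \<Rightarrow> real" where "sgb b = (if b then -1 else 1)"
definition hfb :: "bool \<Rightarrow> real" where "hfb b = (if b then 1/2 else 0)"

text \<open>Modulo \<open>\<int>\<^sup>7\<close>, the element \<open>\<alpha>\<^sup>a \<beta>\<^sup>b \<gamma>\<^sup>c\<close> is \<open>x\<^sub>i \<mapsto> sg7 a b c $ i * x\<^sub>i + hf7 b c $ i\<close>.\<close>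

definition sg7 :: "bool \<Rightarrow> bool \<Rightarrow> bool \<Rightarrow> real^7" where
  "sg7 a b c = vector [sgb a * sgb b * sgb c, sgb a * sgb b, sgb a * sgb c, sgb a, sgb b * sgb c, sgb b, sgb c]"
definition hf7 :: "bool \<Rightarrow> bool \<Rightarrow> real^7" where
  "hf7 b c = vector [hfb c, hfb b, hfb c, 0, 0, 0, 0]"

definition gact :: "bool \<Rightarrow> bool \<Rightarrow> bool \<Rightarrow> real^7 \<Rightarrow> real^7" where
  "gact a b c x = (\<chi> i. sg7 a b c $ i * x $ i + hf7 b c $ i)"

definition sim :: "real^7 \<Rightarrow> real^7 \<Rightarrow> bool" where
  "sim x y \<longleftrightarrow> (\<exists>a b c. y - gact a b c x \<in> int_lattice)"

lemma sg7_cases: "sg7 a b c $ i = 1 \<or> sg7 a b c $ i = -1"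
  using exhaust_7[of i] by (auto simp: sg7_def sgb_def)

lemma hf7_cases: "hf7 b c $ i = 0 \<or> hf7 b c $ i = 1/2"
  using exhaust_7[of i] by (auto simp: hf7_def hfb_def)

lemma sgb_xor: "sgb (a \<noteq> b) = sgb a * sgb b"
  by (simp add: sgb_def)

lemma sg7_mult: "sg7 a b c $ i * sg7 a' b' c' $ i = sg7 (a \<noteq> a') (b \<noteq> b') (c \<noteq> c') $ i"
  using exhaust_7[of i] unfolding sg7_def sgb_xor by (elim disjE; simp)

lemma hf7_add: "hf7 b c $ i + hf7 b' c' $ i - hf7 (b \<noteq> b') (c \<noteq> c') $ i \<in> \<int>"
  using exhaust_7[of i] by (auto simp: hf7_def hfb_def)

lemma lattice_7: "v \<in> int_lattice \<longleftrightarrow>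
    v $ 1 \<in> \<int> \<and> v $ 2 \<in> \<int> \<and> v $ 3 \<in> \<int> \<and> v $ 4 \<in> \<int> \<and> v $ 5 \<in> \<int> \<and> v $ 6 \<in> \<int> \<and> v $ 7 \<in> \<int>" for v :: "real^7"
  by (simp add: int_lattice_def forall_7)

lemma lattice_3: "v \<in> int_lattice \<longleftrightarrow> v $ 1 \<in> \<int> \<and> v $ 2 \<in> \<int> \<and> v $ 3 \<in> \<int>" for v :: "real^3"
  by (simp add: int_lattice_def forall_3)

lemma lattice_add: "u \<in> int_lattice \<Longrightarrow> v \<in> int_lattice \<Longrightarrow> u + v \<in> int_lattice"
  and lattice_diff: "u \<in> int_lattice \<Longrightarrow> v \<in> int_lattice \<Longrightarrow> u - v \<in> int_lattice"
  and lattice_0 [simp]: "0 \<in> int_lattice"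
  and lattice_minus: "u \<in> int_lattice \<Longrightarrow> - u \<in> int_lattice"
  by (auto simp: int_lattice_def)

lemma sim_coord: "sim x y \<longleftrightarrow> (\<exists>a b c. \<forall>i. y $ i - (sg7 a b c $ i * x $ i + hf7 b c $ i) \<in> \<int>)"
  by (simp add: sim_def gact_def int_lattice_def)

lemma sim_refl [simp]: "sim x x"
  unfolding sim_coord
proof (intro exI allI)
  fix i show "x $ i - (sg7 False False False $ i * x $ i + hf7 False False $ i) \<in> \<int>"
    using exhaust_7[of i] by (auto simp: sg7_def hf7_def sgb_def hfb_def)
qed

text \<open>Every element of \<Gamma> is its own inverse modulo the lattice, so the same a, b, c
  serve in both directions. The error term (s + 1) h, with s a sign and h in {0, 1/2}, is an
  integer.\<close>

lemma sim_sym: assumes "sim x y" shows "sim y x"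
proof -
  obtain a b c where *: "y $ i - (sg7 a b c $ i * x $ i + hf7 b c $ i) \<in> \<int>" for i
    using assms by (auto simp: sim_coord)
  have "x $ i - (sg7 a b c $ i * y $ i + hf7 b c $ i) \<in> \<int>" for i
  proof -
    have "x $ i - (sg7 a b c $ i * y $ i + hf7 b c $ i)
        = - sg7 a b c $ i * (y $ i - (sg7 a b c $ i * x $ i + hf7 b c $ i)) - (sg7 a b c $ i + 1) * hf7 b c $ i"
      using sg7_cases[of a b c i] by (auto simp: algebra_simps)
    moreover have "(sg7 a b c $ i + 1) * hf7 b c $ i \<in> \<int>"
      using sg7_cases[of a b c i] hf7_cases[of b c i] by (elim disjE; simp only:; simp)
    moreover have "- sg7 a b c $ i \<in> \<int>" using sg7_cases[of a b c i] by auto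
    ultimately show ?thesis using *[of i] by (metis Ints_diff Ints_mult)
  qed
  then show ?thesis by (auto simp: sim_coord)
qed

text \<open>Signs multiply exactly, while shifts add only up to integers: (s' - 1) h is 0 or -1 when
  h = 1/2, and two half shifts make a whole one. The maps \<open>gact\<close> thus form a group only
  modulo the lattice.\<close>

lemma gact_compose:
  assumes "y - gact a b c x \<in> int_lattice" "z - gact a' b' c' y \<in> int_lattice"
  shows "z - gact (a' \<noteq> a) (b' \<noteq> b) (c' \<noteq> c) x \<in> int_lattice"
proof -
  have 1: "y $ i - (sg7 a b c $ i * x $ i + hf7 b c $ i) \<in> \<int>"
    and 2: "z $ i - (sg7 a' b' c' $ i * y $ i + hf7 b' c' $ i) \<in> \<int>" for i
    using assms by (auto simp: gact_def int_lattice_def)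
  have "z $ i - (sg7 (a' \<noteq> a) (b' \<noteq> b) (c' \<noteq> c) $ i * x $ i + hf7 (b' \<noteq> b) (c' \<noteq> c) $ i) \<in> \<int>" for i
  proof -
    let ?s = "sg7 a b c $ i" and ?s' = "sg7 a' b' c' $ i" and ?h = "hf7 b c $ i" and ?h' = "hf7 b' c' $ i"
    have "z $ i - (sg7 (a' \<noteq> a) (b' \<noteq> b) (c' \<noteq> c) $ i * x $ i + hf7 (b' \<noteq> b) (c' \<noteq> c) $ i)
        = (z $ i - (?s' * y $ i + ?h')) + ?s' * (y $ i - (?s * x $ i + ?h)) + (?s' - 1) * ?h
          + (?h' + ?h - hf7 (b' \<noteq> b) (c' \<noteq> c) $ i)"
      unfolding sg7_mult[symmetric] by (simp add: algebra_simps)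
    moreover have "(?s' - 1) * ?h \<in> \<int>"
      using sg7_cases[of a' b' c' i] hf7_cases[of b c i] by (elim disjE; simp only:; simp)
    moreover have "?s' \<in> \<int>" using sg7_cases[of a' b' c' i] by auto
    ultimately show ?thesis using 1[of i] 2[of i] hf7_add[of b' c' i b c]
      by (simp only: Ints_add Ints_mult)
  qed
  then show ?thesis by (auto simp: gact_def int_lattice_def)
qed

lemma sim_trans: "sim x y \<Longrightarrow> sim y z \<Longrightarrow> sim x z"
  unfolding sim_def using gact_compose by meson

lemma sim_lattice: "y - x \<in> int_lattice \<Longrightarrow> sim x y"
  unfolding sim_def
  by (rule exI[of _ False], rule exI[of _ False], rule exI[of _ False])
     (simp add: gact_def lattice_7 sg7_def hf7_def sgb_def hfb_def)

text \<open>The three maps are exact involutions of R^7, so only the parities of the exponents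
  matter; the composite in the given order differs from \<open>gact\<close> by a lattice
  vector.\<close>

lemma orb_eq: "orb x = {y. sim x y}"
proof -
  have pow: "(inv_alpha ^^ n) y = (if odd n then inv_alpha y else y)"
    "(inv_beta ^^ n) y = (if odd n then inv_beta y else y)"
    "(inv_gamma ^^ n) y = (if odd n then inv_gamma y else y)" for n y
  proof -
    have "inv_alpha (inv_alpha y) = y" "inv_beta (inv_beta y) = y" "inv_gamma (inv_gamma y) = y" for y
      by (simp_all add: vec_eq_iff forall_7 inv_alpha_def inv_beta_def inv_gamma_def)
    then show "(inv_alpha ^^ n) y = (if odd n then inv_alpha y else y)"
    "(inv_beta ^^ n) y = (if odd n then inv_beta y else y)"
    "(inv_gamma ^^ n) y = (if odd n then inv_gamma y else y)"
      by (induction n) auto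
  qed
  have diff: "(inv_alpha ^^ a) ((inv_beta ^^ b) ((inv_gamma ^^ c) x)) - gact (odd a) (odd b) (odd c) x \<in> int_lattice"
    for a b c
    by (cases "odd a"; cases "odd b"; cases "odd c")
       (simp_all add: pow gact_def lattice_7 sg7_def hf7_def sgb_def hfb_def
          inv_alpha_def inv_beta_def inv_gamma_def)
  show ?thesis
  proof safe
    fix y assume "y \<in> orb x"
    then obtain a b c n where y: "n \<in> int_lattice" "y = (inv_alpha ^^ a) ((inv_beta ^^ b) ((inv_gamma ^^ c) x)) + n"
      unfolding orb_def by blast
    have "y - gact (odd a) (odd b) (odd c) x \<in> int_lattice"
      using lattice_add[OF diff[of a b c] y(1)] y(2) by (simp add: algebra_simps)
    then show "sim x y" unfolding sim_def by blast
  next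
    fix y assume "sim x y"
    then obtain a b c where y: "y - gact a b c x \<in> int_lattice" unfolding sim_def by blast
    let ?z = "(inv_alpha ^^ of_bool a) ((inv_beta ^^ of_bool b) ((inv_gamma ^^ of_bool c) x))"
    have "?z - gact a b c x \<in> int_lattice" using diff[of "of_bool a" "of_bool b" "of_bool c"] by simp
    then have "(y - gact a b c x) - (?z - gact a b c x) \<in> int_lattice" using y lattice_diff by blast
    then have "y - ?z \<in> int_lattice" by simp
    moreover have "y = ?z + (y - ?z)" by simp
    ultimately show "y \<in> orb x" unfolding orb_def by blast
  qed
qed

lemma orb_eq_iff: "orb x = orb y \<longleftrightarrow> sim x y"
proof
  assume "orb x = orb y"
  then have "y \<in> orb x" by (simp add: orb_eq)
  then show "sim x y" by (simp add: orb_eq)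
next
  assume "sim x y" then show "orb x = orb y"
    unfolding orb_eq using sim_sym sim_trans by blast
qed

text \<open>The three clauses are the fixed point equations of \<alpha>, \<beta>, \<gamma>, in this
  order: x = -x or x = 1/2 - x modulo 1 in each reversed coordinate. The coordinates that a clause
  leaves free run along the fixed tori.\<close>

lemma singular_coord: "x \<in> singular \<longleftrightarrow>
    (2 * x$1 \<in> \<int> \<and> 2 * x$2 \<in> \<int> \<and> 2 * x$3 \<in> \<int> \<and> 2 * x$4 \<in> \<int>) \<or>
    (2 * x$1 \<in> \<int> \<and> 2 * x$2 - 1/2 \<in> \<int> \<and> 2 * x$5 \<in> \<int> \<and> 2 * x$6 \<in> \<int>) \<or>
    (2 * x$1 - 1/2 \<in> \<int> \<and> 2 * x$3 - 1/2 \<in> \<int> \<and> 2 * x$5 \<in> \<int> \<and> 2 * x$7 \<in> \<int>)"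
proof -
  have *: "- y - y \<in> \<int> \<longleftrightarrow> 2 * y \<in> \<int>" "1/2 - y - y \<in> \<int> \<longleftrightarrow> 2 * y - 1/2 \<in> \<int>" for y :: real
  proof -
    have "- y - y = - (2 * y)" "1/2 - y - y = - (2 * y - 1/2)" by simp_all
    then show "- y - y \<in> \<int> \<longleftrightarrow> 2 * y \<in> \<int>" "1/2 - y - y \<in> \<int> \<longleftrightarrow> 2 * y - 1/2 \<in> \<int>"
      by (metis Ints_minus minus_minus)+
  qed
  have **: "1/2 - 2 * y \<in> \<int> \<longleftrightarrow> 2 * y - 1/2 \<in> \<int>" for y :: real
    using *(2)[of y] by (simp add: algebra_simps)
  show ?thesis
    unfolding singular_def lattice_7 inv_alpha_def inv_beta_def inv_gamma_def by (simp add: * **)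
qed

text \<open>Modulo 1/2 the group acts on a coordinate by a sign only. Hence being a half integer, or
  an odd multiple of 1/4, is preserved coordinate by coordinate.\<close>

lemma two_Ints_transfer:
  assumes "(y::real) - (s * x + h) \<in> \<int>" "s = 1 \<or> s = -1" "h = 0 \<or> h = 1/2"
  shows "2 * x \<in> \<int> \<Longrightarrow> 2 * y \<in> \<int>" "2 * x - 1/2 \<in> \<int> \<Longrightarrow> 2 * y - 1/2 \<in> \<int>"
proof -
  have h: "2 * h \<in> \<int>" using assms(3) by (elim disjE; hypsubst; simp)
  have k: "2 * (y - (s * x + h)) \<in> \<int>" by (intro Ints_mult assms(1)) auto
  have s: "s \<in> \<int>" using assms(2) by auto
  show "2 * y \<in> \<int>" if "2 * x \<in> \<int>"
  proof -
    have "2 * y = 2 * (y - (s * x + h)) + s * (2 * x) + 2 * h" by (simp add: algebra_simps)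
    then show ?thesis using that h k s by (metis Ints_add Ints_mult)
  qed
  show "2 * y - 1/2 \<in> \<int>" if "2 * x - 1/2 \<in> \<int>"
  proof -
    have "2 * y - 1/2 = 2 * (y - (s * x + h)) + s * (2 * x - 1/2) + 2 * h + (s - 1) * (1/2)"
      by (simp add: field_simps)
    moreover have "(s - 1) * (1/2) \<in> \<int>" using assms(2) by auto
    ultimately show ?thesis using that h k s by (metis Ints_add Ints_mult)
  qed
qed

lemma singular_sim: assumes "sim x y" "x \<in> singular" shows "y \<in> singular"
proof -
  obtain a b c where *: "y $ i - (sg7 a b c $ i * x $ i + hf7 b c $ i) \<in> \<int>" for i
    using assms by (auto simp: sim_coord)
  note T = two_Ints_transfer[OF * sg7_cases hf7_cases]
  show ?thesis using assms(2) unfolding singular_coord using T by blast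
qed

section \<open>The quotient relation: closedness and freeness off the singular set\<close>

lemma closed_coord_Ints: "closed {z. f z \<in> \<int>}" if "continuous_on UNIV f" for f :: "'a::topological_space \<Rightarrow> real"
  using closed_vimage[OF closed_Ints that] by (simp add: vimage_def)

lemma closed_singular: "closed singular"
proof -
  have "singular = 
    ({x. 2 * x$1 \<in> \<int>} \<inter> {x. 2 * x$2 \<in> \<int>} \<inter> {x. 2 * x$3 \<in> \<int>} \<inter> {x. 2 * x$4 \<in> \<int>}) \<union>
    ({x. 2 * x$1 \<in> \<int>} \<inter> {x. 2 * x$2 - 1/2 \<in> \<int>} \<inter> {x. 2 * x$5 \<in> \<int>} \<inter> {x. 2 * x$6 \<in> \<int>}) \<union>
    ({x. 2 * x$1 - 1/2 \<in> \<int>} \<inter> {x. 2 * x$3 - 1/2 \<in> \<int>} \<inter> {x. 2 * x$5 \<in> \<int>} \<inter> {x. 2 * x$7 \<in> \<int>})"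
    using singular_coord by blast
  also have "closed \<dots>" by (intro closed_Un closed_Int closed_coord_Ints continuous_intros)
  finally show ?thesis .
qed

definition sim_by :: "bool \<Rightarrow> bool \<Rightarrow> bool \<Rightarrow> ((real^7) \<times> (real^7)) set" where
  "sim_by a b c = {(x, y). y - gact a b c x \<in> int_lattice}"

lemma continuous_gact: "continuous_on S (gact a b c)"
  unfolding gact_def by (intro continuous_intros)

lemma closed_sim_by: "closed (sim_by a b c)"
proof -
  have "sim_by a b c = (\<Inter>i. {z. snd z $ i - gact a b c (fst z) $ i \<in> \<int>})"
    by (auto simp: sim_by_def int_lattice_def)
  also have "closed \<dots>"
    by (intro closed_INT ballI closed_coord_Ints continuous_intros
        continuous_on_compose2[OF continuous_gact[of UNIV]]) auto
  finally show ?thesis .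
qed

lemma closed_sim: "closed {(x, y). sim x y}"
proof -
  have "{(x, y). sim x y} = (\<Union>(a, b, c)\<in>UNIV. sim_by a b c)"
    by (auto simp: sim_def sim_by_def)
  then show ?thesis by (auto intro!: closed_UN closed_sim_by)
qed

lemma Ints_small: "(r::real) \<in> \<int> \<Longrightarrow> \<bar>r\<bar> < 1 \<Longrightarrow> r = 0"
  using Ints_nonzero_abs_less1 by blast

text \<open>The elements other than \<alpha>, \<beta>, \<gamma> shift some coordinate by 1/2 without
  reversing it, hence have no fixed points on the torus: the coordinate is x_2 if both \<alpha> and
  \<beta> occur, and x_1 if \<gamma> occurs with exactly one of them.\<close>

lemma free_off_singular:
  assumes "x - gact a b c x \<in> int_lattice" "x \<notin> singular" shows "\<not> a \<and> \<not> b \<and> \<not> c"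
proof -
  have *: "x $ i - (sg7 a b c $ i * x $ i + hf7 b c $ i) \<in> \<int>" for i
    using assms by (auto simp: gact_def int_lattice_def)
  have e: "x$1 - (sgb a * sgb b * sgb c * x$1 + hfb c) \<in> \<int>" "x$2 - (sgb a * sgb b * x$2 + hfb b) \<in> \<int>"
    "x$3 - (sgb a * sgb c * x$3 + hfb c) \<in> \<int>" "x$4 - sgb a * x$4 \<in> \<int>"
    "x$5 - sgb b * sgb c * x$5 \<in> \<int>" "x$6 - sgb b * x$6 \<in> \<int>" "x$7 - sgb c * x$7 \<in> \<int>"
    using *[of 1] *[of 2] *[of 3] *[of 4] *[of 5] *[of 6] *[of 7] by (simp_all add: sg7_def hf7_def)
  have half: "(- (1/2)::real) \<notin> \<int>" using Ints_small[of "-(1/2)"] by auto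
  have dbl: "y - (- 1) * y = 2 * y" "y - (- 1 * y + 1/2) = 2 * y - 1/2" "y - (1 * y + 1/2) = - (1/2)" for y :: real
    by simp_all
  show ?thesis
  proof (rule ccontr)
    assume "\<not> ?thesis"
    then consider "a" "\<not> b" "\<not> c" | "\<not> a" b "\<not> c" | "\<not> a" "\<not> b" c | a b | "a \<noteq> b" c by blast
    then show False
    proof cases
      case 1
      then have "x \<in> singular"
        using e(1-4) dbl(1) unfolding singular_coord by (simp add: sgb_def hfb_def)
      then show False using assms by blast
    next
      case 2
      then have "x \<in> singular"
        using e(1,2,5,6) dbl unfolding singular_coord by (simp add: sgb_def hfb_def)
      then show False using assms by blast
    next
      case 3
      then have "x \<in> singular"
        using e(1,3,5,7) dbl unfolding singular_coord by (simp add: sgb_def hfb_def)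
      then show False using assms by blast
    next
      case 4
      then show False
        using e(1,2) half by (cases b; cases c) (simp_all add: sgb_def hfb_def)
    next
      case 5
      then show False
        using e(1) half by (cases a; cases b) (simp_all add: sgb_def hfb_def)
    qed
  qed
qed

lemma lattice_small: "norm v < 1 \<Longrightarrow> v \<in> int_lattice \<Longrightarrow> v = 0" for v :: "real^'n"
proof -
  assume v: "norm v < 1" "v \<in> int_lattice"
  have "v $ i = 0" for i
    using Ints_small[of "v $ i"] component_le_norm_cart[of v i] v by (auto simp: int_lattice_def)
  then show "v = 0" by (simp add: vec_eq_iff)
qed

text \<open>The relations of the seven nontrivial group elements are closed and miss (x, x), so a
  product neighbourhood avoids them all. The ball of radius 1/2 then rules out nonzero lattice
  vectors, whose norm is at least 1.\<close>

lemma sim_locally_trivial: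
  assumes "x \<notin> singular"
  shows "\<exists>N. open N \<and> x \<in> N \<and> (\<forall>y\<in>N. \<forall>z\<in>N. sim y z \<longrightarrow> y = z)"
proof -
  let ?G = "UNIV - {(False, False, False)} :: (bool \<times> bool \<times> bool) set"
  have "open (- (\<Union>(a, b, c)\<in>?G. sim_by a b c))"
    by (intro open_Compl closed_UN) (auto intro: closed_sim_by)
  moreover have "(x, x) \<in> - (\<Union>(a, b, c)\<in>?G. sim_by a b c)"
    using free_off_singular[OF _ assms] by (auto simp: sim_by_def)
  ultimately obtain A B where AB: "open A" "open B" "(x, x) \<in> A \<times> B" "A \<times> B \<subseteq> - (\<Union>(a, b, c)\<in>?G. sim_by a b c)"
    by (rule open_prod_elim)
  have "y = z" if "y \<in> A \<inter> B \<inter> ball x (1/2)" "z \<in> A \<inter> B \<inter> ball x (1/2)" "sim y z" for y z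
  proof -
    obtain a b c where s: "z - gact a b c y \<in> int_lattice" using \<open>sim y z\<close> by (auto simp: sim_def)
    then have "(y, z) \<in> sim_by a b c" by (simp add: sim_by_def)
    moreover have "(y, z) \<in> A \<times> B" using that by auto
    ultimately have "(a, b, c) \<notin> ?G" using AB(4) by blast
    then have "gact a b c y = y"
      by (simp add: gact_def vec_eq_iff forall_7 sg7_def hf7_def sgb_def hfb_def)
    then have "z - y \<in> int_lattice" using s by simp
    moreover have "norm (z - y) < 1"
      using that dist_triangle_half_r[of x z 1 y] by (auto simp: dist_norm norm_minus_commute)
    ultimately show "y = z" using lattice_small by fastforce
  qed
  then show ?thesis using AB by (intro exI[of _ "A \<inter> B \<inter> ball x (1/2)"]) auto
qed

lemma smooth_gact_add: "smooth_on S (\<lambda>z. gact a b c z + d)"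
proof -
  have "bounded_linear (\<lambda>z::real^7. \<chi> i. sg7 a b c $ i * z $ i)"
    by (rule linear_conv_bounded_linear[THEN iffD1], rule linearI) (auto simp: vec_eq_iff algebra_simps)
  then have "smooth_on S (\<lambda>z. (\<chi> i. sg7 a b c $ i * z $ i) + (hf7 b c + d))"
    by (intro smooth_on_add smooth_on_const smooth_on_bounded_linear)
  moreover have "(\<lambda>z. (\<chi> i. sg7 a b c $ i * z $ i) + (hf7 b c + d)) = (\<lambda>z. gact a b c z + d)"
    by (auto simp: gact_def vec_eq_iff)
  ultimately show ?thesis by simp
qed

lemma regular_lift:
  assumes "sim x y" "open V" "open W" "x \<in> V" "y \<in> W"
  shows "smooth_lift V (\<lambda>x. Reg (orb x)) W (\<lambda>x. Reg (orb x)) (\<lambda>a. a) x y"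
proof -
  obtain a b c where *: "y - gact a b c x \<in> int_lattice" using assms by (auto simp: sim_def)
  show ?thesis
  \<comment> \<open>The added constant is a lattice vector, so the orbit does not change; it makes
    the lift send x exactly to y.\<close>
  proof (rule smooth_liftI[of V _ _ "\<lambda>z. gact a b c z + (y - gact a b c x)"])
    fix z
    have "(gact a b c z + (y - gact a b c x)) - gact a b c z \<in> int_lattice" using * by simp
    then have "sim z (gact a b c z + (y - gact a b c x))" unfolding sim_def by blast
    then show "Reg (orb z) = Reg (orb (gact a b c z + (y - gact a b c x)))" by (simp add: orb_eq_iff)
  qed (use assms smooth_gact_add in auto)
qed

section \<open>Tubes around the singular tori\<close>

text \<open>Centre coordinates are multiples of 1/4 and shifts multiples of 1/2, so 4 (u' - s u) is
  an integer; the bound 1/8 on both deviations makes it smaller than 1 in absolute value, hence 0.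
  An equivalence between tube points therefore splits into one of deviations and one of
  centres.\<close>

lemma quarter_coord:
  assumes "(\<kappa>' + u') - (s * (\<kappa> + u) + h) \<in> \<int>" "4 * \<kappa> \<in> \<int>" "4 * \<kappa>' \<in> \<int>" "\<bar>u\<bar> < 1/8" "\<bar>u'\<bar> < 1/8"
    "s = 1 \<or> s = -1" "h = 0 \<or> h = (1/2::real)"
  shows "u' = s * u \<and> \<kappa>' - (s * \<kappa> + h) \<in> \<int>"
proof -
  have s: "s \<in> \<int>" using assms(6) by auto
  have h: "4 * h \<in> \<int>" using assms(7) by (elim disjE; hypsubst; simp)
  have "4 * (u' - s * u) = 4 * ((\<kappa>' + u') - (s * (\<kappa> + u) + h)) - 4 * \<kappa>' + s * (4 * \<kappa>) + 4 * h"
    by (simp add: algebra_simps)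
  moreover have "4 * ((\<kappa>' + u') - (s * (\<kappa> + u) + h)) \<in> \<int>" by (intro Ints_mult assms(1)) auto
  ultimately have "4 * (u' - s * u) \<in> \<int>" using assms(2,3) s h by (metis Ints_add Ints_diff Ints_mult)
  moreover have "\<bar>4 * (u' - s * u)\<bar> < 1" using assms(4-6) by auto
  ultimately have "4 * (u' - s * u) = 0" by (rule Ints_small)
  then have u: "u' = s * u" by simp
  have "\<kappa>' - (s * \<kappa> + h) = (\<kappa>' + u') - (s * (\<kappa> + u) + h)" using u by (simp add: algebra_simps)
  then have "\<kappa>' - (s * \<kappa> + h) \<in> \<int>" using assms(1) by (simp only:)
  then show ?thesis using u by blast
qed

lemma frac_not_Ints [simp]: "(1/2::real) \<notin> \<int>" "(1/4::real) \<notin> \<int>" "(3/4::real) \<notin> \<int>"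
    "-(1/2::real) \<notin> \<int>" "-(1/4::real) \<notin> \<int>" "-(3/4::real) \<notin> \<int>"
  using Ints_small[of "1/2"] Ints_small[of "1/4"] Ints_small[of "3/4"]
    Ints_small[of "-(1/2)"] Ints_small[of "-(1/4)"] Ints_small[of "-(3/4)"] by auto

lemma tube_add: "tube k c (t + t') z = tube k c t z + tube k 0 t' 0"
  by (cases k; cases z) (simp_all add: vec_eq_iff forall_7 zero_prod_def)

lemma tube_lattice: "n \<in> int_lattice \<Longrightarrow> tube k 0 n 0 \<in> int_lattice"
  by (cases k) (simp_all add: zero_prod_def lattice_7 lattice_3)

definition half_set :: "real set" where "half_set = {0, 1/2}"

lemma half_setD: "r \<in> half_set \<Longrightarrow> r = 0 \<or> r = 1/2"
  by (simp add: half_set_def)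

lemma half_set_two: "r \<in> half_set \<Longrightarrow> 2 * r \<in> \<int>"
  by (drule half_setD) (elim disjE; hypsubst; simp)

lemma half_set_four: "r \<in> half_set \<Longrightarrow> 4 * r \<in> \<int>"
  by (drule half_setD) (elim disjE; hypsubst; simp)

lemma half_set_diff: "r \<in> half_set \<Longrightarrow> r' \<in> half_set \<Longrightarrow> s = 1 \<or> s = -1 \<Longrightarrow> r' - s * r \<in> \<int> \<Longrightarrow> r' = r"
  by (drule half_setD, drule half_setD) (elim disjE; hypsubst; simp)

lemma centres_alt:
  "centres By_alpha = {vector [0, 0, a, b, 0, 0, 0] | a b. a \<in> half_set \<and> b \<in> half_set}"
  "centres By_beta = {vector [0, 1/4, 0, 0, a, b, 0] | a b. a \<in> half_set \<and> b \<in> half_set}"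
  "centres By_gamma = {vector [1/4, 0, 1/4, 0, a, 0, b] | a b. a \<in> half_set \<and> b \<in> half_set}"
  by (simp_all add: half_set_def)

text \<open>The involution of the tube fixes its centre modulo the lattice, acts as -1 on the normal
  directions and trivially along the torus. The doubled centre coordinates being integers is what
  absorbs the half integers p, q.\<close>

lemma tube_minus:
  assumes c: "c \<in> centres k" shows "sim (tube k c t z) (tube k c t (- z))"
proof -
  obtain z1 z2 where z: "z = (z1, z2)" by force
  show ?thesis
  proof (cases k)
    case By_alpha
    obtain p q where pq: "c = vector [0, 0, p, q, 0, 0, 0]" "p \<in> half_set" "q \<in> half_set"
      using c[unfolded By_alpha] unfolding centres_alt by blast
    have "tube k c t (- z) - gact True False False (tube k c t z) \<in> int_lattice"
      using half_set_two[OF pq(2)] half_set_two[OF pq(3)]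
      by (simp add: By_alpha pq(1) z lattice_7 gact_def sg7_def hf7_def sgb_def hfb_def)
    then show ?thesis unfolding sim_def by blast
  next
    case By_beta
    obtain p q where pq: "c = vector [0, 1/4, 0, 0, p, q, 0]" "p \<in> half_set" "q \<in> half_set"
      using c[unfolded By_beta] unfolding centres_alt by blast
    have "tube k c t (- z) - gact False True False (tube k c t z) \<in> int_lattice"
      using half_set_two[OF pq(2)] half_set_two[OF pq(3)]
      by (simp add: By_beta pq(1) z lattice_7 gact_def sg7_def hf7_def sgb_def hfb_def)
    then show ?thesis unfolding sim_def by blast
  next
    case By_gamma
    obtain p q where pq: "c = vector [1/4, 0, 1/4, 0, p, 0, q]" "p \<in> half_set" "q \<in> half_set"
      using c[unfolded By_gamma] unfolding centres_alt by blast
    have "tube k c t (- z) - gact False False True (tube k c t z) \<in> int_lattice"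
      using half_set_two[OF pq(2)] half_set_two[OF pq(3)]
      by (simp add: By_gamma pq(1) z lattice_7 gact_def sg7_def hf7_def sgb_def hfb_def)
    then show ?thesis unfolding sim_def by blast
  qed
qed

lemma normal_coords_small:
  assumes "norm (z, w) < d"
  shows "\<bar>Re z\<bar> < d" "\<bar>Im z\<bar> < d" "\<bar>Re w\<bar> < d" "\<bar>Im w\<bar> < d"
proof -
  have "norm z < d" "norm w < d"
    using assms norm_fst_le[of z w] norm_snd_le[of w z] by auto
  then show "\<bar>Re z\<bar> < d" "\<bar>Im z\<bar> < d" "\<bar>Re w\<bar> < d" "\<bar>Im w\<bar> < d"
    using abs_Re_le_cmod abs_Im_le_cmod le_less_trans by blast+
qed

text \<open>At a centre with x_1 = x_2 = 0 a shift by 1/2 cannot be compensated by a reversal: x_1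
  excludes \<gamma> and x_2 excludes \<beta>. What remains is a power of \<alpha>, acting by a sign
  on the normal coordinates and trivially along the torus.\<close>

lemma tube_sim_alpha:
  assumes c: "c \<in> centres By_alpha" "c' \<in> centres By_alpha" and nz: "norm z < 1/8" "norm z' < 1/8"
    and sim: "sim (tube By_alpha c t z) (tube By_alpha c' t' z')"
  shows "c = c' \<and> t' - t \<in> int_lattice \<and> (z' = z \<or> z' = - z)"
proof -
  obtain z1 z2 where z: "z = (z1, z2)" by force
  obtain w1 w2 where w: "z' = (w1, w2)" by force
  obtain p q where pq: "c = vector [0, 0, p, q, 0, 0, 0]" "p \<in> half_set" "q \<in> half_set"
    using c(1) unfolding centres_alt by blast
  obtain p' q' where pq': "c' = vector [0, 0, p', q', 0, 0, 0]" "p' \<in> half_set" "q' \<in> half_set"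
    using c(2) unfolding centres_alt by blast
  note small = normal_coords_small[OF nz(1)[unfolded z]] normal_coords_small[OF nz(2)[unfolded w]]
  obtain a b c where *: "tube By_alpha c' t' z' $ i -
      (sg7 a b c $ i * tube By_alpha (vector [0, 0, p, q, 0, 0, 0]) t z $ i + hf7 b c $ i) \<in> \<int>" for i
    using sim unfolding sim_coord pq(1) by blast
  note Q = quarter_coord[OF _ _ _ _ _ sg7_cases hf7_cases]
  have 1: "Re w1 = sg7 a b c $ 1 * Re z1 \<and> 0 - (sg7 a b c $ 1 * 0 + hf7 b c $ 1) \<in> \<int>"
    by (rule Q[OF _ _ _ small(1) small(5)]) (use *[of 1] in \<open>simp_all add: z w pq'(1)\<close>)
  have 2: "Im w1 = sg7 a b c $ 2 * Im z1 \<and> 0 - (sg7 a b c $ 2 * 0 + hf7 b c $ 2) \<in> \<int>"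
    by (rule Q[OF _ _ _ small(2) small(6)]) (use *[of 2] in \<open>simp_all add: z w pq'(1)\<close>)
  have 3: "Re w2 = sg7 a b c $ 3 * Re z2 \<and> p' - (sg7 a b c $ 3 * p + hf7 b c $ 3) \<in> \<int>"
    by (rule Q[OF _ _ _ small(3) small(7)]) (use *[of 3] half_set_four pq pq' in \<open>simp_all add: z w\<close>)
  have 4: "Im w2 = sg7 a b c $ 4 * Im z2 \<and> q' - (sg7 a b c $ 4 * q + hf7 b c $ 4) \<in> \<int>"
    by (rule Q[OF _ _ _ small(4) small(8)]) (use *[of 4] half_set_four pq pq' in \<open>simp_all add: z w\<close>)
  have c: "\<not> c" using 1 by (cases c) (simp_all add: hf7_def hfb_def)
  have b: "\<not> b" using 2 by (cases b) (simp_all add: hf7_def hfb_def)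
  have s: "sgb a = 1 \<or> sgb a = -1" by (simp add: sgb_def)
  have "p' = p" by (rule half_set_diff[OF pq(2) pq'(2) s])
    (use 3 b c in \<open>simp add: sg7_def hf7_def hfb_def sgb_def\<close>)
  moreover have "q' = q" by (rule half_set_diff[OF pq(3) pq'(3) s])
    (use 4 b c in \<open>simp add: sg7_def hf7_def hfb_def sgb_def\<close>)
  moreover have "t' - t \<in> int_lattice"
    using *[of 5] *[of 6] *[of 7] b c by (simp add: lattice_3 sg7_def hf7_def hfb_def sgb_def z w pq'(1))
  moreover have "z' = z \<or> z' = - z"
    using 1 2 3 4 b c unfolding z w
    by (cases a) (simp_all add: sg7_def sgb_def complex_eq_iff)
  ultimately show ?thesis using pq pq' by simp
qed

text \<open>Now x_2 = 1/4 at the centre, a value fixed by reversal together with the shift by 1/2,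
  but by neither alone. So x_1 excludes \<gamma>, and x_2 excludes \<alpha> as well as
  \<alpha>\<beta>.\<close>

lemma tube_sim_beta:
  assumes c: "c \<in> centres By_beta" "c' \<in> centres By_beta" and nz: "norm z < 1/8" "norm z' < 1/8"
    and sim: "sim (tube By_beta c t z) (tube By_beta c' t' z')"
  shows "c = c' \<and> t' - t \<in> int_lattice \<and> (z' = z \<or> z' = - z)"
proof -
  obtain z1 z2 where z: "z = (z1, z2)" by force
  obtain w1 w2 where w: "z' = (w1, w2)" by force
  obtain p q where pq: "c = vector [0, 1/4, 0, 0, p, q, 0]" "p \<in> half_set" "q \<in> half_set"
    using c(1) unfolding centres_alt by blast
  obtain p' q' where pq': "c' = vector [0, 1/4, 0, 0, p', q', 0]" "p' \<in> half_set" "q' \<in> half_set"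
    using c(2) unfolding centres_alt by blast
  note small = normal_coords_small[OF nz(1)[unfolded z]] normal_coords_small[OF nz(2)[unfolded w]]
  obtain a b c where *: "tube By_beta c' t' z' $ i -
      (sg7 a b c $ i * tube By_beta (vector [0, 1/4, 0, 0, p, q, 0]) t z $ i + hf7 b c $ i) \<in> \<int>" for i
    using sim unfolding sim_coord pq(1) by blast
  note Q = quarter_coord[OF _ _ _ _ _ sg7_cases hf7_cases]
  have 1: "Re w1 = sg7 a b c $ 1 * Re z1 \<and> 0 - (sg7 a b c $ 1 * 0 + hf7 b c $ 1) \<in> \<int>"
    by (rule Q[OF _ _ _ small(1) small(5)]) (use *[of 1] in \<open>simp_all add: z w pq'(1)\<close>)
  have 2: "Im w1 = sg7 a b c $ 2 * Im z1 \<and> 1/4 - (sg7 a b c $ 2 * (1/4) + hf7 b c $ 2) \<in> \<int>"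
    by (rule Q[OF _ _ _ small(2) small(6)]) (use *[of 2] in \<open>simp_all add: z w pq'(1)\<close>)
  have 3: "Re w2 = sg7 a b c $ 5 * Re z2 \<and> p' - (sg7 a b c $ 5 * p + hf7 b c $ 5) \<in> \<int>"
    by (rule Q[OF _ _ _ small(3) small(7)]) (use *[of 5] half_set_four pq pq' in \<open>simp_all add: z w\<close>)
  have 4: "Im w2 = sg7 a b c $ 6 * Im z2 \<and> q' - (sg7 a b c $ 6 * q + hf7 b c $ 6) \<in> \<int>"
    by (rule Q[OF _ _ _ small(4) small(8)]) (use *[of 6] half_set_four pq pq' in \<open>simp_all add: z w\<close>)
  have c: "\<not> c" using 1 by (cases c) (simp_all add: hf7_def hfb_def)
  have a: "\<not> a" using 2 by (cases a; cases b) (simp_all add: sg7_def sgb_def hf7_def hfb_def)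
  have s: "sgb b = 1 \<or> sgb b = -1" by (simp add: sgb_def)
  have "p' = p" by (rule half_set_diff[OF pq(2) pq'(2) s])
    (use 3 a c in \<open>simp add: sg7_def hf7_def hfb_def sgb_def\<close>)
  moreover have "q' = q" by (rule half_set_diff[OF pq(3) pq'(3) s])
    (use 4 a c in \<open>simp add: sg7_def hf7_def hfb_def sgb_def\<close>)
  moreover have "t' - t \<in> int_lattice"
    using *[of 3] *[of 4] *[of 7] a c by (simp add: lattice_3 sg7_def hf7_def hfb_def sgb_def z w pq'(1))
  moreover have "z' = z \<or> z' = - z"
    using 1 2 3 4 a c unfolding z w
    by (cases b) (simp_all add: sg7_def sgb_def complex_eq_iff)
  ultimately show ?thesis using pq pq' by simp
qed

text \<open>Both x_1 and x_3 are 1/4 at the centre, where reversal and half shift must occur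
  together: x_3 excludes \<alpha>, and then x_1 excludes \<beta>.\<close>

lemma tube_sim_gamma:
  assumes c: "c \<in> centres By_gamma" "c' \<in> centres By_gamma" and nz: "norm z < 1/8" "norm z' < 1/8"
    and sim: "sim (tube By_gamma c t z) (tube By_gamma c' t' z')"
  shows "c = c' \<and> t' - t \<in> int_lattice \<and> (z' = z \<or> z' = - z)"
proof -
  obtain z1 z2 where z: "z = (z1, z2)" by force
  obtain w1 w2 where w: "z' = (w1, w2)" by force
  obtain p q where pq: "c = vector [1/4, 0, 1/4, 0, p, 0, q]" "p \<in> half_set" "q \<in> half_set"
    using c(1) unfolding centres_alt by blast
  obtain p' q' where pq': "c' = vector [1/4, 0, 1/4, 0, p', 0, q']" "p' \<in> half_set" "q' \<in> half_set"
    using c(2) unfolding centres_alt by blast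
  note small = normal_coords_small[OF nz(1)[unfolded z]] normal_coords_small[OF nz(2)[unfolded w]]
  obtain a b c where *: "tube By_gamma c' t' z' $ i -
      (sg7 a b c $ i * tube By_gamma (vector [1/4, 0, 1/4, 0, p, 0, q]) t z $ i + hf7 b c $ i) \<in> \<int>" for i
    using sim unfolding sim_coord pq(1) by blast
  note Q = quarter_coord[OF _ _ _ _ _ sg7_cases hf7_cases]
  have 1: "Re w1 = sg7 a b c $ 1 * Re z1 \<and> 1/4 - (sg7 a b c $ 1 * (1/4) + hf7 b c $ 1) \<in> \<int>"
    by (rule Q[OF _ _ _ small(1) small(5)]) (use *[of 1] in \<open>simp_all add: z w pq'(1)\<close>)
  have 2: "Im w1 = sg7 a b c $ 3 * Im z1 \<and> 1/4 - (sg7 a b c $ 3 * (1/4) + hf7 b c $ 3) \<in> \<int>"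
    by (rule Q[OF _ _ _ small(2) small(6)]) (use *[of 3] in \<open>simp_all add: z w pq'(1)\<close>)
  have 3: "Im w2 = sg7 a b c $ 5 * Im z2 \<and> p' - (sg7 a b c $ 5 * p + hf7 b c $ 5) \<in> \<int>"
    by (rule Q[OF _ _ _ small(4) small(8)]) (use *[of 5] half_set_four pq pq' in \<open>simp_all add: z w\<close>)
  have 4: "Re w2 = sg7 a b c $ 7 * Re z2 \<and> q' - (sg7 a b c $ 7 * q + hf7 b c $ 7) \<in> \<int>"
    by (rule Q[OF _ _ _ small(3) small(7)]) (use *[of 7] half_set_four pq pq' in \<open>simp_all add: z w\<close>)
  have a: "\<not> a" using 2 by (cases a; cases c) (simp_all add: sg7_def sgb_def hf7_def hfb_def)
  have b: "\<not> b" using 1 a by (cases b; cases c) (simp_all add: sg7_def sgb_def hf7_def hfb_def)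
  have s: "sgb c = 1 \<or> sgb c = -1" by (simp add: sgb_def)
  have "p' = p" by (rule half_set_diff[OF pq(2) pq'(2) s])
    (use 3 a b in \<open>simp add: sg7_def hf7_def hfb_def sgb_def\<close>)
  moreover have "q' = q" by (rule half_set_diff[OF pq(3) pq'(3) s])
    (use 4 a b in \<open>simp add: sg7_def hf7_def hfb_def sgb_def\<close>)
  moreover have "t' - t \<in> int_lattice"
    using *[of 2] *[of 4] *[of 6] a b by (simp add: lattice_3 sg7_def hf7_def hfb_def sgb_def z w pq'(1))
  moreover have "z' = z \<or> z' = - z"
    using 1 2 3 4 a b unfolding z w
    by (cases c) (simp_all add: sg7_def sgb_def complex_eq_iff)
  ultimately show ?thesis using pq pq' by simp
qed

text \<open>The first two coordinates separate the three kinds of tubes.\<close>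

fun base1 :: "invol \<Rightarrow> real" where
  "base1 By_alpha = 0" | "base1 By_beta = 0" | "base1 By_gamma = 1/4"

fun base2 :: "invol \<Rightarrow> real" where
  "base2 By_alpha = 0" | "base2 By_beta = 1/4" | "base2 By_gamma = 0"

lemma tube_first:
  assumes "c \<in> centres k" shows "tube k c t z $ 1 = base1 k + Re (fst z)"
  using assms by (cases k; cases z) auto

lemma tube_second:
  assumes "c \<in> centres k" "k \<noteq> By_gamma" shows "tube k c t z $ 2 = base2 k + Im (fst z)"
  using assms by (cases k; cases z) auto

lemma tube_sim_kind:
  assumes c: "c \<in> centres k" "c' \<in> centres k'" and nz: "norm z < 1/8" "norm z' < 1/8"
    and sim: "sim (tube k c t z) (tube k' c' t' z')"
  shows "k = k'"
proof -
  obtain z1 z2 where z: "z = (z1, z2)" by force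
  obtain w1 w2 where w: "z' = (w1, w2)" by force
  note small = normal_coords_small[OF nz(1)[unfolded z]] normal_coords_small[OF nz(2)[unfolded w]]
  obtain a b d where *: "tube k' c' t' z' $ i - (sg7 a b d $ i * tube k c t z $ i + hf7 b d $ i) \<in> \<int>" for i
    using sim unfolding sim_coord by blast
  note Q = quarter_coord[OF _ _ _ _ _ sg7_cases hf7_cases]
  have b1: "4 * base1 k \<in> \<int>" "4 * base2 k \<in> \<int>" for k by (cases k; simp)+
  have "base1 k' - (sg7 a b d $ 1 * base1 k + hf7 b d $ 1) \<in> \<int>"
    using Q[OF _ b1(1) b1(1) small(1) small(5), of k' a b d 1 k b d 1] *[of 1]
    by (simp add: tube_first[OF c(1)] tube_first[OF c(2)] z w)
  then have kind: "k = By_gamma \<longleftrightarrow> k' = By_gamma"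
    by (cases k; cases k'; cases d) (use sg7_cases[of a b d 1] in \<open>auto simp: hf7_def hfb_def\<close>)
  show ?thesis
  proof (cases "k = By_gamma")
    case False
    then have "base2 k' - (sg7 a b d $ 2 * base2 k + hf7 b d $ 2) \<in> \<int>"
      using Q[OF _ b1(2) b1(2) small(2) small(6), of k' a b d 2 k b d 2] *[of 2] kind
      by (simp add: tube_second[OF c(1)] tube_second[OF c(2)] z w)
    then show ?thesis using False kind
      by (cases k; cases k'; cases b) (use sg7_cases[of a b d 2] in \<open>auto simp: hf7_def hfb_def\<close>)
  qed (use kind in simp)
qed

lemma tube_sim:
  assumes c: "c \<in> centres k" "c' \<in> centres k'" and nz: "norm z < 1/8" "norm z' < 1/8"
    and sim: "sim (tube k c t z) (tube k' c' t' z')"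
  shows "k = k' \<and> c = c' \<and> t' - t \<in> int_lattice \<and> (z' = z \<or> z' = - z)"
proof -
  have k: "k = k'" using tube_sim_kind[OF assms] .
  show ?thesis
  proof (cases k)
    case By_alpha
    show ?thesis
      using tube_sim_alpha[OF c(1)[unfolded By_alpha] c(2)[folded k, unfolded By_alpha] nz sim[folded k, unfolded By_alpha]] k
      by blast
  next
    case By_beta
    show ?thesis
      using tube_sim_beta[OF c(1)[unfolded By_beta] c(2)[folded k, unfolded By_beta] nz sim[folded k, unfolded By_beta]] k
      by blast
  next
    case By_gamma
    show ?thesis
      using tube_sim_gamma[OF c(1)[unfolded By_gamma] c(2)[folded k, unfolded By_gamma] nz sim[folded k, unfolded By_gamma]] k
      by blast
  qed
qed

lemma tube_zero_singular: assumes c: "c \<in> centres k" shows "tube k c t 0 \<in> singular"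
proof -
  note hs = half_set_two
  show ?thesis
  proof (cases k)
    case By_alpha
    obtain p q where pq: "c = vector [0, 0, p, q, 0, 0, 0]" "p \<in> half_set" "q \<in> half_set"
      using c[unfolded By_alpha] unfolding centres_alt by blast
    then show ?thesis unfolding singular_coord By_alpha using hs by (simp add: zero_prod_def)
  next
    case By_beta
    obtain p q where pq: "c = vector [0, 1/4, 0, 0, p, q, 0]" "p \<in> half_set" "q \<in> half_set"
      using c[unfolded By_beta] unfolding centres_alt by blast
    then show ?thesis unfolding singular_coord By_beta using hs by (simp add: zero_prod_def)
  next
    case By_gamma
    obtain p q where pq: "c = vector [1/4, 0, 1/4, 0, p, 0, q]" "p \<in> half_set" "q \<in> half_set"
      using c[unfolded By_gamma] unfolding centres_alt by blast
    then show ?thesis unfolding singular_coord By_gamma using hs by (simp add: zero_prod_def)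
  qed
qed

lemma half_small: "\<bar>u\<bar> < 1/8 \<Longrightarrow> 2 * (r + u) \<in> \<int> \<Longrightarrow> 2 * r \<in> \<int> \<Longrightarrow> u = 0" for u :: real
proof -
  assume u: "\<bar>u\<bar> < 1/8" "2 * (r + u) \<in> \<int>" "2 * r \<in> \<int>"
  have "2 * u = 2 * (r + u) - 2 * r" by simp
  then have "2 * u \<in> \<int>" using u by (metis Ints_diff)
  then show "u = 0" using Ints_small[of "2 * u"] u by simp
qed

lemma quarter_small:
  "\<bar>u\<bar> < 1/8 \<Longrightarrow> 2 * (1/4 + u) \<notin> \<int>" "\<bar>u\<bar> < 1/8 \<Longrightarrow> 2 * u - 1/2 \<notin> \<int>" for u :: real
proof -
  show "2 * (1/4 + u) \<notin> \<int>" if "\<bar>u\<bar> < 1/8"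
  proof
    assume "2 * (1/4 + u) \<in> \<int>"
    then have "2 * (1/4 + u) = 0" by (rule Ints_small) (use that in auto)
    then show False using that by auto
  qed
  show "2 * u - 1/2 \<notin> \<int>" if "\<bar>u\<bar> < 1/8"
  proof
    assume "2 * u - 1/2 \<in> \<int>"
    then have "2 * u - 1/2 = 0" by (rule Ints_small) (use that in auto)
    then show False using that by auto
  qed
qed

text \<open>Within distance 1/8 of a centre the coordinates x_1 and x_2 exclude the fixed point
  equations of the other two involutions. Those of the tube's own involution force every normal
  deviation to vanish.\<close>

lemma tube_nonsingular:
  assumes c: "c \<in> centres k" and nz: "norm z < 1/8" "z \<noteq> 0"
  shows "tube k c t z \<notin> singular"
proof
  assume sing: "tube k c t z \<in> singular"
  obtain z1 z2 where z: "z = (z1, z2)" by force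
  note small = normal_coords_small[OF nz(1)[unfolded z]]
  note hs = half_set_two
  have "Re z1 = 0 \<and> Im z1 = 0 \<and> Re z2 = 0 \<and> Im z2 = 0"
  proof (cases k)
    case By_alpha
    obtain p q where pq: "c = vector [0, 0, p, q, 0, 0, 0]" "p \<in> half_set" "q \<in> half_set"
      using c[unfolded By_alpha] unfolding centres_alt by blast
    show ?thesis using sing small quarter_small half_small[of _ p] half_small[of _ q] half_small[of _ 0] hs pq(2,3)
      unfolding singular_coord by (simp add: By_alpha z pq(1))
  next
    case By_beta
    obtain p q where pq: "c = vector [0, 1/4, 0, 0, p, q, 0]" "p \<in> half_set" "q \<in> half_set"
      using c[unfolded By_beta] unfolding centres_alt by blast
    have "2 * (1/4 + Im z1) - 1/2 = 2 * Im z1" by simp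
    then show ?thesis using sing small quarter_small half_small[of _ p] half_small[of _ q] half_small[of _ 0] hs pq(2,3)
      unfolding singular_coord by (simp add: By_beta z pq(1))
  next
    case By_gamma
    obtain p q where pq: "c = vector [1/4, 0, 1/4, 0, p, 0, q]" "p \<in> half_set" "q \<in> half_set"
      using c[unfolded By_gamma] unfolding centres_alt by blast
    have "2 * (1/4 + Im z1) - 1/2 = 2 * Im z1" "2 * (1/4 + Re z1) - 1/2 = 2 * Re z1" by simp_all
    then show ?thesis using sing small quarter_small half_small[of _ p] half_small[of _ q] half_small[of _ 0] hs pq(2,3)
      unfolding singular_coord by (simp add: By_gamma z pq(1))
  qed
  then show False using nz(2) by (simp add: z zero_prod_def complex_eq_iff)
qed

section \<open>The exceptional charts\<close>

text \<open>\<open>eh_param\<close> involves a square root s of the fibre coordinate u. Keeping s as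
  an argument gives an honest point of C^2 on the line of slope m, of which the blow-up sees only
  the pair of opposite points.\<close>

definition pnt :: "bool \<Rightarrow> complex \<Rightarrow> complex \<Rightarrow> complex \<times> complex" where
  "pnt j m s = (if j then (s * m, s) else (s, s * m))"

definition lin :: "bool \<Rightarrow> complex \<Rightarrow> (complex \<times> complex) set" where
  "lin j m = cline (if j then (m, 1) else (1, m))"

lemma eh_param_pnt:
  assumes "s\<^sup>2 = u" shows "eh_param j (m, u) = ({pnt j m s, - pnt j m s}, lin j m)"
proof -
  have "s'\<^sup>2 = u \<longleftrightarrow> s' = s \<or> s' = - s" for s' unfolding assms[symmetric] by (rule power2_eq_iff)
  then have sets: "{f s' |s'. s'\<^sup>2 = u} = {f s, f (- s)}" for f :: "complex \<Rightarrow> complex \<times> complex" by auto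
  show ?thesis
    using sets[of "\<lambda>s. (s, s * m)"] sets[of "\<lambda>s. (s * m, s)"] by (cases j) (simp_all add: pnt_def lin_def)
qed

lemma cline_scale: assumes "d \<noteq> 0" shows "cline (d * fst v, d * snd v) = cline v"
proof (intro set_eqI iffI)
  fix x assume "x \<in> cline (d * fst v, d * snd v)"
  then obtain e where "x = ((e * d) * fst v, (e * d) * snd v)" by (auto simp: cline_def mult.assoc)
  then show "x \<in> cline v" unfolding cline_def by blast
next
  fix x assume "x \<in> cline v"
  then obtain e where "x = (e * fst v, e * snd v)" by (auto simp: cline_def)
  then have "x = ((e / d) * (d * fst v), (e / d) * (d * snd v))" using assms by simp
  then show "x \<in> cline (d * fst v, d * snd v)" unfolding cline_def fst_conv snd_conv by blast
qed

lemma cline_self: "v \<in> cline v"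
  unfolding cline_def by (auto intro!: exI[of _ 1])

lemma lin_eq: "lin j m = lin j' m' \<longleftrightarrow> (if j = j' then m = m' else m * m' = 1)"
proof -
  have same: "m = m'" if "lin j m = lin j m'" for j m m'
  proof (cases j)
    case True
    then have "(m, 1) \<in> cline (m', 1)" using that cline_self by (metis lin_def)
    then show ?thesis by (auto simp: cline_def)
  next
    case False
    then have "(1, m) \<in> cline (1, m')" using that cline_self by (metis lin_def)
    then show ?thesis by (auto simp: cline_def)
  qed
  have diff: "lin False m = lin True m' \<longleftrightarrow> m * m' = 1" for m m'
  proof
    assume "lin False m = lin True m'"
    then have "(1, m) \<in> cline (m', 1)" using cline_self by (metis lin_def)
    then show "m * m' = 1" by (auto simp: cline_def)
  next
    assume *: "m * m' = 1"
    then have "m' \<noteq> 0" by auto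
    from cline_scale[OF this, of "(1, m)"] show "lin False m = lin True m'"
      using * by (simp add: lin_def mult.commute)
  qed
  show ?thesis
    using same diff[of m m'] diff[of m' m] by (cases j; cases j') (auto simp: mult.commute)
qed

text \<open>Between the two charts the roots are related by s' = m s up to sign; squaring gives u' =
  m^2 u along with m' = 1/m, the transition functions of O(-2).\<close>

lemma eh_param_eq_iff:
  "eh_param j (m, u) = eh_param j' (m', u') \<longleftrightarrow> (if j = j' then m = m' \<and> u = u' else m * m' = 1 \<and> u' = m\<^sup>2 * u)"
proof -
  define s where "s = csqrt u"
  have s: "s\<^sup>2 = u" by (simp add: s_def)
  define s' where "s' = csqrt u'"
  have s': "s'\<^sup>2 = u'" by (simp add: s'_def)
  show ?thesis
  proof
    assume eq: "eh_param j (m, u) = eh_param j' (m', u')"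
    then have l: "lin j m = lin j' m'" and p: "{pnt j m s, - pnt j m s} = {pnt j' m' s', - pnt j' m' s'}"
      unfolding eh_param_pnt[OF s] eh_param_pnt[OF s'] by auto
    from p have p': "pnt j' m' s' = pnt j m s \<or> pnt j' m' s' = - pnt j m s" by (auto simp: doubleton_eq_iff)
    show "if j = j' then m = m' \<and> u = u' else m * m' = 1 \<and> u' = m\<^sup>2 * u"
    proof (cases "j = j'")
      case True
      then have "s' = s \<or> s' = - s" using p' by (auto simp: pnt_def split: if_splits)
      then show ?thesis using True l s s' unfolding lin_eq by auto
    next
      case False
      then have "s' = m * s \<or> s' = - (m * s)" using p' by (auto simp: pnt_def mult.commute split: if_splits)
      then have "u' = m\<^sup>2 * u" using s s' by (auto simp: power_mult_distrib)
      then show ?thesis using False l unfolding lin_eq by auto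
    qed
  next
    assume *: "if j = j' then m = m' \<and> u = u' else m * m' = 1 \<and> u' = m\<^sup>2 * u"
    show "eh_param j (m, u) = eh_param j' (m', u')"
    proof (cases "j = j'")
      case False
      have ms: "(m * s)\<^sup>2 = u'" using * False s by (simp add: power_mult_distrib)
      have "m * s * m' = s" using * False by (simp add: mult.commute mult.left_commute mult.assoc[symmetric])
      then have "pnt j' m' (m * s) = pnt j m s" using False
        by (cases j; cases j') (auto simp: pnt_def mult.commute)
      moreover have "lin j m = lin j' m'" using * False unfolding lin_eq by simp
      ultimately show ?thesis unfolding eh_param_pnt[OF s] eh_param_pnt[OF ms] by simp
    qed (use * in simp)
  qed
qed

lemma pnt_zero: "pnt j m s = 0 \<longleftrightarrow> s = 0"
  by (auto simp: pnt_def zero_prod_def)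

lemma norm_pnt: "(norm (pnt j m s))\<^sup>2 = cmod (s\<^sup>2) * (1 + (cmod m)\<^sup>2)"
  by (cases j) (simp_all add: pnt_def norm_prod_def norm_mult power_mult_distrib norm_power algebra_simps)

text \<open>The squared radius of the underlying point is \<open>cmod s\<close> squared times one
  plus \<open>cmod m\<close> squared, so it depends on u = s^2 alone and not on the choice of the
  root. The formula is the same in both charts.\<close>

lemma eh_ball_iff:
  assumes "0 < \<epsilon>" shows "eh_param j (m, u) \<in> eh_ball \<epsilon> \<longleftrightarrow> cmod u * (1 + (cmod m)\<^sup>2) < \<epsilon>\<^sup>2"
proof -
  define s where "s = csqrt u"
  have s: "s\<^sup>2 = u" by (simp add: s_def)
  have "pnt j m s \<in> cline (if j then (m, 1) else (1, m))"
    unfolding cline_def by (cases j) (auto simp: pnt_def)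
  moreover have "(if j then (m, 1) else (1, m)) \<noteq> 0" by (simp add: zero_prod_def)
  ultimately have "eh_param j (m, u) \<in> eguchi_hanson"
    unfolding eh_param_pnt[OF s] eguchi_hanson_def lin_def by blast
  then have "eh_param j (m, u) \<in> eh_ball \<epsilon> \<longleftrightarrow> {pnt j m s, - pnt j m s} \<in> cone_ball \<epsilon>"
    by (simp add: eh_ball_def blow_down_def eh_param_pnt[OF s])
  also have "\<dots> \<longleftrightarrow> norm (pnt j m s) < \<epsilon>"
  proof
    assume "{pnt j m s, - pnt j m s} \<in> cone_ball \<epsilon>"
    then obtain z where z: "{pnt j m s, - pnt j m s} = {z, - z}" "norm z < \<epsilon>"
      unfolding cone_ball_def by blast
    then have "pnt j m s = z \<or> pnt j m s = - z" unfolding doubleton_eq_iff by blast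
    then have "norm (pnt j m s) = norm z" using norm_minus_cancel[of z] by metis
    then show "norm (pnt j m s) < \<epsilon>" using z(2) by simp
  next
    assume "norm (pnt j m s) < \<epsilon>"
    then show "{pnt j m s, - pnt j m s} \<in> cone_ball \<epsilon>" unfolding cone_ball_def by blast
  qed
  also have "\<dots> \<longleftrightarrow> (norm (pnt j m s))\<^sup>2 < \<epsilon>\<^sup>2"
    using assms power_strict_mono[of "norm (pnt j m s)" \<epsilon> 2] power2_less_imp_less[of "norm (pnt j m s)" \<epsilon>]
    by auto
  finally show ?thesis by (simp add: norm_pnt s)
qed

text \<open>The radius condition written out in the coordinates t, m, u. Both charts of the blow-up
  have this domain, which is why neither the centre nor the chart is a parameter.\<close>

definition exc_dom :: "real \<Rightarrow> (real^7) set" where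
  "exc_dom \<epsilon> = {y. cmod (snd (snd (exc_coord y))) * (1 + (cmod (fst (snd (exc_coord y))))\<^sup>2) < \<epsilon>\<^sup>2}"

definition exc_point :: "(real^3) \<times> complex \<times> complex \<Rightarrow> real^7" where
  "exc_point = (\<lambda>(t, m, u). vector [t$1, t$2, t$3, Re m, Im m, Re u, Im u])"

lemma exc_coord_point [simp]: "exc_coord (exc_point z) = z"
  by (cases z) (simp add: exc_coord_def exc_point_def vec_eq_iff forall_3)

lemma exc_point_coord [simp]: "exc_point (exc_coord y) = y"
  by (simp add: exc_coord_def exc_point_def vec_eq_iff forall_7)

lemma bounded_linear_exc_coord: "bounded_linear exc_coord"
  unfolding linear_conv_bounded_linear[symmetric]
  by (rule linearI) (auto simp: exc_coord_def vec_eq_iff forall_3 complex_eq_iff)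

lemma bounded_linear_exc_point: "bounded_linear exc_point"
  unfolding linear_conv_bounded_linear[symmetric]
  by (rule linearI) (auto simp: exc_point_def vec_eq_iff forall_7 algebra_simps)

lemma continuous_exc_coord: "continuous_on S (\<lambda>y. fst (exc_coord y))"
  "continuous_on S (\<lambda>y. fst (snd (exc_coord y)))" "continuous_on S (\<lambda>y. snd (snd (exc_coord y)))"
  using linear_continuous_on[OF bounded_linear_exc_coord, of S] by (auto intro!: continuous_intros)

lemma open_exc_dom: "open (exc_dom \<epsilon>)"
  unfolding exc_dom_def by (intro open_Collect_less continuous_intros continuous_exc_coord)

lemma tube_shift: "n \<in> int_lattice \<Longrightarrow> orb (tube k c (t + n) z) = orb (tube k c t z)"
proof -
  assume "n \<in> int_lattice"
  then have "sim (tube k c t z) (tube k c (t + n) z)"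
    by (intro sim_lattice) (simp add: tube_add tube_lattice)
  then show ?thesis using orb_eq_iff by blast
qed

lemma glue_shift:
  assumes "n \<in> int_lattice" shows "glue k c (t + n) e = glue k c t e"
proof -
  have "{t + n + n' | n'. n' \<in> int_lattice} = {t + n' | n'. n' \<in> int_lattice}"
  proof (intro set_eqI iffI)
    fix x assume "x \<in> {t + n + n' | n'. n' \<in> int_lattice}"
    then obtain n' where "n' \<in> int_lattice" "x = t + (n + n')" by (auto simp: algebra_simps)
    then show "x \<in> {t + n' | n'. n' \<in> int_lattice}" using lattice_add[OF assms] by blast
  next
    fix x assume "x \<in> {t + n' | n'. n' \<in> int_lattice}"
    then obtain n' where "n' \<in> int_lattice" "x = t + n + (n' - n)" by (auto simp: algebra_simps)
    then show "x \<in> {t + n + n' | n'. n' \<in> int_lattice}" using lattice_diff[OF _ assms] by blast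
  qed
  then show ?thesis unfolding glue_def using tube_shift[OF assms] by simp
qed

text \<open>Any square root may be used: the opposite root gives the opposite normal vector, which
  has the same orbit by \<open>tube_minus\<close>.\<close>

lemma exc_param_eq:
  assumes "c \<in> centres k" "exc_coord y = (t, m, u)" "s\<^sup>2 = u"
  shows "exc_param k c j y = (if u = 0 then Exc k c {t + n | n. n \<in> int_lattice} (lin j m)
    else Reg (orb (tube k c t (pnt j m s))))"
proof -
  have "s = 0 \<longleftrightarrow> u = 0" using assms(3) by auto
  then have 0: "{pnt j m s, - pnt j m s} = {0} \<longleftrightarrow> u = 0" using pnt_zero[of j m s] by auto
  have "orb (tube k c t (- pnt j m s)) = orb (tube k c t (pnt j m s))"
    using tube_minus[OF assms(1)] orb_eq_iff by metis
  then show ?thesis unfolding exc_param_def assms(2) Let_def case_prod_conv eh_param_pnt[OF assms(3)]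
    by (simp only: glue_def blow_down_def fst_conv snd_conv 0) simp
qed

lemma norm_pnt_dom:
  assumes "y \<in> exc_dom \<epsilon>" "exc_coord y = (t, m, u)" "s\<^sup>2 = u" "0 < \<epsilon>" shows "norm (pnt j m s) < \<epsilon>"
  using assms norm_pnt[of j m s] by (auto simp: exc_dom_def intro: power2_less_imp_less)

lemma exc_param_cong:
  assumes "exc_coord y = (t, m, u)" "exc_coord y' = (t', m', u')" "t' - t \<in> int_lattice"
    "eh_param j (m, u) = eh_param j' (m', u')"
  shows "exc_param k c j y = exc_param k c j' y'"
  using glue_shift[OF assms(3), of k c t] assms by (simp add: exc_param_def)

lemma cosets_eq: assumes "{t + n | n. n \<in> int_lattice} = {t' + n | n. n \<in> int_lattice}"
  shows "t' - t \<in> (int_lattice :: (real^'n) set)"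
proof -
  have "t' + 0 \<in> {t' + n | n. n \<in> int_lattice}" by (rule CollectI) (auto intro!: exI[of _ 0])
  then have "t' \<in> {t + n | n. n \<in> int_lattice}" unfolding assms by simp
  then show ?thesis by auto
qed

text \<open>On the zero section all data are recorded by \<open>Exc\<close>. Off it the equation is
  one of orbits and \<open>tube_sim\<close> applies; the sign it leaves open is exactly the
  ambiguity of the square root.\<close>

lemma exc_param_eqD:
  assumes eps: "0 < \<epsilon>" "\<epsilon> \<le> 1/8" and c: "c \<in> centres k" "c' \<in> centres k'"
    and y: "y \<in> exc_dom \<epsilon>" "exc_coord y = (t, m, u)" and y': "y' \<in> exc_dom \<epsilon>" "exc_coord y' = (t', m', u')"
    and eq: "exc_param k c j y = exc_param k' c' j' y'"
  shows "k = k' \<and> c = c' \<and> t' - t \<in> int_lattice \<and> eh_param j (m, u) = eh_param j' (m', u')"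
proof -
  define s where "s = csqrt u"
  have s: "s\<^sup>2 = u" by (simp add: s_def)
  define s' where "s' = csqrt u'"
  have s': "s'\<^sup>2 = u'" by (simp add: s'_def)
  note E = eq[unfolded exc_param_eq[OF c(1) y(2) s] exc_param_eq[OF c(2) y'(2) s']]
  show ?thesis
  proof (cases "u = 0")
    case True
    then have u': "u' = 0" using E by (auto split: if_splits)
    then have "k = k'" "c = c'" "{t + n | n. n \<in> int_lattice} = {t' + n | n. n \<in> int_lattice}" "lin j m = lin j' m'"
      using E True by auto
    moreover from this have "t' - t \<in> int_lattice" by (intro cosets_eq)
    ultimately show ?thesis using True u' unfolding lin_eq eh_param_eq_iff by auto
  next
    case False
    then have u': "u' \<noteq> 0" using E by (auto split: if_splits)
    then have "orb (tube k c t (pnt j m s)) = orb (tube k' c' t' (pnt j' m' s'))" using E False by auto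
    then have sim: "sim (tube k c t (pnt j m s)) (tube k' c' t' (pnt j' m' s'))" using orb_eq_iff by blast
    have "norm (pnt j m s) < 1/8" "norm (pnt j' m' s') < 1/8"
      using norm_pnt_dom[OF y s eps(1), of j] norm_pnt_dom[OF y' s' eps(1), of j'] eps by auto
    from tube_sim[OF c this sim]
    have *: "k = k' \<and> c = c' \<and> t' - t \<in> int_lattice \<and> (pnt j' m' s' = pnt j m s \<or> pnt j' m' s' = - pnt j m s)" .
    have "if j = j' then m = m' \<and> u = u' else m * m' = 1 \<and> u' = m\<^sup>2 * u"
    proof -
      have nz: "s \<noteq> 0" "s' \<noteq> 0" using s s' False u' by auto
      show ?thesis
      proof (cases "j = j'")
        case True
        then have "s' = s \<and> s' * m' = s * m \<or> s' = - s \<and> s' * m' = - (s * m)"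
          using * by (auto simp: pnt_def split: if_splits)
        then show ?thesis using True nz s s' by auto
      next
        case False
        then have "s' = s * m \<and> s' * m' = s \<or> s' = - (s * m) \<and> s' * m' = - s"
          using * by (auto simp: pnt_def split: if_splits)
        then have "s * (m * m') = s * 1 \<and> s'\<^sup>2 = (s * m)\<^sup>2" by (auto simp: mult.assoc)
        then show ?thesis using False nz s s' by (auto simp: power_mult_distrib mult.commute)
      qed
    qed
    then show ?thesis using * unfolding eh_param_eq_iff by blast
  qed
qed

section \<open>Transition maps of the resolution\<close>

fun untube :: "invol \<Rightarrow> real^7 \<Rightarrow> (real^3) \<times> complex \<times> complex" where
  "untube By_alpha v = (vector [v$5, v$6, v$7], Complex (v$1) (v$2), Complex (v$3) (v$4))"
| "untube By_beta v = (vector [v$3, v$4, v$7], Complex (v$1) (v$2), Complex (v$5) (v$6))"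
| "untube By_gamma v = (vector [v$2, v$4, v$6], Complex (v$1) (v$3), Complex (v$7) (v$5))"

lemma untube_tube: "untube k (tube k c t z - c) = (t, z)"
  by (cases k; cases z) (simp_all add: vec_eq_iff forall_3)

lemma tube_untube: "tube k c (fst (untube k (x - c))) (snd (untube k (x - c))) = x"
  by (cases k) (simp_all add: vec_eq_iff forall_7)

lemma bounded_linear_untube: "bounded_linear (untube k)"
  unfolding linear_conv_bounded_linear[symmetric]
  by (cases k; rule linearI; simp add: vec_eq_iff forall_3 complex_eq_iff)

lemma bounded_linear_tube: "bounded_linear (\<lambda>(t, z). tube k 0 t z)"
  unfolding linear_conv_bounded_linear[symmetric]
  by (cases k; rule linearI; clarsimp simp: vec_eq_iff forall_7 algebra_simps)

lemma tube_centre: "tube k c t z = tube k 0 t z + c"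
  by (cases k; cases z) simp_all

lemma smooth_tube:
  assumes "smooth_on S f" "smooth_on S g" shows "smooth_on S (\<lambda>y. tube k c (f y) (g y))"
proof -
  have "smooth_on S (\<lambda>y. (\<lambda>(t, z). tube k 0 t z) (f y, g y) + c)"
    by (intro smooth_on_add smooth_on_const smooth_on_linear_comp[OF bounded_linear_tube] smooth_on_Pair assms)
  then show ?thesis by (simp add: tube_centre[of k c])
qed

lemma smooth_exc_coord: "smooth_on S (\<lambda>y. fst (exc_coord y))"
  "smooth_on S (\<lambda>y. fst (snd (exc_coord y)))" "smooth_on S (\<lambda>y. snd (snd (exc_coord y)))"
  by (intro smooth_on_bounded_linear bounded_linear_exc_coord
      bounded_linear_compose[OF bounded_linear_fst] bounded_linear_compose[OF bounded_linear_snd])+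

lemma smooth_exc_point:
  assumes "smooth_on S f" "smooth_on S g" "smooth_on S h" shows "smooth_on S (\<lambda>y. exc_point (f y, g y, h y))"
  by (intro smooth_on_linear_comp[OF bounded_linear_exc_point] smooth_on_Pair assms)

lemma open_preimage_complex:
  fixes f :: "'a::topological_space \<Rightarrow> complex"
  assumes "continuous_on UNIV f" "open S" shows "open {y. f y \<in> S}"
  using open_vimage[OF assms(2,1)] by (simp add: vimage_def)

text \<open>Away from the zero section a smooth branch of the square root is needed with prescribed
  value s at u. It is s times \<open>csqrt\<close> of the quotient by u, which is near 1 and so off
  the branch cut.\<close>

lemma exc_to_regular:
  assumes c: "c \<in> centres k" and eps: "0 < \<epsilon>" "\<epsilon> \<le> 1/8" and y: "y \<in> exc_dom \<epsilon>" "exc_coord y = (t, m, u)"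
    and s: "s\<^sup>2 = u" "u \<noteq> 0"
  shows "smooth_lift (exc_dom \<epsilon>) (exc_param k c j) (- singular) (\<lambda>x. Reg (orb x)) (\<lambda>a. a) y (tube k c t (pnt j m s))"
proof (rule smooth_liftI)
  let ?N = "exc_dom \<epsilon> \<inter> {z. snd (snd (exc_coord z)) / u \<in> - \<real>\<^sub>\<le>\<^sub>0}"
  let ?r = "\<lambda>z. s * csqrt (snd (snd (exc_coord z)) / u)"
  let ?\<tau> = "\<lambda>z. tube k c (fst (exc_coord z)) (pnt j (fst (snd (exc_coord z))) (?r z))"
  have "s \<noteq> 0" using s by auto
  have "continuous_on UNIV (\<lambda>z. snd (snd (exc_coord z)) / u)"
    using s by (intro continuous_intros continuous_exc_coord) auto
  from open_preimage_complex[OF this, of "- \<real>\<^sub>\<le>\<^sub>0"] show N: "open ?N"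
    by (intro open_Int open_exc_dom) (auto intro: open_Compl closed_nonpos_Reals_complex)
  show "y \<in> ?N" using y s by auto
  show "?N \<subseteq> exc_dom \<epsilon>" by auto
  have "smooth_on ?N (\<lambda>z. csqrt (snd (snd (exc_coord z)) * (1 / u)))"
  proof (rule smooth_on_compose[where T = "- \<real>\<^sub>\<le>\<^sub>0" and f = csqrt])
    show "smooth_on ?N (\<lambda>z. snd (snd (exc_coord z)) * (1 / u))"
      by (intro smooth_on_mult smooth_on_const smooth_exc_coord)
    show "smooth_on (- \<real>\<^sub>\<le>\<^sub>0) csqrt" by (intro smooth_on_holomorphic holomorphic_on_csqrt) auto
  qed auto
  then have r: "smooth_on ?N ?r" by (intro smooth_on_mult smooth_on_const) simp
  have p: "smooth_on ?N (\<lambda>z. pnt j (fst (snd (exc_coord z))) (?r z))"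
    unfolding pnt_def by (cases j; simp only: if_True if_False; intro smooth_on_Pair smooth_on_mult[OF r] r smooth_exc_coord)
  show "smooth_on ?N ?\<tau>" by (intro smooth_tube smooth_exc_coord p)
  show "?\<tau> y = tube k c t (pnt j m s)" using y s by simp
  show "open (- singular)" using closed_singular by auto
  have "norm (pnt j m s) < 1/8" using norm_pnt_dom[OF y s(1) eps(1), of j] eps by simp
  moreover have "pnt j m s \<noteq> 0" using pnt_zero s by auto
  ultimately show "tube k c t (pnt j m s) \<in> - singular" using tube_nonsingular[OF c] by auto
  fix z assume z: "z \<in> ?N"
  obtain t' m' u' where z': "exc_coord z = (t', m', u')" using prod_cases3 by blast
  have "u' \<noteq> 0" using z z' by auto
  moreover have "(?r z)\<^sup>2 = u'" using s z' by (simp add: power_mult_distrib)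
  ultimately show "exc_param k c j z = Reg (orb (?\<tau> z))"
    using exc_param_eq[OF c z', of "?r z" j] z' by simp
qed

text \<open>In the inverse direction no root has to be chosen: if p is the component of the normal
  vector that serves as s in chart j and q the other one, then u = p^2 and m = q / p wherever p does
  not vanish.\<close>

lemma regular_to_exc:
  assumes c: "c \<in> centres k" and eps: "0 < \<epsilon>" "\<epsilon> \<le> 1/8" and y: "y \<in> exc_dom \<epsilon>" "exc_coord y = (t, m, u)"
    and s: "s\<^sup>2 = u" "u \<noteq> 0"
  shows "smooth_lift (- singular) (\<lambda>x. Reg (orb x)) (exc_dom \<epsilon>) (exc_param k c j) (\<lambda>a. a) (tube k c t (pnt j m s)) y"
proof (rule smooth_liftI)
  define Z where "Z x = snd (untube k (x - c))" for x
  define p where "p x = (if j then snd (Z x) else fst (Z x))" for x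
  define q where "q x = (if j then fst (Z x) else snd (Z x))" for x
  let ?N = "- singular \<inter> {x. p x \<in> - {0}}"
  let ?\<tau> = "\<lambda>x. exc_point (fst (untube k (x - c)), q x * inverse (p x), p x * p x)"
  have nz: "norm (pnt j m s) < 1/8" using norm_pnt_dom[OF y s(1) eps(1), of j] eps by simp
  have nz': "pnt j m s \<noteq> 0" using pnt_zero s by auto
  have T: "untube k (tube k c t (pnt j m s) - c) = (t, pnt j m s)" by (rule untube_tube)
  have pq: "p (tube k c t (pnt j m s)) = s" "q (tube k c t (pnt j m s)) = s * m"
    unfolding p_def q_def Z_def T by (simp_all add: pnt_def)
  have "s \<noteq> 0" using s by auto
  have U: "smooth_on S (\<lambda>x. untube k (x - c))" for S
  proof -
    have "smooth_on S (\<lambda>x. untube k (x + (- c)))"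
      by (intro smooth_on_linear_comp[OF bounded_linear_untube] smooth_on_add smooth_on_const smooth_on_id)
    then show ?thesis by simp
  qed
  have Zs: "smooth_on S Z" for S unfolding Z_def by (rule smooth_on_linear_comp[OF bounded_linear_snd U])
  have ps: "smooth_on S p" "smooth_on S q" for S
    unfolding p_def[abs_def] q_def[abs_def]
    by (cases j; simp; rule smooth_on_linear_comp[OF bounded_linear_fst Zs] smooth_on_linear_comp[OF bounded_linear_snd Zs])+
  show "open ?N"
    using open_preimage_complex[OF smooth_on_imp_continuous_on[OF ps(1)], of "- {0}"] closed_singular
    by (intro open_Int) auto
  show "tube k c t (pnt j m s) \<in> ?N" using tube_nonsingular[OF c nz nz'] pq \<open>s \<noteq> 0\<close> by auto
  show "?N \<subseteq> - singular" by auto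
  have "smooth_on ?N (\<lambda>x. inverse (p x))"
    by (rule smooth_on_compose[OF ps(1), of "- {0}" inverse])
       (auto intro!: smooth_on_holomorphic holomorphic_intros)
  then show "smooth_on ?N ?\<tau>"
    by (intro smooth_exc_point smooth_on_mult ps smooth_on_linear_comp[OF bounded_linear_fst U])
  have "?\<tau> (tube k c t (pnt j m s)) = exc_point (t, m, u)"
    using T pq s \<open>s \<noteq> 0\<close> by (simp add: power2_eq_square field_simps)
  then show "?\<tau> (tube k c t (pnt j m s)) = y" using y by (metis exc_point_coord)
  show "open (exc_dom \<epsilon>)" by (rule open_exc_dom)
  show "y \<in> exc_dom \<epsilon>" by fact
  fix x assume x: "x \<in> ?N"
  then have "p x \<noteq> 0" by auto
  then have "pnt j (q x * inverse (p x)) (p x) = Z x"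
    by (cases "Z x"; cases j) (simp_all add: pnt_def p_def q_def field_simps)
  then have "exc_param k c j (?\<tau> x) = Reg (orb (tube k c (fst (untube k (x - c))) (Z x)))"
    using exc_param_eq[OF c exc_coord_point, of "p x" "p x * p x" j] \<open>p x \<noteq> 0\<close>
    by (simp add: power2_eq_square)
  then show "Reg (orb x) = exc_param k c j (?\<tau> x)" by (simp add: Z_def tube_untube)
qed

text \<open>Within one chart only the lattice translation along the torus intervenes. Between charts
  it is combined with the transition of O(-2), smooth where m is nonzero, as it is at the given
  point because m m' = 1.\<close>

lemma exc_to_exc:
  assumes c: "c \<in> centres k" and y: "y \<in> exc_dom \<epsilon>" "exc_coord y = (t, m, u)"
    and y': "y' \<in> exc_dom \<epsilon>" "exc_coord y' = (t', m', u')"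
    and eq: "t' - t \<in> int_lattice" "eh_param j (m, u) = eh_param j' (m', u')"
  shows "smooth_lift (exc_dom \<epsilon>) (exc_param k c j) (exc_dom \<epsilon>) (exc_param k c j') (\<lambda>a. a) y y'"
proof (cases "j = j'")
  case True
  let ?\<tau> = "\<lambda>z. exc_point (fst (exc_coord z) + (t' - t), fst (snd (exc_coord z)), snd (snd (exc_coord z)))"
  show ?thesis
  proof (rule smooth_liftI[OF open_exc_dom y(1) subset_refl _ _ open_exc_dom y'(1)])
    show "smooth_on (exc_dom \<epsilon>) ?\<tau>"
      by (intro smooth_exc_point smooth_on_add smooth_on_const smooth_exc_coord)
    have "?\<tau> y = exc_point (exc_coord y')" using y y' eq True by (simp add: eh_param_eq_iff)
    then show "?\<tau> y = y'" by simp
    fix z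
    obtain t1 m1 u1 where z: "exc_coord z = (t1, m1, u1)" using prod_cases3 by blast
    have "exc_coord (?\<tau> z) = (t1 + (t' - t), m1, u1)" using z by simp
    from exc_param_cong[OF z this] show "exc_param k c j z = exc_param k c j' (?\<tau> z)"
      using eq True by simp
  qed
next
  case False
  let ?m = "\<lambda>z. fst (snd (exc_coord z))"
  let ?N = "exc_dom \<epsilon> \<inter> {z. ?m z \<in> - {0}}"
  let ?\<tau> = "\<lambda>z. exc_point (fst (exc_coord z) + (t' - t), inverse (?m z), ?m z * ?m z * snd (snd (exc_coord z)))"
  have m: "m * m' = 1" "u' = m\<^sup>2 * u" using eq(2) False by (auto simp: eh_param_eq_iff)
  then have m0: "m \<noteq> 0" by auto
  show ?thesis
  proof (rule smooth_liftI[of ?N _ _ ?\<tau>, OF _ _ _ _ _ open_exc_dom y'(1)])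
    show "open ?N"
      using open_preimage_complex[OF continuous_exc_coord(2), of "- {0}"] open_exc_dom by (intro open_Int) auto
    show "y \<in> ?N" using y m0 by simp
    have "smooth_on ?N (\<lambda>z. inverse (?m z))"
      by (rule smooth_on_compose[where T = "- {0}" and f = inverse, OF smooth_exc_coord(2)])
         (auto intro!: smooth_on_holomorphic holomorphic_intros)
    then show "smooth_on ?N ?\<tau>"
      by (intro smooth_exc_point smooth_on_add smooth_on_const smooth_exc_coord smooth_on_mult)
    have "inverse m = m'" using m(1) m0 by (simp add: field_simps)
    then have "?\<tau> y = exc_point (exc_coord y')" using y y' m by (simp add: power2_eq_square)
    then show "?\<tau> y = y'" by simp
    fix z assume z_in: "z \<in> ?N"
    obtain t1 m1 u1 where z: "exc_coord z = (t1, m1, u1)" using prod_cases3 by blast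
    have "exc_coord (?\<tau> z) = (t1 + (t' - t), inverse m1, m1 * m1 * u1)" using z by simp
    from exc_param_cong[OF z this] show "exc_param k c j z = exc_param k c j' (?\<tau> z)"
      using eq False z z_in by (simp add: eh_param_eq_iff power2_eq_square)
  qed auto
qed

section \<open>The resolution as a closed manifold\<close>

definition joyce_family :: "real \<Rightarrow> ((real^7) set \<times> (real^7 \<Rightarrow> mpoint)) set" where
  "joyce_family \<epsilon> = insert (- singular, \<lambda>x. Reg (orb x))
     {(exc_dom \<epsilon>, exc_param k c j) | k c j. c \<in> centres k}"

lemma exc_dom_iff:
  "0 < \<epsilon> \<Longrightarrow> eh_param j (snd (exc_coord y)) \<in> eh_ball \<epsilon> \<longleftrightarrow> y \<in> exc_dom \<epsilon>"
  using eh_ball_iff[of \<epsilon> j "fst (snd (exc_coord y))" "snd (snd (exc_coord y))"] by (simp add: exc_dom_def)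

text \<open>The atlas of the statement is closed under restriction to smaller open sets, so it is
  the one generated by finitely many parametrisations with maximal domain.\<close>

lemma joyce_eq: assumes "0 < \<epsilon>" shows "joyce_manifold \<epsilon> = gen_atlas (joyce_family \<epsilon>)"
proof (intro set_eqI iffI; clarify)
  fix V p assume "(V, p) \<in> joyce_manifold \<epsilon>"
  then consider "p = (\<lambda>x. Reg (orb x))" "open V" "V \<inter> singular = {}" "inj_on p V"
    | k c j where "p = exc_param k c j" "open V" "c \<in> centres k" "\<forall>y\<in>V. y \<in> exc_dom \<epsilon>" "inj_on p V"
    unfolding joyce_manifold_def using exc_dom_iff[OF assms] by blast
  then show "(V, p) \<in> gen_atlas (joyce_family \<epsilon>)"
    by cases (unfold gen_atlas_def joyce_family_def, blast+)
next
  fix V p assume "(V, p) \<in> gen_atlas (joyce_family \<epsilon>)"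
  then consider "p = (\<lambda>x. Reg (orb x))" "open V" "V \<inter> singular = {}" "inj_on p V"
    | k c j where "p = exc_param k c j" "open V" "c \<in> centres k" "\<forall>y\<in>V. y \<in> exc_dom \<epsilon>" "inj_on p V"
    unfolding gen_atlas_def joyce_family_def by blast
  then show "(V, p) \<in> joyce_manifold \<epsilon>"
  proof cases
    case 1
    then show ?thesis unfolding joyce_manifold_def by blast
  next
    case (2 k c j)
    then have "\<forall>y\<in>V. eh_param j (snd (exc_coord y)) \<in> eh_ball \<epsilon>" using exc_dom_iff[OF assms] by blast
    then show ?thesis unfolding joyce_manifold_def using 2 by blast
  qed
qed

lemma joyce_family_cases:
  assumes "(V, p) \<in> joyce_family \<epsilon>"
  obtains "V = - singular" "p = (\<lambda>x. Reg (orb x))"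
    | k c j where "c \<in> centres k" "V = exc_dom \<epsilon>" "p = exc_param k c j"
  using assms unfolding joyce_family_def by blast

lemma regular_in_family: "(- singular, \<lambda>x. Reg (orb x)) \<in> joyce_family \<epsilon>"
  by (simp add: joyce_family_def)

lemma exc_in_family: "c \<in> centres k \<Longrightarrow> (exc_dom \<epsilon>, exc_param k c j) \<in> joyce_family \<epsilon>"
  unfolding joyce_family_def by blast

lemma finite_centres: "finite (centres k)"
proof -
  have *: "finite {f a b | a b. a \<in> half_set \<and> b \<in> half_set}" for f :: "real \<Rightarrow> real \<Rightarrow> real^7"
  proof -
    have "{f a b | a b. a \<in> half_set \<and> b \<in> half_set} = (\<lambda>(a, b). f a b) ` (half_set \<times> half_set)" by auto
    then show ?thesis by (simp add: half_set_def)
  qed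
  show ?thesis by (cases k) (simp_all only: centres_alt *)
qed

lemma finite_invol: "finite (UNIV :: invol set)"
proof -
  have "(UNIV :: invol set) = {By_alpha, By_beta, By_gamma}" using invol.exhaust by auto
  then show ?thesis by (metis finite.emptyI finite_insert)
qed

lemma finite_exc: "finite (SIGMA k:UNIV. centres k \<times> (UNIV :: bool set))"
  using finite_invol finite_centres by (intro finite_SigmaI finite_cartesian_product) auto

lemma countable_joyce_family: "countable (joyce_family \<epsilon>)"
proof -
  have "joyce_family \<epsilon> \<subseteq> insert (- singular, \<lambda>x. Reg (orb x))
      ((\<lambda>(k, c, j). (exc_dom \<epsilon>, exc_param k c j)) ` (SIGMA k:UNIV. centres k \<times> UNIV))"
    unfolding joyce_family_def by force
  then show ?thesis using finite_exc
    by (meson countable_finite finite_imageI finite_insert finite_subset)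
qed

lemma regular_eq_exc:
  assumes "c \<in> centres k" "exc_coord y = (t, m, u)" "s\<^sup>2 = u"
  shows "Reg (orb x) = exc_param k c j y \<longleftrightarrow> u \<noteq> 0 \<and> sim x (tube k c t (pnt j m s))"
  using exc_param_eq[OF assms, of j] orb_eq_iff by auto

text \<open>The existential over s is a projection along a noncompact factor. Closedness survives
  because s^2 converges along the sequence: the roots stay bounded, and a subsequence of them
  converges to a root of the limit.\<close>

lemma closed_regular_exc:
  "closed {(x, y). \<exists>s. s\<^sup>2 = snd (snd (exc_coord y)) \<and>
      sim x (tube k c (fst (exc_coord y)) (pnt j (fst (snd (exc_coord y))) s))}" (is "closed ?C")
  unfolding closed_sequential_limits
proof (intro allI impI, elim conjE)
  fix w l assume w: "\<forall>n. w n \<in> ?C" and lim: "w \<longlonglongrightarrow> l"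
  define T where "T = (\<lambda>(x::real^7, y, s). (x, tube k c (fst (exc_coord y)) (pnt j (fst (snd (exc_coord y))) s)))"
  have T: "continuous_on UNIV T"
  proof -
    have ec: "continuous_on UNIV (\<lambda>z :: (real^7) \<times> (real^7) \<times> complex. exc_coord (fst (snd z)))"
      by (rule continuous_on_compose2[OF linear_continuous_on[OF bounded_linear_exc_coord, of UNIV]])
         (auto intro!: continuous_intros)
    have p: "continuous_on UNIV (\<lambda>z :: (real^7) \<times> (real^7) \<times> complex. pnt j (fst (snd (exc_coord (fst (snd z))))) (snd (snd z)))"
      unfolding pnt_def by (cases j) (auto intro!: continuous_intros ec)
    have "continuous_on UNIV (\<lambda>z :: (real^7) \<times> (real^7) \<times> complex. (\<lambda>(t, z). tube k 0 t z) (fst (exc_coord (fst (snd z))), pnt j (fst (snd (exc_coord (fst (snd z))))) (snd (snd z))) + c)"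
      by (intro continuous_intros bounded_linear.continuous_on[OF bounded_linear_tube] ec p)
    then have "continuous_on UNIV (\<lambda>z :: (real^7) \<times> (real^7) \<times> complex. tube k c (fst (exc_coord (fst (snd z)))) (pnt j (fst (snd (exc_coord (fst (snd z))))) (snd (snd z))))"
      by (simp add: tube_centre[of k c])
    then show ?thesis unfolding T_def case_prod_unfold by (intro continuous_intros)
  qed
  obtain s where s: "\<And>n. (s n)\<^sup>2 = snd (snd (exc_coord (snd (w n))))" "\<And>n. T (fst (w n), snd (w n), s n) \<in> {(x, y). sim x y}"
  proof -
    have "\<forall>n. \<exists>s. s\<^sup>2 = snd (snd (exc_coord (snd (w n)))) \<and> T (fst (w n), snd (w n), s) \<in> {(x, y). sim x y}"
      using w by (auto simp: T_def case_prod_unfold)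
    then show ?thesis using that by metis
  qed
  have u: "(\<lambda>n. snd (snd (exc_coord (snd (w n))))) \<longlonglongrightarrow> snd (snd (exc_coord (snd l)))"
    by (intro tendsto_intros bounded_linear.tendsto[OF bounded_linear_exc_coord] lim)
  then have "bounded (range (\<lambda>n. (s n)\<^sup>2))" unfolding s by (rule convergent_imp_bounded)
  then obtain B where B: "cmod ((s n)\<^sup>2) \<le> B" for n unfolding bounded_iff by auto
  have "cmod (s n) \<le> B + 1" for n
  proof (rule ccontr)
    assume "\<not> cmod (s n) \<le> B + 1"
    then have "cmod (s n) > B + 1" by simp
    moreover have "0 \<le> B" using B[of 0] norm_ge_zero order_trans by blast
    ultimately have "cmod (s n) * 1 \<le> cmod (s n) * cmod (s n)" by (intro mult_left_mono) auto
    then have "cmod (s n) \<le> cmod ((s n)\<^sup>2)" by (simp add: norm_mult power2_eq_square)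
    then show False using B[of n] \<open>cmod (s n) > B + 1\<close> by linarith
  qed
  then have "bounded (range s)" unfolding bounded_iff by auto
  then obtain r s' where r: "strict_mono r" "(s \<circ> r) \<longlonglongrightarrow> s'"
    using bounded_imp_convergent_subsequence by blast
  have wr: "(\<lambda>n. w (r n)) \<longlonglongrightarrow> l" using LIMSEQ_subseq_LIMSEQ[OF lim r(1)] by (simp add: o_def)
  have sr: "(\<lambda>n. s (r n)) \<longlonglongrightarrow> s'" using r(2) by (simp add: o_def)
  have "(\<lambda>n. (s (r n))\<^sup>2) \<longlonglongrightarrow> s'\<^sup>2" by (intro tendsto_intros sr)
  moreover have "(\<lambda>n. (s (r n))\<^sup>2) \<longlonglongrightarrow> snd (snd (exc_coord (snd l)))"
    using LIMSEQ_subseq_LIMSEQ[OF u r(1)] by (simp add: o_def s)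
  ultimately have "s'\<^sup>2 = snd (snd (exc_coord (snd l)))" by (rule LIMSEQ_unique)
  moreover have "(\<lambda>n. T (fst (w (r n)), snd (w (r n)), s (r n))) \<longlonglongrightarrow> T (fst l, snd l, s')"
    by (rule continuous_on_tendsto_compose[OF T]) (intro tendsto_intros wr sr, auto)
  then have "T (fst l, snd l, s') \<in> {(x, y). sim x y}"
    by (rule closed_sequentially[OF closed_sim s(2)])
  ultimately show "l \<in> ?C" by (auto simp: T_def case_prod_unfold)
qed

lemma closed_complex_rel: "closed {z. f z = g z}"
  if "continuous_on UNIV f" "continuous_on UNIV g" for f g :: "'a::topological_space \<Rightarrow> complex"
  using that by (rule closed_Collect_eq)

lemma closed_exc_exc:
  "closed {(y, y'). fst (exc_coord y') - fst (exc_coord y) \<in> int_lattice \<and>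
     eh_param j (snd (exc_coord y)) = eh_param j' (snd (exc_coord y'))}"
proof -
  let ?m = "\<lambda>y. fst (snd (exc_coord y))" and ?u = "\<lambda>y. snd (snd (exc_coord y))"
  have cont: "continuous_on UNIV (\<lambda>z. fst (exc_coord (h z)))" "continuous_on UNIV (\<lambda>z. ?m (h z))"
    "continuous_on UNIV (\<lambda>z. ?u (h z))" if "continuous_on UNIV h" for h :: "(real^7) \<times> (real^7) \<Rightarrow> real^7"
    using continuous_on_compose2[OF continuous_exc_coord(1)[of UNIV] that]
      continuous_on_compose2[OF continuous_exc_coord(2)[of UNIV] that]
      continuous_on_compose2[OF continuous_exc_coord(3)[of UNIV] that] by auto
  note C = cont[OF continuous_on_fst[OF continuous_on_id]] cont[OF continuous_on_snd[OF continuous_on_id]]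
  have L: "closed {z. fst (exc_coord (snd z)) - fst (exc_coord (fst z)) \<in> int_lattice}"
  proof -
    have "{z. fst (exc_coord (snd z)) - fst (exc_coord (fst z)) \<in> int_lattice}
       = (\<Inter>i. {z. fst (exc_coord (snd z)) $ i - fst (exc_coord (fst z)) $ i \<in> \<int>})"
      by (auto simp: int_lattice_def)
    also have "closed \<dots>" by (intro closed_INT ballI closed_coord_Ints continuous_intros C)
    finally show ?thesis .
  qed
  have eh: "eh_param j (snd (exc_coord y)) = eh_param j' (snd (exc_coord y')) \<longleftrightarrow>
     (if j = j' then ?m y = ?m y' \<and> ?u y = ?u y' else ?m y * ?m y' = 1 \<and> ?u y' = (?m y)\<^sup>2 * ?u y)" for y y'
    using eh_param_eq_iff[of j "?m y" "?u y" j' "?m y'" "?u y'"] by simp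
  show ?thesis
  proof (cases "j = j'")
    case True
    have "{(y, y'). fst (exc_coord y') - fst (exc_coord y) \<in> int_lattice \<and>
       eh_param j (snd (exc_coord y)) = eh_param j' (snd (exc_coord y'))}
      = {z. fst (exc_coord (snd z)) - fst (exc_coord (fst z)) \<in> int_lattice}
        \<inter> {z. ?m (fst z) = ?m (snd z)} \<inter> {z. ?u (fst z) = ?u (snd z)}"
      unfolding eh using True by auto
    also have "closed \<dots>" by (intro closed_Int L closed_complex_rel C)
    finally show ?thesis .
  next
    case False
    have "{(y, y'). fst (exc_coord y') - fst (exc_coord y) \<in> int_lattice \<and>
       eh_param j (snd (exc_coord y)) = eh_param j' (snd (exc_coord y'))}
      = {z. fst (exc_coord (snd z)) - fst (exc_coord (fst z)) \<in> int_lattice}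
        \<inter> {z. ?m (fst z) * ?m (snd z) = 1} \<inter> {z. ?u (snd z) = (?m (fst z))\<^sup>2 * ?u (fst z)}"
      unfolding eh using False by auto
    also have "closed \<dots>" by (intro closed_Int L closed_complex_rel continuous_intros C)
    finally show ?thesis .
  qed
qed

lemma param_family_joyce:
  assumes eps: "0 < \<epsilon>" "\<epsilon> \<le> 1/8" shows "param_family (joyce_family \<epsilon>)"
proof
  show "countable (joyce_family \<epsilon>)" by (rule countable_joyce_family)
next
  fix V p assume "(V, p) \<in> joyce_family \<epsilon>"
  then show "open V" by (rule joyce_family_cases) (use closed_singular open_exc_dom in auto)
next
  fix V p x assume V: "(V, p) \<in> joyce_family \<epsilon>" and x: "x \<in> V"
  from V show "\<exists>N. open N \<and> x \<in> N \<and> N \<subseteq> V \<and> inj_on p N"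
  proof (cases rule: joyce_family_cases)
    case 1
    then obtain N where N: "open N" "x \<in> N" "\<forall>y\<in>N. \<forall>z\<in>N. sim y z \<longrightarrow> y = z"
      using sim_locally_trivial[of x] x by auto
    then have "inj_on p (N \<inter> - singular)" unfolding 1 inj_on_def by (simp add: orb_eq_iff)
    then show ?thesis using N 1 x closed_singular by (intro exI[of _ "N \<inter> - singular"]) auto
  next
    case (2 k c j)
    \<comment> \<open>Equal points have the same m and u, and torus coordinates differing by
      integers; in a ball of radius 1/2 these integers are 0.\<close>
    have "inj_on p (exc_dom \<epsilon> \<inter> ball x (1/2))"
    proof (rule inj_onI)
      fix y y' assume y: "y \<in> exc_dom \<epsilon> \<inter> ball x (1/2)" "y' \<in> exc_dom \<epsilon> \<inter> ball x (1/2)" and eq: "p y = p y'"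
      obtain t m u where c: "exc_coord y = (t, m, u)" using prod_cases3 by blast
      obtain t' m' u' where c': "exc_coord y' = (t', m', u')" using prod_cases3 by blast
      have *: "t' - t \<in> int_lattice" "m = m'" "u = u'"
        using exc_param_eqD[OF eps 2(1) 2(1) _ c _ c', of j j] y eq 2 by (auto simp: eh_param_eq_iff)
      have "norm (y' - y) < 1"
        using y dist_triangle_half_r[of x y' 1 y] by (auto simp: dist_norm norm_minus_commute)
      then have small: "\<bar>y' $ i - y $ i\<bar> < 1" for i using component_le_norm_cart[of "y' - y" i] by simp
      have t: "t $ 1 = y $ 1" "t $ 2 = y $ 2" "t $ 3 = y $ 3" "t' $ 1 = y' $ 1" "t' $ 2 = y' $ 2" "t' $ 3 = y' $ 3"
        using c c' by (auto simp: exc_coord_def)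
      then have "t' $ 1 = t $ 1" "t' $ 2 = t $ 2" "t' $ 3 = t $ 3"
        using *(1) Ints_small[OF _ small[of 1]] Ints_small[OF _ small[of 2]] Ints_small[OF _ small[of 3]]
        unfolding lattice_3 by simp_all
      then have "t = t'" by (simp add: vec_eq_iff forall_3)
      then have "exc_coord y = exc_coord y'" using c c' * by simp
      then show "y = y'" by (metis exc_point_coord)
    qed
    then show ?thesis using 2 x open_exc_dom by (intro exI[of _ "exc_dom \<epsilon> \<inter> ball x (1/2)"]) auto
  qed
next
  fix V p W q x y
  assume V: "(V, p) \<in> joyce_family \<epsilon>" and W: "(W, q) \<in> joyce_family \<epsilon>" and xy: "x \<in> V" "y \<in> W" "p x = q y"
  have op: "open (- singular)" using closed_singular by auto
  from V show "smooth_lift V p W q (\<lambda>a. a) x y"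
  proof (cases rule: joyce_family_cases)
    case 1
    note p = 1
    from W show ?thesis
    proof (cases rule: joyce_family_cases)
      case 1
      have "sim x y" using xy by (simp add: p 1 orb_eq_iff)
      then show ?thesis unfolding p 1 by (rule regular_lift) (use op xy p 1 in auto)
    next
      case (2 k c j)
      obtain t m u where c: "exc_coord y = (t, m, u)" using prod_cases3 by blast
      obtain s where s: "s\<^sup>2 = u" using power2_csqrt by blast
      have u: "u \<noteq> 0" "sim x (tube k c t (pnt j m s))"
        using xy(3) regular_eq_exc[OF 2(1) c s, of x j] p 2 by auto
      have y: "y \<in> exc_dom \<epsilon>" using xy 2 by simp
      \<comment> \<open>The lift is composed of two: a group element carries x to the point of the
        tube with parameters y, and the tube coordinates carry that point to y.\<close>
      have L: "smooth_lift (- singular) (\<lambda>x. Reg (orb x)) (exc_dom \<epsilon>) (exc_param k c j) (\<lambda>a. a) (tube k c t (pnt j m s)) y"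
        by (rule regular_to_exc[OF 2(1) eps y c s u(1)])
      have "tube k c t (pnt j m s) \<notin> singular" using singular_sim[OF sim_sym[OF u(2)]] xy p by auto
      then have R: "smooth_lift (- singular) (\<lambda>x. Reg (orb x)) (- singular) (\<lambda>x. Reg (orb x)) (\<lambda>a. a) x (tube k c t (pnt j m s))"
        using regular_lift[OF u(2) op op] xy p by auto
      show ?thesis unfolding p 2 using smooth_lift_compose[OF R L op op] .
    qed
  next
    case (2 k c j)
    note p = 2
    obtain t m u where c: "exc_coord x = (t, m, u)" using prod_cases3 by blast
    obtain s where s: "s\<^sup>2 = u" using power2_csqrt by blast
    have x: "x \<in> exc_dom \<epsilon>" using xy p by simp
    from W show ?thesis
    proof (cases rule: joyce_family_cases)
      case 1
      have u: "u \<noteq> 0" "sim y (tube k c t (pnt j m s))"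
        using xy(3) regular_eq_exc[OF p(1) c s, of y j] p 1 by auto
      have L: "smooth_lift (exc_dom \<epsilon>) (exc_param k c j) (- singular) (\<lambda>x. Reg (orb x)) (\<lambda>a. a) x (tube k c t (pnt j m s))"
        by (rule exc_to_regular[OF p(1) eps x c s u(1)])
      have "tube k c t (pnt j m s) \<notin> singular" using singular_sim[OF sim_sym[OF u(2)]] xy 1 by auto
      then have R: "smooth_lift (- singular) (\<lambda>x. Reg (orb x)) (- singular) (\<lambda>x. Reg (orb x)) (\<lambda>a. a) (tube k c t (pnt j m s)) y"
        using regular_lift[OF sim_sym[OF u(2)] op op] xy 1 by auto
      show ?thesis unfolding p 1 using smooth_lift_compose[OF L R op open_exc_dom] .
    next
      case (2 k' c' j')
      obtain t' m' u' where c': "exc_coord y = (t', m', u')" using prod_cases3 by blast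
      have y: "y \<in> exc_dom \<epsilon>" using xy 2 by simp
      have *: "k = k' \<and> c = c' \<and> t' - t \<in> int_lattice \<and> eh_param j (m, u) = eh_param j' (m', u')"
        by (rule exc_param_eqD[OF eps p(1) 2(1) x c y c']) (use xy p 2 in simp)
      show ?thesis unfolding p(2,3) 2(2,3)
        using exc_to_exc[OF p(1) x c y c', of j j'] * by blast
    qed
  qed
next
  fix V p W q
  assume V: "(V, p) \<in> joyce_family \<epsilon>" and W: "(W, q) \<in> joyce_family \<epsilon>"
  \<comment> \<open>For nonsingular x the condition that u be nonzero is automatic, since the tube
    point over u = 0 is singular. Dropping it turns the relation into the closed one of
    \<open>closed_regular_exc\<close>.\<close>
  have RE: "Reg (orb x) = exc_param k c j y \<longleftrightarrow> (\<exists>s. s\<^sup>2 = snd (snd (exc_coord y)) \<and>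
      sim x (tube k c (fst (exc_coord y)) (pnt j (fst (snd (exc_coord y))) s)))"
    if "x \<notin> singular" "c \<in> centres k" for x y k c j
  proof
    obtain t m u where c: "exc_coord y = (t, m, u)" using prod_cases3 by blast
    {
      assume "Reg (orb x) = exc_param k c j y"
      moreover obtain s where "s\<^sup>2 = u" using power2_csqrt by blast
      ultimately show "\<exists>s. s\<^sup>2 = snd (snd (exc_coord y)) \<and>
        sim x (tube k c (fst (exc_coord y)) (pnt j (fst (snd (exc_coord y))) s))"
        using regular_eq_exc[OF that(2) c, of s x j] c by auto
    }
    assume "\<exists>s. s\<^sup>2 = snd (snd (exc_coord y)) \<and>
        sim x (tube k c (fst (exc_coord y)) (pnt j (fst (snd (exc_coord y))) s))"
    then obtain s where s: "s\<^sup>2 = u" "sim x (tube k c t (pnt j m s))" using c by auto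
    moreover have "u \<noteq> 0"
    proof
      assume "u = 0"
      then have "pnt j m s = 0" using s pnt_zero by auto
      then show False
        using s(2) singular_sim[OF sim_sym[OF s(2)]] tube_zero_singular[OF that(2)] that(1) by simp
    qed
    ultimately show "Reg (orb x) = exc_param k c j y" using regular_eq_exc[OF that(2) c s(1)] by simp
  qed
  have ER: "exc_param k c j y = Reg (orb x) \<longleftrightarrow> (\<exists>s. s\<^sup>2 = snd (snd (exc_coord y)) \<and>
      sim x (tube k c (fst (exc_coord y)) (pnt j (fst (snd (exc_coord y))) s)))"
    if "x \<notin> singular" "c \<in> centres k" for x y k c j
    by (subst eq_commute) (rule RE[OF that])
  from V show "closedin (top_of_set (V \<times> W)) {(x, y). x \<in> V \<and> y \<in> W \<and> p x = q y}"
  proof (cases rule: joyce_family_cases)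
    case 1
    note p = 1
    from W show ?thesis
    proof (cases rule: joyce_family_cases)
      case 1
      have "{(x, y). x \<in> V \<and> y \<in> W \<and> p x = q y} = (V \<times> W) \<inter> {(x, y). sim x y}"
        by (auto simp: p 1 orb_eq_iff)
      then show ?thesis using closed_sim by (auto intro: closedin_closed_Int)
    next
      case (2 k c j)
      have "{(x, y). x \<in> V \<and> y \<in> W \<and> p x = q y} = (V \<times> W) \<inter>
        {(x, y). \<exists>s. s\<^sup>2 = snd (snd (exc_coord y)) \<and>
          sim x (tube k c (fst (exc_coord y)) (pnt j (fst (snd (exc_coord y))) s))}"
        using RE[OF _ 2(1), of _ j] unfolding p 2(2,3) by auto
      then show ?thesis by (simp only: closedin_closed_Int closed_regular_exc)
    qed
  next
    case (2 k c j)
    note p = 2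
    from W show ?thesis
    proof (cases rule: joyce_family_cases)
      case 1
      let ?C = "{(x, y). \<exists>s. s\<^sup>2 = snd (snd (exc_coord y)) \<and>
          sim x (tube k c (fst (exc_coord y)) (pnt j (fst (snd (exc_coord y))) s))}"
      have "closed ((\<lambda>(x, y). (y, x)) -` ?C)"
        by (rule closed_vimage[OF closed_regular_exc]) (auto simp: case_prod_unfold intro!: continuous_intros)
      moreover have "{(x, y). x \<in> V \<and> y \<in> W \<and> p x = q y} = (V \<times> W) \<inter> ((\<lambda>(x, y). (y, x)) -` ?C)"
        using ER[OF _ p(1), of _ j] unfolding p(2,3) 1 by auto
      ultimately show ?thesis by (simp only: closedin_closed_Int)
    next
      case (2 k' c' j')
      show ?thesis
      proof (cases "k = k' \<and> c = c'")
        case True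
        have E: "exc_param k c j y = exc_param k c j' y' \<longleftrightarrow>
            fst (exc_coord y') - fst (exc_coord y) \<in> int_lattice \<and>
            eh_param j (snd (exc_coord y)) = eh_param j' (snd (exc_coord y'))"
          if y: "y \<in> exc_dom \<epsilon>" "y' \<in> exc_dom \<epsilon>" for y y'
        proof -
          obtain t m u where ec: "exc_coord y = (t, m, u)" using prod_cases3 by blast
          obtain t' m' u' where ec': "exc_coord y' = (t', m', u')" using prod_cases3 by blast
          show ?thesis
            unfolding ec ec' fst_conv snd_conv
            using exc_param_eqD[OF eps p(1) p(1) y(1) ec y(2) ec', of j j']
              exc_param_cong[OF ec ec', of j j' k c] by blast
        qed
        have "{(x, y). x \<in> V \<and> y \<in> W \<and> p x = q y} = (V \<times> W) \<inter>
          {(y, y'). fst (exc_coord y') - fst (exc_coord y) \<in> int_lattice \<and>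
           eh_param j (snd (exc_coord y)) = eh_param j' (snd (exc_coord y'))}"
          using E True unfolding p(2,3) 2(2,3) by auto
        then show ?thesis by (simp only: closedin_closed_Int closed_exc_exc)
      next
        case False
        have "\<not> (x \<in> V \<and> y \<in> W \<and> p x = q y)" for x y
        proof
          assume *: "x \<in> V \<and> y \<in> W \<and> p x = q y"
          obtain t m u where c: "exc_coord x = (t, m, u)" using prod_cases3 by blast
          obtain t' m' u' where c': "exc_coord y = (t', m', u')" using prod_cases3 by blast
          show False using exc_param_eqD[OF eps p(1) 2(1) _ c _ c', of j j'] * False unfolding p(2,3) 2(2,3) by blast
        qed
        then have "{(x, y). x \<in> V \<and> y \<in> W \<and> p x = q y} = {}" by blast
        then show ?thesis by (simp only: closedin_empty)
      qed
    qed
  qed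
qed

section \<open>Compactness of the resolution\<close>

lemma half_integer_cases: "2 * r \<in> \<int> \<Longrightarrow> r \<in> \<int> \<or> r - 1/2 \<in> \<int>" for r :: real
proof -
  assume "2 * r \<in> \<int>"
  then obtain n :: int where n: "2 * r = of_int n" by (auto elim: Ints_cases)
  show ?thesis
  proof (cases "even n")
    case True
    then obtain m where "n = 2 * m" by blast
    then have "r = of_int m" using n by simp
    then show ?thesis by simp
  next
    case False
    then obtain m where "n = 2 * m + 1" by (auto elim: oddE)
    then have "r - 1/2 = of_int m" using n by simp
    then show ?thesis by simp
  qed
qed

lemma half_set_representative: "2 * r \<in> \<int> \<Longrightarrow> \<exists>\<kappa>\<in>half_set. \<kappa> - r \<in> \<int>"
  using half_integer_cases[of r] Ints_minus[of r] Ints_minus[of "r - 1/2"] by (auto simp: half_set_def)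

lemma quarter_cases: "2 * r - 1/2 \<in> \<int> \<Longrightarrow> 1/4 - r \<in> \<int> \<or> 1/4 + r \<in> \<int>" for r :: real
proof -
  assume "2 * r - 1/2 \<in> \<int>"
  then have "2 * (r - 1/4) \<in> \<int>" by (simp add: algebra_simps)
  from half_integer_cases[OF this] show ?thesis
  proof
    assume "r - 1/4 \<in> \<int>"
    then have "- (r - 1/4) \<in> \<int>" by (rule Ints_minus)
    then show ?thesis by simp
  next
    assume "r - 1/4 - 1/2 \<in> \<int>"
    then have "(r - 1/4 - 1/2) + 1 \<in> \<int>" by (intro Ints_add) auto
    then show ?thesis by simp
  qed
qed

lemma sum_7: "sum f (UNIV :: 7 set) = f 1 + f 2 + f 3 + f 4 + f 5 + f 6 + f 7"
proof -
  have "(UNIV :: 7 set) = {1, 2, 3, 4, 5, 6, 7}" using exhaust_7 by auto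
  then show ?thesis unfolding \<open>UNIV = _\<close> by (simp add: add.assoc)
qed

lemma norm_untube: "norm (snd (untube k w)) \<le> norm w"
proof -
  have "(norm (snd (untube k w)))\<^sup>2 \<le> (norm w)\<^sup>2"
  proof -
    have "(norm w)\<^sup>2 = (w$1)\<^sup>2 + (w$2)\<^sup>2 + (w$3)\<^sup>2 + (w$4)\<^sup>2 + (w$5)\<^sup>2 + (w$6)\<^sup>2 + (w$7)\<^sup>2"
      unfolding power2_norm_eq_inner by (simp add: inner_vec_def sum_7 power2_eq_square)
    then show ?thesis by (cases k) (simp_all add: norm_prod_def cmod_power2)
  qed
  then show ?thesis by (rule power2_le_imp_le) simp
qed

text \<open>Every singular point can be moved onto one of the twelve chosen tori. For the first two
  kinds the power d of \<gamma> makes x_1 integral, then a power of \<beta> or \<alpha> normalises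
  x_2; lattice vectors bring the remaining fixed coordinates to 0 or 1/2.\<close>

lemma singular_standard:
  assumes "s \<in> singular"
  shows "\<exists>k. \<exists>c\<in>centres k. \<exists>a b d y. y - gact a b d s \<in> int_lattice \<and> snd (untube k (y - c)) = 0"
proof -
  have two: "2 * (sg7 a b d $ i * s $ i + hf7 b d $ i) \<in> \<int>" if "2 * s $ i \<in> \<int>" for a b d i
    by (rule two_Ints_transfer(1)[OF _ sg7_cases[of a b d i] hf7_cases[of b d i] that]) simp
  have first: "\<exists>d. \<forall>a b. sg7 a b d $ 1 * s $ 1 + hf7 b d $ 1 \<in> \<int>" if "2 * s $ 1 \<in> \<int>"
  proof -
    from half_integer_cases[OF that] show ?thesis
    proof
      assume "s $ 1 \<in> \<int>"
      then show ?thesis by (intro exI[of _ False]) (auto simp: sg7_def hf7_def sgb_def hfb_def)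
    next
      assume h: "s $ 1 - 1/2 \<in> \<int>"
      then have "1/2 + s $ 1 \<in> \<int>" "1/2 - s $ 1 \<in> \<int>"
        using Ints_add[OF h Ints_1] Ints_minus[OF h] by (simp_all add: algebra_simps)
      then show ?thesis by (intro exI[of _ True]) (auto simp: sg7_def hf7_def sgb_def hfb_def)
    qed
  qed
  from assms consider
    "2 * s$1 \<in> \<int>" "2 * s$2 \<in> \<int>" "2 * s$3 \<in> \<int>" "2 * s$4 \<in> \<int>" |
    "2 * s$1 \<in> \<int>" "2 * s$2 - 1/2 \<in> \<int>" "2 * s$5 \<in> \<int>" "2 * s$6 \<in> \<int>" |
    "2 * s$1 - 1/2 \<in> \<int>" "2 * s$3 - 1/2 \<in> \<int>" "2 * s$5 \<in> \<int>" "2 * s$7 \<in> \<int>"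
    unfolding singular_coord by blast
  then show ?thesis
  proof cases
    case 1
    obtain d where d: "\<forall>a b. sg7 a b d $ 1 * s $ 1 + hf7 b d $ 1 \<in> \<int>" using first[OF 1(1)] by blast
    obtain b where b: "sg7 False b d $ 2 * s $ 2 + hf7 b d $ 2 \<in> \<int>"
    proof -
      from half_integer_cases[OF 1(2)] show ?thesis
      proof
        assume "s $ 2 \<in> \<int>"
        then show ?thesis by (intro that[of False]) (auto simp: sg7_def hf7_def sgb_def hfb_def)
      next
        assume h: "s $ 2 - 1/2 \<in> \<int>"
        then have "1/2 - s $ 2 \<in> \<int>" using Ints_minus[OF h] by simp
        then show ?thesis by (intro that[of True]) (auto simp: sg7_def hf7_def sgb_def hfb_def)
      qed
    qed
    let ?g = "gact False b d s"
    obtain p where p: "p \<in> half_set" "p - ?g $ 3 \<in> \<int>"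
      using half_set_representative[OF two[OF 1(3)], of False b d] by (auto simp: gact_def)
    obtain q where q: "q \<in> half_set" "q - ?g $ 4 \<in> \<int>"
      using half_set_representative[OF two[OF 1(4)], of False b d] by (auto simp: gact_def)
    let ?c = "vector [0, 0, p, q, 0, 0, 0] :: real^7"
    let ?y = "vector [0, 0, p, q, ?g$5, ?g$6, ?g$7] :: real^7"
    have "?c \<in> centres By_alpha" unfolding centres_alt using p q by blast
    moreover have "?g $ 1 \<in> \<int>" "?g $ 2 \<in> \<int>" using d b by (simp_all add: gact_def)
    then have "?y - ?g \<in> int_lattice" using p(2) q(2) by (simp add: lattice_7)
    moreover have "snd (untube By_alpha (?y - ?c)) = 0" by (simp add: zero_prod_def complex_eq_iff)
    ultimately show ?thesis by blast
  next
    case 2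
    obtain d where d: "\<forall>a b. sg7 a b d $ 1 * s $ 1 + hf7 b d $ 1 \<in> \<int>" using first[OF 2(1)] by blast
    obtain a where a: "1/4 - (sg7 a False d $ 2 * s $ 2 + hf7 False d $ 2) \<in> \<int>"
    proof -
      from quarter_cases[OF 2(2)] show ?thesis
      proof
        assume "1/4 - s $ 2 \<in> \<int>"
        then show ?thesis by (intro that[of False]) (simp add: sg7_def hf7_def sgb_def hfb_def)
      next
        assume "1/4 + s $ 2 \<in> \<int>"
        then show ?thesis by (intro that[of True]) (simp add: sg7_def hf7_def sgb_def hfb_def)
      qed
    qed
    let ?g = "gact a False d s"
    obtain p where p: "p \<in> half_set" "p - ?g $ 5 \<in> \<int>"
      using half_set_representative[OF two[OF 2(3)], of a False d] by (auto simp: gact_def)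
    obtain q where q: "q \<in> half_set" "q - ?g $ 6 \<in> \<int>"
      using half_set_representative[OF two[OF 2(4)], of a False d] by (auto simp: gact_def)
    let ?c = "vector [0, 1/4, 0, 0, p, q, 0] :: real^7"
    let ?y = "vector [0, 1/4, ?g$3, ?g$4, p, q, ?g$7] :: real^7"
    have "?c \<in> centres By_beta" unfolding centres_alt using p q by blast
    moreover have "?g $ 1 \<in> \<int>" "1/4 - ?g $ 2 \<in> \<int>" using d a by (simp_all add: gact_def)
    then have "?y - ?g \<in> int_lattice" using p(2) q(2) by (simp add: lattice_7)
    moreover have "snd (untube By_beta (?y - ?c)) = 0" by (simp add: zero_prod_def complex_eq_iff)
    ultimately show ?thesis by blast
  next
    case 3
    obtain a where a: "1/4 - sgb a * s $ 3 \<in> \<int>"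
      using quarter_cases[OF 3(2)] that[of False] that[of True] by (auto simp: sgb_def)
    obtain e where e: "1/4 - sgb e * s $ 1 \<in> \<int>"
      using quarter_cases[OF 3(1)] that[of False] that[of True] by (auto simp: sgb_def)
    \<comment> \<open>Without \<gamma>, the sign on x_3 is that of a, and the sign on x_1 is the
      product of those of a and b; this b gives x_1 the wanted sign e.\<close>
    let ?b = "a \<noteq> e"
    let ?g = "gact a ?b False s"
    have g: "1/4 - ?g $ 1 \<in> \<int>" "1/4 - ?g $ 3 \<in> \<int>"
      using a e by (auto simp: gact_def sg7_def hf7_def sgb_def hfb_def split: if_splits)
    obtain p where p: "p \<in> half_set" "p - ?g $ 5 \<in> \<int>"
      using half_set_representative[OF two[OF 3(3)], of a ?b False] by (auto simp: gact_def)
    obtain q where q: "q \<in> half_set" "q - ?g $ 7 \<in> \<int>"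
      using half_set_representative[OF two[OF 3(4)], of a ?b False] by (auto simp: gact_def)
    let ?c = "vector [1/4, 0, 1/4, 0, p, 0, q] :: real^7"
    let ?y = "vector [1/4, ?g$2, 1/4, ?g$4, p, ?g$6, q] :: real^7"
    have "?c \<in> centres By_gamma" unfolding centres_alt using p q by blast
    moreover have "?y - ?g \<in> int_lattice" using p(2) q(2) g by (simp add: lattice_7)
    moreover have "snd (untube By_gamma (?y - ?c)) = 0" by (simp add: zero_prod_def complex_eq_iff)
    ultimately show ?thesis by blast
  qed
qed

text \<open>The group element that normalises s acts isometrically: it carries x - s to a vector w
  of the same length, whose normal part is no longer than w itself.\<close>

lemma near_singular:
  assumes "s \<in> singular"
  shows "\<exists>k. \<exists>c\<in>centres k. \<exists>t z. sim x (tube k c t z) \<and> norm z \<le> dist s x"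
proof -
  obtain k c a b d y where *: "c \<in> centres k" "y - gact a b d s \<in> int_lattice" "snd (untube k (y - c)) = 0"
    using singular_standard[OF assms] by blast
  define w where "w = (\<chi> i. sg7 a b d $ i * (x - s) $ i)"
  have "(w \<bullet> w) = (x - s) \<bullet> (x - s)"
    unfolding inner_vec_def
  proof (rule sum.cong[OF refl])
    fix i show "w $ i \<bullet> w $ i = (x - s) $ i \<bullet> (x - s) $ i"
      using sg7_cases[of a b d i] by (auto simp: w_def)
  qed
  then have "norm w = norm (x - s)" by (simp add: norm_eq_sqrt_inner)
  then have nw: "norm w = dist s x" by (simp add: dist_norm norm_minus_commute)
  have "(y + w) - gact a b d x = y - gact a b d s"
    by (simp add: gact_def w_def vec_eq_iff algebra_simps)
  then have "sim x (y + w)" unfolding sim_def using *(2) by metis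
  moreover have "tube k c (fst (untube k (y + w - c))) (snd (untube k (y + w - c))) = y + w"
    by (rule tube_untube)
  moreover have "untube k (y + w - c) = untube k (y - c) + untube k w"
    using bounded_linear.axioms(1)[OF bounded_linear_untube] linear_add[of "untube k" "y - c" w]
    by (simp add: algebra_simps linear_def)
  then have "norm (snd (untube k (y + w - c))) \<le> dist s x"
    using *(3) norm_untube[of k w] nw by simp
  ultimately show ?thesis using *(1) by metis
qed

text \<open>The two charts with slope at most 1 in absolute value already cover the projective line,
  and the unit cube covers the torus; the result is compact, unlike \<open>exc_dom\<close>.\<close>

definition exc_core :: "real \<Rightarrow> (real^7) set" where
  "exc_core \<delta> = {y. fst (exc_coord y) \<in> cbox 0 1 \<and> cmod (fst (snd (exc_coord y))) \<le> 1 \<and>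
                     cmod (snd (snd (exc_coord y))) \<le> \<delta>\<^sup>2}"

lemma compact_exc_core: "compact (exc_core \<delta>)"
proof -
  have "exc_core \<delta> = exc_point ` (cbox 0 1 \<times> cball 0 1 \<times> cball 0 (\<delta>\<^sup>2))"
  proof (intro set_eqI iffI)
    fix y assume "y \<in> exc_core \<delta>"
    then have "exc_coord y \<in> cbox 0 1 \<times> cball 0 1 \<times> cball 0 (\<delta>\<^sup>2)"
      by (auto simp: exc_core_def mem_Times_iff)
    then show "y \<in> exc_point ` (cbox 0 1 \<times> cball 0 1 \<times> cball 0 (\<delta>\<^sup>2))"
      by (metis exc_point_coord image_eqI)
  qed (auto simp: exc_core_def)
  then show ?thesis
    by (simp add: compact_continuous_image linear_continuous_on[OF bounded_linear_exc_point] compact_Times)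
qed

text \<open>Slopes at most 1 bound the factor in the radius condition by 2, and twice the square of
  \<epsilon>/2 is still below the square of \<epsilon>. This is where the half comes from.\<close>

lemma exc_core_dom: assumes "0 < \<epsilon>" shows "exc_core (\<epsilon> / 2) \<subseteq> exc_dom \<epsilon>"
proof
  fix y assume y: "y \<in> exc_core (\<epsilon> / 2)"
  obtain t m u where c: "exc_coord y = (t, m, u)" using prod_cases3 by blast
  have "cmod u * (1 + (cmod m)\<^sup>2) \<le> (\<epsilon> / 2)\<^sup>2 * (1 + 1)"
    using y c by (intro mult_mono add_mono power_le_one) (auto simp: exc_core_def)
  also have "\<dots> < \<epsilon>\<^sup>2" using assms by (simp add: power2_eq_square)
  finally show "y \<in> exc_dom \<epsilon>" by (simp add: exc_dom_def c)
qed

lemma lattice_box: "\<exists>n\<in>int_lattice. x + n \<in> cbox 0 (1::real^'n)"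
  by (intro bexI[of _ "\<chi> i. - of_int \<lfloor>x $ i\<rfloor>"])
     (auto simp: int_lattice_def mem_box_cart intro: of_int_floor_le, linarith)

lemma exc_in_core:
  assumes c: "c \<in> centres k" and y: "exc_coord y = (t, m, u)" and m: "cmod m \<le> 1" "cmod u \<le> \<delta>\<^sup>2"
  shows "\<exists>y'\<in>exc_core \<delta>. exc_param k c j y = exc_param k c j y'"
proof -
  obtain n where n: "n \<in> int_lattice" "t + n \<in> cbox 0 1" using lattice_box by blast
  have "exc_param k c j y = exc_param k c j (exc_point (t + n, m, u))"
    by (rule exc_param_cong[OF y exc_coord_point]) (use n in auto)
  moreover have "exc_point (t + n, m, u) \<in> exc_core \<delta>" using n m by (simp add: exc_core_def)
  ultimately show ?thesis by blast
qed

text \<open>The larger of the two components is used as s; the slope is then at most 1 in absolute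
  value, and \<open>cmod s\<close> is at most the norm of z.\<close>

lemma tube_in_core:
  assumes c: "c \<in> centres k" and z: "z \<noteq> 0" "norm z < \<delta>"
  shows "\<exists>j. \<exists>y\<in>exc_core \<delta>. Reg (orb (tube k c t z)) = exc_param k c j y"
proof -
  obtain z1 z2 where zz: "z = (z1, z2)" by force
  define j where "j = (cmod z1 < cmod z2)"
  define s where "s = (if j then z2 else z1)"
  define m where "m = (if j then z1 / z2 else z2 / z1)"
  have s0: "s \<noteq> 0"
  proof
    assume "s = 0"
    then have "z1 = 0 \<and> z2 = 0" by (auto simp: s_def j_def split: if_splits)
    then show False using z zz by (simp add: zero_prod_def)
  qed
  have pz: "pnt j m s = z" using s0 unfolding s_def by (cases j) (simp_all add: pnt_def m_def zz)
  have m1: "cmod m \<le> 1"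
    using s0 by (auto simp: m_def s_def j_def norm_divide divide_le_eq split: if_splits)
  have "cmod s \<le> norm z" using norm_fst_le[of z1 z2] norm_snd_le[of z2 z1] by (auto simp: s_def zz)
  then have "cmod s < \<delta>" using z by simp
  then have "(cmod s)\<^sup>2 \<le> \<delta>\<^sup>2" by (intro power_mono) auto
  then have u: "cmod (s\<^sup>2) \<le> \<delta>\<^sup>2" by (simp add: norm_power)
  have "exc_param k c j (exc_point (t, m, s\<^sup>2)) = Reg (orb (tube k c t z))"
    using exc_param_eq[OF c exc_coord_point, of s "s\<^sup>2" j t m] s0 pz by simp
  then show ?thesis using exc_in_core[OF c exc_coord_point m1 u, of j t] by metis
qed

text \<open>Finitely many compact images cover: that of the unit cube with balls around the singular
  set removed, and those of the cores. A point within \<delta> of the singular set is equivalent to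
  one in a tube of radius \<delta>, hence lies in a core.\<close>

lemma closed_manifold_joyce:
  assumes eps: "0 < \<epsilon>" "\<epsilon> \<le> 1/8" shows "closed_manifold (joyce_manifold \<epsilon>)"
proof -
  interpret param_family "joyce_family \<epsilon>" by (rule param_family_joyce[OF eps])
  let ?M = "gen_atlas (joyce_family \<epsilon>)"
  define \<delta> where "\<delta> = \<epsilon> / 2"
  have \<delta>: "\<delta> > 0" using eps by (simp add: \<delta>_def)
  define K where "K = cbox 0 1 - (\<Union>s\<in>singular. ball s \<delta>)"
  have cK: "compact K" unfolding K_def by (intro compact_diff compact_cbox open_UN) auto
  have KS: "K \<subseteq> - singular" using \<delta> by (auto simp: K_def)
  define B where "B = (\<lambda>x. Reg (orb x)) ` K \<union>
      (\<Union>(k, c, j)\<in>(SIGMA k:UNIV. centres k \<times> UNIV). exc_param k c j ` exc_core \<delta>)"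
  have "compactin (mtop ?M) B" unfolding B_def
  proof (intro compactin_Un compactin_Union[of "_ ` _"] compactin_image[OF regular_in_family cK KS])
    show "finite ((\<lambda>(k, c, j). exc_param k c j ` exc_core \<delta>) ` (SIGMA k:UNIV. centres k \<times> UNIV))"
      using finite_exc by blast
    fix S assume "S \<in> (\<lambda>(k, c, j). exc_param k c j ` exc_core \<delta>) ` (SIGMA k:UNIV. centres k \<times> UNIV)"
    then obtain k c j where "c \<in> centres k" "S = exc_param k c j ` exc_core \<delta>" by auto
    then show "compactin (mtop ?M) S"
      using compactin_image[OF exc_in_family compact_exc_core] exc_core_dom[OF eps(1)] by (auto simp: \<delta>_def)
  qed
  moreover have reg: "Reg (orb x) \<in> B" if x: "x \<notin> singular" for x
  proof -
    obtain n where n: "n \<in> int_lattice" "x + n \<in> cbox 0 1" using lattice_box by blast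
    have xn: "sim x (x + n)" using n by (intro sim_lattice) simp
    show ?thesis
    proof (cases "x + n \<in> K")
      case True
      moreover have "orb x = orb (x + n)" using xn orb_eq_iff by blast
      ultimately show ?thesis unfolding B_def by (intro UnI1 image_eqI[of _ _ "x + n"]) simp_all
    next
      case False
      then obtain s where s: "s \<in> singular" "dist s (x + n) < \<delta>" using n by (auto simp: K_def)
      obtain k c t z where *: "c \<in> centres k" "sim (x + n) (tube k c t z)" "norm z \<le> dist s (x + n)"
        using near_singular[OF s(1)] by blast
      have sim: "sim x (tube k c t z)" using sim_trans[OF xn *(2)] .
      have "z \<noteq> 0"
      proof
        assume "z = 0"
        then show False using singular_sim[OF sim_sym[OF sim]] tube_zero_singular[OF *(1)] x by simp
      qed
      moreover have "norm z < \<delta>" using * s by simp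
      ultimately obtain j y where "y \<in> exc_core \<delta>" "Reg (orb (tube k c t z)) = exc_param k c j y"
        using tube_in_core[OF *(1)] by blast
      moreover have "orb x = orb (tube k c t z)" using sim orb_eq_iff by blast
      ultimately have "Reg (orb x) = exc_param k c j y" "y \<in> exc_core \<delta>" by simp_all
      then show ?thesis unfolding B_def using *(1) by (intro UnI2 UN_I[of "(k, c, j)"]) auto
    qed
  qed
  have "points ?M \<subseteq> B"
  proof
    fix a assume "a \<in> points ?M"
    then obtain V p x where V: "(V, p) \<in> joyce_family \<epsilon>" "x \<in> V" "a = p x" by (rule pointsE)
    from V(1) show "a \<in> B"
    proof (cases rule: joyce_family_cases)
      case 1
      then show ?thesis using reg V by auto
    next
      case (2 k c j)
      obtain t m u where c: "exc_coord x = (t, m, u)" using prod_cases3 by blast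
      obtain s where s: "s\<^sup>2 = u" using power2_csqrt by blast
      show ?thesis
      proof (cases "u = 0")
        case False
        have "norm (pnt j m s) < 1/8" using norm_pnt_dom[OF _ c s eps(1), of j] V 2 eps by auto
        moreover have "pnt j m s \<noteq> 0" using s False pnt_zero by auto
        ultimately have "tube k c t (pnt j m s) \<notin> singular" by (rule tube_nonsingular[OF 2(1)])
        then show ?thesis using reg exc_param_eq[OF 2(1) c s, of j] False V 2 by simp
      next
        case True
        have core: "exc_param k c j' y' \<in> B" if "y' \<in> exc_core \<delta>" for j' y'
          unfolding B_def using that 2(1) by (intro UnI2 UN_I[of "(k, c, j')"]) auto
        show ?thesis
        proof (cases "cmod m \<le> 1")
          case True
          then show ?thesis using exc_in_core[OF 2(1) c True, of \<delta> j] \<open>u = 0\<close> core V 2 by auto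
        next
          case False
          then have m0: "m \<noteq> 0" by auto
          \<comment> \<open>On the zero section a slope larger than 1 is replaced by its inverse in
            the other chart, while u = 0 is unchanged.\<close>
          have "exc_param k c j x = exc_param k c (\<not> j) (exc_point (t, inverse m, 0))"
            by (rule exc_param_cong[OF c exc_coord_point]) (use m0 \<open>u = 0\<close> in \<open>simp_all add: eh_param_eq_iff\<close>)
          moreover have "cmod (inverse m) \<le> 1" using False by (simp add: norm_inverse inverse_le_1_iff)
          ultimately show ?thesis
            using exc_in_core[OF 2(1) exc_coord_point, of "inverse m" 0 \<delta> "\<not> j" t] core V 2 by auto
        qed
      qed
    qed
  qed
  moreover have "B \<subseteq> points ?M" using compactin_subset_topspace[OF \<open>compactin (mtop ?M) B\<close>] by simp
  ultimately have "compact_space (mtop ?M)" unfolding compact_space_def by (metis subset_antisym topspace_gen)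
  then show ?thesis
    unfolding closed_manifold_def joyce_eq[OF eps(1)] using smooth_manifold_gen by blast
qed

section \<open>Circle actions on two open sets covering the resolution\<close>

definition dom0 :: "(real^7) set" where "dom0 = {x. x \<notin> singular \<and> \<bar>x$1\<bar> < 1/4}"
definition dom1 :: "(real^7) set" where "dom1 = {x. x \<notin> singular \<and> 0 < x$1 \<and> x$1 < 1/2}"
definition slab :: "(real^7) set" where "slab = {x. 0 < x$1 \<and> x$1 < 1/4}"

abbreviation reg0 :: "real^7 \<Rightarrow> mpoint \<times> nat" where "reg0 \<equiv> \<lambda>x. (Reg (orb x), 0)"

text \<open>The \<open>\<alpha>\<close>- and \<open>\<beta>\<close>-tori contain the \<open>x\<^sub>7\<close>-direction, as their third coordinate; the \<open>\<gamma>\<close>-tori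
  contain the \<open>x\<^sub>2\<close>-direction, as their first. The component \<open>0\<close> only serves to land in the
  type of total spaces.\<close>

definition flow0 :: "real \<Rightarrow> ((real^7) set \<times> (real^7 \<Rightarrow> mpoint \<times> nat) \<times> (real^7)) set" where
  "flow0 \<epsilon> = insert (dom0, reg0, axis 7 1)
     {(exc_dom \<epsilon>, \<lambda>y. (exc_param k c j y, 0), axis 3 1) | k c j. c \<in> centres k \<and> k \<noteq> By_gamma}"

definition flow1 :: "real \<Rightarrow> ((real^7) set \<times> (real^7 \<Rightarrow> mpoint \<times> nat) \<times> (real^7)) set" where
  "flow1 \<epsilon> = insert (dom1, reg0, axis 2 1)
     {(exc_dom \<epsilon>, \<lambda>y. (exc_param k c j y, 0), axis 1 1) | k c j. c \<in> centres k \<and> k = By_gamma}"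

lemma no_half_integer:
  "0 < r \<Longrightarrow> r < 1 \<Longrightarrow> (r::real) \<notin> \<int>" "-1 < r \<Longrightarrow> r < 0 \<Longrightarrow> r \<notin> \<int>"
  using Ints_small[of r] by auto

lemma slab_nonsingular: "x \<in> slab \<Longrightarrow> x \<notin> singular"
  using no_half_integer(1)[of "2 * x$1"] no_half_integer(2)[of "2 * x$1 - 1/2"]
  by (auto simp: slab_def singular_coord)

lemma slab_subset: "slab \<subseteq> dom0" "slab \<subseteq> dom1"
  using slab_nonsingular by (auto simp: dom0_def dom1_def slab_def)

lemma convex_slab: "convex slab"
proof -
  have "slab = {x. axis 1 1 \<bullet> x > 0} \<inter> {x. axis 1 1 \<bullet> x < 1/4}" by (auto simp: slab_def inner_axis' )
  then show ?thesis by (metis convex_Int convex_halfspace_gt convex_halfspace_lt)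
qed

lemma open_doms: "open dom0" "open dom1" "open slab"
proof -
  have e: "dom0 = - singular \<inter> {x. \<bar>x$1\<bar> < 1/4}" "dom1 = - singular \<inter> ({x. 0 < x$1} \<inter> {x. x$1 < 1/2})"
    "slab = {x. 0 < x$1} \<inter> {x. x$1 < 1/4}"
    by (auto simp: dom0_def dom1_def slab_def)
  show "open dom0" "open dom1" "open slab"
    unfolding e using closed_singular by (intro open_Int open_Collect_less continuous_intros; blast)+
qed

text \<open>The coordinate x_7 is constrained only at fixed points of \<gamma>, and these have x_1
  congruent to 1/4 modulo 1/2, outside the range considered.\<close>

lemma dom0_shift: "x \<in> dom0 \<Longrightarrow> x + s *\<^sub>R axis 7 1 \<in> dom0"
proof -
  assume x: "x \<in> dom0"
  then have "x$1 < 1/4" "- (1/4) < x$1" unfolding dom0_def mem_Collect_eq abs_less_iff by auto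
  then have "2 * x$1 - 1/2 \<notin> \<int>" by (intro no_half_integer(2)) auto
  then show ?thesis using x by (simp add: dom0_def singular_coord axis_def)
qed

text \<open>The coordinate x_2 is constrained only at fixed points of \<alpha> or \<beta>, where 2
  x_1 is an integer; this is impossible for x_1 strictly between 0 and 1/2.\<close>

lemma dom1_shift: "x \<in> dom1 \<Longrightarrow> x + s *\<^sub>R axis 2 1 \<in> dom1"
proof -
  assume x: "x \<in> dom1"
  then have "2 * x$1 \<notin> \<int>" using no_half_integer(1)[of "2 * x$1"] by (auto simp: dom1_def)
  then show ?thesis using x by (simp add: dom1_def singular_coord axis_def)
qed

lemma slab_shift: "x \<in> slab \<Longrightarrow> i \<noteq> 1 \<Longrightarrow> x + s *\<^sub>R axis i 1 \<in> slab"
  by (simp add: slab_def axis_def)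

text \<open>An element containing \<gamma> adds 1/2 to x_1 up to sign, and so carries the interval
  from -1/4 to 1/4 off itself modulo 1. Without \<gamma> the sign on x_7 is positive, so the
  x_7-translations descend.\<close>

lemma sim_dom0:
  fixes x y :: "real^7"
  assumes "\<bar>x$1\<bar> < 1/4" "\<bar>y$1\<bar> < 1/4" "y - gact a b c x \<in> int_lattice" shows "\<not> c"
proof
  assume c
  have "y$1 - (sg7 a b c $ 1 * x$1 + hf7 b c $ 1) \<in> \<int>" using assms(3) by (simp add: lattice_7 gact_def)
  moreover have "hf7 b c $ 1 = 1/2" using \<open>c\<close> by (simp add: hf7_def hfb_def)
  ultimately have "y$1 - (sg7 a b c $ 1 * x$1 + 1/2) \<in> \<int>" by simp
  moreover have "-1 < y$1 - (sg7 a b c $ 1 * x$1 + 1/2)" "y$1 - (sg7 a b c $ 1 * x$1 + 1/2) < 0"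
    using sg7_cases[of a b c 1] assms(1,2) by auto
  ultimately show False using no_half_integer(2) by blast
qed

text \<open>With exactly one of \<alpha>, \<beta> present, x_1 is either reversed without shift or
  shifted by 1/2 without reversal. Both move the interval from 0 to 1/2 off itself; what remains has
  positive sign on x_2.\<close>

lemma sim_dom1:
  fixes x y :: "real^7"
  assumes "0 < x$1" "x$1 < 1/2" "0 < y$1" "y$1 < 1/2" "y - gact a b c x \<in> int_lattice" shows "a = b"
proof (rule ccontr)
  assume "a \<noteq> b"
  have *: "y$1 - (sgb a * sgb b * sgb c * x$1 + hfb c) \<in> \<int>"
    using assms(5) by (simp add: lattice_7 gact_def sg7_def hf7_def)
  show False
  proof (cases c)
    case True
    then have "y$1 - (x$1 + 1/2) \<in> \<int>" using * \<open>a \<noteq> b\<close> by (cases a; cases b) (simp_all add: sgb_def hfb_def)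
    then show False using no_half_integer(2)[of "y$1 - (x$1 + 1/2)"] assms by simp
  next
    case False
    then have "y$1 + x$1 \<in> \<int>" using * \<open>a \<noteq> b\<close> by (cases a; cases b) (simp_all add: sgb_def hfb_def)
    then show False using no_half_integer(1)[of "y$1 + x$1"] assms by simp
  qed
qed

lemma sim_shift0:
  fixes x y :: "real^7"
  assumes "\<bar>x$1\<bar> < 1/4" "\<bar>y$1\<bar> < 1/4" "sim x y" shows "sim (x + s *\<^sub>R axis 7 1) (y + s *\<^sub>R axis 7 1)"
proof -
  obtain a b c where *: "y - gact a b c x \<in> int_lattice" using assms by (auto simp: sim_def)
  have c: "\<not> c" using sim_dom0[OF assms(1,2) *] .
  have "(y + s *\<^sub>R axis 7 1) - gact a b c (x + s *\<^sub>R axis 7 1) = y - gact a b c x"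
    using c by (simp add: gact_def vec_eq_iff forall_7 axis_def sg7_def sgb_def)
  then show ?thesis using * unfolding sim_def by metis
qed

lemma sim_shift1:
  fixes x y :: "real^7"
  assumes "0 < x$1" "x$1 < 1/2" "0 < y$1" "y$1 < 1/2" "sim x y"
  shows "sim (x + s *\<^sub>R axis 2 1) (y + s *\<^sub>R axis 2 1)"
proof -
  obtain a b c where *: "y - gact a b c x \<in> int_lattice" using assms by (auto simp: sim_def)
  have "a = b" using sim_dom1[OF assms(1-4) *] .
  then have "sg7 a b c $ 2 = 1" by (simp add: sg7_def sgb_def)
  then have "(y + s *\<^sub>R axis 2 1) - gact a b c (x + s *\<^sub>R axis 2 1) = y - gact a b c x"
    by (simp add: gact_def vec_eq_iff forall_7 axis_def)
  then show ?thesis using * unfolding sim_def by metis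
qed

section \<open>Flow lines of the two circle actions\<close>

definition exc_shift :: "real^7 \<Rightarrow> real^3 \<Rightarrow> bool" where
  "exc_shift v f \<longleftrightarrow> (\<forall>y s. exc_coord (y + s *\<^sub>R v) = (fst (exc_coord y) + s *\<^sub>R f, snd (exc_coord y)))"

lemma exc_shift_axis: "exc_shift (axis 3 1) (axis 3 1)" "exc_shift (axis 1 1) (axis 1 1)"
  by (simp_all add: exc_shift_def exc_coord_def vec_eq_iff forall_3 axis_def)

lemma tube_axis:
  "k \<noteq> By_gamma \<Longrightarrow> tube k c (t + s *\<^sub>R axis 3 1) z = tube k c t z + s *\<^sub>R axis 7 1"
  "k = By_gamma \<Longrightarrow> tube k c (t + s *\<^sub>R axis 1 1) z = tube k c t z + s *\<^sub>R axis 2 1"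
proof -
  show "k \<noteq> By_gamma \<Longrightarrow> tube k c (t + s *\<^sub>R axis 3 1) z = tube k c t z + s *\<^sub>R axis 7 1"
    by (cases k; cases z) (simp_all add: vec_eq_iff forall_7 axis_def)
  show "k = By_gamma \<Longrightarrow> tube k c (t + s *\<^sub>R axis 1 1) z = tube k c t z + s *\<^sub>R axis 2 1"
    by (cases z) (simp add: vec_eq_iff forall_7 axis_def)
qed

lemma exc_dom_shift: "exc_shift v f \<Longrightarrow> y \<in> exc_dom \<epsilon> \<Longrightarrow> y + s *\<^sub>R v \<in> exc_dom \<epsilon>"
  by (simp add: exc_shift_def exc_dom_def)

text \<open>Every flow line is of one of two types: the image of a straight line of R^7 in direction
  e, based at a nonsingular point with \<open>R\<close>, or a line in direction f in a torus factor
  of the exceptional set, of a kind with \<open>K\<close>. This description makes no reference to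
  charts, so lines coming from different charts can be compared.\<close>

definition lines_on :: "((real^7) set \<times> (real^7 \<Rightarrow> mpoint \<times> nat) \<times> (real^7)) set \<Rightarrow> (real^7 \<Rightarrow> bool)
    \<Rightarrow> (invol \<Rightarrow> bool) \<Rightarrow> real^7 \<Rightarrow> real^3 \<Rightarrow> bool" where
  "lines_on T R K e f \<longleftrightarrow> (\<forall>V p v x. (V, p, v) \<in> T \<longrightarrow> x \<in> V \<longrightarrow>
     (\<exists>X. X \<notin> singular \<and> R X \<and> (\<forall>s. p (x + s *\<^sub>R v) = reg0 (X + s *\<^sub>R e))) \<or>
     (\<exists>k c t l. K k \<and> (\<forall>s. p (x + s *\<^sub>R v) = (Exc k c {t + s *\<^sub>R f + n | n. n \<in> int_lattice} l, 0))))"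

lemma lines_onE:
  assumes "lines_on T R K e f" "(V, p, v) \<in> T" "x \<in> V"
  obtains X where "X \<notin> singular" "R X" "\<And>s. p (x + s *\<^sub>R v) = reg0 (X + s *\<^sub>R e)"
  | k c t l where "K k" "\<And>s. p (x + s *\<^sub>R v) = (Exc k c {t + s *\<^sub>R f + n | n. n \<in> int_lattice} l, 0)"
  using assms unfolding lines_on_def by blast

text \<open>The flow changes only the torus coordinate, so u is constant along a line: the line lies
  either within the zero section or entirely off it, and then in the tube as a straight
  line.\<close>

lemma exc_line:
  assumes eps: "0 < \<epsilon>" "\<epsilon> \<le> 1/8" and c: "c \<in> centres k" and y: "y \<in> exc_dom \<epsilon>" and v: "exc_shift v f"
    and t: "\<And>t s z. tube k c (t + s *\<^sub>R f) z = tube k c t z + s *\<^sub>R e"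
    and R: "\<And>t z. norm z < 1/8 \<Longrightarrow> R (tube k c t z)"
  shows "(\<exists>X. X \<notin> singular \<and> R X \<and> (\<forall>s. (exc_param k c j (y + s *\<^sub>R v), 0::nat) = reg0 (X + s *\<^sub>R e))) \<or>
     (\<exists>t l. (\<forall>s. (exc_param k c j (y + s *\<^sub>R v), 0::nat) = (Exc k c {t + s *\<^sub>R f + n | n. n \<in> int_lattice} l, 0)))"
proof -
  obtain t m u where ec: "exc_coord y = (t, m, u)" using prod_cases3 by blast
  obtain r where r: "r\<^sup>2 = u" using power2_csqrt by blast
  have "exc_coord (y + s *\<^sub>R v) = (t + s *\<^sub>R f, m, u)" for s using v ec by (simp add: exc_shift_def)
  note E = exc_param_eq[where j = j, OF c this r]
  show ?thesis
  proof (cases "u = 0")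
    case True
    then show ?thesis using E by auto
  next
    case False
    have n: "norm (pnt j m r) < 1/8" using norm_pnt_dom[OF y ec r eps(1), of j] eps by simp
    have "pnt j m r \<noteq> 0" using r False pnt_zero by auto
    then have "tube k c t (pnt j m r) \<notin> singular" using tube_nonsingular[OF c n] by blast
    then show ?thesis using E False t R[OF n, of t] by (intro disjI1 exI[of _ "tube k c t (pnt j m r)"]) auto
  qed
qed

lemma tube_first_bounds:
  assumes "c \<in> centres k" "norm z < 1/8"
  shows "k \<noteq> By_gamma \<Longrightarrow> \<bar>tube k c t z $ 1\<bar> < 1/4"
    "k = By_gamma \<Longrightarrow> 0 < tube k c t z $ 1 \<and> tube k c t z $ 1 < 1/2"
proof -
  obtain z1 z2 where z: "z = (z1, z2)" by force
  have "\<bar>Re z1\<bar> < 1/8" using normal_coords_small(1) assms(2) unfolding z .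
  then have r: "Re z1 < 1/8" "- (1/8) < Re z1" by (simp_all only: abs_less_iff) auto
  show "\<bar>tube k c t z $ 1\<bar> < 1/4" if "k \<noteq> By_gamma"
  proof -
    have "base1 k = 0" using that by (cases k) simp_all
    then show ?thesis using r unfolding tube_first[OF assms(1)] z by (simp add: abs_less_iff)
  qed
  show "0 < tube k c t z $ 1 \<and> tube k c t z $ 1 < 1/2" if "k = By_gamma"
  proof -
    have "base1 k = 1/4" using that by simp
    then show ?thesis using r unfolding tube_first[OF assms(1)] z by simp
  qed
qed

lemma lines_flow0:
  assumes eps: "0 < \<epsilon>" "\<epsilon> \<le> 1/8"
  shows "lines_on (flow0 \<epsilon>) (\<lambda>X. \<bar>X$1\<bar> < 1/4) (\<lambda>k. k \<noteq> By_gamma) (axis 7 1) (axis 3 1)"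
  unfolding lines_on_def
proof (intro allI impI)
  fix V p v and x :: "real^7" assume V: "(V, p, v) \<in> flow0 \<epsilon>" and x: "x \<in> V"
  then consider "V = dom0" "p = reg0" "v = axis 7 1"
    | k c j where "c \<in> centres k" "k \<noteq> By_gamma" "V = exc_dom \<epsilon>" "p = (\<lambda>y. (exc_param k c j y, 0))" "v = axis 3 1"
    unfolding flow0_def by blast
  then show "(\<exists>X. X \<notin> singular \<and> \<bar>X$1\<bar> < 1/4 \<and> (\<forall>s. p (x + s *\<^sub>R v) = reg0 (X + s *\<^sub>R axis 7 1))) \<or>
     (\<exists>k c t l. k \<noteq> By_gamma \<and> (\<forall>s. p (x + s *\<^sub>R v) = (Exc k c {t + s *\<^sub>R axis 3 1 + n | n. n \<in> int_lattice} l, 0)))"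
  proof cases
    case 1
    then show ?thesis using x by (intro disjI1 exI[of _ x]) (auto simp: dom0_def)
  next
    case (2 k c j)
    show ?thesis unfolding 2(4,5)
      using exc_line[OF eps 2(1) _ exc_shift_axis(1) tube_axis(1)[OF 2(2)], of x "\<lambda>X::real^7. \<bar>X$1\<bar> < 1/4" j]
        tube_first_bounds(1)[OF 2(1) _ 2(2)] x 2(2,3) by blast
  qed
qed

lemma lines_flow1:
  assumes eps: "0 < \<epsilon>" "\<epsilon> \<le> 1/8"
  shows "lines_on (flow1 \<epsilon>) (\<lambda>X. 0 < X$1 \<and> X$1 < 1/2) (\<lambda>k. k = By_gamma) (axis 2 1) (axis 1 1)"
  unfolding lines_on_def
proof (intro allI impI)
  fix V p v and x :: "real^7" assume V: "(V, p, v) \<in> flow1 \<epsilon>" and x: "x \<in> V"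
  then consider "V = dom1" "p = reg0" "v = axis 2 1"
    | k c j where "c \<in> centres k" "k = By_gamma" "V = exc_dom \<epsilon>" "p = (\<lambda>y. (exc_param k c j y, 0))" "v = axis 1 1"
    unfolding flow1_def by blast
  then show "(\<exists>X. X \<notin> singular \<and> (0 < X$1 \<and> X$1 < 1/2) \<and> (\<forall>s. p (x + s *\<^sub>R v) = reg0 (X + s *\<^sub>R axis 2 1))) \<or>
     (\<exists>k c t l. k = By_gamma \<and> (\<forall>s. p (x + s *\<^sub>R v) = (Exc k c {t + s *\<^sub>R axis 1 1 + n | n. n \<in> int_lattice} l, 0)))"
  proof cases
    case 1
    then show ?thesis using x by (intro disjI1 exI[of _ x]) (auto simp: dom1_def)
  next
    case (2 k c j)
    show ?thesis unfolding 2(4,5)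
      using exc_line[OF eps 2(1) _ exc_shift_axis(2) tube_axis(2)[OF 2(2)], of x "\<lambda>X::real^7. 0 < X$1 \<and> X$1 < 1/2" j]
        tube_first_bounds(2)[OF 2(1) _ 2(2)] x 2(2,3) by blast
  qed
qed

lemma coset_shift:
  fixes t t' d :: "real^'n"
  assumes "{t + n | n. n \<in> int_lattice} = {t' + n | n. n \<in> int_lattice}"
  shows "{t + d + n | n. n \<in> int_lattice} = {t' + d + n | n. n \<in> int_lattice}"
proof -
  have *: "{t + d + n | n. n \<in> int_lattice} = (\<lambda>x. x + d) ` {t + n | n. n \<in> int_lattice}" for t :: "real^'n"
    by (auto simp: image_iff ac_simps)
  show ?thesis unfolding * assms ..
qed

lemma coset_lattice:
  fixes t d :: "real^'n"
  assumes "d \<in> int_lattice" shows "{t + d + n | n. n \<in> int_lattice} = {t + n | n. n \<in> int_lattice}"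
proof (intro set_eqI iffI)
  fix x assume "x \<in> {t + d + n | n. n \<in> int_lattice}"
  then obtain n where "n \<in> int_lattice" "x = t + (d + n)" by (auto simp: add.assoc)
  then show "x \<in> {t + n | n. n \<in> int_lattice}" using lattice_add[OF assms] by blast
next
  fix x assume "x \<in> {t + n | n. n \<in> int_lattice}"
  then obtain n where "n \<in> int_lattice" "x = t + d + (n - d)" by auto
  then show "x \<in> {t + d + n | n. n \<in> int_lattice}" using lattice_diff[OF _ assms] by blast
qed

lemma axis_lattice: "axis i 1 \<in> int_lattice"
  by (simp add: int_lattice_def axis_def)

text \<open>Points of the two types never coincide, so two lines through a common point have the
  same type. Regular ones stay equal because equivalence survives the translation within
  \<open>R\<close>, exceptional ones because cosets translate.\<close>

lemma flow_of_lines: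
  assumes fam: "param_family (fam T)" and L: "lines_on T R K (axis i 1) (axis i' 1)"
    and dom: "\<And>V p v x s. (V, p, v) \<in> T \<Longrightarrow> x \<in> V \<Longrightarrow> x + s *\<^sub>R v \<in> V"
    and R: "\<And>X Y s. R X \<Longrightarrow> R Y \<Longrightarrow> sim X Y \<Longrightarrow> sim (X + s *\<^sub>R axis i 1) (Y + s *\<^sub>R axis i 1)"
  shows "flow T"
proof (rule flow.intro)
  show "param_family (fam T)" by fact
  show "x + s *\<^sub>R v \<in> V" if "(V, p, v) \<in> T" "x \<in> V" for V p v x s by (rule dom[OF that])
next
  fix V p v W q w x y s
  assume V: "(V, p, v) \<in> T" and W: "(W, q, w) \<in> T" and x: "x \<in> V" and y: "y \<in> W" and eq: "p x = q y"
  from L V x show "p (x + s *\<^sub>R v) = q (y + s *\<^sub>R w)"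
  proof (cases rule: lines_onE)
    case (1 X)
    note X = 1
    from L W y show ?thesis
    proof (cases rule: lines_onE)
      case (1 Y)
      have "sim X Y" using X(3)[of 0] 1(3)[of 0] eq orb_eq_iff by simp
      then have "orb (X + s *\<^sub>R axis i 1) = orb (Y + s *\<^sub>R axis i 1)"
        using R[OF X(2) 1(2)] orb_eq_iff by blast
      then show ?thesis using X(3) 1(3) by simp
    next
      case (2 k c t l)
      then show ?thesis using X(3)[of 0] 2(2)[of 0] eq by simp
    qed
  next
    case (2 k c t l)
    note X = 2
    from L W y show ?thesis
    proof (cases rule: lines_onE)
      case (1 Y)
      then show ?thesis using X(2)[of 0] 1(3)[of 0] eq by simp
    next
      case (2 k' c' t' l')
      have "k = k' \<and> c = c' \<and> l = l' \<and> {t + n | n. n \<in> int_lattice} = {t' + n | n. n \<in> int_lattice}"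
        using X(2)[of 0] 2(2)[of 0] eq by simp
      then show ?thesis using X(2)[of s] 2(2)[of s] coset_shift[of t t' "s *\<^sub>R axis i' 1"] by simp
    qed
  qed
next
  fix V p v x assume V: "(V, p, v) \<in> T" and x: "x \<in> V"
  from L V x show "p (x + v) = p x"
  proof (cases rule: lines_onE)
    case (1 X)
    have "orb (X + axis i 1) = orb X" using sim_lattice[of "X + axis i 1" X] axis_lattice orb_eq_iff
      by (metis add_diff_cancel_left' sim_lattice)
    then show ?thesis using 1(3)[of 0] 1(3)[of 1] by simp
  next
    case (2 k c t l)
    then show ?thesis using 2(2)[of 0] 2(2)[of 1] coset_lattice[OF axis_lattice, of t i'] by simp
  qed
qed

lemma fam_flow0: "fam (flow0 \<epsilon>) = insert (dom0, reg0)
    {(exc_dom \<epsilon>, \<lambda>y. (exc_param k c j y, 0)) | k c j. c \<in> centres k \<and> k \<noteq> By_gamma}"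
  unfolding fam_def flow0_def by force

lemma fam_flow1: "fam (flow1 \<epsilon>) = insert (dom1, reg0)
    {(exc_dom \<epsilon>, \<lambda>y. (exc_param k c j y, 0)) | k c j. c \<in> centres k \<and> k = By_gamma}"
  unfolding fam_def flow1_def by force

text \<open>This is the common shape of the first two total spaces: a nonsingular part
  \<open>D\<close> together with the resolved tubes of the kinds selected by
  \<open>K\<close>.\<close>

lemma family_resolution:
  assumes eps: "0 < \<epsilon>" "\<epsilon> \<le> 1/8" and D: "open D" "D \<subseteq> - singular"
    and Q: "Q = insert (D, reg0) {(exc_dom \<epsilon>, \<lambda>y. (exc_param k c j y, 0)) | k c j. c \<in> centres k \<and> K k}"
  shows "coord_over Q (joyce_family \<epsilon>) fst" "param_family Q"
proof -
  show over: "coord_over Q (joyce_family \<epsilon>) fst"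
    unfolding coord_over_def
  proof (intro ballI, clarify)
    fix W q assume "(W, q) \<in> Q"
    then consider "W = D" "q = reg0"
      | k c j where "c \<in> centres k" "W = exc_dom \<epsilon>" "q = (\<lambda>y. (exc_param k c j y, 0))"
      unfolding Q by blast
    then show "open W \<and> (\<exists>V p. (V, p) \<in> joyce_family \<epsilon> \<and> W \<subseteq> V \<and> (\<forall>y\<in>W. fst (q y) = p y))"
    proof cases
      case 1
      then show ?thesis using D regular_in_family by fastforce
    next
      case (2 k c j)
      then show ?thesis using exc_in_family[OF 2(1), of \<epsilon> j] open_exc_dom by fastforce
    qed
  qed
  have "Q \<subseteq> insert (D, reg0) ((\<lambda>(k, c, j). (exc_dom \<epsilon>, \<lambda>y. (exc_param k c j y, 0))) ` (SIGMA k:UNIV. centres k \<times> UNIV))"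
    unfolding Q by force
  then have "countable Q"
    using finite_exc by (meson countable_finite finite_imageI finite_insert finite_subset)
  moreover have "inj_on fst (\<Union>(W, q)\<in>Q. q ` W)"
    unfolding Q by (rule inj_onI) (auto intro: prod_eqI)
  ultimately show "param_family Q"
    using param_family_over[OF param_family_joyce[OF eps] _ over] by blast
qed

lemma snd_resolution:
  assumes "param_family Q"
    and Q: "Q = insert (D, reg0) {(exc_dom \<epsilon>, \<lambda>y. (exc_param k c j y, 0)) | k c j. c \<in> centres k \<and> K k}"
    and "a \<in> points (gen_atlas Q)" shows "snd a = 0"
  using param_family.pointsE[OF assms(1,3)] unfolding Q by fastforce

lemma flow_flow0: assumes eps: "0 < \<epsilon>" "\<epsilon> \<le> 1/8" shows "flow (flow0 \<epsilon>)"
proof (rule flow_of_lines[OF _ lines_flow0[OF eps]])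
  show "param_family (fam (flow0 \<epsilon>))"
    by (rule family_resolution(2)[OF eps open_doms(1) _ fam_flow0]) (auto simp: dom0_def)
  show "x + s *\<^sub>R v \<in> V" if "(V, p, v) \<in> flow0 \<epsilon>" "x \<in> V" for V p v x s
    using that dom0_shift exc_dom_shift[OF exc_shift_axis(1)] unfolding flow0_def by blast
qed (use sim_shift0 in blast)

lemma flow_flow1: assumes eps: "0 < \<epsilon>" "\<epsilon> \<le> 1/8" shows "flow (flow1 \<epsilon>)"
proof (rule flow_of_lines[OF _ lines_flow1[OF eps]])
  show "param_family (fam (flow1 \<epsilon>))"
    by (rule family_resolution(2)[OF eps open_doms(2) _ fam_flow1]) (auto simp: dom1_def)
  show "x + s *\<^sub>R v \<in> V" if "(V, p, v) \<in> flow1 \<epsilon>" "x \<in> V" for V p v x s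
    using that dom1_shift exc_dom_shift[OF exc_shift_axis(2)] unfolding flow1_def by blast
qed (use sim_shift1 in blast)

section \<open>Connectedness of the one-sheeted total spaces\<close>

lemma open_perturb:
  assumes "open N" "(x::'a::real_normed_vector) \<in> N" shows "\<exists>d>0. \<forall>s. \<bar>s\<bar> < d \<longrightarrow> x + s *\<^sub>R e \<in> N"
proof -
  have "open ((\<lambda>s::real. x + s *\<^sub>R e) -` N)" by (rule open_vimage[OF assms(1)]) (intro continuous_intros)
  moreover have "0 \<in> (\<lambda>s. x + s *\<^sub>R e) -` N" using assms(2) by simp
  ultimately obtain d where "d > 0" "ball 0 d \<subseteq> (\<lambda>s. x + s *\<^sub>R e) -` N"
    unfolding open_contains_ball by blast
  then show ?thesis by (intro exI[of _ d]) (auto simp: subset_iff)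
qed

text \<open>Connectedness holds because the image of the convex set \<open>slab\<close> is dense.\<close>

lemma connected_resolution:
  assumes fam: "param_family Q" and eps: "0 < \<epsilon>" "\<epsilon> \<le> 1/8" and D: "open D" "slab \<subseteq> D"
    and Q: "Q = insert (D, reg0) {(exc_dom \<epsilon>, \<lambda>y. (exc_param k c j y, 0)) | k c j. c \<in> centres k \<and> K k}"
    and tubes: "\<And>k c t z. c \<in> centres k \<Longrightarrow> K k \<Longrightarrow> norm z < 1/8 \<Longrightarrow> z \<noteq> 0 \<Longrightarrow> tube k c t z \<in> D"
    and dense: "\<And>x N. x \<in> D \<Longrightarrow> open N \<Longrightarrow> x \<in> N \<Longrightarrow> N \<subseteq> D \<Longrightarrow> \<exists>z\<in>N. \<exists>w\<in>slab. sim z w"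
  shows "connected_space (mtop (gen_atlas Q))"
proof -
  interpret param_family Q by fact
  have D0: "(D, reg0) \<in> Q" unfolding Q by simp
  have sub: "reg0 ` slab \<subseteq> mtop (gen_atlas Q) closure_of (reg0 ` slab)"
    using in_points[OF D0] D(2) by (intro closure_of_subset) auto
  have reg: "reg0 x \<in> mtop (gen_atlas Q) closure_of (reg0 ` slab)" if x: "x \<in> D" for x
  proof (rule closure_of_param[OF D0 x])
    fix N assume "open N" "x \<in> N" "N \<subseteq> D"
    then obtain z w where "z \<in> N" "w \<in> slab" "sim z w" using dense[OF x] by blast
    moreover from this have "reg0 z = reg0 w" using orb_eq_iff by blast
    ultimately have "z \<in> N" "reg0 z \<in> mtop (gen_atlas Q) closure_of (reg0 ` slab)" using sub by auto
    then show "\<exists>z\<in>N. reg0 z \<in> mtop (gen_atlas Q) closure_of (reg0 ` slab)" by blast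
  qed
  show ?thesis
  proof (rule connected_gen[OF D0 convex_connected[OF convex_slab] D(2)])
    fix V p x assume V: "(V, p) \<in> Q" and x: "x \<in> V"
    then consider "V = D" "p = reg0"
      | k c j where "c \<in> centres k" "K k" "V = exc_dom \<epsilon>" "p = (\<lambda>y. (exc_param k c j y, 0))"
      unfolding Q by blast
    then show "p x \<in> mtop (gen_atlas Q) closure_of (reg0 ` slab)"
    proof cases
      case 1
      then show ?thesis using reg x by auto
    next
      case (2 k c j)
      have nz: "p y \<in> mtop (gen_atlas Q) closure_of (reg0 ` slab)"
        if y: "y \<in> exc_dom \<epsilon>" "snd (snd (exc_coord y)) \<noteq> 0" for y
      proof -
        obtain t m u where ec: "exc_coord y = (t, m, u)" using prod_cases3 by blast
        obtain r where r: "r\<^sup>2 = u" using power2_csqrt by blast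
        have u: "u \<noteq> 0" using y ec by simp
        have "norm (pnt j m r) < 1/8" using norm_pnt_dom[OF y(1) ec r eps(1), of j] eps by simp
        moreover have "pnt j m r \<noteq> 0" using r u pnt_zero by auto
        ultimately have "tube k c t (pnt j m r) \<in> D" using tubes[OF 2(1,2)] by blast
        then show ?thesis using reg exc_param_eq[OF 2(1) ec r, of j] u 2 by simp
      qed
      show ?thesis
      proof (rule closure_of_param[OF V x])
        fix N assume N: "open N" "x \<in> N" "N \<subseteq> V"
        show "\<exists>z\<in>N. p z \<in> mtop (gen_atlas Q) closure_of (reg0 ` slab)"
        proof (cases "snd (snd (exc_coord x)) = 0")
          case False
          then show ?thesis using nz N 2 by blast
        next
          case True
          obtain d where d: "d > 0" "\<And>s. \<bar>s\<bar> < d \<Longrightarrow> x + s *\<^sub>R axis 6 1 \<in> N"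
            using open_perturb[OF N(1,2)] by blast
          \<comment> \<open>The sixth parameter is the real part of u, so this perturbation leaves
            the zero section.\<close>
          let ?z = "x + (d/2) *\<^sub>R axis 6 1"
          have zN: "?z \<in> N" using d(2)[of "d/2"] d(1) by simp
          moreover have "snd (snd (exc_coord ?z)) \<noteq> 0"
            using True d(1) by (simp add: exc_coord_def axis_def complex_eq_iff)
          ultimately show ?thesis using nz[of ?z] N(3) 2(3) by blast
        qed
      qed
    qed
  qed
qed

lemma sim_reflect: "sim x (gact a b c x)"
  unfolding sim_def by (intro exI[of _ a] exI[of _ b] exI[of _ c]) simp

text \<open>\<alpha> exchanges the halves x_1 < 0 and x_1 > 0, so off the wall x_1 = 0 a point or
  its image lies in \<open>slab\<close>; points of the wall are perturbed in direction x_1.\<close>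

lemma connected_flow0: assumes eps: "0 < \<epsilon>" "\<epsilon> \<le> 1/8" shows "connected_space (mtop (gen_atlas (fam (flow0 \<epsilon>))))"
proof (rule connected_resolution[OF _ eps open_doms(1) slab_subset(1) fam_flow0])
  show "param_family (fam (flow0 \<epsilon>))" using flow.family[OF flow_flow0[OF eps]] .
  show "tube k c t z \<in> dom0" if "c \<in> centres k" "k \<noteq> By_gamma" "norm z < 1/8" "z \<noteq> 0" for k c t z
    using tube_first_bounds(1) tube_nonsingular that by (auto simp: dom0_def)
  fix x N assume x: "x \<in> dom0" and N: "open N" "x \<in> N" "N \<subseteq> dom0"
  show "\<exists>z\<in>N. \<exists>w\<in>slab. sim z w"
  proof (cases "x$1 = 0")
    case True
    obtain d where d: "d > 0" "\<And>s. \<bar>s\<bar> < d \<Longrightarrow> x + s *\<^sub>R axis 1 1 \<in> N"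
      using open_perturb[OF N(1,2)] by blast
    let ?z = "x + (d/2) *\<^sub>R axis 1 1"
    have zN: "?z \<in> N" using d(2)[of "d/2"] d(1) by simp
    then have "?z \<in> dom0" using N by blast
    then have "?z \<in> slab" using True d(1) by (simp add: slab_def dom0_def axis_def)
    then show ?thesis using zN sim_refl by blast
  next
    case False
    have "gact True False False x $ 1 = - x $ 1" by (simp add: gact_def sg7_def hf7_def sgb_def hfb_def)
    then have "x \<in> slab \<or> gact True False False x \<in> slab" using x False by (auto simp: dom0_def slab_def)
    then show ?thesis using N(2) sim_refl sim_reflect by blast
  qed
qed

text \<open>The same with the reflection of x_1 in 1/4 given by \<gamma>; from the wall x_1 = 1/4
  the perturbation goes downwards, into \<open>slab\<close>.\<close>

lemma connected_flow1: assumes eps: "0 < \<epsilon>" "\<epsilon> \<le> 1/8" shows "connected_space (mtop (gen_atlas (fam (flow1 \<epsilon>))))"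
proof (rule connected_resolution[OF _ eps open_doms(2) slab_subset(2) fam_flow1])
  show "param_family (fam (flow1 \<epsilon>))" using flow.family[OF flow_flow1[OF eps]] .
  show "tube k c t z \<in> dom1" if "c \<in> centres k" "k = By_gamma" "norm z < 1/8" "z \<noteq> 0" for k c t z
    using tube_first_bounds(2) tube_nonsingular that by (auto simp: dom1_def)
  fix x N assume x: "x \<in> dom1" and N: "open N" "x \<in> N" "N \<subseteq> dom1"
  show "\<exists>z\<in>N. \<exists>w\<in>slab. sim z w"
  proof (cases "x$1 = 1/4")
    case True
    obtain d where d: "d > 0" "\<And>s. \<bar>s\<bar> < d \<Longrightarrow> x + s *\<^sub>R axis 1 1 \<in> N"
      using open_perturb[OF N(1,2)] by blast
    let ?z = "x + (- (d/2)) *\<^sub>R axis 1 1"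
    have zN: "?z \<in> N" using d(2)[of "- (d/2)"] d(1) by simp
    then have "?z \<in> dom1" using N by blast
    then have "?z \<in> slab" using True d(1) by (simp add: slab_def dom1_def axis_def)
    then show ?thesis using zN sim_refl by blast
  next
    case False
    have "gact False False True x $ 1 = 1/2 - x $ 1" by (simp add: gact_def sg7_def hf7_def sgb_def hfb_def)
    then have "x \<in> slab \<or> gact False False True x \<in> slab" using x False by (auto simp: dom1_def slab_def)
    then show ?thesis using N(2) sim_refl sim_reflect by blast
  qed
qed

section \<open>The double covering\<close>

text \<open>A point of \<open>T\<^sup>7\<close>, a coset of \<open>\<int>\<^sup>7\<close>, is encoded by applying the constructor \<open>Reg\<close> to it.\<close>

definition cosp :: "real^7 \<Rightarrow> mpoint \<times> nat" where
  "cosp x = (Reg {x + n | n. n \<in> int_lattice}, 0)"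

definition flow2 :: "7 \<Rightarrow> ((real^7) set \<times> (real^7 \<Rightarrow> mpoint \<times> nat) \<times> (real^7)) set" where
  "flow2 i = {(slab, cosp, axis i 1)}"

definition pr2 :: "mpoint \<times> nat \<Rightarrow> mpoint" where
  "pr2 a = (case fst a of Reg S \<Rightarrow> Reg (\<Union>x\<in>S. orb x) | Exc k c t l \<Rightarrow> Exc k c t l)"

abbreviation family2 :: "((real^7) set \<times> (real^7 \<Rightarrow> mpoint \<times> nat)) set" where
  "family2 \<equiv> {(slab, cosp)}"

lemma fam_flow2: "fam (flow2 i) = family2"
  by (simp add: fam_def flow2_def)

lemma cosp_eq: "cosp x = cosp y \<longleftrightarrow> y - x \<in> int_lattice"
proof
  assume "cosp x = cosp y" then show "y - x \<in> int_lattice" unfolding cosp_def by (intro cosets_eq) simp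
next
  assume "y - x \<in> int_lattice"
  from coset_lattice[OF this, of x] show "cosp x = cosp y" by (simp add: cosp_def)
qed

lemma pr2_cosp: "pr2 (cosp x) = Reg (orb x)"
proof -
  have "orb (x + n) = orb x" if "n \<in> int_lattice" for n
    using sim_lattice[of "x + n" x] that orb_eq_iff by (metis add_diff_cancel_left')
  then have "(\<Union>y\<in>{x + n | n. n \<in> int_lattice}. orb y) = (\<Union>y\<in>{x + n | n. n \<in> int_lattice}. orb x)"
    by (intro SUP_cong) auto
  also have "\<dots> = orb x"
  proof -
    have "x \<in> {x + n | n. n \<in> int_lattice}" by (auto intro!: exI[of _ 0])
    then show ?thesis by blast
  qed
  finally show ?thesis unfolding pr2_def cosp_def by simp
qed

lemma gact_False: "gact False False False x = x"
  by (simp add: gact_def vec_eq_iff forall_7 sg7_def hf7_def sgb_def hfb_def)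

text \<open>The projection of the double covering is two-to-one, so \<open>param_family_over\<close>
  does not apply. Transition maps here are translations by lattice vectors, and the coincidence
  relation is that of the trivial group element.\<close>

lemma param_family2: "param_family family2"
proof
  show "countable family2" by simp
next
  fix V :: "(real^7) set" and p assume "(V, p) \<in> family2" then show "open V" using open_doms by simp
next
  fix V p x assume *: "(V, p) \<in> family2" "x \<in> V"
  have "inj_on cosp (slab \<inter> ball x (1/2))"
  proof (rule inj_onI)
    fix y z assume yz: "y \<in> slab \<inter> ball x (1/2)" "z \<in> slab \<inter> ball x (1/2)" "cosp y = cosp z"
    then have "norm (z - y) < 1"
      using dist_triangle_half_r[of x z 1 y] by (auto simp: dist_norm norm_minus_commute)
    then have "z - y = 0" using lattice_small yz(3) cosp_eq by blast
    then show "y = z" by simp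
  qed
  then show "\<exists>N. open N \<and> x \<in> N \<and> N \<subseteq> V \<and> inj_on p N"
    using * open_doms by (intro exI[of _ "slab \<inter> ball x (1/2)"]) auto
next
  fix V p W q x y
  assume *: "(V, p) \<in> family2" "(W, q) \<in> family2" "x \<in> V" "y \<in> W" "p x = q y"
  then have d: "y - x \<in> int_lattice" using cosp_eq by auto
  have "smooth_lift slab cosp slab cosp (\<lambda>a. a) x y"
  proof (rule smooth_liftI[of slab _ _ "\<lambda>z. z + (y - x)"])
    show "smooth_on slab (\<lambda>z. z + (y - x))" by (intro smooth_on_add smooth_on_const smooth_on_id)
    show "cosp z = cosp (z + (y - x))" for z using d by (simp add: cosp_eq)
  qed (use * open_doms in auto)
  then show "smooth_lift V p W q (\<lambda>a. a) x y" using * by simp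
next
  fix V p W q assume *: "(V, p) \<in> family2" "(W, q) \<in> family2"
  have "{(x, y). x \<in> V \<and> y \<in> W \<and> p x = q y} = (V \<times> W) \<inter> sim_by False False False"
    using * by (auto simp: cosp_eq sim_by_def gact_False)
  then show "closedin (top_of_set (V \<times> W)) {(x, y). x \<in> V \<and> y \<in> W \<and> p x = q y}"
    by (simp only: closedin_closed_Int closed_sim_by)
qed

text \<open>Only x_1 is bounded on \<open>slab\<close>. The direction 7 is the action on the third
  set and the lift of that on the first; the direction 2 is the lift of the action on the second
  set.\<close>

lemma flow_flow2: assumes "i \<noteq> 1" shows "flow (flow2 i)"
proof (rule flow.intro)
  show "param_family (fam (flow2 i))" unfolding fam_flow2 by (rule param_family2)
  show "x + s *\<^sub>R v \<in> V" if "(V, p, v) \<in> flow2 i" "x \<in> V" for V p v x s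
    using that slab_shift[OF _ assms] by (auto simp: flow2_def)
  show "p (x + s *\<^sub>R v) = q (y + s *\<^sub>R w)"
    if "(V, p, v) \<in> flow2 i" "(W, q, w) \<in> flow2 i" "p x = q y" for V p v W q w x y s
    using that by (auto simp: flow2_def cosp_eq)
  show "p (x + v) = p x" if "(V, p, v) \<in> flow2 i" for V p v x
    using that axis_lattice lattice_minus[OF axis_lattice[of i]] by (auto simp: flow2_def cosp_eq)
qed

lemma points2: "points (gen_atlas family2) = cosp ` slab"
  using param_family.points_gen[OF param_family2] by simp

lemma over_family2: "coord_over family2 (joyce_family \<epsilon>) pr2"
  unfolding coord_over_def using regular_in_family[of \<epsilon>] slab_nonsingular open_doms pr2_cosp by fastforce

lemma connected2: "connected_space (mtop (gen_atlas family2))"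
proof (rule param_family.connected_gen[OF param_family2 _ convex_connected[OF convex_slab] subset_refl])
  show "(slab, cosp) \<in> family2" by simp
  fix V p x assume "(V, p) \<in> family2" "x \<in> V"
  then show "p x \<in> mtop (gen_atlas family2) closure_of (cosp ` slab)"
    using closure_of_topspace[of "mtop (gen_atlas family2)"] param_family.topspace_gen[OF param_family2] points2
    by auto
qed

text \<open>This is \<alpha>\<beta> up to the lattice: it fixes x_1 and x_7, adds 1/2 to x_2 and
  reverses x_3, ..., x_6. The shift of x_2 is why it has no fixed points on the torus.\<close>

definition swap :: "real^7 \<Rightarrow> real^7" where "swap = gact True True False"

lemma swap_slab: "x \<in> slab \<Longrightarrow> swap x \<in> slab"
  by (simp add: swap_def slab_def gact_def sg7_def hf7_def sgb_def hfb_def)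

lemma swap_swap: "swap (swap x) - x \<in> int_lattice"
  by (simp add: swap_def lattice_7 gact_def sg7_def hf7_def sgb_def hfb_def)

lemma swap_diff: "y - x \<in> int_lattice \<Longrightarrow> swap y - swap x \<in> int_lattice"
  by (simp add: swap_def lattice_7 gact_def sg7_def hf7_def sgb_def hfb_def)
     (metis Ints_minus minus_diff_eq)

lemma swap_shift: "swap (x + s *\<^sub>R axis 7 1) = swap x + s *\<^sub>R axis 7 1"
  by (simp add: swap_def vec_eq_iff forall_7 gact_def sg7_def hf7_def sgb_def hfb_def axis_def)

lemma sim_swap: "sim x (swap x)"
  unfolding swap_def by (rule sim_reflect)

lemma swap_not_equal: "swap x - x \<notin> int_lattice"
  by (simp add: swap_def lattice_7 gact_def sg7_def hf7_def sgb_def hfb_def)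

text \<open>\<open>slab\<close> lies in both ranges of x_1, so both restrictions hold: no \<gamma>,
  and \<alpha>, \<beta> only together.\<close>

lemma sim_slab:
  assumes "x \<in> slab" "y \<in> slab" "sim x y" shows "cosp y = cosp x \<or> cosp y = cosp (swap x)"
proof -
  obtain a b c where *: "y - gact a b c x \<in> int_lattice" using assms by (auto simp: sim_def)
  have "\<not> c" using sim_dom0[OF _ _ *] assms by (auto simp: slab_def)
  moreover have "a = b" using sim_dom1[OF _ _ _ _ *] assms by (auto simp: slab_def)
  ultimately have "y - x \<in> int_lattice \<or> y - swap x \<in> int_lattice"
    using * gact_False by (cases a) (auto simp: swap_def)
  then show ?thesis using cosp_eq by metis
qed

definition swap2 :: "mpoint \<times> nat \<Rightarrow> mpoint \<times> nat" where
  "swap2 = (\<lambda>a\<in>cosp ` slab. cosp (swap (SOME x. x \<in> slab \<and> a = cosp x)))"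

lemma swap2_cosp: assumes "x \<in> slab" shows "swap2 (cosp x) = cosp (swap x)"
proof -
  have "\<exists>y. y \<in> slab \<and> cosp x = cosp y" using assms by blast
  then have "(SOME y. y \<in> slab \<and> cosp x = cosp y) \<in> slab \<and> cosp x = cosp (SOME y. y \<in> slab \<and> cosp x = cosp y)"
    by (rule someI_ex)
  then have "swap x - swap (SOME y. y \<in> slab \<and> cosp x = cosp y) \<in> int_lattice"
    using swap_diff cosp_eq by metis
  then have "cosp (swap (SOME y. y \<in> slab \<and> cosp x = cosp y)) = cosp (swap x)" using cosp_eq by blast
  moreover have "cosp x \<in> cosp ` slab" using assms by blast
  ultimately show ?thesis unfolding swap2_def by simp
qed

lemma swap2_deck: "swap2 \<in> deck (gen_atlas family2) pr2"
proof -
  have pts: "swap2 a \<in> cosp ` slab \<and> swap2 (swap2 a) = a \<and> pr2 (swap2 a) = pr2 a" if a: "a \<in> cosp ` slab" for a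
  proof -
    obtain x where x: "x \<in> slab" "a = cosp x" using a by blast
    have "cosp (swap (swap x)) = cosp x" using swap_swap cosp_eq by metis
    moreover have "orb (swap x) = orb x" using sim_swap orb_eq_iff by metis
    ultimately show ?thesis using x swap_slab swap2_cosp by (simp add: pr2_cosp)
  qed
  have "diffeomorphism (gen_atlas family2) (gen_atlas family2) swap2"
  proof (rule diffeomorphism_involution[OF param_family2])
    show "swap2 a \<in> points (gen_atlas family2) \<and> swap2 (swap2 a) = a" if "a \<in> points (gen_atlas family2)" for a
      using pts that points2 by simp
    fix W q y assume W: "(W, q) \<in> family2" "y \<in> W"
    have "smooth_lift slab cosp slab cosp swap2 y (swap y)"
    proof (rule smooth_liftI[of slab _ _ swap])
      show "smooth_on slab swap" using smooth_gact_add[of slab True True False 0] by (simp add: swap_def)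
    qed (use W open_doms swap_slab swap2_cosp in auto)
    then show "\<exists>W' q' y'. (W', q') \<in> family2 \<and> y' \<in> W' \<and> smooth_lift W q W' q' swap2 y y'"
      using W swap_slab by blast
  qed
  moreover have "swap2 \<in> extensional (points (gen_atlas family2))" unfolding points2 swap2_def by simp
  ultimately show ?thesis unfolding deck_def points2 using pts by simp
qed

text \<open>Equivariance has to hold for every deck transformation, not only for those exhibited.
  Each point goes to itself or its swap; both agreement sets are closed, and they are disjoint
  because the swap is free, so connectedness of \<open>slab\<close> leaves only one of them.\<close>

lemma deck2_cases:
  assumes g: "g \<in> deck (gen_atlas family2) pr2"
  shows "(\<forall>x\<in>slab. g (cosp x) = cosp x) \<or> (\<forall>x\<in>slab. g (cosp x) = cosp (swap x))"
proof -
  interpret param_family family2 by (rule param_family2)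
  let ?X = "mtop (gen_atlas family2)"
  have d: "diffeomorphism (gen_atlas family2) (gen_atlas family2) g"
    and pr: "\<And>a. a \<in> cosp ` slab \<Longrightarrow> pr2 (g a) = pr2 a"
    using g unfolding deck_def points2 by auto
  have gc: "continuous_map ?X ?X g"
    using smooth_map_continuous[OF param_family2 param_family2] d by (auto simp: diffeomorphism_def)
  have cc: "continuous_map (top_of_set slab) ?X cosp" by (rule continuous_param) simp
  have sc: "continuous_map (top_of_set slab) (top_of_set slab) swap"
    using continuous_gact[of slab True True False] swap_slab
    by (auto simp: swap_def continuous_map_iff_continuous2 image_subset_iff)
  have 1: "closedin (top_of_set slab) {x\<in>slab. g (cosp x) = cosp x}"
    using closedin_continuous_maps_eq[OF Hausdorff_gen continuous_map_compose[OF cc gc] cc] by simp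
  have 2: "closedin (top_of_set slab) {x\<in>slab. g (cosp x) = cosp (swap x)}"
    using closedin_continuous_maps_eq[OF Hausdorff_gen continuous_map_compose[OF cc gc] continuous_map_compose[OF sc cc]] by simp
  have "g (cosp x) = cosp x \<or> g (cosp x) = cosp (swap x)" if x: "x \<in> slab" for x
  proof -
    have "g (cosp x) \<in> cosp ` slab" using d x by (auto simp: diffeomorphism_def smooth_map_def points2)
    then obtain y where y: "y \<in> slab" "g (cosp x) = cosp y" by blast
    have "pr2 (g (cosp x)) = pr2 (cosp x)" using pr x by blast
    then have "orb x = orb y" using y by (simp add: pr2_cosp)
    then have "sim x y" using orb_eq_iff by blast
    then show ?thesis using sim_slab[OF x y(1)] y(2) by simp
  qed
  then have "slab \<subseteq> {x\<in>slab. g (cosp x) = cosp x} \<union> {x\<in>slab. g (cosp x) = cosp (swap x)}" by blast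
  moreover have "{x\<in>slab. g (cosp x) = cosp x} \<inter> {x\<in>slab. g (cosp x) = cosp (swap x)} = {}"
  proof (rule ccontr)
    assume "\<not> ?thesis"
    then obtain x where "g (cosp x) = cosp x" "g (cosp x) = cosp (swap x)" by blast
    then have "cosp x = cosp (swap x)" by simp
    then show False using swap_not_equal cosp_eq by blast
  qed
  ultimately have "{x\<in>slab. g (cosp x) = cosp x} = {} \<or> {x\<in>slab. g (cosp x) = cosp (swap x)} = {}"
    using convex_connected[OF convex_slab] 1 2 unfolding connected_closedin by blast
  then show ?thesis
    using \<open>slab \<subseteq> {x\<in>slab. g (cosp x) = cosp x} \<union> {x\<in>slab. g (cosp x) = cosp (swap x)}\<close> by blast
qed

text \<open>Over the image of a neighbourhood \<open>N\<close> without distinct equivalent points,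
  the two sheets are the classes of \<open>N\<close> and of its swap. They are disjoint because an
  equivalence between z and a swapped w forces z = w, while no class is fixed by the swap.\<close>

lemma double_covering:
  assumes eps: "0 < \<epsilon>" "\<epsilon> \<le> 1/8"
  shows "finite_Galois_covering (gen_atlas family2) (gen_atlas (joyce_family \<epsilon>)) ((\<lambda>x. Reg (orb x)) ` slab) pr2"
proof -
  let ?M = "gen_atlas (joyce_family \<epsilon>)" and ?C = "gen_atlas family2"
  interpret C: param_family family2 by (rule param_family2)
  interpret M: param_family "joyce_family \<epsilon>" by (rule param_family_joyce[OF eps])
  have slab_in: "(slab, cosp) \<in> family2" by simp
  have "\<exists>V. y \<in> V \<and> V \<subseteq> (\<lambda>x. Reg (orb x)) ` slab \<and> openin (mtop ?M) V \<and>
        (\<exists>\<S>. disjoint \<S> \<and> \<Union>\<S> = {x\<in>points ?C. pr2 x \<in> V} \<and>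
           (\<forall>S\<in>\<S>. openin (mtop ?C) S \<and> diffeomorphism (open_submanifold ?C S) (open_submanifold ?M V) pr2))"
    if y: "y \<in> (\<lambda>x. Reg (orb x)) ` slab" for y
  proof -
    obtain x where x: "x \<in> slab" "y = Reg (orb x)" using y by blast
    obtain N0 where N0: "open N0" "x \<in> N0" "\<And>z w. z \<in> N0 \<Longrightarrow> w \<in> N0 \<Longrightarrow> sim z w \<Longrightarrow> z = w"
      using sim_locally_trivial[OF slab_nonsingular[OF x(1)]] by blast
    define N where "N = N0 \<inter> slab"
    have N: "open N" "x \<in> N" "N \<subseteq> slab" "\<And>z w. z \<in> N \<Longrightarrow> w \<in> N \<Longrightarrow> sim z w \<Longrightarrow> z = w"
      using N0 x open_doms by (auto simp: N_def)
    let ?V = "(\<lambda>x. Reg (orb x)) ` N"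
    \<comment> \<open>A preimage, hence visibly open; since the swap is an involution modulo the
      lattice, its classes are those of the swap of \<open>N\<close>.\<close>
    let ?N2 = "slab \<inter> swap -` (\<Union>n\<in>int_lattice. (\<lambda>z. z + n) ` N)"
    have o2: "open ?N2"
    proof (rule open_Int[OF open_doms(3) open_vimage])
      show "open (\<Union>n\<in>int_lattice. (\<lambda>z. z + n) ` N)" using open_translation[OF N(1)] by (auto simp: add.commute)
      show "continuous_on UNIV swap" unfolding swap_def by (rule continuous_gact)
    qed
    have S2: "cosp ` (swap ` N) = cosp ` ?N2"
    proof (intro set_eqI iffI)
      fix a assume "a \<in> cosp ` (swap ` N)"
      then obtain z where z: "z \<in> N" "a = cosp (swap z)" by blast
      have "swap (swap z) = z + (swap (swap z) - z)" by simp
      then have "swap z \<in> ?N2" using z N swap_slab swap_swap[of z] by blast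
      then show "a \<in> cosp ` ?N2" using z by blast
    next
      fix a assume "a \<in> cosp ` ?N2"
      then obtain w n z where w: "w \<in> slab" "a = cosp w" "swap w = z + n" "n \<in> int_lattice" "z \<in> N" by blast
      have "z - swap w \<in> int_lattice" using w lattice_minus by simp
      then have "swap z - swap (swap w) \<in> int_lattice" by (rule swap_diff)
      then have "cosp (swap (swap w)) = cosp (swap z)" using cosp_eq by blast
      moreover have "cosp w = cosp (swap (swap w))" using swap_swap cosp_eq by blast
      ultimately show "a \<in> cosp ` (swap ` N)" using w by auto
    qed
    have open1: "openin (mtop ?C) (cosp ` N)" using C.open_image[OF slab_in N(3,1)] .
    have open2: "openin (mtop ?C) (cosp ` (swap ` N))" unfolding S2 by (rule C.open_image[OF slab_in _ o2]) auto
    have orbs: "orb (swap z) = orb z" for z using sim_swap orb_eq_iff by metis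
    have im1: "pr2 ` (cosp ` N) = ?V" by (auto simp: image_image pr2_cosp)
    have im2: "pr2 ` (cosp ` (swap ` N)) = ?V" by (auto simp: image_image pr2_cosp orbs)
    have injN: "z = w" if "z \<in> N" "w \<in> N" "orb z = orb w" for z w
      using N(4) that orb_eq_iff by blast
    have inj1: "inj_on pr2 (cosp ` N)"
    proof (rule inj_onI)
      fix a b assume "a \<in> cosp ` N" "b \<in> cosp ` N" "pr2 a = pr2 b"
      then obtain z w where "z \<in> N" "w \<in> N" "a = cosp z" "b = cosp w" "orb z = orb w"
        by (auto simp: pr2_cosp)
      then show "a = b" using injN by blast
    qed
    have inj2: "inj_on pr2 (cosp ` (swap ` N))"
    proof (rule inj_onI)
      fix a b assume "a \<in> cosp ` (swap ` N)" "b \<in> cosp ` (swap ` N)" "pr2 a = pr2 b"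
      then obtain z w where "z \<in> N" "w \<in> N" "a = cosp (swap z)" "b = cosp (swap w)" "orb z = orb w"
        by (auto simp: pr2_cosp orbs)
      then show "a = b" using injN by blast
    qed
    have disj: "cosp ` N \<inter> cosp ` (swap ` N) = {}"
    proof (rule ccontr)
      assume "cosp ` N \<inter> cosp ` (swap ` N) \<noteq> {}"
      then obtain z w where zw: "z \<in> N" "w \<in> N" "cosp z = cosp (swap w)" by blast
      then have "pr2 (cosp z) = pr2 (cosp (swap w))" by simp
      then have "sim z w" by (simp add: pr2_cosp orbs orb_eq_iff)
      then have "z = w" using N(4) zw by blast
      then show False using zw(3) swap_not_equal cosp_eq by blast
    qed
    have un: "cosp ` N \<union> cosp ` (swap ` N) = {a\<in>points ?C. pr2 a \<in> ?V}"
    proof (intro set_eqI iffI)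
      fix a assume "a \<in> {a\<in>points ?C. pr2 a \<in> ?V}"
      then obtain w z where w: "w \<in> slab" "a = cosp w" "z \<in> N" "orb w = orb z"
        unfolding points2 by (auto simp: pr2_cosp)
      then have "sim z w" using orb_eq_iff by metis
      then have "cosp w = cosp z \<or> cosp w = cosp (swap z)" using sim_slab w N(3) by blast
      then show "a \<in> cosp ` N \<union> cosp ` (swap ` N)" using w by auto
    next
      fix a assume "a \<in> cosp ` N \<union> cosp ` (swap ` N)"
      then show "a \<in> {a\<in>points ?C. pr2 a \<in> ?V}"
        unfolding points2 using N(3) swap_slab im1 im2 by blast
    qed
    have V: "openin (mtop ?M) ?V" using over_open[OF M.param_family_axioms param_family2 over_family2 open1] im1 by simp
    have d1: "diffeomorphism (open_submanifold ?C (cosp ` N)) (open_submanifold ?M ?V) pr2"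
      using over_diffeo[OF M.param_family_axioms param_family2 over_family2 open1 inj1] im1 by simp
    have d2: "diffeomorphism (open_submanifold ?C (cosp ` (swap ` N))) (open_submanifold ?M ?V) pr2"
      using over_diffeo[OF M.param_family_axioms param_family2 over_family2 open2 inj2] im2 by simp
    show ?thesis
    proof (intro exI[of _ ?V] conjI exI[of _ "{cosp ` N, cosp ` (swap ` N)}"])
      show "y \<in> ?V" using x N by blast
      show "?V \<subseteq> (\<lambda>x. Reg (orb x)) ` slab" using N by blast
      show "openin (mtop ?M) ?V" by fact
      show "disjoint {cosp ` N, cosp ` (swap ` N)}" using disj by (auto simp: disjoint_def)
      show "\<Union> {cosp ` N, cosp ` (swap ` N)} = {a\<in>points ?C. pr2 a \<in> ?V}" using un by simp
      show "\<forall>S\<in>{cosp ` N, cosp ` (swap ` N)}. openin (mtop ?C) S \<and>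
          diffeomorphism (open_submanifold ?C S) (open_submanifold ?M ?V) pr2"
        using open1 open2 d1 d2 by blast
    qed
  qed
  moreover have "pr2 ` points ?C = (\<lambda>x. Reg (orb x)) ` slab" unfolding points2 by (auto simp: image_image pr2_cosp)
  ultimately have cov: "smooth_covering ?C ?M ((\<lambda>x. Reg (orb x)) ` slab) pr2"
    unfolding smooth_covering_def by blast
  have fin: "finite {a\<in>points ?C. pr2 a = y}" if y: "y \<in> (\<lambda>x. Reg (orb x)) ` slab" for y
  proof -
    obtain x where x: "x \<in> slab" "y = Reg (orb x)" using y by blast
    have "{a\<in>points ?C. pr2 a = y} \<subseteq> {cosp x, cosp (swap x)}"
    proof
      fix a assume "a \<in> {a\<in>points ?C. pr2 a = y}"
      then obtain w where w: "w \<in> slab" "a = cosp w" "orb w = orb x"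
        unfolding points2 using x by (auto simp: pr2_cosp)
      then have "sim x w" using orb_eq_iff by metis
      then show "a \<in> {cosp x, cosp (swap x)}" using sim_slab[OF x(1) w(1)] w(2) by auto
    qed
    then show ?thesis by (rule finite_subset) simp
  qed
  have trans: "\<exists>g\<in>deck ?C pr2. g a = a'" if "a \<in> points ?C" "a' \<in> points ?C" "pr2 a = pr2 a'" for a a'
  proof -
    obtain x x' where x: "x \<in> slab" "a = cosp x" "x' \<in> slab" "a' = cosp x'"
      using \<open>a \<in> points ?C\<close> \<open>a' \<in> points ?C\<close> unfolding points2 by blast
    then have "sim x x'" using \<open>pr2 a = pr2 a'\<close> orb_eq_iff by (simp add: pr2_cosp)
    then consider "a' = a" | "a' = swap2 a" using sim_slab[OF x(1,3)] x swap2_cosp by auto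
    then show ?thesis
    proof cases
      case 1
      then show ?thesis using deck_identity[OF param_family2, of pr2] \<open>a \<in> points ?C\<close>
        by (intro bexI[of _ "\<lambda>a\<in>points ?C. a"]) auto
    qed (use swap2_deck in blast)
  qed
  show ?thesis unfolding finite_Galois_covering_def
    using C.smooth_manifold_gen connected2 cov fin trans by blast
qed

section \<open>The F-structure\<close>

text \<open>\<open>twist\<close> is the identity: the one nontrivial deck transformation acts
  trivially on x_7, so it commutes with the circle acting on the double covering.\<close>

definition joyce_F :: "real \<Rightarrow> (real^7, mpoint, mpoint \<times> nat) F_structure" where
  "joyce_F \<epsilon> = \<lparr> num = 3,
     cset = (\<lambda>i. if i = 0 then fst ` points (gen_atlas (fam (flow0 \<epsilon>)))
                 else if i = 1 then fst ` points (gen_atlas (fam (flow1 \<epsilon>)))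
                 else (\<lambda>x. Reg (orb x)) ` slab),
     cover = (\<lambda>i. if i = 0 then gen_atlas (fam (flow0 \<epsilon>))
                  else if i = 1 then gen_atlas (fam (flow1 \<epsilon>)) else gen_atlas family2),
     proj = (\<lambda>i. if i < 2 then fst else pr2),
     tdim = (\<lambda>i. 1),
     act = (\<lambda>i. if i = 0 then flow_act (flow0 \<epsilon>)
                else if i = 1 then flow_act (flow1 \<epsilon>) else flow_act (flow2 7)),
     twist = (\<lambda>i g t. t) \<rparr>"

locale joyce =
  fixes \<epsilon> :: real
  assumes eps: "0 < \<epsilon>" "\<epsilon> \<le> 1/8"
begin

abbreviation "F \<equiv> joyce_F \<epsilon>"
abbreviation "M \<equiv> gen_atlas (joyce_family \<epsilon>)"
abbreviation "T0 \<equiv> flow0 \<epsilon>"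
abbreviation "T1 \<equiv> flow1 \<epsilon>"
abbreviation "C0 \<equiv> gen_atlas (fam T0)"
abbreviation "C1 \<equiv> gen_atlas (fam T1)"
abbreviation "C2 \<equiv> gen_atlas family2"
abbreviation "U0 \<equiv> fst ` points C0"
abbreviation "U1 \<equiv> fst ` points C1"
abbreviation "U2 \<equiv> (\<lambda>x. Reg (orb x)) ` slab"

lemma F_num [simp]: "num F = 3"
  and F_cset [simp]: "cset F 0 = U0" "cset F 1 = U1" "cset F (Suc 0) = U1" "cset F 2 = U2"
  and F_cover [simp]: "cover F 0 = C0" "cover F 1 = C1" "cover F (Suc 0) = C1" "cover F 2 = C2"
  and F_proj [simp]: "proj F 0 = fst" "proj F 1 = fst" "proj F (Suc 0) = fst" "proj F 2 = pr2"
  and F_tdim [simp]: "tdim F i = 1"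
  and F_act [simp]: "act F 0 = flow_act T0" "act F 1 = flow_act T1" "act F (Suc 0) = flow_act T1"
    "act F 2 = flow_act (flow2 7)"
  and F_twist [simp]: "twist F i g t = t"
  by (simp_all add: joyce_F_def)

lemma less_3: "i < (3::nat) \<longleftrightarrow> i = 0 \<or> i = 1 \<or> i = 2"
  by auto

sublocale PM: param_family "joyce_family \<epsilon>" by (rule param_family_joyce[OF eps])
sublocale f0: flow T0 by (rule flow_flow0[OF eps])
sublocale f1: flow T1 by (rule flow_flow1[OF eps])
sublocale P2: param_family family2 by (rule param_family2)

lemma over0: "coord_over (fam T0) (joyce_family \<epsilon>) fst"
  by (rule family_resolution(1)[OF eps open_doms(1) _ fam_flow0]) (auto simp: dom0_def)

lemma over1: "coord_over (fam T1) (joyce_family \<epsilon>) fst"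
  by (rule family_resolution(1)[OF eps open_doms(2) _ fam_flow1]) (auto simp: dom1_def)

lemma snd0: "a \<in> points C0 \<Longrightarrow> snd a = 0"
  by (rule snd_resolution[OF f0.param_family_axioms fam_flow0])

lemma snd1: "a \<in> points C1 \<Longrightarrow> snd a = 0"
  by (rule snd_resolution[OF f1.param_family_axioms fam_flow1])

lemma inj0: "inj_on fst (points C0)" and inj1: "inj_on fst (points C1)"
  using snd0 snd1 by (auto simp: inj_on_def prod_eq_iff)

lemma chart0: "(dom0, reg0, axis 7 1) \<in> T0" and chart1: "(dom1, reg0, axis 2 1) \<in> T1"
  by (simp_all add: flow0_def flow1_def)

lemma slab_points: "x \<in> slab \<Longrightarrow> reg0 x \<in> points C0" "x \<in> slab \<Longrightarrow> reg0 x \<in> points C1"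
  using f0.in_points[OF f0.fam_memI[OF chart0]] f1.in_points[OF f1.fam_memI[OF chart1]] slab_subset by blast+

lemma act_slab:
  assumes "x \<in> slab" "t 0 = cis (2 * pi * s)"
  shows "flow_act T0 t (reg0 x) = reg0 (x + s *\<^sub>R axis 7 1)"
    "flow_act T1 t (reg0 x) = reg0 (x + s *\<^sub>R axis 2 1)"
  using f0.flow_act_eq[where t = t and s = s, OF chart0 _ assms(2)]
    f1.flow_act_eq[where t = t and s = s, OF chart1 _ assms(2)] slab_subset assms(1) by blast+

lemma act2_slab:
  assumes "i \<noteq> 1" "x \<in> slab" "t 0 = cis (2 * pi * s)"
  shows "flow_act (flow2 i) t (cosp x) = cosp (x + s *\<^sub>R axis i 1)"
  by (rule flow.flow_act_eq[where t = t and s = s, OF flow_flow2[OF assms(1)] _ assms(2,3)])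
    (simp add: flow2_def)

section \<open>The three open sets and the circle actions on them\<close>

lemma open_csets: "openin (mtop M) U0" "openin (mtop M) U1" "openin (mtop M) U2"
proof -
  show "openin (mtop M) U0"
    using over_open[OF PM.param_family_axioms f0.param_family_axioms over0]
      openin_topspace[of "mtop C0"] by simp
  show "openin (mtop M) U1"
    using over_open[OF PM.param_family_axioms f1.param_family_axioms over1]
      openin_topspace[of "mtop C1"] by simp
  show "openin (mtop M) U2"
    using PM.open_image[OF regular_in_family _ open_doms(3)] slab_nonsingular by blast
qed

lemma U0_cases:
  assumes "y \<in> U0"
  obtains x :: "real^7" where "x \<notin> singular" "\<bar>x$1\<bar> < 1/4" "y = Reg (orb x)"
    | k c t l where "k \<noteq> By_gamma" "y = Exc k c t l"
proof -
  obtain a where a: "a \<in> points C0" "y = fst a" using assms by blast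
  then obtain V p v x where V: "(V, p, v) \<in> T0" "x \<in> V" "a = p x" by (auto elim: f0.points_T)
  from lines_flow0[OF eps] V(1,2) show ?thesis
  proof (cases rule: lines_onE)
    case (1 X)
    then show ?thesis using that(1)[of X] 1(3)[of 0] V a by simp
  next
    case (2 k c t l)
    then show ?thesis using that(2)[of k] 2(2)[of 0] V a by simp
  qed
qed

lemma U1_cases:
  assumes "y \<in> U1"
  obtains x :: "real^7" where "x \<notin> singular" "0 < x$1" "x$1 < 1/2" "y = Reg (orb x)"
    | k c t l where "k = By_gamma" "y = Exc k c t l"
proof -
  obtain a where a: "a \<in> points C1" "y = fst a" using assms by blast
  then obtain V p v x where V: "(V, p, v) \<in> T1" "x \<in> V" "a = p x" by (auto elim: f1.points_T)
  from lines_flow1[OF eps] V(1,2) show ?thesis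
  proof (cases rule: lines_onE)
    case (1 X)
    then show ?thesis using that(1)[of X] 1(3)[of 0] V a by simp
  next
    case (2 k c t l)
    then show ?thesis using that(2)[of k] 2(2)[of 0] V a by simp
  qed
qed

text \<open>The two exceptional parts involve different involutions and cannot meet. A common
  regular point has a representative with \<open>\<bar>x\<^sub>1\<bar> < 1/4\<close>; if x_1
  vanished, every equivalent point would have x_1 in {0, 1/2} modulo 1, contrary to membership in
  the second set. So x_1 is nonzero, and \<alpha> makes it positive.\<close>

lemma U01: "U0 \<inter> U1 = U2"
proof (intro set_eqI iffI)
  fix y assume "y \<in> U0 \<inter> U1"
  then have y: "y \<in> U0" "y \<in> U1" by auto
  from y(1) show "y \<in> U2"
  proof (cases rule: U0_cases)
    case (1 x)
    note x = 1
    from y(2) show ?thesis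
    proof (cases rule: U1_cases)
      case (1 z)
      then have "sim x z" using x orb_eq_iff by simp
      then obtain a b c where *: "z - gact a b c x \<in> int_lattice" by (auto simp: sim_def)
      have "x$1 \<noteq> 0"
      proof
        assume "x$1 = 0"
        then have "z$1 - hf7 b c $ 1 \<in> \<int>" using * by (simp add: lattice_7 gact_def)
        then show False
          using no_half_integer(1)[of "z$1"] no_half_integer(2)[of "z$1 - 1/2"] 1(2,3)
          by (cases c) (auto simp: hf7_def hfb_def)
      qed
      moreover have "gact True False False x $ 1 = - x $ 1" by (simp add: gact_def sg7_def hf7_def sgb_def hfb_def)
      ultimately have "x \<in> slab \<or> gact True False False x \<in> slab" using x(2) by (auto simp: slab_def)
      moreover have "orb (gact True False False x) = orb x" using sim_reflect orb_eq_iff by metis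
      ultimately show ?thesis using x(3) by (metis image_eqI)
    qed (use x in simp)
  next
    case (2 k c t l)
    note x = 2
    from y(2) show ?thesis by (cases rule: U1_cases) (use x in simp_all)
  qed
next
  fix y assume "y \<in> U2"
  then show "y \<in> U0 \<inter> U1" using slab_points by force
qed

text \<open>Reduction modulo 1 brings x_1 into the interval from -1/2 to 1/2, which splits into four
  quarters; the identity, \<alpha>, \<gamma> and \<alpha>\<gamma> bring one of them each to the
  interval from 0 to 1/4, up to an integer.\<close>

lemma fundamental_first: fixes x :: "real^7" shows "\<exists>y. sim x y \<and> 0 \<le> y$1 \<and> y$1 \<le> 1/4"
proof -
  define n where "n = \<lfloor>x$1 + 1/2\<rfloor>"
  define r where "r = x$1 - of_int n"
  have r: "-(1/2) \<le> r" "r < 1/2" unfolding r_def n_def by linarith+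
  have go: "\<exists>y. sim x y \<and> y$1 = sgb a * sgb c * x$1 + hfb c + of_int m" for a c and m :: int
  proof -
    let ?y = "gact a False c x + of_int m *\<^sub>R axis 1 1"
    have "?y - gact a False c x \<in> int_lattice" by (simp add: int_lattice_def axis_def)
    then have "sim x ?y" unfolding sim_def by blast
    then show ?thesis by (intro exI[of _ ?y]) (simp add: gact_def sg7_def hf7_def sgb_def axis_def hfb_def)
  qed
  consider "0 \<le> r" "r \<le> 1/4" | "1/4 < r" | "-(1/4) \<le> r" "r < 0" | "r < -(1/4)" by linarith
  then show ?thesis
  proof cases
    case 1
    obtain y :: "real^7" where "sim x y" "y$1 = sgb False * sgb False * x$1 + hfb False + of_int (- n)" using go by blast
    then show ?thesis using 1 by (intro exI[of _ y]) (simp add: sgb_def hfb_def r_def)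
  next
    case 2
    obtain y :: "real^7" where "sim x y" "y$1 = sgb False * sgb True * x$1 + hfb True + of_int n" using go by blast
    then show ?thesis using 2 r by (intro exI[of _ y]) (simp add: sgb_def hfb_def r_def)
  next
    case 3
    obtain y :: "real^7" where "sim x y" "y$1 = sgb True * sgb False * x$1 + hfb False + of_int n" using go by blast
    then show ?thesis using 3 by (intro exI[of _ y]) (simp add: sgb_def hfb_def r_def)
  next
    case 4
    obtain y :: "real^7" where "sim x y" "y$1 = sgb True * sgb True * x$1 + hfb True + of_int (- n)" using go by blast
    then show ?thesis using 4 r by (intro exI[of _ y]) (simp add: sgb_def hfb_def r_def)
  qed
qed

lemma U_cover: "U0 \<union> U1 = points M"
proof
  show "U0 \<union> U1 \<subseteq> points M" using openin_subset[OF open_csets(1)] openin_subset[OF open_csets(2)] by simp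
  show "points M \<subseteq> U0 \<union> U1"
  proof
    fix a assume "a \<in> points M"
    then obtain V p x where V: "(V, p) \<in> joyce_family \<epsilon>" "x \<in> V" "a = p x" by (rule PM.pointsE)
    from V(1) show "a \<in> U0 \<union> U1"
    proof (cases rule: joyce_family_cases)
      case 1
      obtain y :: "real^7" where y: "sim x y" "0 \<le> y$1" "y$1 \<le> 1/4" using fundamental_first by blast
      have "y \<notin> singular" using singular_sim[OF sim_sym[OF y(1)]] V 1 by auto
      then have "y \<in> dom0 \<or> y \<in> dom1" using y by (auto simp: dom0_def dom1_def)
      then have "reg0 y \<in> points C0 \<or> reg0 y \<in> points C1"
        using f0.in_points[OF f0.fam_memI[OF chart0]] f1.in_points[OF f1.fam_memI[OF chart1]] by blast
      moreover have "a = fst (reg0 y)" using V 1 y(1) orb_eq_iff by simp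
      ultimately show ?thesis by blast
    next
      case (2 k c j)
      have "(exc_param k c j x, 0) \<in> points C0 \<or> (exc_param k c j x, 0) \<in> points C1"
      proof (cases "k = By_gamma")
        case True
        have "(exc_dom \<epsilon>, \<lambda>y. (exc_param k c j y, 0::nat)) \<in> fam T1" unfolding fam_flow1 using 2 True by blast
        from f1.in_points[OF this, of x] show ?thesis using V 2 by simp
      next
        case False
        have "(exc_dom \<epsilon>, \<lambda>y. (exc_param k c j y, 0::nat)) \<in> fam T0" unfolding fam_flow0 using 2 False by blast
        from f0.in_points[OF this, of x] show ?thesis using V 2 by simp
      qed
      then show ?thesis using V 2 by force
    qed
  qed
qed

lemma Galois: "i < 3 \<Longrightarrow> finite_Galois_covering (cover F i) M (cset F i) (proj F i)"
  using one_sheeted_covering[OF PM.param_family_axioms f0.param_family_axioms over0 inj0 connected_flow0[OF eps]]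
    one_sheeted_covering[OF PM.param_family_axioms f1.param_family_axioms over1 inj1 connected_flow1[OF eps]]
    double_covering[OF eps]
  unfolding less_3 by (elim disjE) simp_all

lemma smooth_act: "i < 3 \<Longrightarrow> smooth_torus_action 1 (cover F i) (act F i)"
  using f0.smooth_flow f1.smooth_flow flow.smooth_flow[OF flow_flow2[of 7]]
  unfolding less_3 by (elim disjE) (simp_all add: fam_flow2)

lemma kernel:
  assumes "i < 3" shows "{t\<in>torus 1. \<forall>x\<in>points (cover F i). act F i t x = x} \<subseteq> {1}"
proof safe
  fix t assume t: "t \<in> torus 1" and fix_all: "\<forall>x\<in>points (cover F i). act F i t x = x"
  obtain s where s: "t 0 = cis (2 * pi * s)" using torus_1_cis[OF t] by blast
  \<comment> \<open>The entry 1/8 at x_4 prevents confusion of a translation with the swap: the swap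
    turns it into -1/8, not congruent to 1/8. With 0 there, the translation of x_2 by 1/2 would fix
    the orbit of this point.\<close>
  define x0 :: "real^7" where "x0 = vector [1/8, 0, 0, 1/8, 0, 0, 0]"
  have x0: "x0 \<in> slab" by (simp add: x0_def slab_def)
  have "s \<in> \<int>"
  proof -
    consider "i = 0" | "i = 1" | "i = 2" using assms unfolding less_3 by blast
    then show ?thesis
    proof cases
      case 1
      then have "orb (x0 + s *\<^sub>R axis 7 1) = orb x0"
        using fix_all slab_points(1)[OF x0] act_slab(1)[where t = t and s = s, OF x0 s] by auto
      then have "sim x0 (x0 + s *\<^sub>R axis 7 1)" using orb_eq_iff by metis
      then have "cosp (x0 + s *\<^sub>R axis 7 1) = cosp x0 \<or> cosp (x0 + s *\<^sub>R axis 7 1) = cosp (swap x0)"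
        using sim_slab[OF x0 slab_shift[OF x0]] by simp
      then show ?thesis
      proof
        assume "cosp (x0 + s *\<^sub>R axis 7 1) = cosp x0"
        then have "x0 - (x0 + s *\<^sub>R axis 7 1) \<in> int_lattice" using cosp_eq by blast
        then show ?thesis by (simp add: lattice_7 axis_def)
      next
        assume "cosp (x0 + s *\<^sub>R axis 7 1) = cosp (swap x0)"
        then have "swap x0 - (x0 + s *\<^sub>R axis 7 1) \<in> int_lattice" using cosp_eq by blast
        then have "(swap x0 - (x0 + s *\<^sub>R axis 7 1)) $ 2 \<in> \<int>" unfolding lattice_7 by blast
        then show ?thesis by (simp add: axis_def swap_def x0_def gact_def sg7_def hf7_def sgb_def hfb_def)
      qed
    next
      case 2
      then have "orb (x0 + s *\<^sub>R axis 2 1) = orb x0"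
        using fix_all slab_points(2)[OF x0] act_slab(2)[where t = t and s = s, OF x0 s] by auto
      then have "sim x0 (x0 + s *\<^sub>R axis 2 1)" using orb_eq_iff by metis
      then have "cosp (x0 + s *\<^sub>R axis 2 1) = cosp x0 \<or> cosp (x0 + s *\<^sub>R axis 2 1) = cosp (swap x0)"
        using sim_slab[OF x0 slab_shift[OF x0]] by simp
      then show ?thesis
      proof
        assume "cosp (x0 + s *\<^sub>R axis 2 1) = cosp x0"
        then have "x0 - (x0 + s *\<^sub>R axis 2 1) \<in> int_lattice" using cosp_eq by blast
        then show ?thesis by (simp add: lattice_7 axis_def)
      next
        assume "cosp (x0 + s *\<^sub>R axis 2 1) = cosp (swap x0)"
        then have "swap x0 - (x0 + s *\<^sub>R axis 2 1) \<in> int_lattice" using cosp_eq by blast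
        then have "(swap x0 - (x0 + s *\<^sub>R axis 2 1)) $ 4 \<in> \<int>" unfolding lattice_7 by blast
        then show ?thesis by (simp add: axis_def swap_def x0_def gact_def sg7_def hf7_def sgb_def hfb_def)
      qed
    next
      case 3
      have "cosp x0 \<in> points C2" using x0 points2 by blast
      then have "flow_act (flow2 7) t (cosp x0) = cosp x0" using fix_all 3 by simp
      then have "cosp (x0 + s *\<^sub>R axis 7 1) = cosp x0" using act2_slab[where t = t and s = s and i = 7, OF _ x0 s] by simp
      then have "x0 - (x0 + s *\<^sub>R axis 7 1) \<in> int_lattice" using cosp_eq by blast
      then show ?thesis by (simp add: lattice_7 axis_def)
    qed
  qed
  then obtain n :: int where "s = of_int n" by (auto elim: Ints_cases)
  then have "t 0 = 1" using s cis_multiple_2pi[of n] by (simp add: mult.commute)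
  moreover have "t j = 1" if "j \<ge> 1" for j using t that by (auto simp: torus_def)
  ultimately have "t j = 1 j" for j by (cases j) auto
  then show "t = 1" by (rule ext)
qed

text \<open>Deck transformations of one-sheeted coverings are the identity; those of the double
  covering are the identity or the swap, and the swap commutes with translations of x_7.\<close>

lemma twisted:
  assumes "i < 3" "g \<in> deck (cover F i) (proj F i)" "t \<in> torus 1" "a \<in> points (cover F i)"
  shows "g (act F i t a) = act F i t (g a)"
proof -
  have g: "diffeomorphism (cover F i) (cover F i) g" "\<And>a. a \<in> points (cover F i) \<Longrightarrow> proj F i (g a) = proj F i a"
    using assms(2) by (auto simp: deck_def)
  have gp: "g b \<in> points (cover F i)" if "b \<in> points (cover F i)" for b
    using g(1) that by (auto simp: diffeomorphism_def smooth_map_def)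
  have inv: "act F i t a \<in> points (cover F i)"
    using smooth_act[OF assms(1)] assms(3,4) by (auto simp: smooth_torus_action_def torus_acts_def)
  consider "i = 0" | "i = 1" | "i = 2" using assms(1) unfolding less_3 by blast
  then show ?thesis
  proof cases
    case 1
    have "g b = b" if "b \<in> points (cover F i)" for b
      using inj_onD[OF inj0] g(2)[OF that] gp[OF that] that 1 by auto
    then show ?thesis using inv assms(4) by simp
  next
    case 2
    have "g b = b" if "b \<in> points (cover F i)" for b
      using inj_onD[OF inj1] g(2)[OF that] gp[OF that] that 2 by auto
    then show ?thesis using inv assms(4) by simp
  next
    case 3
    obtain x where x: "x \<in> slab" "a = cosp x" using assms(4) 3 points2 by auto
    obtain s where s: "t 0 = cis (2 * pi * s)" using torus_1_cis[OF assms(3)] by blast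
    have x': "x + s *\<^sub>R axis 7 1 \<in> slab" using slab_shift[OF x(1)] by simp
    have act: "flow_act (flow2 7) t (cosp z) = cosp (z + s *\<^sub>R axis 7 1)" if "z \<in> slab" for z
      using act2_slab[where t = t and s = s, OF _ that s] by simp
    have "g \<in> deck C2 pr2" using assms(2) 3 by simp
    from deck2_cases[OF this] show ?thesis
      using x x' act swap_slab swap_shift 3 by (elim disjE) simp_all
  qed
qed

lemma identity_aut: "(\<lambda>t. t) \<in> torus_aut k"
  unfolding torus_aut_def by (auto intro!: exI[of _ "\<lambda>t. t"] simp: homeomorphism_def)

lemma preserves_slab:
  assumes "i < 3" "t \<in> torus 1" "a \<in> points (cover F i)" "proj F i a \<in> U2"
  shows "proj F i (act F i t a) \<in> U2"
proof -
  obtain s where s: "t 0 = cis (2 * pi * s)" using torus_1_cis[OF assms(2)] by blast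
  obtain x where x: "x \<in> slab" "proj F i a = Reg (orb x)" using assms(4) by blast
  consider "i = 0" | "i = 1" | "i = 2" using assms(1) unfolding less_3 by blast
  then show ?thesis
  proof cases
    case 1
    then have "a = reg0 x" using x snd0[of a] assms(3) by (simp add: prod_eq_iff)
    then show ?thesis using act_slab(1)[where t = t and s = s, OF x(1) s] slab_shift[OF x(1), of 7] 1 by simp
  next
    case 2
    then have "a = reg0 x" using x snd1[of a] assms(3) by (simp add: prod_eq_iff)
    then show ?thesis using act_slab(2)[where t = t and s = s, OF x(1) s] slab_shift[OF x(1), of 2] 2 by simp
  next
    case 3
    obtain y where y: "y \<in> slab" "a = cosp y" using assms(3) 3 points2 by auto
    then show ?thesis using act2_slab[where t = t and s = s and i = 7, OF _ y(1) s] slab_shift[OF y(1), of 7] 3 by (simp add: pr2_cosp)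
  qed
qed

section \<open>Invariance of intersections and commuting lifts\<close>

lemma proj_points: "i < 3 \<Longrightarrow> a \<in> points (cover F i) \<Longrightarrow> proj F i a \<in> cset F i"
  unfolding less_3 using points2 pr2_cosp by (elim disjE) auto

lemma act_points: "i < 3 \<Longrightarrow> t \<in> torus 1 \<Longrightarrow> a \<in> points (cover F i) \<Longrightarrow> act F i t a \<in> points (cover F i)"
  using smooth_act[of i] by (auto simp: smooth_torus_action_def torus_acts_def)

lemma csets_Int: "i < 3 \<Longrightarrow> j < 3 \<Longrightarrow> i \<noteq> j \<Longrightarrow> cset F i \<inter> cset F j = U2"
  unfolding less_3 using U01 by (elim disjE) auto

lemma U2_subset: "i < 3 \<Longrightarrow> U2 \<subseteq> cset F i"
  unfolding less_3 using U01 by (elim disjE) auto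

text \<open>Any two distinct sets meet exactly in the third one, which all the circles preserve; a
  single set is preserved as the image of its total space.\<close>

lemma Inter_invariant:
  assumes "J \<subseteq> {..<3}" "j \<in> J" "t \<in> torus 1" "a \<in> points (cover F j)" "proj F j a \<in> (\<Inter>i\<in>J. cset F i)"
  shows "proj F j (act F j t a) \<in> (\<Inter>i\<in>J. cset F i)"
proof
  fix i assume i: "i \<in> J"
  have ij: "i < 3" "j < 3" using assms i by auto
  show "proj F j (act F j t a) \<in> cset F i"
  proof (cases "i = j")
    case True
    then show ?thesis using proj_points act_points assms ij by simp
  next
    case False
    have "proj F j a \<in> cset F i \<inter> cset F j" using assms(2,5) i by blast
    then have "proj F j a \<in> U2" using csets_Int[OF ij False] by simp
    then show ?thesis using preserves_slab[OF ij(2) assms(3,4)] U2_subset[OF ij(1)] by blast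
  qed
qed

text \<open>A one-sheeted projection of this kind is open, so attaching the tag 0 is a continuous
  inverse to it. This provides the continuous components of points in a fibre product.\<close>

lemma section_continuous:
  assumes PQ: "param_family Q" "coord_over Q (joyce_family \<epsilon>) fst"
    and snd: "\<And>a. a \<in> points (gen_atlas Q) \<Longrightarrow> snd a = (0::nat)"
    and f: "continuous_map X (mtop M) f" "\<And>x. x \<in> topspace X \<Longrightarrow> f x \<in> fst ` points (gen_atlas Q)"
  shows "continuous_map X (mtop (gen_atlas Q)) (\<lambda>x. (f x, 0))"
  unfolding continuous_map_def
proof (intro conjI allI impI)
  interpret Q: param_family Q by fact
  have lift: "(f x, 0) \<in> points (gen_atlas Q)" if x: "x \<in> topspace X" for x
  proof -
    obtain a where a: "a \<in> points (gen_atlas Q)" "f x = fst a" using f(2)[OF x] by blast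
    then have "a = (f x, 0)" using snd by (simp add: prod_eq_iff)
    then show ?thesis using a by simp
  qed
  then show "(\<lambda>x. (f x, 0)) \<in> topspace X \<rightarrow> topspace (mtop (gen_atlas Q))" by simp
  fix O' assume O': "openin (mtop (gen_atlas Q)) O'"
  have "openin (mtop M) (fst ` O')" by (rule over_open[OF PM.param_family_axioms PQ O'])
  then have "openin X {x \<in> topspace X. f x \<in> fst ` O'}" using f(1) by (simp add: continuous_map_def)
  moreover have "f x \<in> fst ` O' \<longleftrightarrow> (f x, 0) \<in> O'" for x
  proof
    assume "f x \<in> fst ` O'"
    then obtain a where a: "a \<in> O'" "f x = fst a" by blast
    moreover have "a \<in> points (gen_atlas Q)" using openin_subset[OF O'] a by auto
    ultimately show "(f x, 0) \<in> O'" using snd by (metis prod.collapse)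
  qed force
  ultimately show "openin X {x \<in> topspace X. (f x, 0) \<in> O'}" by simp
qed

lemma proj_continuous: "i < 3 \<Longrightarrow> continuous_map (mtop (cover F i)) (mtop M) (proj F i)"
proof -
  have "continuous_map (mtop C0) (mtop M) fst"
    by (rule smooth_map_continuous[OF f0.param_family_axioms PM.param_family_axioms
        over_smooth[OF PM.param_family_axioms f0.param_family_axioms over0]])
  moreover have "continuous_map (mtop C1) (mtop M) fst"
    by (rule smooth_map_continuous[OF f1.param_family_axioms PM.param_family_axioms
        over_smooth[OF PM.param_family_axioms f1.param_family_axioms over1]])
  moreover have "continuous_map (mtop C2) (mtop M) pr2"
    by (rule smooth_map_continuous[OF P2.param_family_axioms PM.param_family_axioms
        over_smooth[OF PM.param_family_axioms P2.param_family_axioms over_family2]])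
  ultimately show "i < 3 \<Longrightarrow> continuous_map (mtop (cover F i)) (mtop M) (proj F i)"
    unfolding less_3 by (elim disjE) simp_all
qed

lemma section_cover:
  assumes "i < 2" "continuous_map X (mtop M) f" "\<And>x. x \<in> topspace X \<Longrightarrow> f x \<in> cset F i"
  shows "continuous_map X (mtop (cover F i)) (\<lambda>x. (f x, 0))"
proof (cases "i = 0")
  case True
  then show ?thesis using section_continuous[OF f0.param_family_axioms over0 snd0 assms(2)] assms(3) by simp
next
  case False
  then have "i = 1" using assms(1) by simp
  then show ?thesis using section_continuous[OF f1.param_family_axioms over1 snd1 assms(2)] assms(3) by simp
qed

lemma topspace_cover: "i < 3 \<Longrightarrow> topspace (mtop (cover F i)) = points (cover F i)"
  unfolding less_3 by (elim disjE) simp_all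

lemma continuous_act: "i < 3 \<Longrightarrow> continuous_torus_action 1 (mtop (cover F i)) (act F i)"
  using f0.continuous_flow f1.continuous_flow flow.continuous_flow[OF flow_flow2[of 7]]
  unfolding less_3 by (elim disjE) (simp_all add: fam_flow2)

lemma snd_cover: "i < 2 \<Longrightarrow> a \<in> points (cover F i) \<Longrightarrow> snd a = 0"
  using snd0[of a] snd1[of a] by - (drule less_2_cases, elim disjE; simp)

lemma cset_image: "i < 2 \<Longrightarrow> cset F i = proj F i ` points (cover F i)"
  by - (drule less_2_cases, elim disjE; simp)

lemma proj_fst: "i < 2 \<Longrightarrow> proj F i = fst"
  by (auto dest: less_2_cases)

text \<open>The image of the double covering lies in the other two sets, so a fibre product
  involving it is a copy of its total space. The lifted circles translate x_7, and x_2 for the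
  second set; translations commute.\<close>

lemma lifts_double:
  assumes J: "J \<subseteq> {..<3}" "2 \<in> J" shows "commuting_lifts F J"
proof (rule commuting_liftsI[where m = 2 and \<sigma> = "\<lambda>i y. (y, 0)" and E = "points C2"
      and \<psi> = "\<lambda>j. flow_act (flow2 (if j = 1 then 2 else 7))"])
  have J2: "i < 2" if "i \<in> J" "i \<noteq> 2" for i using that J by force
  have J3: "i < 3" if "i \<in> J" for i using that J by force
  show "2 \<in> J" by fact
  show "topspace (mtop (cover F i)) = points (cover F i)" if "i \<in> J" for i using topspace_cover J3 that by blast
  show "(proj F i b, 0) = b" if "i \<in> J" "i \<noteq> 2" "b \<in> points (cover F i)" for i b
    using snd_cover[OF J2] proj_fst[OF J2] that by (simp add: prod_eq_iff)
  show "points C2 = {a \<in> points (cover F 2). \<forall>i\<in>J. i \<noteq> 2 \<longrightarrow> (\<exists>b\<in>points (cover F i). proj F i b = proj F 2 a)}"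
  proof -
    have "\<exists>b\<in>points (cover F i). proj F i b = pr2 a" if "a \<in> points C2" "i \<in> J" "i \<noteq> 2" for a i
    proof -
      have "pr2 a \<in> cset F i" using proj_points[of 2 a] U2_subset[OF J3[OF that(2)]] that(1) by auto
      then show ?thesis using cset_image[OF J2[OF that(2,3)]] by (metis imageE)
    qed
    then show ?thesis by auto
  qed
  have fl: "flow (flow2 (if j = 1 then 2 else 7))" for j :: nat using flow_flow2 by simp
  show "continuous_torus_action (tdim F j) (subtopology (mtop (cover F 2)) (points C2)) (flow_act (flow2 (if j = 1 then 2 else 7)))"
    if "j \<in> J" for j
    using flow.continuous_flow[OF fl[of j]] subtopology_topspace[of "mtop C2"] by (simp add: fam_flow2)
  show "continuous_map (subtopology (mtop (cover F 2)) (points C2)) (mtop (cover F i)) (\<lambda>a. (proj F 2 a, 0))"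
    if "i \<in> J" "i \<noteq> 2" for i
  proof (rule section_cover[OF J2[OF that]])
    show "continuous_map (subtopology (mtop (cover F 2)) (points C2)) (mtop M) (proj F 2)"
      by (intro continuous_map_from_subtopology proj_continuous) simp
    show "proj F 2 a \<in> cset F i" if "a \<in> topspace (subtopology (mtop (cover F 2)) (points C2))" for a
      using proj_points[of 2 a] U2_subset[OF J3[OF \<open>i \<in> J\<close>]] that by auto
  qed
  show "flow_act (flow2 (if (2::nat) = 1 then 2 else 7)) t a = act F 2 t a" for t a by simp
  show "act F j t (proj F 2 a, 0) = (proj F 2 (flow_act (flow2 (if j = 1 then 2 else 7)) t a), 0)"
    if *: "j \<in> J" "j \<noteq> 2" "t \<in> torus (tdim F j)" "a \<in> points C2" for j t a
  proof -
    obtain x where x: "x \<in> slab" "a = cosp x" using *(4) points2 by auto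
    obtain s where s: "t 0 = cis (2 * pi * s)" using *(3) torus_1_cis by auto
    show ?thesis
      using J2[OF *(1,2)] act_slab[where t = t and s = s, OF x(1) s] act2_slab[where t = t and s = s, OF _ x(1) s] x(2)
      by (auto dest!: less_2_cases simp: pr2_cosp)
  qed
  show "flow_act (flow2 (if i = 1 then 2 else 7)) s (flow_act (flow2 (if j = 1 then 2 else 7)) t a) =
      flow_act (flow2 (if j = 1 then 2 else 7)) t (flow_act (flow2 (if i = 1 then 2 else 7)) s a)"
    if *: "s \<in> torus (tdim F i)" "t \<in> torus (tdim F j)" "a \<in> points C2" for i j :: nat and s t a
  proof -
    obtain x where x: "x \<in> slab" "a = cosp x" using *(3) points2 by auto
    obtain r where r: "s 0 = cis (2 * pi * r)" using *(1) torus_1_cis by auto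
    obtain q where q: "t 0 = cis (2 * pi * q)" using *(2) torus_1_cis by auto
    define u v :: 7 where "u = (if i = 1 then 2 else 7)" and "v = (if j = 1 then 2 else 7)"
    have uv: "u \<noteq> 1" "v \<noteq> 1" by (simp_all add: u_def v_def)
    have "flow_act (flow2 u) s (flow_act (flow2 v) t a) = flow_act (flow2 v) t (flow_act (flow2 u) s a)"
      unfolding x(2) act2_slab[where t = s and s = r, OF uv(1) x(1) r] act2_slab[where t = t and s = q, OF uv(2) x(1) q]
        act2_slab[where t = s and s = r, OF uv(1) slab_shift[OF x(1) uv(2)] r] act2_slab[where t = t and s = q, OF uv(2) slab_shift[OF x(1) uv(1)] q]
      by (simp add: ac_simps)
    then show ?thesis by (simp add: u_def v_def)
  qed
qed

lemma reg0_slab: "{a\<in>points C0. fst a \<in> U1} = reg0 ` slab" "{a\<in>points C1. fst a \<in> U0} = reg0 ` slab"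
proof -
  show "{a\<in>points C0. fst a \<in> U1} = reg0 ` slab"
  proof (intro set_eqI iffI)
    fix a assume "a \<in> {a\<in>points C0. fst a \<in> U1}"
    then have "fst a \<in> U2" "snd a = 0" using U01 snd0 by auto
    then show "a \<in> reg0 ` slab" by (auto simp: image_iff prod_eq_iff)
  next
    fix a assume "a \<in> reg0 ` slab"
    then show "a \<in> {a\<in>points C0. fst a \<in> U1}" using slab_points by force
  qed
  show "{a\<in>points C1. fst a \<in> U0} = reg0 ` slab"
  proof (intro set_eqI iffI)
    fix a assume "a \<in> {a\<in>points C1. fst a \<in> U0}"
    then have "fst a \<in> U2" "snd a = 0" using U01 snd1 by auto
    then show "a \<in> reg0 ` slab" by (auto simp: image_iff prod_eq_iff)
  next
    fix a assume "a \<in> reg0 ` slab"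
    then show "a \<in> {a\<in>points C1. fst a \<in> U0}" using slab_points by force
  qed
qed

lemma slab_invariant:
  assumes "t \<in> torus 1" "a \<in> reg0 ` slab"
  shows "flow_act T0 t a \<in> reg0 ` slab" "flow_act T1 t a \<in> reg0 ` slab"
proof -
  obtain s where s: "t 0 = cis (2 * pi * s)" using torus_1_cis[OF assms(1)] by blast
  obtain x where x: "x \<in> slab" "a = reg0 x" using assms(2) by blast
  show "flow_act T0 t a \<in> reg0 ` slab" "flow_act T1 t a \<in> reg0 ` slab"
    unfolding x(2) act_slab[where t = t and s = s, OF x(1) s] using slab_shift[OF x(1), of 7 s] slab_shift[OF x(1), of 2 s] by auto
qed

text \<open>Both subspaces carry the topology of the open set below, through \<open>fst\<close>. The
  comparison is needed because the second action is known to be continuous in its own total space,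
  while the fibre product is modelled on the first.\<close>

lemma slab_topologies: "subtopology (mtop C0) (reg0 ` slab) = subtopology (mtop C1) (reg0 ` slab)"
proof -
  have iff: "openin (mtop (gen_atlas Q)) S \<longleftrightarrow> openin (mtop M) (fst ` S)"
    if Q: "param_family Q" "coord_over Q (joyce_family \<epsilon>) fst" and S: "S \<subseteq> points (gen_atlas Q)"
      and inj: "inj_on fst (points (gen_atlas Q))" for Q :: "((real^7) set \<times> (real^7 \<Rightarrow> mpoint \<times> nat)) set" and S
  proof
    assume "openin (mtop (gen_atlas Q)) S"
    then show "openin (mtop M) (fst ` S)" by (rule over_open[OF PM.param_family_axioms Q])
  next
    assume o: "openin (mtop M) (fst ` S)"
    have "continuous_map (mtop (gen_atlas Q)) (mtop M) fst"
      by (rule smooth_map_continuous[OF Q(1) PM.param_family_axioms over_smooth[OF PM.param_family_axioms Q]])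
    then have "openin (mtop (gen_atlas Q)) {a \<in> topspace (mtop (gen_atlas Q)). fst a \<in> fst ` S}"
      using o by (simp add: continuous_map_def)
    moreover have "{a \<in> topspace (mtop (gen_atlas Q)). fst a \<in> fst ` S} = S"
      unfolding param_family.topspace_gen[OF Q(1)] using S inj by (auto simp: inj_on_def)
    ultimately show "openin (mtop (gen_atlas Q)) S" by simp
  qed
  have sub: "reg0 ` slab \<subseteq> points C0" "reg0 ` slab \<subseteq> points C1" using slab_points by auto
  have img: "fst ` (reg0 ` slab) = U2" by (auto simp: image_image)
  have op: "openin (mtop C0) (reg0 ` slab)" "openin (mtop C1) (reg0 ` slab)"
    using iff[OF f0.param_family_axioms over0 sub(1) inj0] iff[OF f1.param_family_axioms over1 sub(2) inj1]
      open_csets(3) img by simp_all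
  show ?thesis
    unfolding topology_eq openin_open_subtopology[OF op(1)] openin_open_subtopology[OF op(2)]
  proof
    fix S
    show "openin (mtop C0) S \<and> S \<subseteq> reg0 ` slab \<longleftrightarrow> openin (mtop C1) S \<and> S \<subseteq> reg0 ` slab"
    proof (cases "S \<subseteq> reg0 ` slab")
      case True
      then show ?thesis
        using iff[OF f0.param_family_axioms over0 subset_trans[OF True sub(1)] inj0]
          iff[OF f1.param_family_axioms over1 subset_trans[OF True sub(2)] inj1] by simp
    qed simp
  qed
qed

lemma lifts_single:
  assumes "j < 2" shows "commuting_lifts F {j}"
proof (rule commuting_liftsI[where m = j and \<sigma> = "\<lambda>i y. (y, 0)" and E = "points (cover F j)" and \<psi> = "act F"])
  have j: "j < 3" using assms by simp
  show "topspace (mtop (cover F i)) = points (cover F i)" if "i \<in> {j}" for i using topspace_cover j that by blast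
  show "continuous_torus_action (tdim F i) (subtopology (mtop (cover F j)) (points (cover F j))) (act F i)"
    if "i \<in> {j}" for i
    using continuous_act[OF j] subtopology_topspace[of "mtop (cover F j)"] topspace_cover[OF j] that by simp
  fix i i' s t a
  assume *: "i \<in> {j}" "i' \<in> {j}" "s \<in> torus (tdim F i)" "t \<in> torus (tdim F i')" "a \<in> points (cover F j)"
  have "torus_acts 1 (points (cover F j)) (act F j)"
    using smooth_act[OF j] by (simp add: smooth_torus_action_def)
  then show "act F i s (act F i' t a) = act F i' t (act F i s a)"
    using * unfolding torus_acts_def by simp (metis mult.commute)
qed auto

text \<open>For the two one-sheeted coverings the fibre product is a copy of their intersection,
  represented by points of \<open>slab\<close>; there the circles translate the different
  coordinates x_7 and x_2.\<close>

lemma lifts_both: "commuting_lifts F {0, 1}"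
proof (rule commuting_liftsI[where m = 0 and \<sigma> = "\<lambda>i y. (y, 0)" and E = "reg0 ` slab" and \<psi> = "act F"])
  show "0 \<in> {0, 1::nat}" by simp
  show "topspace (mtop (cover F i)) = points (cover F i)" if "i \<in> {0, 1}" for i using topspace_cover[of i] that by auto
  show "(proj F i b, 0) = b" if "i \<in> {0, 1}" "i \<noteq> 0" "b \<in> points (cover F i)" for i b
    using snd_cover[of i b] proj_fst[of i] that by (auto simp: prod_eq_iff)
  have "(\<exists>b\<in>points C1. fst b = fst a) \<longleftrightarrow> fst a \<in> U1" for a :: "mpoint \<times> nat" by (metis image_iff)
  then have "(\<forall>i\<in>{0, 1}. i \<noteq> 0 \<longrightarrow> (\<exists>b\<in>points (cover F i). proj F i b = proj F 0 a)) \<longleftrightarrow> fst a \<in> U1" for a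
    by simp
  then show "reg0 ` slab = {a \<in> points (cover F 0). \<forall>i\<in>{0, 1}. i \<noteq> 0 \<longrightarrow> (\<exists>b\<in>points (cover F i). proj F i b = proj F 0 a)}"
    using reg0_slab(1) by simp
  have sub: "reg0 ` slab \<subseteq> topspace (mtop C0)" "reg0 ` slab \<subseteq> topspace (mtop C1)" using slab_points by auto
  show "continuous_torus_action (tdim F j) (subtopology (mtop (cover F 0)) (reg0 ` slab)) (act F j)"
    if "j \<in> {0, 1}" for j
  proof (cases "j = 0")
    case True
    then show ?thesis
      using continuous_torus_action_subtopology[OF f0.continuous_flow sub(1)] slab_invariant(1) by simp
  next
    case False
    then have "j = 1" using that by simp
    then show ?thesis
      using continuous_torus_action_subtopology[OF f1.continuous_flow sub(2)] slab_invariant(2) slab_topologies by simp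
  qed
  show "continuous_map (subtopology (mtop (cover F 0)) (reg0 ` slab)) (mtop (cover F i)) (\<lambda>a. (proj F 0 a, 0))"
    if i: "i \<in> {0, 1}" "i \<noteq> 0" for i
  proof (rule section_cover)
    show "continuous_map (subtopology (mtop (cover F 0)) (reg0 ` slab)) (mtop M) (proj F 0)"
      by (intro continuous_map_from_subtopology proj_continuous) simp
    show "proj F 0 a \<in> cset F i" if "a \<in> topspace (subtopology (mtop (cover F 0)) (reg0 ` slab))" for a
      using that i U2_subset[of 1] by auto
  qed (use i in simp)
  show "act F j t (proj F 0 a, 0) = (proj F 0 (act F j t a), 0)"
    if "j \<in> {0, 1}" "j \<noteq> 0" "t \<in> torus (tdim F j)" "a \<in> reg0 ` slab" for j t a
  proof -
    have "snd a = 0" "snd (flow_act T1 t a) = 0" using slab_invariant(2)[of t a] that by auto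
    moreover have "j = 1" using that by simp
    ultimately show ?thesis by (simp add: prod_eq_iff) (metis prod.collapse)
  qed
  show "act F i s (act F j t a) = act F j t (act F i s a)"
    if *: "i \<in> {0, 1}" "j \<in> {0, 1}" "s \<in> torus (tdim F i)" "t \<in> torus (tdim F j)" "a \<in> reg0 ` slab" for i j s t a
  proof -
    obtain x where x: "x \<in> slab" "a = reg0 x" using *(5) by auto
    obtain r where r: "s 0 = cis (2 * pi * r)" using *(3) torus_1_cis by auto
    obtain q where q: "t 0 = cis (2 * pi * q)" using *(4) torus_1_cis by auto
    define e :: "nat \<Rightarrow> 7" where "e i = (if i = 0 then 7 else 2)" for i
    have act: "act F i t (reg0 z) = reg0 (z + s *\<^sub>R axis (e i) 1)"
      if "i \<in> {0, 1}" "z \<in> slab" "t 0 = cis (2 * pi * s)" for i z t s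
      using act_slab[where t = t and s = s, OF that(2,3)] that(1) by (auto simp: e_def)
    have sh: "z + s *\<^sub>R axis (e i) 1 \<in> slab" if "z \<in> slab" for z s i
      using slab_shift[OF that] by (simp add: e_def)
    show ?thesis
      unfolding x(2) act[where t = s and s = r, OF *(1) x(1) r] act[where t = t and s = q, OF *(2) x(1) q]
        act[where t = s and s = r, OF *(1) sh[OF x(1)] r] act[where t = t and s = q, OF *(2) sh[OF x(1)] q]
      by (simp add: ac_simps)
  qed
qed simp

lemma lifts: assumes "J \<subseteq> {..<3}" "J \<noteq> {}" shows "commuting_lifts F J"
proof (cases "2 \<in> J")
  case False
  then have "J \<subseteq> {0, 1}" using assms(1) by (auto simp: subset_iff less_3)
  then consider "J = {0}" | "J = {1}" | "J = {0, 1}" using assms(2) by blast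
  then show ?thesis using lifts_single[of 0] lifts_single[of 1] lifts_both by cases simp_all
qed (use lifts_double assms in blast)

lemma F_structure: "is_F_structure (joyce_manifold \<epsilon>) F"
  unfolding is_F_structure_def
proof (intro conjI)
  show "closed_manifold (joyce_manifold \<epsilon>)" by (rule closed_manifold_joyce[OF eps])
  show "\<forall>i<num F. openin (mtop (joyce_manifold \<epsilon>)) (cset F i)"
    unfolding joyce_eq[OF eps(1)] F_num less_3 using open_csets by auto
  have union: "(\<Union>i<num F. cset F i) = cset F 0 \<union> cset F 1 \<union> cset F 2"
    unfolding F_num by (simp add: lessThan_Suc numeral_3_eq_3 numeral_2_eq_2 Un_ac)
  show "(\<Union>i<num F. cset F i) = points (joyce_manifold \<epsilon>)"
  proof -
    have "U2 \<subseteq> U0" unfolding U01[symmetric] by (rule Int_lower1)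
    then have "U0 \<union> U1 \<union> U2 = U0 \<union> U1" by (intro Un_absorb2) (rule le_supI1)
    then show ?thesis using union unfolding joyce_eq[OF eps(1)] F_cset U_cover[symmetric] by simp
  qed
  show "\<forall>i<num F. finite_Galois_covering (cover F i) (joyce_manifold \<epsilon>) (cset F i) (proj F i)"
    unfolding joyce_eq[OF eps(1)] F_num using Galois by blast
  show "\<forall>i<num F. 1 \<le> tdim F i \<and> smooth_torus_action (tdim F i) (cover F i) (act F i) \<and>
      finite {t \<in> torus (tdim F i). \<forall>x\<in>points (cover F i). act F i t x = x}"
  proof (intro allI impI conjI)
    fix i assume i: "i < num F"
    show "1 \<le> tdim F i" by simp
    show "smooth_torus_action (tdim F i) (cover F i) (act F i)" using smooth_act[of i] i by simp
    show "finite {t \<in> torus (tdim F i). \<forall>x\<in>points (cover F i). act F i t x = x}"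
      using finite_subset[OF kernel[of i]] i by simp
  qed
  show "\<forall>i<num F. let \<Gamma> = deck (cover F i) (proj F i); X = points (cover F i); T = torus (tdim F i) in
        (\<forall>g\<in>\<Gamma>. twist F i g \<in> torus_aut (tdim F i)) \<and>
        (\<forall>g\<in>\<Gamma>. \<forall>h\<in>\<Gamma>. \<forall>t\<in>T. twist F i (compose X g h) t = twist F i g (twist F i h t)) \<and>
        (\<forall>g\<in>\<Gamma>. \<forall>t\<in>T. \<forall>x\<in>X. g (act F i t x) = act F i (twist F i g t) (g x))"
  proof -
    have "twist F i g = (\<lambda>t. t)" for i g by (rule ext) simp
    then show ?thesis unfolding Let_def F_num F_tdim using identity_aut[of 1] twisted by presburger
  qed
  show "\<forall>J. J \<subseteq> {..<num F} \<and> J \<noteq> {} \<and> (\<Inter>j\<in>J. cset F j) \<noteq> {} \<longrightarrow>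
        (\<forall>j\<in>J. \<forall>t\<in>torus (tdim F j). \<forall>x\<in>points (cover F j).
           proj F j x \<in> (\<Inter>i\<in>J. cset F i) \<longrightarrow> proj F j (act F j t x) \<in> (\<Inter>i\<in>J. cset F i)) \<and>
        commuting_lifts F J"
    unfolding F_num F_tdim
  proof (intro allI impI conjI ballI)
    fix J assume J: "J \<subseteq> {..<3} \<and> J \<noteq> {} \<and> (\<Inter>j\<in>J. cset F j) \<noteq> {}"
    then show "commuting_lifts F J" using lifts by blast
    fix j t a
    assume "j \<in> J" "t \<in> torus 1" "a \<in> points (cover F j)" "proj F j a \<in> (\<Inter>i\<in>J. cset F i)"
    then show "proj F j (act F j t a) \<in> (\<Inter>i\<in>J. cset F i)" by (rule Inter_invariant[OF conjunct1[OF J]])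
  qed
qed

end

section \<open>Orbits and polarization\<close>

lemma orbit_eqI:
  assumes "invariant M F Q" "y \<in> Q" "\<And>S. invariant M F S \<Longrightarrow> y \<in> S \<Longrightarrow> Q \<subseteq> S"
  shows "orbit M F y = Q"
  unfolding orbit_def using assms by blast

lemma torus_1_exists: "\<exists>t\<in>torus 1. t 0 = cis (2 * pi * s)"
  by (rule bexI[of _ "\<lambda>j. if j = 0 then cis (2 * pi * s) else 1"]) (auto simp: torus_def)

lemma mem_span_pair: "l \<in> span {e, f} \<longleftrightarrow> (\<exists>a b. l = a *\<^sub>R e + b *\<^sub>R f)"
proof
  assume "l \<in> span {e, f}"
  then obtain a where "l - a *\<^sub>R e \<in> span {f}" by (auto simp: span_breakdown_eq)
  then obtain b where "l - a *\<^sub>R e = b *\<^sub>R f" by (auto simp: span_singleton)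
  then have "l = a *\<^sub>R e + b *\<^sub>R f" by (simp add: algebra_simps)
  then show "\<exists>a b. l = a *\<^sub>R e + b *\<^sub>R f" by blast
next
  assume "\<exists>a b. l = a *\<^sub>R e + b *\<^sub>R f"
  then obtain a b where "l = a *\<^sub>R e + b *\<^sub>R f" by blast
  moreover have "a *\<^sub>R e + b *\<^sub>R f \<in> span {e, f}" by (intro span_add span_scale span_base) simp_all
  ultimately show "l \<in> span {e, f}" by simp
qed

text \<open>Periodicity in both directions lets fractional parts replace all coefficients, so the
  compact parallelogram spanned by e and f serves as \<open>K\<close>. The vectors may coincide,
  which covers circles as well as 2-tori.\<close>

lemma (in param_family) periodic_orbit_submanifold:
  assumes P: "(V, p) \<in> P" and U: "open U" "U \<subseteq> V"
    and stay: "\<And>x a b. x \<in> U \<Longrightarrow> x + (a *\<^sub>R e + b *\<^sub>R f) \<in> U"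
    and eqv: "\<And>x y a b. x \<in> U \<Longrightarrow> y \<in> U \<Longrightarrow> p x = p y \<Longrightarrow>
      p (x + (a *\<^sub>R e + b *\<^sub>R f)) = p (y + (a *\<^sub>R e + b *\<^sub>R f))"
    and per: "\<And>x m n. x \<in> U \<Longrightarrow> p (x + (of_int m *\<^sub>R e + of_int n *\<^sub>R f)) = p x"
    and x0: "x0 \<in> U"
  shows "submanifold_of_dim (gen_atlas P) (dim {e, f}) {p (x0 + (a *\<^sub>R e + b *\<^sub>R f)) |a b. True}"
proof -
  let ?K = "(\<lambda>z. fst z *\<^sub>R e + snd z *\<^sub>R f) ` ({0..1} \<times> {0..1})"
  have "submanifold_of_dim (gen_atlas P) (dim (span {e, f})) {p (x0 + l) |l. l \<in> span {e, f}}"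
  proof (rule orbit_submanifold[OF P U subspace_span _ _ _ _ _ x0])
    show "x + l \<in> U" if "x \<in> U" "l \<in> span {e, f}" for x l
      using that stay by (auto simp: mem_span_pair)
    show "p (x + l) = p (y + l)" if "x \<in> U" "y \<in> U" "p x = p y" "l \<in> span {e, f}" for x y l
      using that eqv by (auto simp: mem_span_pair)
    show "compact ?K" by (intro compact_continuous_image continuous_intros compact_Times compact_Icc)
    show "?K \<subseteq> span {e, f}" using mem_span_pair by blast
    show "\<exists>k\<in>?K. \<forall>x\<in>U. p (x + l) = p (x + k)" if l: "l \<in> span {e, f}" for l
    proof -
      obtain a b where ab: "l = a *\<^sub>R e + b *\<^sub>R f" using l by (auto simp: mem_span_pair)
      let ?k = "frac a *\<^sub>R e + frac b *\<^sub>R f"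
      have "p (x + l) = p (x + ?k)" if x: "x \<in> U" for x
      proof -
        have "l = ?k + (of_int \<lfloor>a\<rfloor> *\<^sub>R e + of_int \<lfloor>b\<rfloor> *\<^sub>R f)" by (simp add: ab frac_def algebra_simps)
        then have "x + l = (x + ?k) + (of_int \<lfloor>a\<rfloor> *\<^sub>R e + of_int \<lfloor>b\<rfloor> *\<^sub>R f)" by (simp only: add.assoc)
        then show ?thesis using per[OF stay[OF x]] by metis
      qed
      moreover have "?k \<in> ?K" using frac_ge_0 frac_lt_1[THEN less_imp_le]
        by (intro image_eqI[of _ _ "(frac a, frac b)"]) auto
      ultimately show ?thesis by blast
    qed
  qed
  moreover have "{p (x0 + l) |l. l \<in> span {e, f}} = {p (x0 + (a *\<^sub>R e + b *\<^sub>R f)) |a b. True}"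
    by (auto simp: mem_span_pair)
  ultimately show ?thesis by (simp add: dim_span)
qed

context joyce
begin

lemma invariantI:
  assumes "Q \<subseteq> points M"
    and "\<And>i a t. i < 3 \<Longrightarrow> a \<in> points (cover F i) \<Longrightarrow> t \<in> torus 1 \<Longrightarrow> proj F i a \<in> Q \<Longrightarrow> proj F i (act F i t a) \<in> Q"
  shows "invariant M F Q"
  unfolding invariant_def F_num F_tdim using assms by blast

lemma invariantD:
  assumes "invariant M F S" "i < 3" "a \<in> points (cover F i)" "t \<in> torus 1" "proj F i a \<in> S"
  shows "proj F i (act F i t a) \<in> S"
  using assms unfolding invariant_def F_num F_tdim by blast

text \<open>The second circle moves x_2, the first and third move x_7; the plane they sweep out is
  invariant, since equivalent points of \<open>slab\<close> have equivalent translates. The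
  dimension of its span is left unevaluated, as polarization asks only for constancy.\<close>

lemma orbit_slab:
  assumes y: "y \<in> U2"
  shows "submanifold_of_dim M (dim {axis 2 1, axis 7 1 :: real^7}) (orbit M F y)"
proof -
  obtain x where x: "x \<in> slab" "y = Reg (orb x)" using y by blast
  let ?e = "axis 2 1 :: real^7" and ?f = "axis 7 1 :: real^7"
  have stay: "z + (a *\<^sub>R ?e + b *\<^sub>R ?f) \<in> slab" if "z \<in> slab" for z a b
    using slab_shift[OF slab_shift[OF that, of 2 a], of 7 b] by (simp add: add.assoc)
  have eqv: "Reg (orb (z + (a *\<^sub>R ?e + b *\<^sub>R ?f))) = Reg (orb (w + (a *\<^sub>R ?e + b *\<^sub>R ?f)))"
    if "z \<in> slab" "w \<in> slab" "Reg (orb z) = Reg (orb w)" for z w a b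
  proof -
    have "sim z w" using that orb_eq_iff by simp
    then have "sim (z + a *\<^sub>R ?e) (w + a *\<^sub>R ?e)"
      by (rule sim_shift1[rotated -1]) (use that in \<open>auto simp: slab_def\<close>)
    then have "sim (z + a *\<^sub>R ?e + b *\<^sub>R ?f) (w + a *\<^sub>R ?e + b *\<^sub>R ?f)"
      by (rule sim_shift0[rotated -1])
        (use slab_shift[OF that(1), of 2 a] slab_shift[OF that(2), of 2 a] in \<open>auto simp: slab_def\<close>)
    then have "orb (z + a *\<^sub>R ?e + b *\<^sub>R ?f) = orb (w + a *\<^sub>R ?e + b *\<^sub>R ?f)" using orb_eq_iff by blast
    then show ?thesis by (simp add: add.assoc)
  qed
  have per: "Reg (orb (z + (of_int m *\<^sub>R ?e + of_int n *\<^sub>R ?f))) = Reg (orb z)" for z m n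
  proof -
    have "of_int m *\<^sub>R ?e + of_int n *\<^sub>R ?f \<in> int_lattice" by (simp add: int_lattice_def axis_def)
    then have "sim z (z + (of_int m *\<^sub>R ?e + of_int n *\<^sub>R ?f))" by (intro sim_lattice) simp
    then have "orb z = orb (z + (of_int m *\<^sub>R ?e + of_int n *\<^sub>R ?f))" using orb_eq_iff by blast
    then show ?thesis by simp
  qed
  let ?Q = "{Reg (orb (x + (a *\<^sub>R ?e + b *\<^sub>R ?f))) |a b. True}"
  have sub: "submanifold_of_dim M (dim {?e, ?f}) ?Q"
    by (rule PM.periodic_orbit_submanifold[OF regular_in_family open_doms(3) _ stay eqv per x(1)])
       (use slab_nonsingular in auto)
  have "orbit M F y = ?Q"
  proof (rule orbit_eqI)
    show "y \<in> ?Q" unfolding x(2) by (rule CollectI, rule exI[of _ 0], rule exI[of _ 0]) simp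
    show "invariant M F ?Q"
    proof (rule invariantI)
      show "?Q \<subseteq> points M" using PM.in_points[OF regular_in_family] stay[OF x(1)] slab_nonsingular by blast
      fix i a t assume i: "i < (3::nat)" and a: "a \<in> points (cover F i)" and t: "t \<in> torus 1" and Q: "proj F i a \<in> ?Q"
      obtain c d where cd: "proj F i a = Reg (orb (x + (c *\<^sub>R ?e + d *\<^sub>R ?f)))" using Q by blast
      obtain s where s: "t 0 = cis (2 * pi * s)" using torus_1_cis[OF t] by blast
      let ?X = "x + (c *\<^sub>R ?e + d *\<^sub>R ?f)"
      have X: "?X \<in> slab" by (rule stay[OF x(1)])
      consider "i = 0" | "i = 1" | "i = 2" using i unfolding less_3 by blast
      then show "proj F i (act F i t a) \<in> ?Q"
      proof cases
        case 1
        then have "a = reg0 ?X" using snd0[of a] a cd by (simp add: prod_eq_iff)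
        then have "proj F i (act F i t a) = Reg (orb (x + (c *\<^sub>R ?e + (d + s) *\<^sub>R ?f)))"
          using 1 act_slab(1)[where t = t and s = s, OF X s] by (simp add: scaleR_add_left add.assoc)
        then show ?thesis by blast
      next
        case 2
        then have "a = reg0 ?X" using snd1[of a] a cd by (simp add: prod_eq_iff)
        then have "proj F i (act F i t a) = Reg (orb (x + ((c + s) *\<^sub>R ?e + d *\<^sub>R ?f)))"
          using 2 act_slab(2)[where t = t and s = s, OF X s] by (simp add: scaleR_add_left ac_simps)
        then show ?thesis by blast
      next
        case 3
        then obtain w where w: "w \<in> slab" "a = cosp w" using a points2 by auto
        have "Reg (orb w) = Reg (orb ?X)" using cd 3 w by (simp add: pr2_cosp)
        from eqv[OF w(1) X this, of 0 s]
        have "Reg (orb (w + s *\<^sub>R ?f)) = Reg (orb (x + (c *\<^sub>R ?e + (d + s) *\<^sub>R ?f)))"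
          by (simp add: scaleR_add_left add.assoc)
        then have "proj F i (act F i t a) = Reg (orb (x + (c *\<^sub>R ?e + (d + s) *\<^sub>R ?f)))"
          using 3 w act2_slab[where t = t and s = s and i = 7, OF _ w(1) s] by (simp add: pr2_cosp)
        then show ?thesis by blast
      qed
    qed
    fix S assume S: "invariant M F S" "y \<in> S"
    show "?Q \<subseteq> S"
    proof clarify
      fix c d
      obtain t where t: "t \<in> torus 1" "t 0 = cis (2 * pi * c)" using torus_1_exists by blast
      obtain u where u: "u \<in> torus 1" "u 0 = cis (2 * pi * d)" using torus_1_exists by blast
      have "proj F 1 (act F 1 t (reg0 x)) \<in> S"
        by (rule invariantD[OF S(1) _ _ t(1)]) (use S(2) x slab_points(2) in auto)
      then have 1: "Reg (orb (x + c *\<^sub>R ?e)) \<in> S"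
        using act_slab(2)[where t = t and s = c, OF x(1) t(2)] by simp
      have xc: "x + c *\<^sub>R ?e \<in> slab" using slab_shift[OF x(1)] by simp
      have "proj F 0 (act F 0 u (reg0 (x + c *\<^sub>R ?e))) \<in> S"
        by (rule invariantD[OF S(1) _ _ u(1)]) (use 1 slab_points(1)[OF xc] in auto)
      then show "Reg (orb (x + (c *\<^sub>R ?e + d *\<^sub>R ?f))) \<in> S"
        using act_slab(1)[where t = u and s = d, OF xc u(2)] by (simp add: add.assoc)
    qed
  qed
  then show ?thesis using sub by simp
qed

text \<open>Off the overlap only one circle acts on the orbit. If another set met it in some point,
  that point would lie in the overlap, which is invariant under the circle of i, and flowing back
  would put y there too.\<close>

lemma orbit_circle:
  assumes i: "i < 2" and T: "flow T" "coord_over (fam T) (joyce_family \<epsilon>) fst"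
    and FT: "cover F i = gen_atlas (fam T)" "act F i = flow_act T"
    and axes: "\<And>V q v. (V, q, v) \<in> T \<Longrightarrow> \<exists>j. v = axis j 1"
    and y: "y \<in> cset F i" "y \<notin> U2"
  shows "submanifold_of_dim M 1 (orbit M F y)"
proof -
  interpret T: flow T by (rule T(1))
  have i3: "i < 3" using i by simp
  have inj: "a = b" if "a \<in> points (cover F i)" "b \<in> points (cover F i)" "fst a = fst b" for a b
    using snd_cover[OF i] that by (simp add: prod_eq_iff)
  obtain a where a: "a \<in> points (cover F i)" "y = fst a"
    using y(1) unfolding cset_image[OF i] proj_fst[OF i] by blast
  then obtain W q v x where W: "(W, q, v) \<in> T" "x \<in> W" "a = q x" unfolding FT(1) by (blast elim: T.points_T)
  obtain V p where V: "(V, p) \<in> joyce_family \<epsilon>" "W \<subseteq> V" "\<And>z. z \<in> W \<Longrightarrow> fst (q z) = p z" "open W"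
    using coord_overE[OF T(2) T.fam_memI[OF W(1)]] by metis
  have qW: "q z \<in> points (cover F i)" if "z \<in> W" for z unfolding FT(1) by (rule T.in_points[OF T.fam_memI[OF W(1)] that])
  obtain j where v: "v = axis j 1" using axes[OF W(1)] by blast
  have stay: "z + (c *\<^sub>R v + d *\<^sub>R v) \<in> W" if "z \<in> W" for z c d
    using T.invariant_dom[OF W(1) that, of "c + d"] by (simp add: scaleR_add_left)
  have stay1: "z + s *\<^sub>R v \<in> W" if "z \<in> W" for z s using T.invariant_dom[OF W(1) that] .
  have eqv: "p (z + (c *\<^sub>R v + d *\<^sub>R v)) = p (w + (c *\<^sub>R v + d *\<^sub>R v))"
    if zw: "z \<in> W" "w \<in> W" "p z = p w" for z w c d
  proof -
    have "q z = q w" by (rule inj[OF qW[OF zw(1)] qW[OF zw(2)]]) (use V(3) zw in simp)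
    then have "q (z + (c + d) *\<^sub>R v) = q (w + (c + d) *\<^sub>R v)" by (rule T.consistent[OF W(1) W(1) zw(1,2)])
    then show ?thesis using V(3)[OF stay1[OF zw(1), of "c + d"]] V(3)[OF stay1[OF zw(2), of "c + d"]]
      by (simp add: scaleR_add_left)
  qed
  have per: "p (z + (of_int m *\<^sub>R v + of_int n *\<^sub>R v)) = p z" if z: "z \<in> W" for z m n
    using T.period_int[OF W(1) z, of "m + n"] V(3)[OF stay1[OF z, of "of_int (m + n)"]] V(3)[OF z]
    by (simp add: scaleR_add_left)
  let ?Q = "{p (x + (c *\<^sub>R v + d *\<^sub>R v)) |c d. True}"
  \<comment> \<open>The result for two directions is used with both equal, so that the span is a
    line.\<close>
  have "submanifold_of_dim M (dim {v, v}) ?Q"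
    by (rule PM.periodic_orbit_submanifold[OF V(1,4,2) stay eqv per W(2)])
  moreover have "dim {v, v} = 1" unfolding v by (simp add: axis_eq_0_iff)
  moreover have Q: "?Q = {p (x + s *\<^sub>R v) |s. True}"
  proof (intro set_eqI iffI)
    fix b assume "b \<in> ?Q"
    then obtain c d where "b = p (x + (c + d) *\<^sub>R v)" by (auto simp: scaleR_add_left)
    then show "b \<in> {p (x + s *\<^sub>R v) |s. True}" by blast
  next
    fix b assume "b \<in> {p (x + s *\<^sub>R v) |s. True}"
    then obtain s where "b = p (x + (s *\<^sub>R v + 0 *\<^sub>R v))" by auto
    then show "b \<in> ?Q" by blast
  qed
  moreover have act: "act F i t (q (x + s *\<^sub>R v)) = q (x + (s + r) *\<^sub>R v)" if "t 0 = cis (2 * pi * r)" for t s r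
    unfolding FT(2) using T.flow_act_eq[where t = t and s = r, OF W(1) stay1[OF W(2), of s] that]
    by (simp add: scaleR_add_left add.assoc)
  have pq: "fst (q (x + s *\<^sub>R v)) = p (x + s *\<^sub>R v)" for s by (rule V(3)[OF stay1[OF W(2)]])
  have yp: "y = p (x + 0 *\<^sub>R v)" using a W pq[of 0] by simp
  have "orbit M F y = {p (x + s *\<^sub>R v) |s. True}"
  proof (rule orbit_eqI)
    show "y \<in> {p (x + s *\<^sub>R v) |s. True}" using yp by blast
    show "invariant M F {p (x + s *\<^sub>R v) |s. True}"
    proof (rule invariantI)
      show "{p (x + s *\<^sub>R v) |s. True} \<subseteq> points M" using PM.in_points[OF V(1)] stay1[OF W(2)] V(2) by blast
      fix k b t
      assume k: "k < (3::nat)" and b: "b \<in> points (cover F k)" and t: "t \<in> torus 1"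
        and bQ: "proj F k b \<in> {p (x + s *\<^sub>R v) |s. True}"
      obtain s where s: "proj F k b = p (x + s *\<^sub>R v)" using bQ by blast
      show "proj F k (act F k t b) \<in> {p (x + s *\<^sub>R v) |s. True}"
      proof (cases "k = i")
        case True
        have "b = q (x + s *\<^sub>R v)"
          by (rule inj) (use b qW[OF stay1[OF W(2)]] s pq proj_fst[OF i] True in simp_all)
        moreover obtain r where "t 0 = cis (2 * pi * r)" using torus_1_cis[OF t] by blast
        ultimately have "proj F k (act F k t b) = p (x + (s + r) *\<^sub>R v)"
          using act pq proj_fst[OF i] True by simp
        then show ?thesis by blast
      next
        case False
        have "p (x + s *\<^sub>R v) \<in> cset F k" using proj_points[OF k b] s by simp
        moreover have "p (x + s *\<^sub>R v) \<in> cset F i"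
          using proj_points[OF i3 qW[OF stay1[OF W(2)]], of s] pq proj_fst[OF i] by simp
        ultimately have U2: "p (x + s *\<^sub>R v) \<in> U2" using csets_Int[OF k i3 False] by blast
        \<comment> \<open>Flowing for time -s returns from the hypothetical overlap point to
          y.\<close>
        obtain u where u: "u \<in> torus 1" "u 0 = cis (2 * pi * (- s))" using torus_1_exists by blast
        have "proj F i (act F i u (q (x + s *\<^sub>R v))) \<in> U2"
          by (rule preserves_slab[OF i3 u(1) qW[OF stay1[OF W(2)]]]) (use U2 pq proj_fst[OF i] in simp)
        then have "y \<in> U2" unfolding act[where t = u and r = "- s", OF u(2)] proj_fst[OF i] pq yp by simp
        then show ?thesis using y(2) by blast
      qed
    qed
    fix S assume S: "invariant M F S" "y \<in> S"
    show "{p (x + s *\<^sub>R v) |s. True} \<subseteq> S"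
    proof clarify
      fix s
      obtain t where t: "t \<in> torus 1" "t 0 = cis (2 * pi * s)" using torus_1_exists by blast
      have "proj F i (act F i t (q (x + 0 *\<^sub>R v))) \<in> S"
        by (rule invariantD[OF S(1) i3 qW[OF stay1[OF W(2)]] t(1)])
          (use S(2) yp pq[of 0] proj_fst[OF i] in simp)
      then show "p (x + s *\<^sub>R v) \<in> S" unfolding act[where t = t and r = s, OF t(2)] proj_fst[OF i] pq by simp
    qed
  qed
  ultimately show ?thesis by simp
qed

text \<open>If the intersection over I lies in the overlap, all its orbits are those of
  \<open>orbit_slab\<close>. Otherwise I omits the index 2, so the overlap belongs to the removed
  union, and only circles remain.\<close>

lemma polarized_F: "polarized (joyce_manifold \<epsilon>) F"
  unfolding polarized_def joyce_eq[OF eps(1)] Let_def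
proof (intro allI impI)
  fix I :: "nat set" assume I: "I \<subseteq> {..<num F}"
  let ?U = "{y \<in> points M. \<forall>i\<in>I. y \<in> cset F i}" and ?V = "\<Union>i\<in>{..<num F} - I. cset F i"
  show "\<exists>d. \<forall>y\<in>?U - ?V. submanifold_of_dim M d (orbit M F y)"
  proof (cases "2 \<in> I \<or> {0, 1} \<subseteq> I")
    case True
    have "y \<in> U2" if "y \<in> ?U" for y
    proof (cases "2 \<in> I")
      case True
      then have "y \<in> cset F 2" using that by blast
      then show ?thesis by simp
    next
      case False
      then have "y \<in> cset F 0 \<inter> cset F 1" using True that by blast
      then show ?thesis using U01 by simp
    qed
    then show ?thesis using orbit_slab by blast
  next
    case False
    have axes0: "\<exists>j. v = axis j 1" if "(V, q, v) \<in> T0" for V q v using that unfolding flow0_def by blast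
    have axes1: "\<exists>j. v = axis j 1" if "(V, q, v) \<in> T1" for V q v using that unfolding flow1_def by blast
    have "submanifold_of_dim M 1 (orbit M F y)" if y: "y \<in> ?U - ?V" for y
    proof -
      have "2 \<in> {..<num F} - I" using False by simp
      then have "y \<notin> cset F 2" using y by blast
      then have y2: "y \<notin> U2" by simp
      have "y \<in> U0 \<union> U1" unfolding U_cover using y by blast
      then consider "y \<in> cset F 0" | "y \<in> cset F 1" unfolding F_cset by blast
      then show ?thesis
      proof cases
        case 1
        show ?thesis
          by (rule orbit_circle[OF _ f0.flow_axioms over0 _ _ axes0 1 y2]) simp_all
      next
        case 2
        show ?thesis
          by (rule orbit_circle[OF _ f1.flow_axioms over1 _ _ axes1 2 y2]) simp_all
      qed
    qed
    then show ?thesis by blast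
  qed
qed

lemma one_nontrivial: "\<exists>!i. i < num F \<and> \<not> trivial_covering F i"
proof (rule ex1I[of _ 2])
  define x0 :: "real^7" where "x0 = vector [1/8, 0, 0, 0, 0, 0, 0]"
  have x0: "x0 \<in> slab" by (simp add: x0_def slab_def)
  have "\<not> inj_on pr2 (points C2)"
  proof
    assume inj: "inj_on pr2 (points C2)"
    have "orb (swap x0) = orb x0" using sim_swap orb_eq_iff by metis
    then have "cosp (swap x0) = cosp x0"
      by (intro inj_onD[OF inj]) (use x0 swap_slab points2 in \<open>auto simp: pr2_cosp\<close>)
    then show False using swap_not_equal cosp_eq by metis
  qed
  then show "2 < num F \<and> \<not> trivial_covering F 2" by (simp add: trivial_covering_def)
  fix i assume i: "i < num F \<and> \<not> trivial_covering F i"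
  have "trivial_covering F 0" "trivial_covering F 1" using inj0 inj1 by (simp_all add: trivial_covering_def)
  then show "i = 2" using i unfolding F_num less_3 by blast
qed

end

theorem mainTheorem4:
  fixes \<epsilon> :: real
  assumes "0 < \<epsilon>" and "\<epsilon> \<le> 1/8"
  shows "\<exists>F :: (real^7, mpoint, mpoint \<times> nat) F_structure.
           is_F_structure (joyce_manifold \<epsilon>) F \<and>
           polarized (joyce_manifold \<epsilon>) F \<and>
           (\<exists>!i. i < num F \<and> \<not> trivial_covering F i)"
proof -
  interpret joyce \<epsilon> using assms by unfold_locales
  show ?thesis using F_structure polarized_F one_nontrivial by blast
qed

end
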